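(* Let $(A,\mathfrak m)$ be an Artinian local ring with infinite residue field, let $S$ be a finitely generated standard $d$-graded algebra over $A$ ($d>0$), and let $M$ be a finitely generated $d$-graded $S$-module such that $S_{(1,1,\ldots,1)}\nsubseteq\sqrt{\mathrm{Ann}_S M}$. Set $\ell=\dim M^\triangle$, and let $k_1,\ldots,k_d$ be non-negative integers with $k_1+\cdots+k_d=\ell-1$. Then the following statements hold. (i) $e(M;k_1,\ldots,k_d)\neq 0$ if and only if there exists an $S_{++}$-filter-regular sequence $x_1,\ldots,x_{\ell-1}$ with respect to $M$ consisting of $k_1$ elements of $S_1$, $\ldots$, $k_d$ elements of $S_d$ such that $\dim \overline M^{\triangle}=1$, where $\overline M=M/(x_1,\ldots,x_{\ell-1})M$. (ii) Suppose that $e(M;k_1,\ldots,k_d)\neq 0$ and that $x_1,\ldots,x_{\ell-1}$ is an $S_{++}$-filter-regular sequence with respect to $M$ consisting of $k_1$ elements of $S_1$, $\ldots$, $k_d$ elements of $S_d$. Set $\overline M=M/(x_1,\ldots,x_{\ell-1})M$ and let $r=r(S^{\triangle}_+;\overline M^{\triangle})$ be the reduction number of $S^\triangle_+$ with respect to $\overline M^\triangle$. Then $$e(M;k_1,\ldots,k_d)=l_A\left[\frac{\overline M^\triangle_n}{(0_{\overline M^\triangle}:(S_+^{\triangle})^{\infty})_n}\right]\quad\text{for all } n\ge r.$$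
   Context: Multigraded setting. $S=\bigoplus_{n_1,\ldots,n_d\ge 0}S_{(n_1,\ldots,n_d)}$ is a finitely generated standard $d$-graded algebra over $A$, i.e. generated over $A$ by finitely many elements of total degree 1; $M=\bigoplus_{n_1,\ldots,n_d\ge 0}M_{(n_1,\ldots,n_d)}$ is a finitely generated $d$-graded $S$-module. $S_i=S_{(0,\ldots,1,\ldots,0)}$ with $1$ in position $i$; $S_{++}=\bigoplus_{n_1,\ldots,n_d>0}S_{(n_1,\ldots,n_d)}$. Diagonals: $S^\triangle=\bigoplus_{n\ge 0}S_{(n,\ldots,n)}$, $S^\triangle_+=\bigoplus_{n>0}S_{(n,\ldots,n)}$, $M^\triangle=\bigoplus_{n\ge0}M_{(n,\ldots,n)}$, with $M^\triangle_n=M_{(n,\ldots,n)}$; $\dim M^\triangle$ is the Krull dimension of $M^\triangle$ as an $S^\triangle$-module. $l_A$ denotes length of $A$-modules. For an ideal $\mathfrak b$ of a ring and a module $N$ over it, $0_N:\mathfrak b^\infty=\bigcup_{n\ge0}(0_N:\mathfrak b^n)$. "For all large $n_1,\ldots,n_d$" means for all $n_1,\ldots,n_d\ge N$, for some integer $N$. Mixed multiplicities. If $S_{(1,\ldots,1)}\nsubseteq\sqrt{\mathrm{Ann}_S M}$, then $\ell=\dim M^\triangle>0$ and $l_A[M_{(n_1,\ldots,n_d)}]$ agrees for all large $n_1,\ldots,n_d$ with a polynomial of total degree $\ell-1$, whose terms of total degree $\ell-1$ are written $$\sum_{k_1+\cdots+k_d=\ell-1}e(M;k_1,\ldots,k_d)\frac{n_1^{k_1}\cdots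 n_d^{k_d}}{k_1!\cdots k_d!}.$$ The $e(M;k_1,\ldots,k_d)$ are non-negative integers, not all zero, called the mixed multiplicities of $M$ of type $(k_1,\ldots,k_d)$. Filter-regular sequences. For a finitely generated $d$-graded $S$-module $M$ with $S_{(1,\ldots,1)}\nsubseteq\sqrt{\mathrm{Ann}_S M}$, a homogeneous element $x\in S$ is an $S_{++}$-filter-regular element with respect to $M$ if $x\notin P$ for every $P\in\mathrm{Ass}_S M$ with $S_{++}\nsubseteq P$. Homogeneous elements $x_1,\ldots,x_t$ form an $S_{++}$-filter-regular sequence with respect to $M$ if, for each $i=1,\ldots,t$, $x_i$ is an $S_{++}$-filter-regular element with respect to $M/(x_1,\ldots,x_{i-1})M$ (in particular this module satisfies the condition on $S_{(1,\ldots,1)}$). Reductions. Let $S'=\bigoplus_{n\ge0}S'_n$ be a finitely generated standard graded algebra over $A$, $S'_+=\bigoplus_{n>0}S'_n$, and $N=\bigoplus_{n\ge0}N_n$ a finitely generated graded $S'$-module. A homogeneous ideal $J$ of $S'$ generated by elements of degree 1 is a reduction of $S'_+$ with respect to $N$ if $(JN)_n=N_n$ for all large $n$; it is a minimal reduction if it does not properly contain any other reduction of $S'_+$ with respect to $N$. The reduction number $r_J(S'_+;N)$ is the least integer $n$ such that $(JN)_{m+1}=N_{m+1}$ for all $m\ge n$, and $r(S'_+;N)=\min\{r_J(S'_+;N)\mid J \text{ a minimal reduction of } S'_+ \text{ with respect to } N\}$. *)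

theory Defs
  imports "HOL-Library.Extended_Real" "HOL-Algebra.Algebra"
begin

section \<open>Commutative algebra over explicit carriers\<close>

definition artinian_ring :: "('a, 'k) ring_scheme \<Rightarrow> bool" where
  "artinian_ring R \<longleftrightarrow> cring R \<and>
     (\<forall>I :: nat \<Rightarrow> 'a set. (\<forall>n. ideal (I n) R \<and> I (Suc n) \<subseteq> I n)
        \<longrightarrow> (\<exists>N. \<forall>n\<ge>N. I n = I N))"

definition local_ring_with :: "('a, 'k) ring_scheme \<Rightarrow> 'a set \<Rightarrow> bool" where
  "local_ring_with R \<mm> \<longleftrightarrow> cring R \<and> (\<forall>I. maximalideal I R \<longleftrightarrow> I = \<mm>)"

definition ring_radical :: "('a, 'k) ring_scheme \<Rightarrow> 'a set \<Rightarrow> 'a set" where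
  "ring_radical R I = {s \<in> carrier R. \<exists>n::nat. s [^]\<^bsub>R\<^esub> n \<in> I}"

text \<open>The value is \<open>-\<infinity>\<close> for the zero ring.\<close>

definition ring_krull_dim :: "('a, 'k) ring_scheme \<Rightarrow> ereal" where
  "ring_krull_dim R =
     Sup {ereal (real n) | n. \<exists>P :: nat \<Rightarrow> 'a set.
            (\<forall>i\<le>n. primeideal (P i) R) \<and> (\<forall>i<n. P i \<subset> P (Suc i))}"

definition annihilator :: "('a, 'k) ring_scheme \<Rightarrow> ('a, 'm, 'l) module_scheme \<Rightarrow> 'a set" where
  "annihilator R M = {s \<in> carrier R. \<forall>m\<in>carrier M. s \<odot>\<^bsub>M\<^esub> m = \<zero>\<^bsub>M\<^esub>}"

definition module_krull_dim ::
    "('a, 'k) ring_scheme \<Rightarrow> ('a, 'm, 'l) module_scheme \<Rightarrow> ereal" where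
  "module_krull_dim R M = ring_krull_dim (R Quot (annihilator R M))"

definition assoc_primes ::
    "('a, 'k) ring_scheme \<Rightarrow> ('a, 'm, 'l) module_scheme \<Rightarrow> 'a set set" where
  "assoc_primes R M =
     {P. primeideal P R \<and>
         (\<exists>m\<in>carrier M. P = {s \<in> carrier R. s \<odot>\<^bsub>M\<^esub> m = \<zero>\<^bsub>M\<^esub>})}"

definition module_length :: "('a, 'k) ring_scheme \<Rightarrow> ('a, 'm, 'l) module_scheme \<Rightarrow> enat" where
  "module_length R M =
     Sup {enat n | n. \<exists>H :: nat \<Rightarrow> 'm set.
            (\<forall>i\<le>n. submodule (H i) R M) \<and> (\<forall>i<n. H i \<subset> H (Suc i))}"

definition submodule_span ::
    "('a, 'k) ring_scheme \<Rightarrow> ('a, 'm, 'l) module_scheme \<Rightarrow> 'm set \<Rightarrow> 'm set" where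
  "submodule_span R M B = \<Inter>{H. submodule H R M \<and> B \<subseteq> H}"

definition finitely_generated_module ::
    "('a, 'k) ring_scheme \<Rightarrow> ('a, 'm, 'l) module_scheme \<Rightarrow> bool" where
  "finitely_generated_module R M \<longleftrightarrow> module R M \<and>
     (\<exists>B. finite B \<and> B \<subseteq> carrier M \<and> submodule_span R M B = carrier M)"

text \<open>The submodule \<open>J M\<close> for an ideal \<open>J\<close>.\<close>

definition ideal_smult ::
    "('a, 'k) ring_scheme \<Rightarrow> 'a set \<Rightarrow> ('a, 'm, 'l) module_scheme \<Rightarrow> 'm set" where
  "ideal_smult R J M = submodule_span R M {s \<odot>\<^bsub>M\<^esub> m | s m. s \<in> J \<and> m \<in> carrier M}"

text \<open>The ring multiplication and unit of a module record play no role and are left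
  unspecified.\<close>

definition quotient_module :: "('a, 'm, 'l) module_scheme \<Rightarrow> 'm set \<Rightarrow> ('a, 'm set) module" where
  "quotient_module M H =
     \<lparr>carrier = a_rcosets\<^bsub>M\<^esub> H, monoid.mult = undefined, one = undefined,
      ring.zero = H, ring.add = set_add M,
      smult = (\<lambda>a B. \<Union>x\<in>B. H +>\<^bsub>M\<^esub> (a \<odot>\<^bsub>M\<^esub> x))\<rparr>"

text \<open>An \<open>S\<close>-module viewed as an \<open>A\<close>-module, for an \<open>A\<close>-algebra \<open>S\<close>.\<close>

definition restrict_scalars ::
    "('a, 's, 'k) module_scheme \<Rightarrow> ('s, 'm, 'l) module_scheme \<Rightarrow> ('a, 'm) module" where
  "restrict_scalars S M =
     \<lparr>carrier = carrier M, monoid.mult = monoid.mult M, one = one M, ring.zero = ring.zero M, ring.add = ring.add M,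
      smult = (\<lambda>a m. (a \<odot>\<^bsub>S\<^esub> \<one>\<^bsub>S\<^esub>) \<odot>\<^bsub>M\<^esub> m)\<rparr>"

text \<open>\<open>0\<^sub>N : I\<^sup>\<infinity>\<close>; powers of ideals are powers in the library's structure of ideals
  under \<^const>\<open>ideal_prod\<close>.\<close>

definition zero_colon_infty ::
    "('a, 'k) ring_scheme \<Rightarrow> ('a, 'm, 'l) module_scheme \<Rightarrow> 'a set \<Rightarrow> 'm set" where
  "zero_colon_infty R N I =
     (\<Union>n::nat. {m \<in> carrier N. \<forall>s \<in> I [^]\<^bsub>ideals_set R\<^esub> n. s \<odot>\<^bsub>N\<^esub> m = \<zero>\<^bsub>N\<^esub>})"

section \<open>Gradings\<close>

definition direct_sum_decomp :: "('b, 'k) ring_scheme \<Rightarrow> ('i \<Rightarrow> 'b set) \<Rightarrow> bool" where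
  "direct_sum_decomp G D \<longleftrightarrow>
     (\<forall>u. additive_subgroup (D u) G) \<and>
     (\<forall>x\<in>carrier G. \<exists>!f. (\<forall>u. f u \<in> D u) \<and> finite {u. f u \<noteq> \<zero>\<^bsub>G\<^esub>} \<and>
        x = finsum G f {u. f u \<noteq> \<zero>\<^bsub>G\<^esub>})"

text \<open>The subset \<open>\<Oplus>\<^sub>u\<^sub>\<in>\<^sub>U D u\<close> of \<open>G\<close>.\<close>

definition graded_sum :: "('b, 'k) ring_scheme \<Rightarrow> ('i \<Rightarrow> 'b set) \<Rightarrow> 'i set \<Rightarrow> 'b set" where
  "graded_sum G D U =
     {finsum G f I | f I. finite I \<and> I \<subseteq> U \<and> (\<forall>u\<in>I. f u \<in> D u)}"

text \<open>Multidegrees are functions \<open>'d \<Rightarrow> nat\<close> on a finite (nonempty) index type with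
  \<open>d = CARD('d)\<close>.\<close>

definition unit_deg :: "'d \<Rightarrow> 'd \<Rightarrow> nat" where
  "unit_deg i = (\<lambda>j. if j = i then 1 else 0)"

definition diag_deg :: "nat \<Rightarrow> 'd \<Rightarrow> nat" where
  "diag_deg n = (\<lambda>_. n)"

text \<open>The structure map \<open>A \<rightarrow> S\<close> is \<open>a \<mapsto> a \<odot> 1\<close>; the last condition says that
  \<open>S\<close> is generated over its image by finitely many elements of total degree 1.\<close>

definition standard_multigraded_algebra ::
    "('a, 'k) ring_scheme \<Rightarrow> ('a, 's, 'l) module_scheme \<Rightarrow> (('d::finite \<Rightarrow> nat) \<Rightarrow> 's set) \<Rightarrow> bool"
  where
  "standard_multigraded_algebra A S Sg \<longleftrightarrow>
     algebra A S \<and> direct_sum_decomp S Sg \<and>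
     (\<forall>u. \<forall>a\<in>carrier A. \<forall>s\<in>Sg u. a \<odot>\<^bsub>S\<^esub> s \<in> Sg u) \<and>
     (\<forall>u v. \<forall>s\<in>Sg u. \<forall>t\<in>Sg v. s \<otimes>\<^bsub>S\<^esub> t \<in> Sg (\<lambda>i. u i + v i)) \<and>
     (\<exists>B. finite B \<and> B \<subseteq> (\<Union>i. Sg (unit_deg i)) \<and>
        generate_ring S ((\<lambda>a. a \<odot>\<^bsub>S\<^esub> \<one>\<^bsub>S\<^esub>) ` carrier A \<union> B) = carrier S)"

definition fg_multigraded_module ::
    "('s, 'k) ring_scheme \<Rightarrow> (('d::finite \<Rightarrow> nat) \<Rightarrow> 's set) \<Rightarrow>
     ('s, 'm, 'l) module_scheme \<Rightarrow> (('d \<Rightarrow> nat) \<Rightarrow> 'm set) \<Rightarrow> bool" where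
  "fg_multigraded_module S Sg M Mg \<longleftrightarrow>
     finitely_generated_module S M \<and> direct_sum_decomp M Mg \<and>
     (\<forall>u v. \<forall>s\<in>Sg u. \<forall>m\<in>Mg v. s \<odot>\<^bsub>M\<^esub> m \<in> Mg (\<lambda>i. u i + v i))"

text \<open>\<open>S\<^sub>+\<^sub>+\<close>\<close>

definition plus_plus :: "('s, 'k) ring_scheme \<Rightarrow> (('d::finite \<Rightarrow> nat) \<Rightarrow> 's set) \<Rightarrow> 's set" where
  "plus_plus S Sg = graded_sum S Sg {u. \<forall>i. 0 < u i}"

text \<open>\<open>S\<^sup>\<triangle>\<close> as a ring, or \<open>M\<^sup>\<triangle>\<close> as a module, depending on the record passed.\<close>

definition diagonal ::
    "('b, 'k) ring_scheme \<Rightarrow> (('d::finite \<Rightarrow> nat) \<Rightarrow> 'b set) \<Rightarrow> ('b, 'k) ring_scheme" where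
  "diagonal G D = G\<lparr>carrier := graded_sum G D (range diag_deg)\<rparr>"

text \<open>\<open>S\<^sup>\<triangle>\<^sub>+\<close>\<close>

definition diagonal_plus ::
    "('s, 'k) ring_scheme \<Rightarrow> (('d::finite \<Rightarrow> nat) \<Rightarrow> 's set) \<Rightarrow> 's set" where
  "diagonal_plus S Sg = graded_sum S Sg (diag_deg ` {0<..})"

section \<open>Mixed multiplicities\<close>

text \<open>Polynomials in variables indexed by \<open>'d\<close> are given by their (finitely supported)
  coefficient functions.\<close>

definition mpoly_eval :: "(('d::finite \<Rightarrow> nat) \<Rightarrow> rat) \<Rightarrow> ('d \<Rightarrow> nat) \<Rightarrow> rat" where
  "mpoly_eval c n = (\<Sum>u\<in>{u. c u \<noteq> 0}. c u * (\<Prod>i\<in>UNIV. of_nat (n i) ^ u i))"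

definition is_hilbert_poly ::
    "('a, 'k) ring_scheme \<Rightarrow> ('a, 's, 'l) module_scheme \<Rightarrow> ('s, 'm, 'n) module_scheme \<Rightarrow>
     (('d::finite \<Rightarrow> nat) \<Rightarrow> 'm set) \<Rightarrow> (('d \<Rightarrow> nat) \<Rightarrow> rat) \<Rightarrow> bool" where
  "is_hilbert_poly A S M Mg c \<longleftrightarrow> finite {u. c u \<noteq> 0} \<and>
     (\<exists>N. \<forall>n. (\<forall>i. N \<le> n i) \<longrightarrow>
        (\<exists>l. module_length A ((restrict_scalars S M)\<lparr>carrier := Mg n\<rparr>) = enat l \<and>
             of_nat l = mpoly_eval c n))"

text \<open>To be used for \<open>\<Sum>k\<^sub>i = dim M\<^sup>\<triangle> - 1\<close>, the total degree of the (unique) Hilbert polynomial.\<close>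

definition mixed_multiplicity ::
    "('a, 'k) ring_scheme \<Rightarrow> ('a, 's, 'l) module_scheme \<Rightarrow> ('s, 'm, 'n) module_scheme \<Rightarrow>
     (('d::finite \<Rightarrow> nat) \<Rightarrow> 'm set) \<Rightarrow> ('d \<Rightarrow> nat) \<Rightarrow> nat" where
  "mixed_multiplicity A S M Mg k =
     (THE e. \<exists>c. is_hilbert_poly A S M Mg c \<and> c k = of_nat e / (\<Prod>i\<in>UNIV. fact (k i)))"

section \<open>Filter-regular sequences\<close>

text \<open>\<open>S\<^sub>(\<^sub>1\<^sub>,\<^sub>\<dots>\<^sub>,\<^sub>1\<^sub>)\<close> is not contained in the radical of the annihilator of \<open>M\<close>.\<close>

definition diagonally_nondegenerate ::
    "('s, 'k) ring_scheme \<Rightarrow> (('d::finite \<Rightarrow> nat) \<Rightarrow> 's set) \<Rightarrow> ('s, 'm, 'l) module_scheme \<Rightarrow> bool"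
  where
  "diagonally_nondegenerate S Sg M \<longleftrightarrow>
     \<not> Sg (diag_deg 1) \<subseteq> ring_radical S (annihilator S M)"

definition filter_regular_elem ::
    "('s, 'k) ring_scheme \<Rightarrow> (('d::finite \<Rightarrow> nat) \<Rightarrow> 's set) \<Rightarrow>
     ('s, 'm, 'l) module_scheme \<Rightarrow> 's \<Rightarrow> bool" where
  "filter_regular_elem S Sg M x \<longleftrightarrow>
     diagonally_nondegenerate S Sg M \<and> (\<exists>u. x \<in> Sg u) \<and>
     (\<forall>P\<in>assoc_primes S M. \<not> plus_plus S Sg \<subseteq> P \<longrightarrow> x \<notin> P)"

text \<open>\<open>M / (x\<^sub>1, \<dots>, x\<^sub>t) M\<close> and its induced grading.\<close>

definition quot_seq ::
    "('s, 'k) ring_scheme \<Rightarrow> ('s, 'm, 'l) module_scheme \<Rightarrow> 's list \<Rightarrow> ('s, 'm set) module" where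
  "quot_seq S M xs = quotient_module M (ideal_smult S (genideal S (set xs)) M)"

definition quot_seq_grading ::
    "('s, 'k) ring_scheme \<Rightarrow> ('s, 'm, 'l) module_scheme \<Rightarrow> 's list \<Rightarrow>
     ('i \<Rightarrow> 'm set) \<Rightarrow> 'i \<Rightarrow> 'm set set" where
  "quot_seq_grading S M xs Mg u =
     (\<lambda>m. ideal_smult S (genideal S (set xs)) M +>\<^bsub>M\<^esub> m) ` Mg u"

definition filter_regular_seq ::
    "('s, 'k) ring_scheme \<Rightarrow> (('d::finite \<Rightarrow> nat) \<Rightarrow> 's set) \<Rightarrow>
     ('s, 'm, 'l) module_scheme \<Rightarrow> 's list \<Rightarrow> bool" where
  "filter_regular_seq S Sg M xs \<longleftrightarrow>
     (\<forall>i<length xs. filter_regular_elem S Sg (quot_seq S M (take i xs)) (xs ! i))"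

text \<open>The sequence consists, in any order, of \<open>k i\<close> elements of \<open>S\<^sub>i\<close> for each \<open>i\<close>; \<open>\<tau> j\<close> is the
  index to which the \<open>j\<close>-th element is assigned.\<close>

definition seq_of_type :: "(('d::finite \<Rightarrow> nat) \<Rightarrow> 's set) \<Rightarrow> ('d \<Rightarrow> nat) \<Rightarrow> 's list \<Rightarrow> bool" where
  "seq_of_type Sg k xs \<longleftrightarrow>
     (\<exists>\<tau> :: nat \<Rightarrow> 'd. (\<forall>j<length xs. xs ! j \<in> Sg (unit_deg (\<tau> j))) \<and>
        (\<forall>i. card {j. j < length xs \<and> \<tau> j = i} = k i))"

section \<open>Reductions\<close>

text \<open>Here \<open>R\<close> is graded by \<open>Rg\<close> and \<open>N\<close> by \<open>Ng\<close>, both over the natural numbers. Reductions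
  are reductions of the irrelevant ideal \<open>R\<^sub>+\<close> with respect to \<open>N\<close>.\<close>

definition is_reduction ::
    "('s, 'k) ring_scheme \<Rightarrow> (nat \<Rightarrow> 's set) \<Rightarrow> ('s, 'm, 'l) module_scheme \<Rightarrow>
     (nat \<Rightarrow> 'm set) \<Rightarrow> 's set \<Rightarrow> bool" where
  "is_reduction R Rg N Ng J \<longleftrightarrow>
     (\<exists>B \<subseteq> Rg 1. J = genideal R B) \<and>
     (\<exists>n0. \<forall>n\<ge>n0. ideal_smult R J N \<inter> Ng n = Ng n)"

definition is_minimal_reduction ::
    "('s, 'k) ring_scheme \<Rightarrow> (nat \<Rightarrow> 's set) \<Rightarrow> ('s, 'm, 'l) module_scheme \<Rightarrow>
     (nat \<Rightarrow> 'm set) \<Rightarrow> 's set \<Rightarrow> bool" where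
  "is_minimal_reduction R Rg N Ng J \<longleftrightarrow>
     is_reduction R Rg N Ng J \<and> (\<nexists>K. is_reduction R Rg N Ng K \<and> K \<subset> J)"

definition reduction_number_wrt ::
    "('s, 'k) ring_scheme \<Rightarrow> ('s, 'm, 'l) module_scheme \<Rightarrow> (nat \<Rightarrow> 'm set) \<Rightarrow> 's set \<Rightarrow> nat" where
  "reduction_number_wrt R N Ng J =
     (LEAST n. \<forall>m\<ge>n. ideal_smult R J N \<inter> Ng (m + 1) = Ng (m + 1))"

definition reduction_number ::
    "('s, 'k) ring_scheme \<Rightarrow> (nat \<Rightarrow> 's set) \<Rightarrow> ('s, 'm, 'l) module_scheme \<Rightarrow>
     (nat \<Rightarrow> 'm set) \<Rightarrow> nat" where
  "reduction_number R Rg N Ng =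
     (LEAST r. \<exists>J. is_minimal_reduction R Rg N Ng J \<and> r = reduction_number_wrt R N Ng J)"

end

theory Submission
  imports Defs
begin

text \<open>For a homogeneous \<open>x\<close>, being \<open>S\<^sub>+\<^sub>+\<close>-filter-regular means that multiplication by \<open>x\<close> is injective on
  \<open>M\<^sub>n\<close> for all large \<open>n\<close>. If \<open>x\<close> has degree \<open>e\<^sub>i\<close>, the Hilbert function of \<open>M/xM\<close> is therefore the
  backward difference of that of \<open>M\<close> in direction \<open>i\<close>, so that a sequence \<open>x\<^sub>1, \<dots>, x\<^sub>t\<close> of type \<open>k\<close>, where
  \<open>t = \<ell> - 1\<close>, turns the Hilbert polynomial into the constant \<open>e(M; k)\<close>. Such sequences exist by prime
  avoidance, the residue field being infinite; without the non-degeneracy condition they exist even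
  when \<open>e(M; k) = 0\<close>, and the condition holds along the way when \<open>e(M; k) \<noteq> 0\<close>.

  Dimensions are compared through chains of primes of the diagonal ring: a chain over \<open>M/xM\<close> that
  starts at a prime not containing \<open>S\<^sub>(\<^sub>1\<^sub>,\<^sub>\<dots>\<^sub>,\<^sub>1\<^sub>)\<close> can be prolonged downwards to one over \<open>M\<close>. This bounds the
  degree of the Hilbert polynomial by \<open>\<ell> - 1\<close> and shows that the diagonal of the last quotient, whose
  Hilbert function is eventually \<open>e(M; k)\<close>, has dimension 1 exactly when \<open>e(M; k) \<noteq> 0\<close>.

  A minimal reduction of the diagonal of that quotient is generated by one element \<open>x\<close>: by Nakayama's
  lemma no relevant associated prime contains the generators of a reduction, so prime avoidance gives a
  filter-regular \<open>x\<close> among their \<open>A\<close>-linear combinations, and eventually constant lengths make \<open>x\<close>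
  eventually bijective. From the reduction number on \<open>x\<close> is surjective, and the elements killed by a
  large power of \<open>x\<close> form \<open>0 : (S\<^sup>\<triangle>\<^sub>+)\<^sup>\<infinity>\<close>.\<close>

section \<open>Polynomial functions on tuples of naturals\<close>

text \<open>Dimension enters only through chains of primes: a chain gives a lower bound for
  \<open>ell\<close>, and upper bounds follow because a monomial of large degree, or a long chain
  over the last quotient, lifts to a long chain over \<open>M\<close>. The obstacle is that
  filter-regularity controls large degrees only. Below a prime containing all elements of large
  diagonal degree it gives nothing, hence the condition on the bottom prime; for chains of positive
  length it is automatic, since a prime of the diagonal ring containing S_(1,...,1) is maximal.

  Hilbert functions are attached to graded submodules K of the fixed module M and stand for M/K.
  Successive quotients become an increasing sequence of submodules, lengths become lengths of
  intervals, and polynomiality is proved by Noetherian induction on K. The chain condition itself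
  comes from the finite length of A by adjoining the algebra generators one at a time.

  In (ii), surjectivity of x is available from the reduction number on, injectivity only beyond an
  unrelated threshold; a high power of x bridges the gap.\<close>

definition large :: "(('d::finite \<Rightarrow> nat) \<Rightarrow> bool) \<Rightarrow> bool" where
  "large P \<longleftrightarrow> (\<exists>N. \<forall>n. (\<forall>i. N \<le> n i) \<longrightarrow> P n)"

lemma largeI: "(\<And>n. (\<And>i. N \<le> n i) \<Longrightarrow> P n) \<Longrightarrow> large P"
  unfolding large_def by blast

lemma large_mono: "large P \<Longrightarrow> (\<And>n. P n \<Longrightarrow> Q n) \<Longrightarrow> large Q"
  unfolding large_def by blast

lemma large_conj: "large P \<Longrightarrow> large Q \<Longrightarrow> large (\<lambda>n. P n \<and> Q n)"
  unfolding large_def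
proof -
  assume "\<exists>N. \<forall>n. (\<forall>i. N \<le> n i) \<longrightarrow> P n" "\<exists>N. \<forall>n. (\<forall>i. N \<le> n i) \<longrightarrow> Q n"
  then obtain N1 N2 where "\<forall>n. (\<forall>i. N1 \<le> n i) \<longrightarrow> P n" "\<forall>n. (\<forall>i. N2 \<le> n i) \<longrightarrow> Q n"
    by blast
  then show "\<exists>N. \<forall>n. (\<forall>i. N \<le> n i) \<longrightarrow> P n \<and> Q n"
    by (intro exI[of _ "max N1 N2"]) auto
qed

lemma large_True: "(\<And>n. P n) \<Longrightarrow> large P"
  unfolding large_def by blast

lemma large_ball_finite:
  assumes "finite Z" "\<And>x. x \<in> Z \<Longrightarrow> large (P x)"
  shows "large (\<lambda>n. \<forall>x\<in>Z. P x n)"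
  using assms
proof (induction Z)
  case empty then show ?case by (simp add: large_def)
next
  case (insert x F)
  have "large (\<lambda>n. P x n \<and> (\<forall>x\<in>F. P x n))"
    using insert by (intro large_conj) auto
  then show ?case by (rule large_mono) auto
qed

lemma large_ge: "large (\<lambda>n. \<forall>i. N \<le> n i)"
  unfolding large_def by blast

lemma large_shift_down:
  fixes i :: "'d::finite"
  assumes "large (P :: ('d \<Rightarrow> nat) \<Rightarrow> bool)" shows "large (\<lambda>n. P (n(i := n i - 1)))"
proof -
  obtain N where N: "\<And>n. (\<forall>i. N \<le> n i) \<Longrightarrow> P n" using assms unfolding large_def by blast
  show ?thesis
  proof (rule largeI[of "N + 1"])
    fix n :: "'d \<Rightarrow> nat" assume n: "\<And>j. N + 1 \<le> n j"
    have "N \<le> (n(i := n i - 1)) j" for j using n[of j] by auto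
    then show "P (n(i := n i - 1))" using N by blast
  qed
qed

lemma large_shift_up:
  assumes "large P" shows "large (\<lambda>n. P (\<lambda>j. n j + v j))"
proof -
  obtain N where N: "\<And>n. (\<forall>i. N \<le> n i) \<Longrightarrow> P n" using assms unfolding large_def by blast
  show ?thesis
    by (rule largeI[of N]) (auto intro!: N simp: trans_le_add1)
qed

text \<open>The eventual quantifier is never vacuous: the constant tuple at the threshold is an
  instance. This is how eventual statements are turned into contradictions.\<close>

lemma large_const: 
  assumes "large (\<lambda>n::'d::finite \<Rightarrow> nat. P)" shows P
proof -
  obtain N where "\<And>n::'d \<Rightarrow> nat. (\<forall>i. N \<le> n i) \<Longrightarrow> P" using assms unfolding large_def by blast
  from this[of "\<lambda>_. N"] show P by simp
qed

section \<open>Backward differences of polynomials\<close>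

definition monom_fun :: "('d::finite \<Rightarrow> nat) \<Rightarrow> ('d \<Rightarrow> nat) \<Rightarrow> rat" where
  "monom_fun u n = (\<Prod>i\<in>UNIV. of_nat (n i) ^ u i)"

lemma mpoly_eval_superset:
  assumes "finite T" "{u. c u \<noteq> 0} \<subseteq> T"
  shows "mpoly_eval c n = (\<Sum>u\<in>T. c u * monom_fun u n)"
  unfolding mpoly_eval_def monom_fun_def
  by (rule sum.mono_neutral_left) (use assms in auto)

lemma mpoly_eval_add:
  assumes "finite {u. c u \<noteq> 0}" "finite {u. d u \<noteq> 0}"
  shows "mpoly_eval (\<lambda>u. c u + d u) n = mpoly_eval c n + mpoly_eval d n"
proof -
  let ?T = "{u. c u \<noteq> 0} \<union> {u. d u \<noteq> 0}"
  have T: "finite ?T" using assms by simp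
  show ?thesis
    by (subst (1 2 3) mpoly_eval_superset[OF T]) (auto simp: sum.distrib algebra_simps)
qed

lemma mpoly_eval_diff:
  assumes "finite {u. c u \<noteq> 0}" "finite {u. d u \<noteq> 0}"
  shows "mpoly_eval (\<lambda>u. c u - d u) n = mpoly_eval c n - mpoly_eval d n"
proof -
  let ?T = "{u. c u \<noteq> 0} \<union> {u. d u \<noteq> 0}"
  have T: "finite ?T" using assms by simp
  show ?thesis
    by (subst (1 2 3) mpoly_eval_superset[OF T]) (auto simp: sum_subtractf algebra_simps)
qed

lemma monom_fun_upd:
  "monom_fun (u(i := q)) n = of_nat (n i) ^ q * (\<Prod>j\<in>UNIV-{i}. of_nat (n j) ^ u j)"
  unfolding monom_fun_def
  by (subst prod.remove[of UNIV i]) (auto intro!: prod.cong)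

lemma monom_fun_split:
  "monom_fun u n = of_nat (n i) ^ u i * (\<Prod>j\<in>UNIV-{i}. of_nat (n j) ^ u j)"
  using monom_fun_upd[of u i "u i" n] by simp

text \<open>Binomial theorem with the top term cancelled. The coefficient at
  \<open>q = p - 1\<close> is \<open>p\<close>, which makes the backward difference act on top terms
  like a derivative.\<close>

lemma power_diff_backward:
  fixes x :: rat
  shows "x ^ p - (x - 1) ^ p = (\<Sum>q<p. (- of_nat (p choose q) * (-1) ^ (p - q)) * x ^ q)"
proof -
  have "(x - 1) ^ p = (x + (-1)) ^ p" by simp
  also have "\<dots> = (\<Sum>q\<le>p. of_nat (p choose q) * x ^ q * (-1) ^ (p - q))"
    by (rule binomial_ring)
  also have "\<dots> = (\<Sum>q<p. of_nat (p choose q) * x ^ q * (-1) ^ (p - q)) + x ^ p"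
    by (simp add: lessThan_Suc_atMost[symmetric])
  finally show ?thesis
    by (simp add: sum_negf[symmetric] algebra_simps)
qed

text \<open>Only the coefficients in total degree \<open>D - 1\<close> are described exactly; there
  the difference in direction \<open>i\<close> is the partial derivative. \<open>D\<close> is a
  bound and not the degree itself, so that monomials of different degrees can be added later. The
  condition \<open>1 \<le> n i\<close> keeps the subtraction on natural numbers honest.\<close>

lemma nabla_monom:
  fixes u :: "'d::finite \<Rightarrow> nat"
  assumes "(\<Sum>j\<in>UNIV. u j) \<le> D"
  shows "\<exists>c'. finite {v. c' v \<noteq> 0} \<and> (\<forall>v. c' v \<noteq> 0 \<longrightarrow> (\<Sum>j\<in>UNIV. v j) + 1 \<le> D) \<and>
     (\<forall>v. (\<Sum>j\<in>UNIV. v j) + 1 = D \<longrightarrow> c' v = (of_nat (v i) + 1) * (if v(i := v i + 1) = u then a else 0)) \<and>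
     (\<forall>n. 1 \<le> n i \<longrightarrow> a * monom_fun u n - a * monom_fun u (n(i := n i - 1)) = mpoly_eval c' n)"
proof -
  let ?b = "\<lambda>q. (- of_nat (u i choose q) * (-1) ^ (u i - q)) :: rat"
  define c' where "c' v = (if v i < u i \<and> v(i := u i) = u then a * ?b (v i) else 0)" for v
  let ?T = "(\<lambda>q. u(i := q)) ` {..<u i}"
  have sub: "{v. c' v \<noteq> 0} \<subseteq> ?T"
  proof
    fix v assume "v \<in> {v. c' v \<noteq> 0}"
    then have "v i < u i" "v(i := u i) = u" by (auto simp: c'_def split: if_splits)
    then have "v = u(i := v i)" by (metis fun_upd_triv fun_upd_upd)
    then show "v \<in> ?T" using \<open>v i < u i\<close> by blast
  qed
  have sumupd: "(\<Sum>j\<in>UNIV. (v(i := q)) j) + v i = (\<Sum>j\<in>UNIV. v j) + q" for v :: "'d \<Rightarrow> nat" and q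
  proof -
    have "(\<Sum>j\<in>UNIV. (v(i := q)) j) = q + (\<Sum>j\<in>UNIV-{i}. v j)"
      by (subst sum.remove[of UNIV i]) auto
    moreover have "(\<Sum>j\<in>UNIV. v j) = v i + (\<Sum>j\<in>UNIV-{i}. v j)"
      by (subst sum.remove[of UNIV i]) auto
    ultimately show ?thesis by simp
  qed
  have fin: "finite {v. c' v \<noteq> 0}" using sub finite_subset by blast
  moreover have "(\<Sum>j\<in>UNIV. v j) + 1 \<le> D" if "c' v \<noteq> 0" for v
  proof -
    have "v i < u i" "v(i := u i) = u" using that by (auto simp: c'_def split: if_splits)
    with sumupd[of v "u i"] have "(\<Sum>j\<in>UNIV. u j) + v i = (\<Sum>j\<in>UNIV. v j) + u i" by simp
    with \<open>v i < u i\<close> assms show ?thesis by linarith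
  qed
  moreover have "c' v = (of_nat (v i) + 1) * (if v(i := v i + 1) = u then a else 0)"
    if s: "(\<Sum>j\<in>UNIV. v j) + 1 = D" for v
  proof (cases "v(i := v i + 1) = u")
    case True
    then have 1: "u i = v i + 1" by (metis fun_upd_same)
    then have "v(i := u i) = u" using True by simp
    then show ?thesis using 1 True by (simp add: c'_def)
  next
    case False
    have "c' v = 0"
    proof (rule ccontr)
      assume "c' v \<noteq> 0"
      then have *: "v i < u i" "v(i := u i) = u" by (auto simp: c'_def split: if_splits)
      with sumupd[of v "u i"] have "(\<Sum>j\<in>UNIV. u j) + v i = (\<Sum>j\<in>UNIV. v j) + u i" by simp
      \<comment> \<open>In degree \<open>D - 1\<close> the exponent at \<open>i\<close> can have
        dropped by one only, since \<open>u\<close> itself has degree at most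
        \<open>D\<close>.\<close>
      with * assms s have "u i = v i + 1" by linarith
      with * False show False by simp
    qed
    then show ?thesis using False by simp
  qed
  moreover have "a * monom_fun u n - a * monom_fun u (n(i := n i - 1)) = mpoly_eval c' n" if "1 \<le> n i" for n
  proof -
    let ?g = "\<Prod>j\<in>UNIV-{i}. of_nat (n j) ^ u j :: rat"
    let ?x = "of_nat (n i) :: rat"
    have 1: "monom_fun u (n(i := n i - 1)) = (?x - 1) ^ u i * ?g"
      using that by (subst monom_fun_split[of _ _ i]) (auto simp: of_nat_diff intro!: prod.cong)
    have "mpoly_eval c' n = (\<Sum>v\<in>?T. c' v * monom_fun v n)"
      by (rule mpoly_eval_superset[OF _ sub]) simp
    also have "\<dots> = (\<Sum>q<u i. c' (u(i := q)) * monom_fun (u(i := q)) n)"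
    proof (subst sum.reindex)
      show "inj_on (\<lambda>q. u(i := q)) {..<u i}"
        by (rule inj_onI) (metis fun_upd_same)
    qed simp
    also have "\<dots> = (\<Sum>q<u i. a * ?b q * (?x ^ q * ?g))"
      by (rule sum.cong) (auto simp: c'_def monom_fun_upd)
    also have "\<dots> = a * ?g * (\<Sum>q<u i. ?b q * ?x ^ q)"
      by (simp add: sum_distrib_left algebra_simps)
    also have "\<dots> = a * ?g * (?x ^ u i - (?x - 1) ^ u i)"
      by (subst power_diff_backward) simp
    finally show ?thesis
      by (subst 1, subst monom_fun_split[of u n i]) (simp add: algebra_simps)
  qed
  ultimately show ?thesis by (intro exI[of _ c']) auto
qed

text \<open>Linearity, one monomial at a time. The induction runs over a finite superset of the
  support, because deleting the monomial \<open>w\<close> changes the coefficient function as well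
  as the set.\<close>

lemma nabla_exists:
  fixes c :: "('d::finite \<Rightarrow> nat) \<Rightarrow> rat"
  assumes "finite {u. c u \<noteq> 0}" "\<And>u. c u \<noteq> 0 \<Longrightarrow> (\<Sum>j\<in>UNIV. u j) \<le> D"
  shows "\<exists>c'. finite {v. c' v \<noteq> 0} \<and> (\<forall>v. c' v \<noteq> 0 \<longrightarrow> (\<Sum>j\<in>UNIV. v j) + 1 \<le> D) \<and>
     (\<forall>v. (\<Sum>j\<in>UNIV. v j) + 1 = D \<longrightarrow> c' v = (of_nat (v i) + 1) * c (v(i := v i + 1))) \<and>
     (\<forall>n. 1 \<le> n i \<longrightarrow> mpoly_eval c n - mpoly_eval c (n(i := n i - 1)) = mpoly_eval c' n)"
proof -
  have "\<exists>c'. finite {v. c' v \<noteq> 0} \<and> (\<forall>v. c' v \<noteq> 0 \<longrightarrow> (\<Sum>j\<in>UNIV. v j) + 1 \<le> D) \<and>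
     (\<forall>v. (\<Sum>j\<in>UNIV. v j) + 1 = D \<longrightarrow> c' v = (of_nat (v i) + 1) * c (v(i := v i + 1))) \<and>
     (\<forall>n. 1 \<le> n i \<longrightarrow> mpoly_eval c n - mpoly_eval c (n(i := n i - 1)) = mpoly_eval c' n)"
    if "finite T" "{u. c u \<noteq> 0} \<subseteq> T" "\<And>u. u \<in> T \<Longrightarrow> (\<Sum>j\<in>UNIV. u j) \<le> D" for T c
    using that
  proof (induction T arbitrary: c)
    case empty
    then have "c = (\<lambda>_. 0)" by auto
    then show ?case by (intro exI[of _ "\<lambda>_. 0"]) (simp add: mpoly_eval_def)
  next
    case (insert w T)
    define d where "d = c(w := 0)"
    have dT: "{u. d u \<noteq> 0} \<subseteq> T" using insert.prems by (auto simp: d_def)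
    obtain c1 where c1: "finite {v. c1 v \<noteq> 0}" "\<forall>v. c1 v \<noteq> 0 \<longrightarrow> (\<Sum>j\<in>UNIV. v j) + 1 \<le> D"
      "\<forall>v. (\<Sum>j\<in>UNIV. v j) + 1 = D \<longrightarrow> c1 v = (of_nat (v i) + 1) * d (v(i := v i + 1))"
      "\<forall>n. 1 \<le> n i \<longrightarrow> mpoly_eval d n - mpoly_eval d (n(i := n i - 1)) = mpoly_eval c1 n"
      using insert.IH[OF dT] insert.prems by blast
    obtain c2 where c2: "finite {v. c2 v \<noteq> 0}" "\<forall>v. c2 v \<noteq> 0 \<longrightarrow> (\<Sum>j\<in>UNIV. v j) + 1 \<le> D"
      "\<forall>v. (\<Sum>j\<in>UNIV. v j) + 1 = D \<longrightarrow> c2 v = (of_nat (v i) + 1) * (if v(i := v i + 1) = w then c w else 0)"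
      "\<forall>n. 1 \<le> n i \<longrightarrow> c w * monom_fun w n - c w * monom_fun w (n(i := n i - 1)) = mpoly_eval c2 n"
      using nabla_monom[of w D i "c w"] insert.prems by auto
    have ev: "mpoly_eval c n = mpoly_eval d n + c w * monom_fun w n" for n
    proof -
      have "mpoly_eval c n = (\<Sum>u\<in>insert w T. c u * monom_fun u n)"
        using insert by (intro mpoly_eval_superset) auto
      also have "\<dots> = c w * monom_fun w n + (\<Sum>u\<in>T. c u * monom_fun u n)"
        using insert by simp
      also have "(\<Sum>u\<in>T. c u * monom_fun u n) = (\<Sum>u\<in>T. d u * monom_fun u n)"
        using insert by (intro sum.cong) (auto simp: d_def)
      also have "\<dots> = mpoly_eval d n"
        using insert dT by (intro mpoly_eval_superset[symmetric]) auto
      finally show ?thesis by simp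
    qed
    let ?c = "\<lambda>v. c1 v + c2 v"
    have "{v. ?c v \<noteq> 0} \<subseteq> {v. c1 v \<noteq> 0} \<union> {v. c2 v \<noteq> 0}" by auto
    then have "finite {v. ?c v \<noteq> 0}" using c1(1) c2(1) finite_subset by blast
    moreover have "(\<Sum>j\<in>UNIV. v j) + 1 \<le> D" if "?c v \<noteq> 0" for v
    proof -
      have "c1 v \<noteq> 0 \<or> c2 v \<noteq> 0" using that by auto
      then show ?thesis using c1(2) c2(2) by blast
    qed
    moreover have "?c v = (of_nat (v i) + 1) * c (v(i := v i + 1))" if "(\<Sum>j\<in>UNIV. v j) + 1 = D" for v
    proof -
      have "?c v = (of_nat (v i) + 1) * (d (v(i := v i + 1)) + (if v(i := v i + 1) = w then c w else 0))"
        using c1(3) c2(3) that by (simp only: distrib_left)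
      also have "d (v(i := v i + 1)) + (if v(i := v i + 1) = w then c w else 0) = c (v(i := v i + 1))"
        by (simp add: d_def)
      finally show ?thesis .
    qed
    moreover have "mpoly_eval c n - mpoly_eval c (n(i := n i - 1)) = mpoly_eval ?c n" if "1 \<le> n i" for n
    proof -
      have "mpoly_eval d n - mpoly_eval d (n(i := n i - 1)) = mpoly_eval c1 n"
        "c w * monom_fun w n - c w * monom_fun w (n(i := n i - 1)) = mpoly_eval c2 n"
        using c1(4) c2(4) that by blast+
      then show ?thesis
        unfolding ev mpoly_eval_add[OF c1(1) c2(1)] by linarith
    qed
    ultimately show ?case by (intro exI[of _ ?c]) blast
  qed
  from this[OF assms(1) order.refl] assms(2) show ?thesis by auto
qed

lemma prod_fact_upd:
  fixes k :: "'d::finite \<Rightarrow> nat"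
  shows "(\<Prod>j\<in>UNIV. fact ((k(i := Suc (k i))) j)) = (of_nat (k i) + 1) * (\<Prod>j\<in>UNIV. fact (k j) :: rat)"
proof -
  have "(\<Prod>j\<in>UNIV. fact ((k(i := Suc (k i))) j)) = fact (Suc (k i)) * (\<Prod>j\<in>UNIV-{i}. fact (k j) :: rat)"
    by (subst prod.remove[of UNIV i]) (auto intro!: prod.cong)
  moreover have "(\<Prod>j\<in>UNIV. fact (k j) :: rat) = fact (k i) * (\<Prod>j\<in>UNIV-{i}. fact (k j) :: rat)"
    by (subst prod.remove[of UNIV i]) auto
  ultimately show ?thesis by (simp add: algebra_simps)
qed

lemma sum_count_list_UNIV: "(\<Sum>i\<in>UNIV. count_list xs (i::'d::finite)) = length xs"
  by (rule sum_count_set) auto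

text \<open>Each difference lowers the degree bound by one and differentiates the top form, so after
  \<open>length is\<close> differences only the coefficient at the multidegree counted by
  \<open>is\<close> survives, and the derivatives contribute the factorials. The functions
  \<open>h t\<close> are tied to each other only eventually, since Hilbert functions of successive
  quotients are differences only in large degrees.\<close>

lemma iterated_nabla_top:
  fixes h :: "nat \<Rightarrow> ('d::finite \<Rightarrow> nat) \<Rightarrow> rat"
  assumes "finite {u. c u \<noteq> 0}" "\<And>u. c u \<noteq> 0 \<Longrightarrow> (\<Sum>j\<in>UNIV. u j) \<le> length is"
    and "large (\<lambda>n. h 0 n = mpoly_eval c n)"
    and "\<And>t. t < length is \<Longrightarrow> large (\<lambda>n. h (Suc t) n = h t n - h t (n(is ! t := n (is ! t) - 1)))"
  shows "large (\<lambda>n. h (length is) n = c (count_list is) * (\<Prod>i\<in>UNIV. fact (count_list is i)))"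
  using assms
proof (induction "is" arbitrary: h c)
  case Nil
  have "mpoly_eval c n = (\<Sum>u\<in>{\<lambda>_. 0}. c u * monom_fun u n)" for n
  proof (rule mpoly_eval_superset)
    show "{u. c u \<noteq> 0} \<subseteq> {\<lambda>_. 0}"
    proof
      fix u assume "u \<in> {u. c u \<noteq> 0}"
      then have "(\<Sum>j\<in>UNIV. u j) = 0" using Nil.prems(2) by fastforce
      then show "u \<in> {\<lambda>_. 0}" by (simp add: fun_eq_iff)
    qed
  qed simp
  then have e: "mpoly_eval c n = c (\<lambda>_. 0)" for n by (simp add: monom_fun_def)
  have "count_list [] = (\<lambda>_::'d. 0)" by (simp add: fun_eq_iff)
  then show ?case using Nil.prems(3) by (simp add: e)
next
  case (Cons i xs)
  have "\<And>u. c u \<noteq> 0 \<Longrightarrow> (\<Sum>j\<in>UNIV. u j) \<le> Suc (length xs)"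
    using Cons.prems(2) by fastforce
  from nabla_exists[OF Cons.prems(1) this, of i]
  obtain c' where c': "finite {v. c' v \<noteq> 0}" "\<And>v. c' v \<noteq> 0 \<Longrightarrow> (\<Sum>j\<in>UNIV. v j) + 1 \<le> Suc (length xs)"
     "\<And>v. (\<Sum>j\<in>UNIV. v j) + 1 = Suc (length xs) \<Longrightarrow> c' v = (of_nat (v i) + 1) * c (v(i := v i + 1))"
     "\<And>n. 1 \<le> n i \<Longrightarrow> mpoly_eval c n - mpoly_eval c (n(i := n i - 1)) = mpoly_eval c' n"
    by blast
  have "large (\<lambda>n. h (Suc (length xs)) n = c' (count_list xs) * (\<Prod>i\<in>UNIV. fact (count_list xs i)))"
  proof (rule Cons.IH[of c' "\<lambda>t. h (Suc t)"])
    show "large (\<lambda>n. h (Suc 0) n = mpoly_eval c' n)"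
    proof -
      have "large (\<lambda>n. (h (Suc 0) n = h 0 n - h 0 (n(i := n i - 1))) \<and> h 0 n = mpoly_eval c n
              \<and> h 0 (n(i := n i - 1)) = mpoly_eval c (n(i := n i - 1)) \<and> (\<forall>i. 1 \<le> n i))"
        using Cons.prems(4)[of 0, simplified nth_Cons_0] Cons.prems(3) large_shift_down[OF Cons.prems(3)]
        by (intro large_conj large_ge) (simp_all del: fun_upd_apply)
      then show ?thesis by (rule large_mono) (use c'(4) in auto)
    qed
    show "large (\<lambda>n. h (Suc (Suc t)) n = h (Suc t) n - h (Suc t) (n(xs ! t := n (xs ! t) - 1)))"
      if "t < length xs" for t
      using Cons.prems(4)[of "Suc t", simplified nth_Cons_Suc] that by (simp del: fun_upd_apply)
  qed (use c' in \<open>auto simp: Suc_le_eq less_Suc_eq_le\<close>)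
  moreover have "c' (count_list xs) = (of_nat (count_list xs i) + 1) * c (count_list (i # xs))"
  proof -
    have "count_list (i # xs) = (count_list xs)(i := count_list xs i + 1)" by auto
    then show ?thesis using c'(3)[of "count_list xs"] by (simp add: sum_count_list_UNIV)
  qed
  moreover have "(\<Prod>j\<in>UNIV. fact (count_list (i # xs) j)) =
      (of_nat (count_list xs i) + 1) * (\<Prod>j\<in>UNIV. fact (count_list xs j) :: rat)"
  proof -
    have "count_list (i # xs) = (count_list xs)(i := Suc (count_list xs i))" by auto
    then show ?thesis using prod_fact_upd[of "count_list xs" i] by simp
  qed
  ultimately show ?case by (simp add: mult_ac del: count_list.simps fun_upd_apply)
qed

lemma exists_count_list:
  fixes k :: "'d::finite \<Rightarrow> nat"
  shows "\<exists>xs. count_list xs = k"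
proof -
  have "\<exists>xs. count_list xs = k" if "(\<Sum>i\<in>UNIV. k i) = m" for m and k :: "'d \<Rightarrow> nat"
    using that
  proof (induction m arbitrary: k)
    case 0
    then have "k = (\<lambda>_. 0)" by (simp add: fun_eq_iff)
    then show ?case by (intro exI[of _ "[]"]) (simp add: fun_eq_iff)
  next
    case (Suc m)
    then obtain i where i: "k i > 0" by (metis gr0I nat.simps(3) sum.neutral)
    have "(\<Sum>j\<in>UNIV. (k(i := k i - 1)) j) = m"
    proof -
      have "(\<Sum>j\<in>UNIV. (k(i := k i - 1)) j) = k i - 1 + (\<Sum>j\<in>UNIV-{i}. k j)"
        by (subst sum.remove[of UNIV i]) auto
      moreover have "(\<Sum>j\<in>UNIV. k j) = k i + (\<Sum>j\<in>UNIV-{i}. k j)"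
        by (subst sum.remove[of UNIV i]) auto
      ultimately show ?thesis using Suc.prems i by simp
    qed
    from Suc.IH[OF this] obtain xs where xs: "count_list xs = k(i := k i - 1)" by blast
    have "count_list (i # xs) = k" using xs i by (auto simp: fun_eq_iff)
    then show ?case by blast
  qed
  then show ?thesis by blast
qed

text \<open>Differentiating along a monomial \<open>k\<close> of top degree leaves a nonzero
  multiple of its coefficient, while all differences of an eventually vanishing function vanish
  eventually.\<close>

lemma mpoly_eval_large_zero:
  fixes c :: "('d::finite \<Rightarrow> nat) \<Rightarrow> rat"
  assumes "finite {u. c u \<noteq> 0}" "large (\<lambda>n. mpoly_eval c n = 0)"
  shows "c = (\<lambda>_. 0)"
proof (rule ccontr)
  assume "c \<noteq> (\<lambda>_. 0)"
  then have ne: "{u. c u \<noteq> 0} \<noteq> {}" by auto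
  define D where "D = Max ((\<lambda>u. \<Sum>j\<in>UNIV. u j) ` {u. c u \<noteq> 0})"
  have "D \<in> (\<lambda>u. \<Sum>j\<in>UNIV. u j) ` {u. c u \<noteq> 0}"
    unfolding D_def using assms(1) ne by (intro Max_in) auto
  then obtain k where k: "c k \<noteq> 0" "(\<Sum>j\<in>UNIV. k j) = D" by auto
  obtain xs where xs: "count_list xs = k" using exists_count_list by blast
  have len: "length xs = D" using sum_count_list_UNIV[of xs] k xs by simp
  define h where "h = rec_nat (mpoly_eval c) (\<lambda>t f n. f n - f (n(xs ! t := n (xs ! t) - 1)))"
  have h0: "h 0 = mpoly_eval c" and hS: "h (Suc t) = (\<lambda>n. h t n - h t (n(xs ! t := n (xs ! t) - 1)))" for t
    by (simp_all add: h_def)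
  have z: "large (\<lambda>n. h t n = 0)" for t
  proof (induction t)
    case 0 then show ?case using assms(2) by (simp add: h0)
  next
    case (Suc t)
    have "large (\<lambda>n. h t n = 0 \<and> h t (n(xs ! t := n (xs ! t) - 1)) = 0)"
      by (intro large_conj Suc large_shift_down[OF Suc])
    then show ?case by (rule large_mono) (simp add: hS)
  qed
  have "large (\<lambda>n. h (length xs) n = c (count_list xs) * (\<Prod>i\<in>UNIV. fact (count_list xs i)))"
  proof (rule iterated_nabla_top[OF assms(1)])
    fix u assume "c u \<noteq> 0"
    then show "(\<Sum>j\<in>UNIV. u j) \<le> length xs"
      unfolding len D_def using assms(1) by (intro Max_ge) auto
  next
    show "large (\<lambda>n. h (Suc t) n = h t n - h t (n(xs ! t := n (xs ! t) - 1)))" for t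
      by (rule large_True) (simp only: hS)
  qed (simp_all add: h0 large_True)
  from large_conj[OF this z[of "length xs"]]
  have "large (\<lambda>n::'d\<Rightarrow>nat. c (count_list xs) * (\<Prod>i\<in>UNIV. fact (count_list xs i)) = 0)"
    by (rule large_mono) auto
  then have "c k * (\<Prod>i\<in>UNIV. fact (k i)) = 0" using xs large_const by auto
  then show False using k(1) by auto
qed

section \<open>Polynomial functions and summation in one variable\<close>

definition polyfun :: "(('d::finite \<Rightarrow> nat) \<Rightarrow> rat) \<Rightarrow> bool" where
  "polyfun f \<longleftrightarrow> (\<exists>c. finite {u. c u \<noteq> 0} \<and> (\<forall>n. f n = mpoly_eval c n))"

lemma polyfun_monom: "polyfun (\<lambda>n. a * monom_fun u n)"
  unfolding polyfun_def
proof (intro exI conjI allI)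
  show "finite {v. (if v = u then a else 0) \<noteq> 0}" by simp
  show "a * monom_fun u n = mpoly_eval (\<lambda>v. if v = u then a else 0) n" for n
    by (subst mpoly_eval_superset[of "{u}"]) auto
qed

lemma polyfun_add: "polyfun f \<Longrightarrow> polyfun g \<Longrightarrow> polyfun (\<lambda>n. f n + g n)"
  unfolding polyfun_def
proof (elim exE conjE)
  fix c d :: "('a \<Rightarrow> nat) \<Rightarrow> rat"
  assume a: "finite {u. c u \<noteq> 0}" "\<forall>n. f n = mpoly_eval c n" "finite {u. d u \<noteq> 0}" "\<forall>n. g n = mpoly_eval d n"
  have "{u. c u + d u \<noteq> 0} \<subseteq> {u. c u \<noteq> 0} \<union> {u. d u \<noteq> 0}" by auto
  then have "finite {u. c u + d u \<noteq> 0}" using a finite_subset by blast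
  then show "\<exists>c. finite {u. c u \<noteq> 0} \<and> (\<forall>n. f n + g n = mpoly_eval c n)"
    using a by (intro exI[of _ "\<lambda>u. c u + d u"]) (simp add: mpoly_eval_add)
qed

lemma polyfun_zero: "polyfun (\<lambda>n. 0)"
  using polyfun_monom[of 0] by simp

lemma polyfun_const: "polyfun (\<lambda>n. a)"
  using polyfun_monom[of a "\<lambda>_. 0"] by (simp add: monom_fun_def)

lemma polyfun_sum: "finite T \<Longrightarrow> (\<And>u. u \<in> T \<Longrightarrow> polyfun (f u)) \<Longrightarrow> polyfun (\<lambda>n. \<Sum>u\<in>T. f u n)"
  by (induction T rule: finite_induct) (auto intro: polyfun_zero polyfun_add)

lemma polyfun_cases:
  assumes "polyfun f"
  obtains T c where "finite T" "f = (\<lambda>n. \<Sum>u\<in>T. c u * monom_fun u n)"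
  using assms unfolding polyfun_def
  by (metis (no_types, lifting) ext mpoly_eval_superset order.refl)

lemma polyfun_scale: 
  assumes "polyfun f" shows "polyfun (\<lambda>n. a * f n)"
proof -
  obtain T c where T: "finite T" "f = (\<lambda>n. \<Sum>u\<in>T. c u * monom_fun u n)" using assms by (rule polyfun_cases)
  have "polyfun (\<lambda>n. \<Sum>u\<in>T. (a * c u) * monom_fun u n)"
    by (intro polyfun_sum polyfun_monom T)
  then show ?thesis by (simp add: T(2) sum_distrib_left mult.assoc)
qed

lemma polyfun_diff: "polyfun f \<Longrightarrow> polyfun g \<Longrightarrow> polyfun (\<lambda>n. f n - g n)"
  using polyfun_add[of f "\<lambda>n. (-1) * g n"] polyfun_scale[of g "-1"] by simp

lemma polyfun_subst:
  assumes "polyfun f" shows "polyfun (\<lambda>n. f (n(j := N)))"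
proof -
  obtain T c where T: "finite T" "f = (\<lambda>n. \<Sum>u\<in>T. c u * monom_fun u n)" using assms by (rule polyfun_cases)
  have "monom_fun u (n(j := N)) = of_nat N ^ u j * monom_fun (u(j := 0)) n" for u n
    by (subst monom_fun_split[of _ _ j]) (auto simp: monom_fun_upd intro!: prod.cong)
  then have "(\<lambda>n. f (n(j := N))) = (\<lambda>n. \<Sum>u\<in>T. (c u * of_nat N ^ u j) * monom_fun (u(j := 0)) n)"
    by (simp add: T(2) mult.assoc)
  then show ?thesis by (simp add: polyfun_sum polyfun_monom T)
qed

text \<open>Telescoping \<open>(t + 1) ^ (p + 1) - t ^ (p + 1)\<close> expresses the sum of p-th
  powers through sums with smaller exponents. The monomial in the remaining variables is carried
  along as a factor, so that no product of polynomial functions has to be formed.\<close>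

lemma polyfun_power_sum:
  fixes j :: "'d::finite"
  shows "polyfun (\<lambda>n. (\<Sum>t\<le>n j. of_nat t ^ p) * (\<Prod>i\<in>UNIV-{j}. of_nat (n i) ^ u i))"
proof (induction p rule: less_induct)
  case (less p)
  let ?g = "\<lambda>n. \<Prod>i\<in>UNIV-{j}. of_nat (n i) ^ u i :: rat"
  have id: "of_nat (p + 1) * (\<Sum>t\<le>x. of_nat t ^ p) =
      (of_nat x + 1) ^ (p+1) - (\<Sum>q<p. of_nat ((p+1) choose q) * (\<Sum>t\<le>x. of_nat t ^ q :: rat))" for x :: nat
  proof -
    have step: "(of_nat t + 1) ^ (p+1) - of_nat t ^ (p+1) = (\<Sum>q\<le>p. of_nat ((p+1) choose q) * of_nat t ^ q :: rat)" for t :: nat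
      by (subst binomial_ring) simp
    have "(of_nat x + 1) ^ (p+1) = (\<Sum>t\<le>x. ((of_nat t + 1) ^ (p+1) - of_nat t ^ (p+1)) :: rat)"
    proof (induction x)
      case (Suc x)
      have "(of_nat (Suc x) :: rat) = of_nat x + 1" by simp
      then show ?case using Suc by (simp only: sum.atMost_Suc)
    qed simp
    also have "\<dots> = (\<Sum>t\<le>x. \<Sum>q\<le>p. of_nat ((p+1) choose q) * of_nat t ^ q)"
      by (simp only: step)
    also have "\<dots> = (\<Sum>q\<le>p. of_nat ((p+1) choose q) * (\<Sum>t\<le>x. of_nat t ^ q))"
      by (subst sum.swap) (simp add: sum_distrib_left)
    also have "\<dots> = (\<Sum>q<p. of_nat ((p+1) choose q) * (\<Sum>t\<le>x. of_nat t ^ q)) + of_nat (p+1) * (\<Sum>t\<le>x. of_nat t ^ p)"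
      by (simp add: lessThan_Suc_atMost[symmetric])
    finally show ?thesis by simp
  qed
  have "polyfun (\<lambda>n. (\<Sum>q\<le>p+1. of_nat ((p+1) choose q) * monom_fun (u(j := q)) n)
      - (\<Sum>q<p. of_nat ((p+1) choose q) * ((\<Sum>t\<le>n j. of_nat t ^ q) * ?g n)))"
    by (intro polyfun_diff polyfun_sum polyfun_monom polyfun_scale) (auto intro: less)
  then have "polyfun (\<lambda>n. (1 / of_nat (p+1)) * ((\<Sum>q\<le>p+1. of_nat ((p+1) choose q) * monom_fun (u(j := q)) n)
      - (\<Sum>q<p. of_nat ((p+1) choose q) * ((\<Sum>t\<le>n j. of_nat t ^ q) * ?g n))))"
    by (rule polyfun_scale)
  also have "(\<lambda>n. (1 / of_nat (p+1)) * ((\<Sum>q\<le>p+1. of_nat ((p+1) choose q) * monom_fun (u(j := q)) n)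
      - (\<Sum>q<p. of_nat ((p+1) choose q) * ((\<Sum>t\<le>n j. of_nat t ^ q) * ?g n)))) =
     (\<lambda>n. (\<Sum>t\<le>n j. of_nat t ^ p) * ?g n)"
  proof
    fix n :: "'d \<Rightarrow> nat"
    have 1: "(\<Sum>q\<le>p+1. of_nat ((p+1) choose q) * monom_fun (u(j := q)) n) = (of_nat (n j) + 1) ^ (p+1) * ?g n"
      by (subst binomial_ring) (simp only: monom_fun_upd sum_distrib_right mult.assoc power_one mult_1_right mult_1_left)
    have 2: "(\<Sum>q<p. of_nat ((p+1) choose q) * ((\<Sum>t\<le>n j. of_nat t ^ q) * ?g n)) =
        (\<Sum>q<p. of_nat ((p+1) choose q) * (\<Sum>t\<le>n j. of_nat t ^ q)) * ?g n"
      by (simp only: sum_distrib_right mult.assoc)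
    have "(1 / of_nat (p+1)) * ((of_nat (n j) + 1) ^ (p+1) * ?g n -
       (\<Sum>q<p. of_nat ((p+1) choose q) * (\<Sum>t\<le>n j. of_nat t ^ q)) * ?g n) =
       (1 / of_nat (p+1)) * (of_nat (p + 1) * (\<Sum>t\<le>n j. of_nat t ^ p)) * ?g n"
      unfolding id by (simp only: left_diff_distrib mult.assoc)
    also have "\<dots> = (\<Sum>t\<le>n j. of_nat t ^ p) * ?g n"
    proof -
      have "(of_nat (p + 1) :: rat) \<noteq> 0" by (simp only: of_nat_eq_0_iff)
      then show ?thesis by (simp only: mult.assoc[symmetric] divide_self_if times_divide_eq_left mult_1_left if_False)
    qed
    finally show "(1 / of_nat (p+1)) * ((\<Sum>q\<le>p+1. of_nat ((p+1) choose q) * monom_fun (u(j := q)) n)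
      - (\<Sum>q<p. of_nat ((p+1) choose q) * ((\<Sum>t\<le>n j. of_nat t ^ q) * ?g n))) =
      (\<Sum>t\<le>n j. of_nat t ^ p) * ?g n" unfolding 1 2 .
  qed
  finally show ?case .
qed

lemma polyfun_partial_sum:
  assumes "polyfun f" shows "polyfun (\<lambda>n. \<Sum>t\<le>n j. f (n(j := t)))"
proof -
  obtain T c where T: "finite T" "f = (\<lambda>n. \<Sum>u\<in>T. c u * monom_fun u n)" using assms by (rule polyfun_cases)
  have m: "monom_fun u (n(j := t)) = of_nat t ^ u j * (\<Prod>i\<in>UNIV-{j}. of_nat (n i) ^ u i)" for u n t
    by (subst monom_fun_split[of _ _ j]) (auto intro!: prod.cong)
  have "(\<lambda>n. \<Sum>t\<le>n j. f (n(j := t))) =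
    (\<lambda>n. \<Sum>u\<in>T. c u * ((\<Sum>t\<le>n j. of_nat t ^ u j) * (\<Prod>i\<in>UNIV-{j}. of_nat (n i) ^ u i)))"
    unfolding T(2) m by (subst sum.swap) (simp add: sum_distrib_left sum_distrib_right mult_ac)
  then show ?thesis
    by (simp only:) (intro polyfun_sum polyfun_scale polyfun_power_sum T)
qed

text \<open>Discrete integration, by induction on the set of variables on which \<open>f\<close>
  depends. Freezing the variable \<open>j\<close> at the threshold \<open>N\<close> leaves a
  function of fewer variables, and \<open>f\<close> is recovered from it by summing its difference
  in direction \<open>j\<close> from \<open>N + 1\<close> to \<open>n j\<close>.\<close>

theorem eventually_polyfun_if_differences:
  fixes f :: "('d::finite \<Rightarrow> nat) \<Rightarrow> rat"
  assumes "\<And>i. polyfun (Q i)" "\<And>i. large (\<lambda>n. f n - f (n(i := n i - 1)) = Q i n)"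
  shows "\<exists>g. polyfun g \<and> large (\<lambda>n. f n = g n)"
proof -
  have "\<exists>g. polyfun g \<and> large (\<lambda>n. f n = g n)"
    if "finite I" "\<And>n n'. (\<And>i. i \<in> I \<Longrightarrow> n i = n' i) \<Longrightarrow> f n = f n'"
      "\<And>i. polyfun (Q i)" "\<And>i. large (\<lambda>n. f n - f (n(i := n i - 1)) = Q i n)"
    for I :: "'d set" and f Q
    using that
  proof (induction I arbitrary: f Q)
    case empty
    have "f n = f (\<lambda>_. 0)" for n by (rule empty.prems(1)) simp
    then have "large (\<lambda>n. f n = f (\<lambda>_. 0))" by (rule large_True)
    then show ?case by (intro exI[of _ "\<lambda>_. f (\<lambda>_. 0)"] conjI polyfun_const)
  next
    case (insert j I)
    have "large (\<lambda>n. \<forall>i\<in>UNIV. f n - f (n(i := n i - 1)) = Q i n)"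
      by (rule large_ball_finite[OF finite_UNIV]) (rule insert.prems(3))
    then obtain N where N: "\<And>n i. (\<forall>i. N \<le> n i) \<Longrightarrow> f n - f (n(i := n i - 1)) = Q i n"
      unfolding large_def by auto
    define f' where "f' n = f (n(j := N))" for n
    have "\<exists>g. polyfun g \<and> large (\<lambda>n. f' n = g n)"
    proof (rule insert.IH[of f' "\<lambda>i n. if i = j then 0 else Q i (n(j := N))"])
      show "f' n = f' n'" if "\<And>i. i \<in> I \<Longrightarrow> n i = n' i" for n n'
        unfolding f'_def by (rule insert.prems(1)) (use that in auto)
      show "polyfun (\<lambda>n. if i = j then 0 else Q i (n(j := N)))" for i
        using insert.prems(2) by (cases "i = j") (auto intro: polyfun_zero polyfun_subst)
      show "large (\<lambda>n. f' n - f' (n(i := n i - 1)) = (if i = j then 0 else Q i (n(j := N))))" for i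
      proof (rule largeI[of N])
        fix n :: "'d \<Rightarrow> nat" assume n: "\<And>i. N \<le> n i"
        show "f' n - f' (n(i := n i - 1)) = (if i = j then 0 else Q i (n(j := N)))"
        proof (cases "i = j")
          case False
          then have "n(i := n i - 1, j := N) = (n(j := N))(i := (n(j := N)) i - 1)"
            by (auto simp: fun_eq_iff)
          then show ?thesis using False N[of "n(j := N)" i] n by (simp add: f'_def)
        qed (simp add: f'_def)
      qed
    qed
    then obtain g where g: "polyfun g" "large (\<lambda>n. f' n = g n)" by blast
    \<comment> \<open>The sum over \<open>N < t \<le> n j\<close> is written as a difference of two
      sums starting at 0: the first is a partial sum of a polynomial function, the second a finite
      sum of specialisations.\<close>
    let ?G = "\<lambda>n. g n + ((\<Sum>t\<le>n j. Q j (n(j := t))) - (\<Sum>t\<le>N. Q j (n(j := t))))"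
    have "polyfun ?G"
      by (intro polyfun_add polyfun_diff polyfun_partial_sum polyfun_sum polyfun_subst insert.prems g) simp
    moreover have "large (\<lambda>n. f n = ?G n)"
    proof -
      have "f n = f' n + ((\<Sum>t\<le>n j. Q j (n(j := t))) - (\<Sum>t\<le>N. Q j (n(j := t))))" if n: "\<forall>i. N \<le> n i" for n
      proof -
        have "f (n(j := N + m)) = f' n + ((\<Sum>t\<le>N+m. Q j (n(j := t))) - (\<Sum>t\<le>N. Q j (n(j := t))))" for m
        proof (induction m)
          case 0 show ?case by (simp add: f'_def del: fun_upd_apply)
        next
          case (Suc m)
          have "f (n(j := N + Suc m)) - f (n(j := N + m)) = Q j (n(j := N + Suc m))"
            using N[of "n(j := N + Suc m)" j] n by simp
          then show ?case using Suc by (simp add: algebra_simps del: fun_upd_apply)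
        qed
        from this[of "n j - N"] show ?thesis using n by simp
      qed
      then have "large (\<lambda>n. f n = f' n + ((\<Sum>t\<le>n j. Q j (n(j := t))) - (\<Sum>t\<le>N. Q j (n(j := t)))))"
        by (intro largeI[of N]) simp
      from large_conj[OF this g(2)] show ?thesis by (rule large_mono) simp
    qed
    ultimately show ?case by (intro exI[of _ ?G] conjI)
  qed
  note gen = this
  show ?thesis
  proof (rule gen[of UNIV f Q])
    show "f n = f n'" if "\<And>i. i \<in> UNIV \<Longrightarrow> n i = n' i" for n n'
    proof -
      have "n = n'" using that by (intro ext) simp
      then show ?thesis by simp
    qed
  qed (use assms in simp_all)
qed

section \<open>Lengths of intervals of submodules\<close>

text \<open>The length of \<open>L / K\<close>, measured inside the ambient module, so that no
  quotient has to be formed and no chain of quotients arises.\<close>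

definition rel_length ::
    "('a, 'k) ring_scheme \<Rightarrow> ('a, 'm, 'l) module_scheme \<Rightarrow> 'm set \<Rightarrow> 'm set \<Rightarrow> enat" where
  "rel_length R M K L =
     Sup {enat n | n. \<exists>H :: nat \<Rightarrow> 'm set.
            (\<forall>i\<le>n. submodule (H i) R M \<and> K \<subseteq> H i \<and> H i \<subseteq> L) \<and> (\<forall>i<n. H i \<subset> H (Suc i))}"

lemma rel_length_ge:
  assumes "\<And>i. i \<le> n \<Longrightarrow> submodule (H i) R M" "\<And>i. i \<le> n \<Longrightarrow> K \<subseteq> H i" "\<And>i. i \<le> n \<Longrightarrow> H i \<subseteq> L"
    "\<And>i. i < n \<Longrightarrow> H i \<subset> H (Suc i)"
  shows "enat n \<le> rel_length R M K L"
  unfolding rel_length_def by (rule Sup_upper) (use assms in blast)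

lemma rel_length_leI:
  assumes "\<And>n H. \<lbrakk>\<And>i. i \<le> n \<Longrightarrow> submodule (H i) R M; \<And>i. i \<le> n \<Longrightarrow> K \<subseteq> H i;
      \<And>i. i \<le> n \<Longrightarrow> H i \<subseteq> L; \<And>i. i < n \<Longrightarrow> H i \<subset> H (Suc i)\<rbrakk> \<Longrightarrow> enat n \<le> x"
  shows "rel_length R M K L \<le> x"
  unfolding rel_length_def
proof (rule Sup_least)
  fix y assume "y \<in> {enat n | n. \<exists>H :: nat \<Rightarrow> _ set.
            (\<forall>i\<le>n. submodule (H i) R M \<and> K \<subseteq> H i \<and> H i \<subseteq> L) \<and> (\<forall>i<n. H i \<subset> H (Suc i))}"
  then obtain n H where "y = enat n" "\<forall>i\<le>n. submodule (H i) R M \<and> K \<subseteq> H i \<and> H i \<subseteq> L"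
    "\<forall>i<n. H i \<subset> H (Suc i)" by blast
  then show "y \<le> x" using assms[of n H] by blast
qed

lemma Sup_enat_attained:
  assumes "Sup Y = enat n" "Y \<noteq> {}" shows "enat n \<in> Y"
proof -
  have "finite Y" using assms by (auto simp: Sup_enat_def split: if_splits)
  then show ?thesis using assms Max_in[of Y] by (auto simp: Sup_enat_def)
qed

lemma rel_length_attained:
  assumes "rel_length R M K L = enat n" "submodule K R M" "K \<subseteq> L"
  obtains H where "\<And>i. i \<le> n \<Longrightarrow> submodule (H i) R M" "\<And>i. i \<le> n \<Longrightarrow> K \<subseteq> H i"
    "\<And>i. i \<le> n \<Longrightarrow> H i \<subseteq> L" "\<And>i. i < n \<Longrightarrow> H i \<subset> H (Suc i)"
proof -
  let ?Y = "{enat n | n. \<exists>H :: nat \<Rightarrow> _ set.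
            (\<forall>i\<le>n. submodule (H i) R M \<and> K \<subseteq> H i \<and> H i \<subseteq> L) \<and> (\<forall>i<n. H i \<subset> H (Suc i))}"
  have "enat 0 \<in> ?Y" using assms by (auto intro!: exI[of _ "\<lambda>_. K"])
  then have "enat n \<in> ?Y"
    by (intro Sup_enat_attained) (use assms(1) in \<open>auto simp: rel_length_def\<close>)
  then show ?thesis using that by auto
qed

text \<open>The map \<open>f\<close> acts on submodules and not on elements; images, preimages,
  intersections and sums with a fixed submodule all fit this form, and only strictness of the map
  has to be checked.\<close>

lemma rel_length_embed:
  assumes "\<And>H. \<lbrakk>submodule H R M; K \<subseteq> H; H \<subseteq> L\<rbrakk> \<Longrightarrow> submodule (f H) R' M' \<and> K' \<subseteq> f H \<and> f H \<subseteq> L'"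
    and "\<And>G H. \<lbrakk>submodule G R M; K \<subseteq> G; submodule H R M; H \<subseteq> L; G \<subset> H\<rbrakk> \<Longrightarrow> f G \<subset> f H"
  shows "rel_length R M K L \<le> rel_length R' M' K' L'"
proof (rule rel_length_leI)
  fix n H assume H: "\<And>i. i \<le> n \<Longrightarrow> submodule (H i) R M" "\<And>i. i \<le> n \<Longrightarrow> K \<subseteq> H i"
      "\<And>i. i \<le> n \<Longrightarrow> H i \<subseteq> L" "\<And>i. i < n \<Longrightarrow> H i \<subset> H (Suc i)"
  show "enat n \<le> rel_length R' M' K' L'"
    by (rule rel_length_ge[of n "\<lambda>i. f (H i)"]) (use assms H in auto)
qed

lemma rel_length_mono:
  assumes "K \<subseteq> K'" "L' \<subseteq> L" shows "rel_length R M K' L' \<le> rel_length R M K L"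
  by (rule rel_length_embed) (use assms in auto)

lemma rel_length_refl [simp]: "rel_length R M K K = 0"
proof -
  have "rel_length R M K K \<le> 0"
  proof (rule rel_length_leI)
    fix n :: nat and H
    assume H: "\<And>i. i \<le> n \<Longrightarrow> K \<subseteq> H i" "\<And>i. i \<le> n \<Longrightarrow> H i \<subseteq> K" "\<And>i. i < n \<Longrightarrow> H i \<subset> H (Suc i)"
    have "n = 0"
    proof (rule ccontr)
      assume "n \<noteq> 0"
      then have "H 0 = K" "H 1 = K" "H 0 \<subset> H 1"
        using H(1)[of 0] H(2)[of 0] H(1)[of 1] H(2)[of 1] H(3)[of 0] by auto
      then show False by simp
    qed
    then show "enat n \<le> 0" by (simp add: zero_enat_def)
  qed
  then show ?thesis by simp
qed

lemma rel_length_pos: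
  assumes "submodule K R M" "submodule L R M" "K \<subset> L" shows "1 \<le> rel_length R M K L"
proof -
  have "enat 1 \<le> rel_length R M K L"
    by (rule rel_length_ge[of 1 "\<lambda>i. if i = 0 then K else L"]) (use assms in auto)
  then show ?thesis by (simp add: one_enat_def)
qed

lemma rel_length_zeroD:
  assumes "submodule K R M" "submodule L R M" "K \<subseteq> L" "rel_length R M K L = 0" shows "K = L"
proof (rule ccontr)
  assume "K \<noteq> L"
  then have "1 \<le> rel_length R M K L" using rel_length_pos[OF assms(1,2)] assms(3) by auto
  then show False using assms(4) by simp
qed

text \<open>Repetitions can be deleted from a weakly increasing chain, so its proper steps count.
  The traces of a strict chain under intersection or sum are only weakly increasing, which is where
  this is applied.\<close>

lemma rel_length_mono_chain:
  assumes "\<And>i. i \<le> n \<Longrightarrow> submodule (G i) R M" "\<And>i. i \<le> n \<Longrightarrow> K \<subseteq> G i" "\<And>i. i \<le> n \<Longrightarrow> G i \<subseteq> L"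
    "\<And>i. i < n \<Longrightarrow> G i \<subseteq> G (Suc i)"
  shows "enat (card {i. i < n \<and> G i \<noteq> G (Suc i)}) \<le> rel_length R M K L"
proof -
  have "\<exists>H. (\<forall>i\<le>card {i. i < m \<and> G i \<noteq> G (Suc i)}. submodule (H i) R M \<and> K \<subseteq> H i \<and> H i \<subseteq> L) \<and>
      (\<forall>i<card {i. i < m \<and> G i \<noteq> G (Suc i)}. H i \<subset> H (Suc i)) \<and>
      H (card {i. i < m \<and> G i \<noteq> G (Suc i)}) = G m" if "m \<le> n" for m
    using that
  proof (induction m)
    case 0
    show ?case by (rule exI[of _ "\<lambda>_. G 0"]) (use assms in auto)
  next
    case (Suc m)
    define c where "c = card {i. i < m \<and> G i \<noteq> G (Suc i)}"
    obtain H where H: "\<forall>i\<le>c. submodule (H i) R M \<and> K \<subseteq> H i \<and> H i \<subseteq> L"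
      "\<forall>i<c. H i \<subset> H (Suc i)" "H c = G m"
      using Suc unfolding c_def by auto
    show ?case
    proof (cases "G m = G (Suc m)")
      case True
      then have "{i. i < Suc m \<and> G i \<noteq> G (Suc i)} = {i. i < m \<and> G i \<noteq> G (Suc i)}"
        using less_Suc_eq by auto
      then show ?thesis using H True unfolding c_def by (intro exI[of _ H]) simp
    next
      case False
      then have "{i. i < Suc m \<and> G i \<noteq> G (Suc i)} = insert m {i. i < m \<and> G i \<noteq> G (Suc i)}"
        using less_Suc_eq by auto
      then have c: "card {i. i < Suc m \<and> G i \<noteq> G (Suc i)} = Suc c" by (simp add: c_def)
      have GS: "submodule (G (Suc m)) R M" "K \<subseteq> G (Suc m)" "G (Suc m) \<subseteq> L" "G m \<subset> G (Suc m)"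
        using assms(1-3)[of "Suc m"] assms(4)[of m] Suc.prems False by auto
      show ?thesis unfolding c
        by (rule exI[of _ "\<lambda>i. if i = Suc c then G (Suc m) else H i"])
          (use H GS in \<open>auto simp: less_Suc_eq le_Suc_eq\<close>)
    qed
  qed
  from this[of n] obtain H where "\<forall>i\<le>card {i. i < n \<and> G i \<noteq> G (Suc i)}. submodule (H i) R M \<and> K \<subseteq> H i \<and> H i \<subseteq> L"
    "\<forall>i<card {i. i < n \<and> G i \<noteq> G (Suc i)}. H i \<subset> H (Suc i)" by auto
  then show ?thesis by (intro rel_length_ge[of _ H]) auto
qed

lemma (in abelian_group) add_minus_cancel:
  assumes "x \<in> carrier G" "y \<in> carrier G"
  shows "(x \<oplus> y) \<ominus> x = y" "(x \<oplus> y) \<ominus> y = x" "(x \<ominus> y) \<oplus> y = x" "y \<oplus> (x \<ominus> y) = x"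
proof -
  show 1: "(x \<oplus> y) \<ominus> x = y" unfolding a_minus_def
    using assms a_comm[of "x \<oplus> y" "\<ominus> x"] r_neg1 by simp
  show "(x \<oplus> y) \<ominus> y = x" unfolding a_minus_def using assms by (simp add: a_assoc r_neg)
  show 2: "(x \<ominus> y) \<oplus> y = x" unfolding a_minus_def using assms by (simp add: a_assoc l_neg)
  show "y \<oplus> (x \<ominus> y) = x" using 2 a_comm[of y "x \<ominus> y"] assms by simp
qed

context module
begin

lemma submodule_iff:
  "submodule H R M \<longleftrightarrow> H \<subseteq> carrier M \<and> \<zero>\<^bsub>M\<^esub> \<in> H \<and> (\<forall>a\<in>H. \<forall>b\<in>H. a \<oplus>\<^bsub>M\<^esub> b \<in> H) \<and>
     (\<forall>a\<in>carrier R. \<forall>x\<in>H. a \<odot>\<^bsub>M\<^esub> x \<in> H)"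
proof
  assume h: "submodule H R M"
  then interpret submodule H R M .
  show "H \<subseteq> carrier M \<and> \<zero>\<^bsub>M\<^esub> \<in> H \<and> (\<forall>a\<in>H. \<forall>b\<in>H. a \<oplus>\<^bsub>M\<^esub> b \<in> H) \<and> (\<forall>a\<in>carrier R. \<forall>x\<in>H. a \<odot>\<^bsub>M\<^esub> x \<in> H)"
    using submoduleE[OF h] subgroup.one_closed[OF subgroup_axioms] by auto
next
  assume h: "H \<subseteq> carrier M \<and> \<zero>\<^bsub>M\<^esub> \<in> H \<and> (\<forall>a\<in>H. \<forall>b\<in>H. a \<oplus>\<^bsub>M\<^esub> b \<in> H) \<and> (\<forall>a\<in>carrier R. \<forall>x\<in>H. a \<odot>\<^bsub>M\<^esub> x \<in> H)"
  have "\<ominus>\<^bsub>M\<^esub> x \<in> H" if "x \<in> H" for x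
  proof -
    have "(\<ominus> \<one>) \<odot>\<^bsub>M\<^esub> x \<in> H" using h that by auto
    moreover have "x \<in> carrier M" using h that by auto
    ultimately show ?thesis using smult_l_minus[of "\<one>" x] by simp
  qed
  then show "submodule H R M" using h by (intro submoduleI) auto
qed

lemma submodule_Int: "submodule H R M \<Longrightarrow> submodule K R M \<Longrightarrow> submodule (H \<inter> K) R M"
  unfolding submodule_iff by auto

lemma submodule_subset: "submodule H R M \<Longrightarrow> H \<subseteq> carrier M"
  unfolding submodule_iff by auto

lemma submodule_zero_mem: "submodule H R M \<Longrightarrow> \<zero>\<^bsub>M\<^esub> \<in> H"
  unfolding submodule_iff by auto

lemma submodule_add_mem: "submodule H R M \<Longrightarrow> x \<in> H \<Longrightarrow> y \<in> H \<Longrightarrow> x \<oplus>\<^bsub>M\<^esub> y \<in> H"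
  unfolding submodule_iff by auto

lemma submodule_neg_mem: "submodule H R M \<Longrightarrow> x \<in> H \<Longrightarrow> \<ominus>\<^bsub>M\<^esub> x \<in> H"
  using submoduleE(3) by auto

lemma submodule_diff_mem: "submodule H R M \<Longrightarrow> x \<in> H \<Longrightarrow> y \<in> H \<Longrightarrow> x \<ominus>\<^bsub>M\<^esub> y \<in> H"
  unfolding a_minus_def by (intro submodule_add_mem submodule_neg_mem)

lemma submodule_smult_mem: "submodule H R M \<Longrightarrow> a \<in> carrier R \<Longrightarrow> x \<in> H \<Longrightarrow> a \<odot>\<^bsub>M\<^esub> x \<in> H"
  unfolding submodule_iff by auto

lemma submodule_zero: "submodule {\<zero>\<^bsub>M\<^esub>} R M"
  unfolding submodule_iff by auto

lemma set_add_iff: "x \<in> H <+>\<^bsub>M\<^esub> K \<longleftrightarrow> (\<exists>h\<in>H. \<exists>k\<in>K. x = h \<oplus>\<^bsub>M\<^esub> k)"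
  unfolding set_add_def' by auto

lemma submodule_set_add:
  assumes H: "submodule H R M" and K: "submodule K R M" shows "submodule (H <+>\<^bsub>M\<^esub> K) R M"
  unfolding submodule_iff
proof (intro conjI subsetI ballI)
  have c: "H \<subseteq> carrier M" "K \<subseteq> carrier M" using assms submodule_subset by auto
  show "\<And>x. x \<in> H <+>\<^bsub>M\<^esub> K \<Longrightarrow> x \<in> carrier M" using c by (auto simp: set_add_iff)
  show "\<zero>\<^bsub>M\<^esub> \<in> H <+>\<^bsub>M\<^esub> K" unfolding set_add_iff
    using assms submodule_zero_mem by (metis M.zero_closed M.r_zero)
  show "a \<oplus>\<^bsub>M\<^esub> b \<in> H <+>\<^bsub>M\<^esub> K" if ab: "a \<in> H <+>\<^bsub>M\<^esub> K" "b \<in> H <+>\<^bsub>M\<^esub> K" for a b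
  proof -
    obtain h1 k1 h2 k2 where e: "h1 \<in> H" "k1 \<in> K" "a = h1 \<oplus>\<^bsub>M\<^esub> k1" "h2 \<in> H" "k2 \<in> K" "b = h2 \<oplus>\<^bsub>M\<^esub> k2"
      using ab unfolding set_add_iff by auto
    have "a \<oplus>\<^bsub>M\<^esub> b = (h1 \<oplus>\<^bsub>M\<^esub> h2) \<oplus>\<^bsub>M\<^esub> (k1 \<oplus>\<^bsub>M\<^esub> k2)"
      using e c by (simp add: M.add.m_ac subset_iff)
    then show ?thesis unfolding set_add_iff using e assms submodule_add_mem by blast
  qed
  show "a \<odot>\<^bsub>M\<^esub> x \<in> H <+>\<^bsub>M\<^esub> K" if ax: "a \<in> carrier R" "x \<in> H <+>\<^bsub>M\<^esub> K" for a x
  proof -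
    obtain h k where e: "h \<in> H" "k \<in> K" "x = h \<oplus>\<^bsub>M\<^esub> k" using ax unfolding set_add_iff by blast
    then have "a \<odot>\<^bsub>M\<^esub> x = a \<odot>\<^bsub>M\<^esub> h \<oplus>\<^bsub>M\<^esub> a \<odot>\<^bsub>M\<^esub> k"
      using c ax by (simp add: smult_r_distr subset_iff)
    then show ?thesis unfolding set_add_iff using e ax assms submodule_smult_mem by blast
  qed
qed

lemma set_add_upper1:
  assumes "submodule H R M" "submodule K R M" shows "H \<subseteq> H <+>\<^bsub>M\<^esub> K"
proof
  fix x assume "x \<in> H"
  moreover have "x = x \<oplus>\<^bsub>M\<^esub> \<zero>\<^bsub>M\<^esub>" using submodule_subset[OF assms(1)] \<open>x \<in> H\<close> by auto
  ultimately show "x \<in> H <+>\<^bsub>M\<^esub> K" unfolding set_add_iff using submodule_zero_mem[OF assms(2)] by blast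
qed

lemma set_add_upper2:
  assumes "submodule H R M" "submodule K R M" shows "K \<subseteq> H <+>\<^bsub>M\<^esub> K"
proof
  fix x assume "x \<in> K"
  moreover have "x = \<zero>\<^bsub>M\<^esub> \<oplus>\<^bsub>M\<^esub> x" using submodule_subset[OF assms(2)] \<open>x \<in> K\<close> by auto
  ultimately show "x \<in> H <+>\<^bsub>M\<^esub> K" unfolding set_add_iff using submodule_zero_mem[OF assms(1)] by blast
qed

lemma set_add_least:
  assumes "submodule L R M" "H \<subseteq> L" "K \<subseteq> L" shows "H <+>\<^bsub>M\<^esub> K \<subseteq> L"
  using assms submodule_add_mem unfolding set_add_iff subset_iff by blast

text \<open>The modular law in contrapositive use: a proper inclusion stays visible after
  intersecting with \<open>L\<close> or after adding \<open>L\<close>.\<close>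

lemma modular_eq:
  assumes "submodule G R M" "submodule H R M" "submodule L R M" "G \<subseteq> H"
    "G \<inter> L = H \<inter> L" "G <+>\<^bsub>M\<^esub> L = H <+>\<^bsub>M\<^esub> L"
  shows "G = H"
proof
  show "H \<subseteq> G"
  proof
    fix x assume x: "x \<in> H"
    then have "x \<in> G <+>\<^bsub>M\<^esub> L" using assms(6) set_add_upper1[OF assms(2,3)] by auto
    then obtain g l where gl: "g \<in> G" "l \<in> L" "x = g \<oplus>\<^bsub>M\<^esub> l" unfolding set_add_iff by blast
    have c: "g \<in> carrier M" "l \<in> carrier M" using gl submodule_subset[OF assms(1)] submodule_subset[OF assms(3)] by auto
    have "l = x \<ominus>\<^bsub>M\<^esub> g" using gl c M.add_minus_cancel(1) by metis
    moreover have "x \<ominus>\<^bsub>M\<^esub> g \<in> H" using submodule_diff_mem[OF assms(2) x] gl(1) assms(4) by blast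
    ultimately have "l \<in> H" by simp
    then have "l \<in> G" using gl assms(5) by auto
    then show "x \<in> G" using gl submodule_add_mem[OF assms(1)] by auto
  qed
qed (rule assms)

text \<open>A chain from \<open>K\<close> to \<open>Q\<close> is traced below \<open>L\<close> by
  intersections and above \<open>L\<close> by sums; by \<open>modular_eq\<close> each proper step is
  proper in one of the traces. Conversely chains are concatenated. The argument covers infinite
  lengths and replaces a Jordan-Hoelder theorem.\<close>

theorem rel_length_add:
  assumes K: "submodule K R M" and L: "submodule L R M" and Q: "submodule Q R M" and sub: "K \<subseteq> L" "L \<subseteq> Q"
  shows "rel_length R M K Q = rel_length R M K L + rel_length R M L Q"
proof (rule antisym)
  show "rel_length R M K Q \<le> rel_length R M K L + rel_length R M L Q"
  proof (rule rel_length_leI)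
    fix n H assume H: "\<And>i. i \<le> n \<Longrightarrow> submodule (H i) R M" "\<And>i. i \<le> n \<Longrightarrow> K \<subseteq> H i"
      "\<And>i. i \<le> n \<Longrightarrow> H i \<subseteq> Q" "\<And>i. i < n \<Longrightarrow> H i \<subset> H (Suc i)"
    let ?s1 = "{i. i < n \<and> H i \<inter> L \<noteq> H (Suc i) \<inter> L}"
    let ?s2 = "{i. i < n \<and> H i <+>\<^bsub>M\<^esub> L \<noteq> H (Suc i) <+>\<^bsub>M\<^esub> L}"
    have "enat (card ?s1) \<le> rel_length R M K L"
    proof (rule rel_length_mono_chain)
      fix i assume i: "i < n"
      show "H i \<inter> L \<subseteq> H (Suc i) \<inter> L" using H(4)[OF i] by blast
    next
      fix i assume i: "i \<le> n"
      show "submodule (H i \<inter> L) R M" using submodule_Int[OF H(1)[OF i] L] .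
      show "K \<subseteq> H i \<inter> L" using H(2)[OF i] sub(1) by blast
      show "H i \<inter> L \<subseteq> L" by blast
    qed
    moreover have "enat (card ?s2) \<le> rel_length R M L Q"
    proof (rule rel_length_mono_chain)
      fix i assume i: "i < n"
      show "H i <+>\<^bsub>M\<^esub> L \<subseteq> H (Suc i) <+>\<^bsub>M\<^esub> L"
        using H(4)[OF i] unfolding set_add_iff subset_iff by blast
    next
      fix i assume i: "i \<le> n"
      show "submodule (H i <+>\<^bsub>M\<^esub> L) R M" using submodule_set_add[OF H(1)[OF i] L] .
      show "L \<subseteq> H i <+>\<^bsub>M\<^esub> L" using set_add_upper2[OF H(1)[OF i] L] .
      show "H i <+>\<^bsub>M\<^esub> L \<subseteq> Q" using set_add_least[OF Q H(3)[OF i] sub(2)] .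
    qed
    moreover have "{..<n} \<subseteq> ?s1 \<union> ?s2"
    proof
      fix i assume "i \<in> {..<n}"
      then have i: "i < n" by simp
      have "H i \<noteq> H (Suc i)" using H(4)[OF i] by auto
      then have "\<not> (H i \<inter> L = H (Suc i) \<inter> L \<and> H i <+>\<^bsub>M\<^esub> L = H (Suc i) <+>\<^bsub>M\<^esub> L)"
        using modular_eq[OF H(1) H(1) L, of i "Suc i"] H(4)[OF i] i by auto
      then show "i \<in> ?s1 \<union> ?s2" using i by auto
    qed
    then have "n \<le> card ?s1 + card ?s2"
      using card_mono[of "?s1 \<union> ?s2" "{..<n}"] card_Un_le[of ?s1 ?s2] by auto
    then have "enat n \<le> enat (card ?s1) + enat (card ?s2)" by simp
    ultimately show "enat n \<le> rel_length R M K L + rel_length R M L Q"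
      by (meson add_mono order_trans)
  qed
next
  show "rel_length R M K L + rel_length R M L Q \<le> rel_length R M K Q"
  proof (cases "rel_length R M K Q")
    case (enat q)
    have "rel_length R M K L \<le> enat q" "rel_length R M L Q \<le> enat q"
      using rel_length_mono[of K K L Q R M] rel_length_mono[of K L Q Q R M] sub enat by auto
    then obtain a b where ab: "rel_length R M K L = enat a" "rel_length R M L Q = enat b"
      using enat_ile by metis
    obtain G where G: "\<And>i. i \<le> a \<Longrightarrow> submodule (G i) R M" "\<And>i. i \<le> a \<Longrightarrow> K \<subseteq> G i"
      "\<And>i. i \<le> a \<Longrightarrow> G i \<subseteq> L" "\<And>i. i < a \<Longrightarrow> G i \<subset> G (Suc i)"
      using rel_length_attained[OF ab(1) K sub(1)] by metis
    obtain H where H: "\<And>i. i \<le> b \<Longrightarrow> submodule (H i) R M" "\<And>i. i \<le> b \<Longrightarrow> L \<subseteq> H i"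
      "\<And>i. i \<le> b \<Longrightarrow> H i \<subseteq> Q" "\<And>i. i < b \<Longrightarrow> H i \<subset> H (Suc i)"
      using rel_length_attained[OF ab(2) L sub(2)] by metis
    have "enat (a + b) \<le> rel_length R M K Q"
    \<comment> \<open>At index \<open>a\<close> the chain jumps from \<open>G a\<close> to
      \<open>H 1\<close>, skipping \<open>H 0\<close>; the jump is proper because
      \<open>G a \<subseteq> L \<subseteq> H 0 \<subset> H 1\<close>.\<close>
    proof (rule rel_length_ge[of _ "\<lambda>i. if i \<le> a then G i else H (i - a)"])
      fix i assume i: "i \<le> a + b"
      then have i': "i - a \<le> b" by simp
      show "submodule (if i \<le> a then G i else H (i - a)) R M" using G(1)[of i] H(1)[OF i'] by simp
      show "K \<subseteq> (if i \<le> a then G i else H (i - a))" using G(2)[of i] H(2)[OF i'] sub(1) by auto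
      show "(if i \<le> a then G i else H (i - a)) \<subseteq> Q" using G(3)[of i] H(3)[OF i'] sub(2) by auto
    next
      fix i assume i: "i < a + b"
      consider "i < a" | "i = a" | "i > a" by linarith
      then show "(if i \<le> a then G i else H (i - a)) \<subset> (if Suc i \<le> a then G (Suc i) else H (Suc i - a))"
      proof cases
        case 2
        have "G a \<subseteq> L" "L \<subseteq> H 0" "H 0 \<subset> H 1" using 2 i G(3)[of a] H(2)[of 0] H(4)[of 0] by simp_all
        then show ?thesis using 2 by auto
      next
        case 3
        then show ?thesis using i H(4)[of "i - a"] by (simp add: Suc_diff_le)
      qed (use G in auto)
    qed
    then show ?thesis using ab by simp
  qed simp
qed

text \<open>Second isomorphism theorem for intervals: intersecting with \<open>L\<close> and adding
  \<open>K\<close> are maps between the two intervals, both strict by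
  \<open>modular_eq\<close>.\<close>

lemma rel_length_inter_le:
  assumes "submodule K R M" "submodule L R M" "submodule Q R M" "K \<subseteq> Q" "L \<subseteq> Q"
  shows "rel_length R M K (K <+>\<^bsub>M\<^esub> L) = rel_length R M (K \<inter> L) L"
proof (rule antisym)
  show "rel_length R M K (K <+>\<^bsub>M\<^esub> L) \<le> rel_length R M (K \<inter> L) L"
  proof (rule rel_length_embed[of R M K "K <+>\<^bsub>M\<^esub> L" "\<lambda>H. H \<inter> L"])
    fix G H assume h: "submodule G R M" "K \<subseteq> G" "submodule H R M" "H \<subseteq> K <+>\<^bsub>M\<^esub> L" "G \<subset> H"
    have "G <+>\<^bsub>M\<^esub> L = K <+>\<^bsub>M\<^esub> L" "H <+>\<^bsub>M\<^esub> L = K <+>\<^bsub>M\<^esub> L"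
    proof -
      have s: "submodule (K <+>\<^bsub>M\<^esub> L) R M" "L \<subseteq> K <+>\<^bsub>M\<^esub> L"
        using assms submodule_set_add set_add_upper2 by auto
      have "G' <+>\<^bsub>M\<^esub> L = K <+>\<^bsub>M\<^esub> L" if "submodule G' R M" "K \<subseteq> G'" "G' \<subseteq> K <+>\<^bsub>M\<^esub> L" for G'
      proof
        show "G' <+>\<^bsub>M\<^esub> L \<subseteq> K <+>\<^bsub>M\<^esub> L" using set_add_least[OF s(1) that(3) s(2)] .
        show "K <+>\<^bsub>M\<^esub> L \<subseteq> G' <+>\<^bsub>M\<^esub> L" using that(2) unfolding set_add_iff subset_iff by blast
      qed
      then show "G <+>\<^bsub>M\<^esub> L = K <+>\<^bsub>M\<^esub> L" "H <+>\<^bsub>M\<^esub> L = K <+>\<^bsub>M\<^esub> L" using h by auto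
    qed
    then have "G \<inter> L \<noteq> H \<inter> L" using modular_eq[OF h(1,3) assms(2)] h(5) by auto
    then show "G \<inter> L \<subset> H \<inter> L" using h by auto
  qed (use assms submodule_Int in auto)
  show "rel_length R M (K \<inter> L) L \<le> rel_length R M K (K <+>\<^bsub>M\<^esub> L)"
  proof (rule rel_length_embed[of R M "K \<inter> L" L "\<lambda>H. H <+>\<^bsub>M\<^esub> K"])
    fix H assume h: "submodule H R M" "K \<inter> L \<subseteq> H" "H \<subseteq> L"
    have "H <+>\<^bsub>M\<^esub> K \<subseteq> K <+>\<^bsub>M\<^esub> L"
      using h set_add_upper1[OF assms(1,2)] set_add_upper2[OF assms(1,2)] submodule_set_add[OF assms(1,2)]
      by (intro set_add_least) auto
    then show "submodule (H <+>\<^bsub>M\<^esub> K) R M \<and> K \<subseteq> H <+>\<^bsub>M\<^esub> K \<and> H <+>\<^bsub>M\<^esub> K \<subseteq> K <+>\<^bsub>M\<^esub> L"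
      using submodule_set_add[OF h(1) assms(1)] set_add_upper2[OF h(1) assms(1)] by auto
  next
    fix G H assume h: "submodule G R M" "K \<inter> L \<subseteq> G" "submodule H R M" "H \<subseteq> L" "G \<subset> H"
    have "G \<inter> K = H \<inter> K" using h by auto
    then have "G <+>\<^bsub>M\<^esub> K \<noteq> H <+>\<^bsub>M\<^esub> K" using modular_eq[OF h(1,3) assms(1)] h by auto
    moreover have "G <+>\<^bsub>M\<^esub> K \<subseteq> H <+>\<^bsub>M\<^esub> K" using h unfolding set_add_iff subset_iff psubset_eq by blast
    ultimately show "G <+>\<^bsub>M\<^esub> K \<subset> H <+>\<^bsub>M\<^esub> K" by auto
  qed
qed

end

subsection \<open>Linear maps\<close>

locale module_map = M1: module R M + M2: module R M'
  for R (structure) and M and M' +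
  fixes f
  assumes f_closed: "x \<in> carrier M \<Longrightarrow> f x \<in> carrier M'"
    and f_add: "x \<in> carrier M \<Longrightarrow> y \<in> carrier M \<Longrightarrow> f (x \<oplus>\<^bsub>M\<^esub> y) = f x \<oplus>\<^bsub>M'\<^esub> f y"
    and f_smult: "a \<in> carrier R \<Longrightarrow> x \<in> carrier M \<Longrightarrow> f (a \<odot>\<^bsub>M\<^esub> x) = a \<odot>\<^bsub>M'\<^esub> f x"
begin

lemma f_zero: "f \<zero>\<^bsub>M\<^esub> = \<zero>\<^bsub>M'\<^esub>"
  using f_smult[of \<zero> "\<zero>\<^bsub>M\<^esub>"] f_closed by simp

lemma f_neg: "x \<in> carrier M \<Longrightarrow> f (\<ominus>\<^bsub>M\<^esub> x) = \<ominus>\<^bsub>M'\<^esub> f x"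
  using f_smult[of "\<ominus> \<one>" x] f_closed[of x] M1.smult_l_minus[of \<one> x] M2.smult_l_minus[of \<one> "f x"] by simp

lemma f_diff: "x \<in> carrier M \<Longrightarrow> y \<in> carrier M \<Longrightarrow> f (x \<ominus>\<^bsub>M\<^esub> y) = f x \<ominus>\<^bsub>M'\<^esub> f y"
  by (simp add: a_minus_def f_add f_neg)

lemma submodule_image:
  assumes "submodule L R M" shows "submodule (f ` L) R M'"
proof -
  have c: "L \<subseteq> carrier M" using M1.submodule_subset[OF assms] .
  show ?thesis unfolding M2.submodule_iff
  proof (intro conjI ballI)
    show "f ` L \<subseteq> carrier M'" using c f_closed by auto
    show "\<zero>\<^bsub>M'\<^esub> \<in> f ` L" using f_zero M1.submodule_zero_mem[OF assms] by (metis imageI)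
    fix a b assume "a \<in> f ` L" "b \<in> f ` L"
    then obtain x y where "x \<in> L" "y \<in> L" "a = f x" "b = f y" by auto
    then show "a \<oplus>\<^bsub>M'\<^esub> b \<in> f ` L" using f_add[of x y] M1.submodule_add_mem[OF assms] c by (metis imageI subsetD)
  next
    fix a b assume "a \<in> carrier R" "b \<in> f ` L"
    then obtain y where "y \<in> L" "b = f y" by auto
    then show "a \<odot>\<^bsub>M'\<^esub> b \<in> f ` L" using f_smult[of a y] M1.submodule_smult_mem[OF assms] c \<open>a \<in> carrier R\<close>
      by (metis imageI subsetD)
  qed
qed

lemma submodule_preimage:
  assumes "submodule L R M" "submodule K' R M'" shows "submodule {x \<in> L. f x \<in> K'} R M"
proof -
  have c: "L \<subseteq> carrier M" using M1.submodule_subset[OF assms(1)] .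
  then show ?thesis using assms unfolding M1.submodule_iff M2.submodule_iff
    by (auto simp: f_zero f_add f_smult subset_iff)
qed

text \<open>Homomorphism theorem for intervals: \<open>L\<close> modulo the preimage of
  \<open>K'\<close> is \<open>(K' + f L) / K'\<close>. With \<open>K'\<close> zero it compares
  kernel and image; all later length computations for quotients and multiplication maps are
  instances.\<close>

theorem rel_length_preimage:
  assumes L: "submodule L R M" and K: "submodule K' R M'"
  shows "rel_length R M {x \<in> L. f x \<in> K'} L = rel_length R M' K' (K' <+>\<^bsub>M'\<^esub> f ` L)"
proof (rule antisym)
  have c: "L \<subseteq> carrier M" using M1.submodule_subset[OF L] .
  have cK: "K' \<subseteq> carrier M'" using M2.submodule_subset[OF K] .
  show "rel_length R M {x \<in> L. f x \<in> K'} L \<le> rel_length R M' K' (K' <+>\<^bsub>M'\<^esub> f ` L)"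
  proof (rule rel_length_embed[of R M _ L "\<lambda>H. K' <+>\<^bsub>M'\<^esub> f ` H"])
    fix H assume h: "submodule H R M" "{x \<in> L. f x \<in> K'} \<subseteq> H" "H \<subseteq> L"
    have "K' <+>\<^bsub>M'\<^esub> f ` H \<subseteq> K' <+>\<^bsub>M'\<^esub> f ` L" using h unfolding M2.set_add_iff subset_iff psubset_eq by blast
    then show "submodule (K' <+>\<^bsub>M'\<^esub> f ` H) R M' \<and> K' \<subseteq> K' <+>\<^bsub>M'\<^esub> f ` H \<and> K' <+>\<^bsub>M'\<^esub> f ` H \<subseteq> K' <+>\<^bsub>M'\<^esub> f ` L"
      using M2.submodule_set_add[OF K submodule_image[OF h(1)]] M2.set_add_upper1[OF K submodule_image[OF h(1)]] by auto
  next
    fix G H assume h: "submodule G R M" "{x \<in> L. f x \<in> K'} \<subseteq> G" "submodule H R M" "H \<subseteq> L" "G \<subset> H"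
    then obtain x where x: "x \<in> H" "x \<notin> G" by auto
    have cG: "G \<subseteq> carrier M" using M1.submodule_subset[OF h(1)] .
    have "f x \<notin> K' <+>\<^bsub>M'\<^esub> f ` G"
    proof
      assume "f x \<in> K' <+>\<^bsub>M'\<^esub> f ` G"
      then obtain k g where kg: "k \<in> K'" "g \<in> G" "f x = k \<oplus>\<^bsub>M'\<^esub> f g" unfolding M2.set_add_iff by blast
      have cc: "x \<in> carrier M" "g \<in> carrier M" "k \<in> carrier M'" using x kg h c cG cK by auto
      have "f (x \<ominus>\<^bsub>M\<^esub> g) = k"
        using cc kg(3) f_closed[of g] f_diff[of x g] M2.M.add_minus_cancel(2)[of k "f g"] by simp
      moreover have "x \<in> L" "g \<in> L" using x kg h by blast+
      then have "x \<ominus>\<^bsub>M\<^esub> g \<in> L" using M1.submodule_diff_mem[OF L] by blast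
      ultimately have "x \<ominus>\<^bsub>M\<^esub> g \<in> G" using kg h by auto
      then have "(x \<ominus>\<^bsub>M\<^esub> g) \<oplus>\<^bsub>M\<^esub> g \<in> G" using M1.submodule_add_mem[OF h(1)] kg by auto
      moreover have "(x \<ominus>\<^bsub>M\<^esub> g) \<oplus>\<^bsub>M\<^esub> g = x" using cc M1.M.add_minus_cancel(3) by simp
      ultimately show False using x by simp
    qed
    moreover have "f x \<in> K' <+>\<^bsub>M'\<^esub> f ` H"
      using M2.set_add_upper2[OF K submodule_image[OF h(3)]] x by auto
    moreover have "K' <+>\<^bsub>M'\<^esub> f ` G \<subseteq> K' <+>\<^bsub>M'\<^esub> f ` H" using h unfolding M2.set_add_iff subset_iff psubset_eq by blast
    ultimately show "K' <+>\<^bsub>M'\<^esub> f ` G \<subset> K' <+>\<^bsub>M'\<^esub> f ` H" by auto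
  qed
  show "rel_length R M' K' (K' <+>\<^bsub>M'\<^esub> f ` L) \<le> rel_length R M {x \<in> L. f x \<in> K'} L"
  proof (rule rel_length_embed[of R M' K' _ "\<lambda>H. {x \<in> L. f x \<in> H}"])
    fix H assume "submodule H R M'" "K' \<subseteq> H" "H \<subseteq> K' <+>\<^bsub>M'\<^esub> f ` L"
    then show "submodule {x \<in> L. f x \<in> H} R M \<and> {x \<in> L. f x \<in> K'} \<subseteq> {x \<in> L. f x \<in> H} \<and> {x \<in> L. f x \<in> H} \<subseteq> L"
      using submodule_preimage[OF L] by auto
  next
    fix G H assume h: "submodule G R M'" "K' \<subseteq> G" "submodule H R M'" "H \<subseteq> K' <+>\<^bsub>M'\<^esub> f ` L" "G \<subset> H"
    then obtain y where y: "y \<in> H" "y \<notin> G" by auto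
    then obtain k x where kx: "k \<in> K'" "x \<in> L" "y = k \<oplus>\<^bsub>M'\<^esub> f x" using h unfolding M2.set_add_iff subset_iff psubset_eq by blast
    have cc: "x \<in> carrier M" "k \<in> carrier M'" "f x \<in> carrier M'" using kx c cK f_closed by auto
    have "f x = y \<ominus>\<^bsub>M'\<^esub> k" using kx cc M2.M.add_minus_cancel(1)[of k "f x"] by simp
    moreover have "y \<ominus>\<^bsub>M'\<^esub> k \<in> H" using M2.submodule_diff_mem[OF h(3) y(1)] kx(1) h by blast
    ultimately have "f x \<in> H" by simp
    moreover have "f x \<notin> G" using M2.submodule_add_mem[OF h(1)] y kx h by auto
    ultimately show "{x \<in> L. f x \<in> G} \<subset> {x \<in> L. f x \<in> H}" using kx h by auto
  qed
qed

end

subsection \<open>Quotient modules\<close>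

context module
begin

lemma abelian_subgroup_submodule: "submodule H R M \<Longrightarrow> abelian_subgroup H M"
  using abelian_subgroupI3[OF additive_subgroup.intro[OF submodule.axioms(1)]] M.abelian_group_axioms by auto

lemma quotient_module_simps:
  "carrier (quotient_module M H) = a_rcosets\<^bsub>M\<^esub> H" "\<zero>\<^bsub>quotient_module M H\<^esub> = H"
  "x \<oplus>\<^bsub>quotient_module M H\<^esub> y = x <+>\<^bsub>M\<^esub> y"
  by (simp_all add: quotient_module_def)

lemma carrier_quotient_module: "carrier (quotient_module M H) = (\<lambda>x. H +>\<^bsub>M\<^esub> x) ` carrier M"
  unfolding quotient_module_simps A_RCOSETS_def' by auto

lemma coset_mem_iff:
  assumes "submodule H R M" "x \<in> carrier M" "y \<in> carrier M"
  shows "H +>\<^bsub>M\<^esub> x = H +>\<^bsub>M\<^esub> y \<longleftrightarrow> x \<ominus>\<^bsub>M\<^esub> y \<in> H"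
proof -
  interpret abelian_subgroup H M using abelian_subgroup_submodule[OF assms(1)] .
  have "H +>\<^bsub>M\<^esub> x = H +>\<^bsub>M\<^esub> y \<longleftrightarrow> x \<in> H +>\<^bsub>M\<^esub> y"
    using a_repr_independence'[OF _ assms(3)] a_rcos_self[OF assms(2)] by metis
  also have "\<dots> \<longleftrightarrow> x \<ominus>\<^bsub>M\<^esub> y \<in> H"
    using a_rcos_module[OF assms(3,2)] by (simp add: a_minus_def)
  finally show ?thesis .
qed

lemma coset_zero_iff:
  assumes "submodule H R M" "x \<in> carrier M"
  shows "H +>\<^bsub>M\<^esub> x = H \<longleftrightarrow> x \<in> H"
proof -
  have "H +>\<^bsub>M\<^esub> \<zero>\<^bsub>M\<^esub> = H" using submodule_subset[OF assms(1)] by simp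
  moreover have "x \<ominus>\<^bsub>M\<^esub> \<zero>\<^bsub>M\<^esub> = x" using assms(2) by (simp add: a_minus_def)
  ultimately show ?thesis using coset_mem_iff[OF assms M.zero_closed] by simp
qed

lemma coset_add:
  assumes "submodule H R M" "x \<in> carrier M" "y \<in> carrier M"
  shows "(H +>\<^bsub>M\<^esub> x) <+>\<^bsub>M\<^esub> (H +>\<^bsub>M\<^esub> y) = H +>\<^bsub>M\<^esub> (x \<oplus>\<^bsub>M\<^esub> y)"
  using abelian_subgroup.a_rcos_sum[OF abelian_subgroup_submodule[OF assms(1)]] assms by auto

text \<open>The scalar action on a quotient is a union over all representatives; it is a single
  coset because the cosets united all coincide.\<close>

lemma coset_smult:
  assumes "submodule H R M" "a \<in> carrier R" "x \<in> carrier M"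
  shows "a \<odot>\<^bsub>quotient_module M H\<^esub> (H +>\<^bsub>M\<^esub> x) = H +>\<^bsub>M\<^esub> (a \<odot>\<^bsub>M\<^esub> x)"
proof -
  have self: "x \<in> H +>\<^bsub>M\<^esub> x"
    using abelian_subgroup.a_rcos_self[OF abelian_subgroup_submodule[OF assms(1)]] assms by auto
  have "H +>\<^bsub>M\<^esub> (a \<odot>\<^bsub>M\<^esub> y) = H +>\<^bsub>M\<^esub> (a \<odot>\<^bsub>M\<^esub> x)" if y: "y \<in> H +>\<^bsub>M\<^esub> x" for y
  proof -
    obtain h where h: "h \<in> H" "y = h \<oplus>\<^bsub>M\<^esub> x" using y by (auto simp: a_r_coset_def')
    have c: "h \<in> carrier M" using h submodule_subset[OF assms(1)] by auto
    have "a \<odot>\<^bsub>M\<^esub> y \<ominus>\<^bsub>M\<^esub> a \<odot>\<^bsub>M\<^esub> x = a \<odot>\<^bsub>M\<^esub> h"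
      using h c assms M.add_minus_cancel(2) by (simp add: smult_r_distr)
    then show ?thesis
      using coset_mem_iff[OF assms(1), of "a \<odot>\<^bsub>M\<^esub> y" "a \<odot>\<^bsub>M\<^esub> x"] h c assms submodule_smult_mem[OF assms(1,2) h(1)] by auto
  qed
  then have "(\<Union>y\<in>H +>\<^bsub>M\<^esub> x. H +>\<^bsub>M\<^esub> (a \<odot>\<^bsub>M\<^esub> y)) = (\<Union>y\<in>H +>\<^bsub>M\<^esub> x. H +>\<^bsub>M\<^esub> (a \<odot>\<^bsub>M\<^esub> x))"
    by (intro SUP_cong refl)
  also have "\<dots> = H +>\<^bsub>M\<^esub> (a \<odot>\<^bsub>M\<^esub> x)" using self by blast
  finally show ?thesis by (simp add: quotient_module_def)
qed

lemma quotient_module_map: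
  assumes H: "submodule H R M"
  shows "module_map R M (quotient_module M H) (\<lambda>x. H +>\<^bsub>M\<^esub> x)"
proof -
  interpret abelian_subgroup H M using abelian_subgroup_submodule[OF H] .
  note sm = coset_smult[OF H] and ad = coset_add[OF H]
  have z: "H = H +>\<^bsub>M\<^esub> \<zero>\<^bsub>M\<^esub>" using coset_zero_iff[OF H M.zero_closed] submodule_zero_mem[OF H] by simp
  have ab: "abelian_group (quotient_module M H)"
  proof (rule abelian_groupI)
    show "\<zero>\<^bsub>quotient_module M H\<^esub> \<in> carrier (quotient_module M H)"
      unfolding carrier_quotient_module quotient_module_simps(2) using z by blast
    fix x assume "x \<in> carrier (quotient_module M H)"
    then obtain x' where x': "x' \<in> carrier M" "x = H +>\<^bsub>M\<^esub> x'" unfolding carrier_quotient_module by blast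
    have "\<zero>\<^bsub>quotient_module M H\<^esub> \<oplus>\<^bsub>quotient_module M H\<^esub> x = (H +>\<^bsub>M\<^esub> \<zero>\<^bsub>M\<^esub>) <+>\<^bsub>M\<^esub> (H +>\<^bsub>M\<^esub> x')"
      unfolding quotient_module_simps x' using z by simp
    then show "\<zero>\<^bsub>quotient_module M H\<^esub> \<oplus>\<^bsub>quotient_module M H\<^esub> x = x" using x' by (simp add: ad)
    have "(H +>\<^bsub>M\<^esub> \<ominus>\<^bsub>M\<^esub> x') \<oplus>\<^bsub>quotient_module M H\<^esub> x = \<zero>\<^bsub>quotient_module M H\<^esub>"
      unfolding quotient_module_simps x' using x'(1) z by (simp add: ad M.l_neg)
    then show "\<exists>y\<in>carrier (quotient_module M H). y \<oplus>\<^bsub>quotient_module M H\<^esub> x = \<zero>\<^bsub>quotient_module M H\<^esub>"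
      using x'(1) unfolding carrier_quotient_module by blast
  qed (auto simp: carrier_quotient_module ad quotient_module_simps(3) M.add.m_ac)
  have md: "module R (quotient_module M H)"
    by (rule moduleI)
      (auto simp: is_cring ab carrier_quotient_module sm ad quotient_module_simps(3) smult_l_distr smult_r_distr smult_assoc1)
  show ?thesis
    by (intro module_map.intro module_map_axioms.intro md module_axioms)
      (auto simp: carrier_quotient_module sm ad quotient_module_simps(3))
qed

lemma submodule_sub_iff:
  assumes "submodule L R M"
  shows "submodule H R (M\<lparr>carrier := L\<rparr>) \<longleftrightarrow> submodule H R M \<and> H \<subseteq> L"
proof -
  interpret L: module R "M\<lparr>carrier := L\<rparr>"
    using submodule.submodule_is_module[OF assms] module_axioms by auto
  show ?thesis unfolding submodule_iff L.submodule_iff using submodule_subset[OF assms] by auto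
qed

lemma module_length_eq: "module_length R M = rel_length R M {\<zero>\<^bsub>M\<^esub>} (carrier M)"
proof -
  have "(\<forall>i\<le>n. submodule (H i) R M) \<longleftrightarrow>
     (\<forall>i\<le>n. submodule (H i) R M \<and> {\<zero>\<^bsub>M\<^esub>} \<subseteq> H i \<and> H i \<subseteq> carrier M)" for H :: "nat \<Rightarrow> 'c set" and n
    using submodule_subset submodule_zero_mem by auto
  then show ?thesis unfolding module_length_def rel_length_def by simp
qed

lemma rel_length_sub:
  assumes "submodule L R M" "Q \<subseteq> L"
  shows "rel_length R (M\<lparr>carrier := L\<rparr>) K Q = rel_length R M K Q"
  by (intro antisym; rule rel_length_embed[where f = "\<lambda>H. H"])
    (use submodule_sub_iff[OF assms(1)] assms in auto)

lemma module_length_sub: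
  assumes "submodule L R M"
  shows "module_length R (M\<lparr>carrier := L\<rparr>) = rel_length R M {\<zero>\<^bsub>M\<^esub>} L"
proof -
  interpret L: module R "M\<lparr>carrier := L\<rparr>"
    using submodule.submodule_is_module[OF assms] module_axioms by auto
  show ?thesis using L.module_length_eq rel_length_sub[OF assms, of L "{\<zero>\<^bsub>M\<^esub>}"] by simp
qed

lemma module_length_quotient:
  assumes "submodule K R M"
  shows "module_length R (quotient_module M K) = rel_length R M K (carrier M)"
proof -
  interpret q: module_map R M "quotient_module M K" "\<lambda>x. K +>\<^bsub>M\<^esub> x" using quotient_module_map[OF assms] .
  have "{x \<in> carrier M. K +>\<^bsub>M\<^esub> x \<in> {K}} = K"
    using coset_zero_iff[OF assms] submodule_subset[OF assms] by auto
  moreover have "{K} <+>\<^bsub>quotient_module M K\<^esub> (\<lambda>x. K +>\<^bsub>M\<^esub> x) ` carrier M = carrier (quotient_module M K)"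
  proof -
    have s: "submodule {K} R (quotient_module M K)"
      using q.M2.submodule_zero by (simp add: quotient_module_simps)
    have c: "submodule (carrier (quotient_module M K)) R (quotient_module M K)" by (rule q.M2.carrier_is_submodule)
    show ?thesis
      unfolding carrier_quotient_module[symmetric]
      using q.M2.set_add_upper2[OF s c] q.M2.set_add_least[OF c q.M2.submodule_subset[OF s] subset_refl] by auto
  qed
  ultimately show ?thesis
    using q.rel_length_preimage[OF carrier_is_submodule, of "{K}"] q.M2.module_length_eq q.M2.submodule_zero
    by (simp add: quotient_module_simps)
qed

lemma module_length_subquotient:
  assumes "submodule K R M" "submodule L R M" "K \<subseteq> L"
  shows "module_length R (quotient_module (M\<lparr>carrier := L\<rparr>) K) = rel_length R M K L"
proof -
  interpret L: module R "M\<lparr>carrier := L\<rparr>"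
    using submodule.submodule_is_module[OF assms(2)] module_axioms by auto
  have "submodule K R (M\<lparr>carrier := L\<rparr>)" using submodule_sub_iff[OF assms(2)] assms by auto
  from L.module_length_quotient[OF this] show ?thesis
    using rel_length_sub[OF assms(2), of L K] by simp
qed

end

section \<open>Ideals and prime ideals\<close>

text \<open>Turns ideals into submodules, so that lengths and chain conditions for modules apply to
  ideals.\<close>

definition self_module :: "('a, 'k) ring_scheme \<Rightarrow> ('a, 'a) module" where
  "self_module R = \<lparr>carrier = carrier R, monoid.mult = monoid.mult R, one = one R,
     ring.zero = ring.zero R, ring.add = ring.add R, smult = monoid.mult R\<rparr>"

lemma self_module_simps [simp]:
  "carrier (self_module R) = carrier R" "x \<oplus>\<^bsub>self_module R\<^esub> y = x \<oplus>\<^bsub>R\<^esub> y"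
  "\<zero>\<^bsub>self_module R\<^esub> = \<zero>\<^bsub>R\<^esub>" "a \<odot>\<^bsub>self_module R\<^esub> x = a \<otimes>\<^bsub>R\<^esub> x"
  by (simp_all add: self_module_def)

context cring
begin

lemma module_self_module: "module R (self_module R)"
proof (rule moduleI)
  show "abelian_group (self_module R)"
  proof (rule abelian_groupI)
    fix x assume "x \<in> carrier (self_module R)"
    then show "\<exists>y\<in>carrier (self_module R). y \<oplus>\<^bsub>self_module R\<^esub> x = \<zero>\<^bsub>self_module R\<^esub>"
      by (intro bexI[of _ "\<ominus> x"]) (auto simp: l_neg)
  qed (auto simp: a_ac)
qed (auto simp: l_distr r_distr m_assoc is_cring)

lemma ideal_iff:
  "ideal I R \<longleftrightarrow> I \<subseteq> carrier R \<and> \<zero> \<in> I \<and> (\<forall>a\<in>I. \<forall>b\<in>I. a \<oplus> b \<in> I) \<and> (\<forall>r\<in>carrier R. \<forall>x\<in>I. r \<otimes> x \<in> I)"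
proof
  assume "ideal I R"
  then interpret ideal I R .
  show "I \<subseteq> carrier R \<and> \<zero> \<in> I \<and> (\<forall>a\<in>I. \<forall>b\<in>I. a \<oplus> b \<in> I) \<and> (\<forall>r\<in>carrier R. \<forall>x\<in>I. r \<otimes> x \<in> I)"
    using a_subset I_l_closed by auto
next
  assume h: "I \<subseteq> carrier R \<and> \<zero> \<in> I \<and> (\<forall>a\<in>I. \<forall>b\<in>I. a \<oplus> b \<in> I) \<and> (\<forall>r\<in>carrier R. \<forall>x\<in>I. r \<otimes> x \<in> I)"
  have neg: "\<ominus> x \<in> I" if "x \<in> I" for x
  proof -
    have "(\<ominus> \<one>) \<otimes> x \<in> I" using h that by auto
    moreover have "x \<in> carrier R" using h that by auto
    ultimately show ?thesis by (simp add: l_minus)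
  qed
  show "ideal I R"
  proof (rule idealI[OF ring_axioms])
    show "subgroup I (add_monoid R)"
      using h neg by unfold_locales (auto simp: a_inv_def[symmetric])
  next
    fix a x assume ax: "a \<in> I" "x \<in> carrier R"
    show "x \<otimes> a \<in> I" using h ax by blast
    moreover have "a \<otimes> x = x \<otimes> a" using h ax m_comm by blast
    ultimately show "a \<otimes> x \<in> I" by simp
  qed
qed

lemma submodule_self_iff: "submodule I R (self_module R) \<longleftrightarrow> ideal I R"
  unfolding module.submodule_iff[OF module_self_module] ideal_iff by simp

lemma ideal_subset: "ideal I R \<Longrightarrow> I \<subseteq> carrier R"
  unfolding ideal_iff by auto

lemma ideal_zero_mem: "ideal I R \<Longrightarrow> \<zero> \<in> I"
  unfolding ideal_iff by auto

lemma ideal_add_mem: "ideal I R \<Longrightarrow> x \<in> I \<Longrightarrow> y \<in> I \<Longrightarrow> x \<oplus> y \<in> I"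
  unfolding ideal_iff by auto

lemma ideal_mult_mem: "ideal I R \<Longrightarrow> r \<in> carrier R \<Longrightarrow> x \<in> I \<Longrightarrow> r \<otimes> x \<in> I"
  unfolding ideal_iff by auto

lemma ideal_neg_mem: "ideal I R \<Longrightarrow> x \<in> I \<Longrightarrow> \<ominus> x \<in> I"
  using additive_subgroup.a_inv_closed[OF ideal.axioms(1)] by (metis abelian_group_axioms ideal.axioms(1) additive_subgroup.a_inv_closed)

lemma ideal_diff_mem: "ideal I R \<Longrightarrow> x \<in> I \<Longrightarrow> y \<in> I \<Longrightarrow> x \<ominus> y \<in> I"
  unfolding a_minus_def by (intro ideal_add_mem ideal_neg_mem)

text \<open>Zorn's lemma. The set \<open>Z\<close> is arbitrary because three kinds are avoided
  later: multiplicative sets (giving primes), \<open>{\<one>}\<close> (giving maximal ideals), and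
  one point together with the complement of an ideal (giving a hyperplane).\<close>

lemma exists_ideal_maximal_disjoint:
  assumes I: "ideal I R" and dis: "I \<inter> Z = {}"
  shows "\<exists>P. ideal P R \<and> I \<subseteq> P \<and> P \<inter> Z = {} \<and> (\<forall>J. ideal J R \<longrightarrow> P \<subset> J \<longrightarrow> J \<inter> Z \<noteq> {})"
proof -
  let ?Y = "{J. ideal J R \<and> I \<subseteq> J \<and> J \<inter> Z = {}}"
  have "\<exists>M\<in>?Y. \<forall>N\<in>?Y. M \<subseteq> N \<longrightarrow> N = M"
  proof (rule subset_Zorn_nonempty)
    show "?Y \<noteq> {}" using assms by blast
    fix C assume C: "C \<noteq> {}" "subset.chain ?Y C"
    have CY: "J \<in> C \<Longrightarrow> J \<in> ?Y" for J using C(2) unfolding pred_on.chain_def by blast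
    have "subset.chain {I. ideal I R} C" using C(2) unfolding pred_on.chain_def by blast
    from chain_Union_is_ideal[OF this] have "ideal (\<Union>C) R" using C(1) by simp
    moreover have "I \<subseteq> \<Union>C" using C(1) CY by blast
    moreover have "\<Union>C \<inter> Z = {}" using CY by blast
    ultimately show "\<Union>C \<in> ?Y" by blast
  qed
  then obtain M where "M \<in> ?Y" "\<forall>N\<in>?Y. M \<subseteq> N \<longrightarrow> N = M" by blast
  then show ?thesis by (intro exI[of _ M]) blast
qed

lemma ideal_add_cgenideal:
  assumes "ideal P R" "a \<in> carrier R"
  shows "ideal (P <+>\<^bsub>R\<^esub> PIdl a) R" "P \<subseteq> P <+>\<^bsub>R\<^esub> PIdl a" "a \<in> P <+>\<^bsub>R\<^esub> PIdl a"
    "x \<in> P <+>\<^bsub>R\<^esub> PIdl a \<longleftrightarrow> (\<exists>p\<in>P. \<exists>r\<in>carrier R. x = p \<oplus> r \<otimes> a)"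
proof -
  show e: "x \<in> P <+>\<^bsub>R\<^esub> PIdl a \<longleftrightarrow> (\<exists>p\<in>P. \<exists>r\<in>carrier R. x = p \<oplus> r \<otimes> a)" for x
    unfolding set_add_def' cgenideal_def by blast
  show "ideal (P <+>\<^bsub>R\<^esub> PIdl a) R" using add_ideals[OF assms(1) cgenideal_ideal[OF assms(2)]] .
  have c: "P \<subseteq> carrier R" using ideal_subset[OF assms(1)] .
  show "P \<subseteq> P <+>\<^bsub>R\<^esub> PIdl a"
  proof
    fix x assume x: "x \<in> P"
    then have "x = x \<oplus> \<zero> \<otimes> a" using assms(2) c by auto
    then show "x \<in> P <+>\<^bsub>R\<^esub> PIdl a" unfolding e using x by blast
  qed
  have "a = \<zero> \<oplus> \<one> \<otimes> a" using assms(2) by simp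
  then show "a \<in> P <+>\<^bsub>R\<^esub> PIdl a" unfolding e using ideal_zero_mem[OF assms(1)] by blast
qed

text \<open>An ideal \<open>P\<close> maximal among those missing \<open>T\<close> is prime: if
  neither \<open>a\<close> nor \<open>b\<close> lies in it, then \<open>P + (a)\<close> and
  \<open>P + (b)\<close> both meet \<open>T\<close>, and when \<open>a b\<close> lies in
  \<open>P\<close> the product of the two meeting points lies in \<open>P\<close> and in
  \<open>T\<close>.\<close>

theorem exists_primeideal_disjoint:
  assumes I: "ideal I R" and dis: "I \<inter> T = {}" and T: "\<one> \<in> T" "\<And>s t. s \<in> T \<Longrightarrow> t \<in> T \<Longrightarrow> s \<otimes> t \<in> T"
  shows "\<exists>P. primeideal P R \<and> I \<subseteq> P \<and> P \<inter> T = {}"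
proof -
  obtain P where P: "ideal P R" "I \<subseteq> P" "P \<inter> T = {}" "\<And>J. ideal J R \<Longrightarrow> P \<subset> J \<Longrightarrow> J \<inter> T \<noteq> {}"
    using exists_ideal_maximal_disjoint[OF I dis] by blast
  have c: "P \<subseteq> carrier R" using ideal_subset[OF P(1)] .
  have "primeideal P R"
  proof (rule primeidealI[OF P(1) is_cring])
    show "carrier R \<noteq> P" using T(1) P(3) one_closed by blast
    fix a b assume ab: "a \<in> carrier R" "b \<in> carrier R" "a \<otimes> b \<in> P"
    show "a \<in> P \<or> b \<in> P"
    proof (rule ccontr)
      assume n: "\<not> (a \<in> P \<or> b \<in> P)"
      have "(P <+>\<^bsub>R\<^esub> PIdl a) \<inter> T \<noteq> {}" "(P <+>\<^bsub>R\<^esub> PIdl b) \<inter> T \<noteq> {}"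
        using P(4) ideal_add_cgenideal(1-3)[OF P(1) ab(1)] ideal_add_cgenideal(1-3)[OF P(1) ab(2)] n by blast+
      then obtain s t where st: "s \<in> P <+>\<^bsub>R\<^esub> PIdl a" "s \<in> T" "t \<in> P <+>\<^bsub>R\<^esub> PIdl b" "t \<in> T" by blast
      obtain p r where pr: "p \<in> P" "r \<in> carrier R" "s = p \<oplus> r \<otimes> a"
        using st(1) unfolding ideal_add_cgenideal(4)[OF P(1) ab(1)] by blast
      obtain q u where qu: "q \<in> P" "u \<in> carrier R" "t = q \<oplus> u \<otimes> b"
        using st(3) unfolding ideal_add_cgenideal(4)[OF P(1) ab(2)] by blast
      have cc: "p \<in> carrier R" "q \<in> carrier R" using pr qu c by auto
      have "s \<otimes> t = (t \<otimes> p \<oplus> (r \<otimes> a) \<otimes> q) \<oplus> (r \<otimes> u) \<otimes> (a \<otimes> b)"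
        unfolding pr(3) qu(3) using cc ab(1,2) pr(2) qu(2) by algebra
      moreover have "t \<in> carrier R" using qu cc ab by simp
      ultimately have "s \<otimes> t \<in> P"
        using pr qu ab cc P(1) ideal_add_mem ideal_mult_mem by (metis m_closed)
      then show False using T(2)[OF st(2,4)] P(3) by blast
    qed
  qed
  then show ?thesis using P by blast
qed

lemma exists_maximalideal:
  assumes "ideal I R" "\<one> \<notin> I" shows "\<exists>P. maximalideal P R \<and> I \<subseteq> P"
proof -
  obtain P where P: "ideal P R" "I \<subseteq> P" "P \<inter> {\<one>} = {}" "\<And>J. ideal J R \<Longrightarrow> P \<subset> J \<Longrightarrow> J \<inter> {\<one>} \<noteq> {}"
    using exists_ideal_maximal_disjoint[OF assms(1), of "{\<one>}"] assms(2) by blast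
  have "maximalideal P R"
  proof (rule maximalidealI[OF P(1)])
    show "carrier R \<noteq> P" using P(3) one_closed by blast
    fix J assume J: "ideal J R" "P \<subseteq> J" "J \<subseteq> carrier R"
    show "J = P \<or> J = carrier R"
    proof (cases "J = P")
      case False
      then have "\<one> \<in> J" using P(4)[OF J(1)] J(2) by blast
      then show ?thesis using ideal.one_imp_carrier[OF J(1)] by blast
    qed simp
  qed
  then show ?thesis using P(2) by blast
qed

subsection \<open>Krull dimension of quotients\<close>

lemma primeideal_quotient_image:
  assumes I: "ideal I R" and P: "primeideal P R" and sub: "I \<subseteq> P"
  shows "primeideal ((\<lambda>x. I +> x) ` P) (R Quot I)"
    and "x \<in> carrier R \<Longrightarrow> I +> x \<in> (\<lambda>x. I +> x) ` P \<longleftrightarrow> x \<in> P"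
proof -
  interpret I: ideal I R by fact
  interpret P: primeideal P R by fact
  interpret Q: cring "R Quot I" using I.quotient_is_cring[OF is_cring] .
  have cP: "P \<subseteq> carrier R" using P.a_subset .
  have eq: "I +> x = I +> y \<longleftrightarrow> x \<ominus> y \<in> I" if "x \<in> carrier R" "y \<in> carrier R" for x y
  proof -
    have "I +> x = I +> y \<longleftrightarrow> x \<in> I +> y"
      using I.a_repr_independence'[OF _ that(2)] I.a_rcos_self[OF that(1)] by metis
    then show ?thesis using I.a_rcos_module[OF that(2,1)] by (simp add: a_minus_def)
  qed
  show mem: "I +> x \<in> (\<lambda>x. I +> x) ` P \<longleftrightarrow> x \<in> P" if x: "x \<in> carrier R" for x
  proof
    assume "I +> x \<in> (\<lambda>x. I +> x) ` P"
    then obtain y where y: "y \<in> P" "I +> x = I +> y" by blast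
    then have "x \<ominus> y \<in> P" using eq[OF x] cP sub by blast
    then have "(x \<ominus> y) \<oplus> y \<in> P" using y(1) by simp
    then show "x \<in> P" using add_minus_cancel(3)[OF x] y(1) cP by auto
  qed blast
  have car: "carrier (R Quot I) = (\<lambda>x. I +> x) ` carrier R"
    unfolding FactRing_def A_RCOSETS_def' by auto
  have mult: "(I +> x) \<otimes>\<^bsub>R Quot I\<^esub> (I +> y) = I +> (x \<otimes> y)" if "x \<in> carrier R" "y \<in> carrier R" for x y
    unfolding FactRing_def using I.rcoset_mult_add[OF that] by simp
  have add: "(I +> x) \<oplus>\<^bsub>R Quot I\<^esub> (I +> y) = I +> (x \<oplus> y)" if "x \<in> carrier R" "y \<in> carrier R" for x y
    unfolding FactRing_def using I.a_rcos_sum[OF that] by simp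
  have zero: "\<zero>\<^bsub>R Quot I\<^esub> = I +> \<zero>" unfolding FactRing_def using I.a_subset by simp
  show "primeideal ((\<lambda>x. I +> x) ` P) (R Quot I)"
  proof (rule primeidealI)
    show "ideal ((\<lambda>x. I +> x) ` P) (R Quot I)"
      unfolding Q.ideal_iff
    proof (intro conjI ballI)
      show "(\<lambda>x. I +> x) ` P \<subseteq> carrier (R Quot I)" unfolding car using cP by blast
      show "\<zero>\<^bsub>R Quot I\<^esub> \<in> (\<lambda>x. I +> x) ` P" unfolding zero by (rule imageI) simp
      fix a b assume "a \<in> (\<lambda>x. I +> x) ` P" "b \<in> (\<lambda>x. I +> x) ` P"
      then obtain x y where xy: "x \<in> P" "y \<in> P" "a = I +> x" "b = I +> y" by blast
      then have "a \<oplus>\<^bsub>R Quot I\<^esub> b = I +> (x \<oplus> y)" using add cP by blast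
      then show "a \<oplus>\<^bsub>R Quot I\<^esub> b \<in> (\<lambda>x. I +> x) ` P" using xy by simp
    next
      fix a b assume "a \<in> carrier (R Quot I)" "b \<in> (\<lambda>x. I +> x) ` P"
      then obtain x y where xy: "x \<in> carrier R" "y \<in> P" "a = I +> x" "b = I +> y" unfolding car by blast
      then have "a \<otimes>\<^bsub>R Quot I\<^esub> b = I +> (x \<otimes> y)" using mult cP by blast
      then show "a \<otimes>\<^bsub>R Quot I\<^esub> b \<in> (\<lambda>x. I +> x) ` P" using xy P.I_l_closed by simp
    qed
    show "cring (R Quot I)" by (rule Q.is_cring)
    show "carrier (R Quot I) \<noteq> (\<lambda>x. I +> x) ` P"
    proof
      assume "carrier (R Quot I) = (\<lambda>x. I +> x) ` P"
      then have "I +> \<one> \<in> (\<lambda>x. I +> x) ` P" unfolding car by blast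
      then have "\<one> \<in> P" using mem by simp
      then show False using P.I_notcarr P.one_imp_carrier by blast
    qed
    fix a b assume ab: "a \<in> carrier (R Quot I)" "b \<in> carrier (R Quot I)" "a \<otimes>\<^bsub>R Quot I\<^esub> b \<in> (\<lambda>x. I +> x) ` P"
    then obtain x y where xy: "x \<in> carrier R" "y \<in> carrier R" "a = I +> x" "b = I +> y" unfolding car by blast
    then have "x \<otimes> y \<in> P" using ab(3) mult mem by simp
    then have "x \<in> P \<or> y \<in> P" using P.I_prime xy by blast
    then show "a \<in> (\<lambda>x. I +> x) ` P \<or> b \<in> (\<lambda>x. I +> x) ` P" using xy by blast
  qed
qed

lemma ring_krull_dim_quot_ge:
  assumes I: "ideal I R" and P: "\<And>i. i \<le> n \<Longrightarrow> primeideal (P i) R" "I \<subseteq> P 0" "\<And>i. i < n \<Longrightarrow> P i \<subset> P (Suc i)"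
  shows "ereal (real n) \<le> ring_krull_dim (R Quot I)"
proof -
  have sub: "I \<subseteq> P i" if "i \<le> n" for i
    using that
  proof (induction i)
    case 0 then show ?case using P by simp
  next
    case (Suc i) then show ?case using P(3)[of i] by auto
  qed
  have "(\<lambda>x. I +> x) ` P i \<subset> (\<lambda>x. I +> x) ` P (Suc i)" if i: "i < n" for i
  proof -
    obtain x where x: "x \<in> P (Suc i)" "x \<notin> P i" using P(3)[OF i] by blast
    have "x \<in> carrier R" using x P(1)[of "Suc i"] i ideal_subset primeideal.axioms(1) by (metis Suc_leI subsetD)
    then have "I +> x \<notin> (\<lambda>x. I +> x) ` P i"
      using primeideal_quotient_image(2)[OF I P(1) sub] i x by simp
    then show ?thesis using P(3)[OF i] x by blast
  qed
  then show ?thesis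
    unfolding ring_krull_dim_def
    by (intro Sup_upper CollectI exI[of _ n] conjI refl exI[of _ "\<lambda>i. (\<lambda>x. I +> x) ` P i"])
      (use primeideal_quotient_image(1)[OF I P(1) sub] in auto)
qed

lemma ring_krull_dim_quot_chain:
  assumes I: "ideal I R" and Q: "\<And>i. i \<le> n \<Longrightarrow> primeideal (Q i) (R Quot I)" "\<And>i. i < n \<Longrightarrow> Q i \<subset> Q (Suc i)"
  shows "\<exists>P. (\<forall>i\<le>n. primeideal (P i) R \<and> I \<subseteq> P i) \<and> (\<forall>i<n. P i \<subset> P (Suc i))"
proof -
  interpret I: ideal I R by fact
  interpret h: ring_hom_ring R "R Quot I" "(+>) I" by (rule I.rcos_ring_hom_ring)
  define P where "P i = {r \<in> carrier R. I +> r \<in> Q i}" for i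
  have car: "carrier (R Quot I) = (\<lambda>x. I +> x) ` carrier R"
    unfolding FactRing_def A_RCOSETS_def' by auto
  have zero: "\<zero>\<^bsub>R Quot I\<^esub> = I" unfolding FactRing_def by simp
  have p: "primeideal (P i) R" if "i \<le> n" for i
    unfolding P_def using h.primeideal_vimage[OF is_cring Q(1)[OF that]] .
  have "I \<subseteq> P i" if "i \<le> n" for i
  proof
    fix x assume x: "x \<in> I"
    have "I \<in> Q i" using additive_subgroup.zero_closed[OF ideal.axioms(1)[OF primeideal.axioms(1)[OF Q(1)[OF that]]]] zero by simp
    moreover have "I +> x = I" using a_rcos_zero[OF I x] .
    ultimately show "x \<in> P i" unfolding P_def using x I.a_subset by auto
  qed
  moreover have "P i \<subset> P (Suc i)" if i: "i < n" for i
  proof -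
    obtain y where y: "y \<in> Q (Suc i)" "y \<notin> Q i" using Q(2)[OF i] by blast
    have "Q (Suc i) \<subseteq> carrier (R Quot I)"
      using additive_subgroup.a_subset[OF ideal.axioms(1)[OF primeideal.axioms(1)[OF Q(1)[of "Suc i"]]]] i by simp
    then obtain x where "x \<in> carrier R" "y = I +> x" using y unfolding car by blast
    then have "x \<in> P (Suc i)" "x \<notin> P i" using y unfolding P_def by auto
    moreover have "P i \<subseteq> P (Suc i)" using Q(2)[OF i] unfolding P_def by blast
    ultimately show ?thesis by blast
  qed
  ultimately show ?thesis using p by (intro exI[of _ P]) blast
qed

end

section \<open>Artinian local rings\<close>

locale artinian_local =
  fixes A :: "('a, 'k) ring_scheme" (structure) and \<mm> :: "'a set"
  assumes artinian: "artinian_ring A" and local_with: "local_ring_with A \<mm>"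
begin

sublocale cring A using artinian unfolding artinian_ring_def by blast

lemma maximal_m: "maximalideal \<mm> A"
  using local_with unfolding local_ring_with_def by blast

lemma m_ideal: "ideal \<mm> A" using maximal_m maximalideal.axioms(1) by blast

lemma one_notin_m: "\<one> \<notin> \<mm>"
  using maximalideal.I_notcarr[OF maximal_m] ideal.one_imp_carrier[OF m_ideal] by blast

lemma unit_if_notin_m:
  assumes "a \<in> carrier A" "a \<notin> \<mm>" obtains b where "b \<in> carrier A" "b \<otimes> a = \<one>"
proof (cases "\<one> \<in> PIdl a")
  case True
  then obtain b where "b \<in> carrier A" "\<one> = b \<otimes> a" unfolding cgenideal_def by blast
  then show thesis by (intro that[of b]) simp_all
next
  case False
  then obtain P where "maximalideal P A" "PIdl a \<subseteq> P" using exists_maximalideal[OF cgenideal_ideal[OF assms(1)]] by blast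
  then have "a \<in> \<mm>" using local_with cgenideal_self[OF assms(1)] unfolding local_ring_with_def by blast
  then show thesis using assms by simp
qed

text \<open>The descending chain of the principal ideals generated by the powers of \<open>a\<close>
  stops.\<close>

lemma power_stable:
  assumes a: "a \<in> carrier A"
  obtains N b where "b \<in> carrier A" "a [^] (N::nat) = b \<otimes> a [^] (Suc N)"
proof -
  have "ideal (PIdl (a [^] n)) A \<and> PIdl (a [^] Suc n) \<subseteq> PIdl (a [^] n)" for n :: nat
  proof
    show i: "ideal (PIdl (a [^] n)) A" using cgenideal_ideal a by simp
    have "a [^] Suc n = a \<otimes> a [^] n" using a by (simp add: nat_pow_comm m_comm)
    then have "a [^] Suc n \<in> PIdl (a [^] n)" unfolding cgenideal_def using a by blast
    then show "PIdl (a [^] Suc n) \<subseteq> PIdl (a [^] n)" by (rule cgenideal_minimal[OF i])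
  qed
  note st = this
  have "\<exists>N::nat. \<forall>n\<ge>N. PIdl (a [^] n) = PIdl (a [^] N)"
    by (rule artinian[unfolded artinian_ring_def, THEN conjunct2, rule_format, of "\<lambda>n::nat. PIdl (a [^] n)", OF st])
  then obtain N :: nat where "\<forall>n\<ge>N. PIdl (a [^] n) = PIdl (a [^] N)" by blast
  then have "PIdl (a [^] Suc N) = PIdl (a [^] N)" using le_SucI by blast
  then have "a [^] N \<in> PIdl (a [^] Suc N)" using cgenideal_self[of "a [^] N"] a by simp
  then show thesis using that unfolding cgenideal_def by blast
qed

text \<open>From \<open>a^N = b a^(N+1)\<close> one gets \<open>(1 - b a) a^N = 0\<close>, and
  \<open>1 - b a\<close> is a unit because \<open>b a\<close> lies in the maximal ideal.\<close>

lemma nilpotent_if_in_m: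
  assumes "a \<in> \<mm>" shows "\<exists>n::nat. a [^] n = \<zero>"
proof -
  have a: "a \<in> carrier A" using assms ideal_subset[OF m_ideal] by blast
  obtain N b where b: "b \<in> carrier A" "a [^] (N::nat) = b \<otimes> a [^] (Suc N)" using power_stable[OF a] .
  have "\<one> \<ominus> b \<otimes> a \<notin> \<mm>"
  proof
    assume h: "\<one> \<ominus> b \<otimes> a \<in> \<mm>"
    have "b \<otimes> a \<in> \<mm>" using ideal_mult_mem[OF m_ideal b(1) assms] .
    then have "(\<one> \<ominus> b \<otimes> a) \<oplus> b \<otimes> a \<in> \<mm>" using h ideal_add_mem[OF m_ideal] by blast
    then show False using one_notin_m add_minus_cancel(3)[of \<one> "b \<otimes> a"] a b by simp
  qed
  then obtain c where c: "c \<in> carrier A" "c \<otimes> (\<one> \<ominus> b \<otimes> a) = \<one>"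
    using unit_if_notin_m[of "\<one> \<ominus> b \<otimes> a"] a b by auto
  have p: "a [^] N \<in> carrier A" using a by simp
  have "b \<otimes> (a [^] N \<otimes> a) = a [^] N" using b by simp
  then have e: "(b \<otimes> a) \<otimes> a [^] N = a [^] N" using a b(1) p m_comm m_assoc by metis
  have "(\<one> \<ominus> b \<otimes> a) \<otimes> a [^] N = a [^] N \<ominus> (b \<otimes> a) \<otimes> a [^] N"
    using a b p by algebra
  also have "\<dots> = \<zero>" using e p by (simp add: a_minus_def r_neg)
  finally have "c \<otimes> ((\<one> \<ominus> b \<otimes> a) \<otimes> a [^] N) = \<zero>" using c by simp
  moreover have "c \<otimes> ((\<one> \<ominus> b \<otimes> a) \<otimes> a [^] N) = (c \<otimes> (\<one> \<ominus> b \<otimes> a)) \<otimes> a [^] N"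
    by (rule m_assoc[symmetric]) (use a b c p in simp_all)
  ultimately have "a [^] N = \<zero>" unfolding c(2) using p by simp
  then show ?thesis by blast
qed

lemma exists_minimal_ideal:
  assumes "Y \<noteq> {}" "\<And>T. T \<in> Y \<Longrightarrow> ideal T A"
  shows "\<exists>T\<in>Y. \<forall>T'\<in>Y. T' \<subseteq> T \<longrightarrow> T' = T"
proof (rule ccontr)
  assume "\<not> ?thesis"
  then have "\<forall>T\<in>Y. \<exists>T'\<in>Y. T' \<subset> T" by blast
  then obtain g where g: "\<And>T. T \<in> Y \<Longrightarrow> g T \<in> Y \<and> g T \<subset> T" by metis
  obtain T0 where T0: "T0 \<in> Y" using assms(1) by blast
  define I where "I n = (g ^^ n) T0" for n
  have IY: "I n \<in> Y" for n by (induction n) (simp_all add: I_def T0 g)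
  have "\<forall>n. ideal (I n) A \<and> I (Suc n) \<subseteq> I n" using IY assms(2) g by (auto simp: I_def)
  then obtain N where "\<forall>n\<ge>N. I n = I N"
    using artinian unfolding artinian_ring_def by blast
  then have "I (Suc N) = I N" using le_SucI by blast
  then show False using g[OF IY[of N]] by (simp add: I_def)
qed

text \<open>Every nonzero multiple of \<open>t\<close> generates \<open>t\<close> again, so the
  principal ideal has no nonzero proper subideal and a chain in it has at most one step.\<close>

lemma rel_length_cyclic_simple:
  assumes t: "t \<in> carrier A" and tr: "\<And>r. r \<in> carrier A \<Longrightarrow> r \<otimes> t \<noteq> \<zero> \<Longrightarrow> \<exists>b\<in>carrier A. b \<otimes> (r \<otimes> t) = t"
  shows "rel_length A (self_module A) {\<zero>} (PIdl t) \<le> 1"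
proof (rule rel_length_leI)
  fix n H assume H: "\<And>i. i \<le> n \<Longrightarrow> submodule (H i) A (self_module A)" "\<And>i. i \<le> n \<Longrightarrow> {\<zero>} \<subseteq> H i"
      "\<And>i. i \<le> n \<Longrightarrow> H i \<subseteq> PIdl t" "\<And>i. i < n \<Longrightarrow> H i \<subset> H (Suc i)"
  have "n \<le> 1"
  proof (rule ccontr)
    assume n: "\<not> n \<le> 1"
    have H1: "ideal (H 1) A" using H(1)[of 1] n submodule_self_iff by simp
    have "H 0 \<subset> H 1" using H(4)[of 0] n by simp
    then obtain w where w: "w \<in> H 1" "w \<noteq> \<zero>" using H(2)[of 0] by auto
    have "w \<in> PIdl t" using w H(3)[of 1] n by auto
    then obtain r where r: "r \<in> carrier A" "w = r \<otimes> t" unfolding cgenideal_def by blast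
    then obtain b where "b \<in> carrier A" "b \<otimes> w = t" using tr w by blast
    then have "t \<in> H 1" using ideal_mult_mem[OF H1 _ w(1)] by blast
    then have "PIdl t \<subseteq> H 1" using cgenideal_minimal[OF H1] by blast
    moreover have "H 1 \<subset> H 2" "H 2 \<subseteq> PIdl t" using H(4)[of 1] H(3)[of 2] n by (auto simp: numeral_2_eq_2)
    ultimately show False by blast
  qed
  then show "enat n \<le> 1" by (simp add: one_enat_def)
qed

text \<open>A minimal ideal of infinite length would be annihilated or mapped onto itself by
  every scalar, hence a vector space; splitting off a line gives a contradiction.\<close>

theorem finite_length: "rel_length A (self_module A) {\<zero>} (carrier A) \<noteq> \<infinity>"
proof
  assume inf: "rel_length A (self_module A) {\<zero>} (carrier A) = \<infinity>"
  interpret V: module A "self_module A" by (rule module_self_module)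
  let ?len = "rel_length A (self_module A)"
  define Y where "Y = {T. ideal T A \<and> ?len {\<zero>} T = \<infinity>}"
  have "carrier A \<in> Y" using inf oneideal by (simp add: Y_def)
  then have ne: "Y \<noteq> {}" by blast
  have idl: "ideal T A" if "T \<in> Y" for T using that unfolding Y_def by blast
  obtain T where TY: "T \<in> Y" and min: "\<And>T'. T' \<in> Y \<Longrightarrow> T' \<subseteq> T \<Longrightarrow> T' = T"
    using exists_minimal_ideal[OF ne idl] by blast
  have T: "ideal T A" "?len {\<zero>} T = \<infinity>" using TY by (auto simp: Y_def)
  have sT: "submodule T A (self_module A)" using T submodule_self_iff by blast
  have cT: "T \<subseteq> carrier A" using ideal_subset[OF T(1)] .
  have s0: "submodule {\<zero>} A (self_module A)" using V.submodule_zero by simp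
  have fin: "?len {\<zero>} T' \<noteq> \<infinity>" if "ideal T' A" "T' \<subset> T" for T'
    using min[of T'] that by (auto simp: Y_def)
  \<comment> \<open>If multiplication by \<open>a\<close> were neither zero nor onto, its kernel and
    its image would be properly contained in \<open>T\<close>, hence of finite length by minimality,
    and then so would be \<open>T\<close>.\<close>
  have dich: "(\<forall>x\<in>T. a \<otimes> x = \<zero>) \<or> (\<forall>x\<in>T. \<exists>y\<in>T. x = a \<otimes> y)" if a: "a \<in> carrier A" for a
  proof (rule ccontr)
    assume n: "\<not> ?thesis"
    interpret f: module_map A "self_module A" "self_module A" "\<lambda>x. a \<otimes> x"
      by unfold_locales (use a in \<open>auto simp: r_distr m_lcomm\<close>)
    let ?K = "{x \<in> T. a \<otimes> x \<in> {\<zero>}}" and ?I = "(\<lambda>x. a \<otimes> x) ` T"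
    have sK: "submodule ?K A (self_module A)" using f.submodule_preimage[OF sT s0] .
    have sI: "submodule ?I A (self_module A)" using f.submodule_image[OF sT] .
    have "{\<zero>} <+>\<^bsub>self_module A\<^esub> ?I = ?I"
      using V.set_add_upper2[OF s0 sI] V.set_add_least[OF sI _ subset_refl, of "{\<zero>}"] V.submodule_zero_mem[OF sI] by auto
    then have e: "?len ?K T = ?len {\<zero>} ?I" using f.rel_length_preimage[OF sT s0] by simp
    have "?I \<subseteq> T" using ideal_mult_mem[OF T(1) a] by blast
    then have "?I \<subset> T" using n by blast
    then have "?len {\<zero>} ?I \<noteq> \<infinity>" using fin sI submodule_self_iff by blast
    moreover have "?K \<subset> T" using n by blast
    then have "?len {\<zero>} ?K \<noteq> \<infinity>" using fin sK submodule_self_iff by blast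
    moreover have "?len {\<zero>} T = ?len {\<zero>} ?K + ?len ?K T"
      using V.rel_length_add[OF s0 sK sT] V.submodule_zero_mem[OF sK] by auto
    ultimately show False using T(2) e plus_eq_infty_iff_enat by metis
  qed
  \<comment> \<open>Where \<open>a\<close> maps \<open>T\<close> onto itself, so does
    \<open>a^N\<close>. Writing \<open>x = a^N y\<close> and using \<open>a^N = b a^(N+1)\<close>
    shows that \<open>b\<close> inverts \<open>a\<close> on \<open>T\<close>, for all
    \<open>x\<close> at once.\<close>
  have inv: "\<exists>b\<in>carrier A. \<forall>x\<in>T. b \<otimes> (a \<otimes> x) = x" if a: "a \<in> carrier A" and n: "\<not> (\<forall>x\<in>T. a \<otimes> x = \<zero>)" for a
  proof -
    have onto: "\<exists>y\<in>T. x = a \<otimes> y" if "x \<in> T" for x using dich[OF a] n that by blast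
    have onton: "\<exists>y\<in>T. x = a [^] (m::nat) \<otimes> y" if "x \<in> T" for x m
      using that
    proof (induction m arbitrary: x)
      case 0 then show ?case using cT by (intro bexI[of _ x]) auto
    next
      case (Suc m)
      obtain y where y: "y \<in> T" "x = a [^] m \<otimes> y" using Suc by blast
      obtain z where z: "z \<in> T" "y = a \<otimes> z" using onto[OF y(1)] by blast
      have "x = a [^] Suc m \<otimes> z" using y z a cT by (simp add: m_assoc subset_iff)
      then show ?case using z by blast
    qed
    obtain N b where b: "b \<in> carrier A" "a [^] (N::nat) = b \<otimes> a [^] (Suc N)" using power_stable[OF a] .
    have "b \<otimes> (a \<otimes> x) = x" if x: "x \<in> T" for x
    proof -
      obtain y where y: "y \<in> T" "x = a [^] N \<otimes> y" using onton[OF x] by blast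
      have yc: "y \<in> carrier A" using y cT by blast
      have p: "a [^] N \<in> carrier A" using a by simp
      have "b \<otimes> (a \<otimes> x) = (b \<otimes> (a [^] N \<otimes> a)) \<otimes> y"
        unfolding y(2) using a b(1) yc p by algebra
      also have "\<dots> = x" using b(2) y by simp
      finally show ?thesis .
    qed
    then show ?thesis using b(1) by blast
  qed
  have "T \<noteq> {\<zero>}" using T(2) by auto
  then obtain t where t: "t \<in> T" "t \<noteq> \<zero>" using ideal_zero_mem[OF T(1)] by blast
  have tc: "t \<in> carrier A" using t cT by blast
  have i0: "ideal {\<zero>} A" by (rule zeroideal)
  \<comment> \<open>A hyperplane complementary to the line through \<open>t\<close>. Avoiding the
    complement of \<open>T\<close> forces the ideal into \<open>T\<close>; avoiding \<open>t\<close>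
    makes it proper there.\<close>
  obtain P where P: "ideal P A" "P \<inter> insert t (carrier A - T) = {}"
     "\<And>J. ideal J A \<Longrightarrow> P \<subset> J \<Longrightarrow> J \<inter> insert t (carrier A - T) \<noteq> {}"
    using exists_ideal_maximal_disjoint[OF i0, of "insert t (carrier A - T)"] t ideal_zero_mem[OF T(1)] by blast
  have PT: "P \<subset> T" using P(2) ideal_subset[OF P(1)] t by blast
  \<comment> \<open>Exchange argument: for \<open>u\<close> outside \<open>P\<close>, maximality
    puts \<open>t\<close> into \<open>P + (u)\<close>, and the coefficient of \<open>u\<close> in
    \<open>t\<close> acts invertibly on \<open>T\<close>, so \<open>u\<close> can be solved
    for.\<close>
  have T_eq: "T \<subseteq> P <+>\<^bsub>A\<^esub> PIdl t"
  proof
    fix u assume u: "u \<in> T"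
    have uc: "u \<in> carrier A" using u cT by blast
    show "u \<in> P <+>\<^bsub>A\<^esub> PIdl t"
    proof (cases "u \<in> P")
      case True then show ?thesis using ideal_add_cgenideal(2)[OF P(1) tc] by blast
    next
      case False
      have "P <+>\<^bsub>A\<^esub> PIdl u \<subseteq> T"
      proof
        fix x assume "x \<in> P <+>\<^bsub>A\<^esub> PIdl u"
        then obtain p r where "p \<in> P" "r \<in> carrier A" "x = p \<oplus> r \<otimes> u" unfolding ideal_add_cgenideal(4)[OF P(1) uc] by blast
        then show "x \<in> T" using ideal_add_mem[OF T(1)] ideal_mult_mem[OF T(1) _ u] PT by blast
      qed
      moreover have "P \<subset> P <+>\<^bsub>A\<^esub> PIdl u" using ideal_add_cgenideal(2,3)[OF P(1) uc] False by blast
      ultimately have "t \<in> P <+>\<^bsub>A\<^esub> PIdl u" using P(3)[OF ideal_add_cgenideal(1)[OF P(1) uc]] by blast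
      then obtain p r where pr: "p \<in> P" "r \<in> carrier A" "t = p \<oplus> r \<otimes> u"
        unfolding ideal_add_cgenideal(4)[OF P(1) uc] by blast
      have pc: "p \<in> carrier A" using pr(1) ideal_subset[OF P(1)] by blast
      have "\<not> (\<forall>x\<in>T. r \<otimes> x = \<zero>)"
      proof
        assume "\<forall>x\<in>T. r \<otimes> x = \<zero>"
        then have "t = p" using pr u pc by simp
        then show False using pr(1) P(2) by blast
      qed
      then obtain b where b: "b \<in> carrier A" "b \<otimes> (r \<otimes> u) = u" using inv[OF pr(2)] u by blast
      have "r \<otimes> u = t \<ominus> p" using pr(3) pc add_minus_cancel(1)[of p "r \<otimes> u"] pr(2) uc by simp
      then have "u = b \<otimes> (t \<ominus> p)" using b by simp
      also have "\<dots> = (\<ominus> b) \<otimes> p \<oplus> b \<otimes> t" using b pc tc by algebra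
      finally show ?thesis unfolding ideal_add_cgenideal(4)[OF P(1) tc]
        using ideal_mult_mem[OF P(1) _ pr(1), of "\<ominus> b"] b(1) by blast
    qed
  qed
  have sP: "submodule P A (self_module A)" and st: "submodule (PIdl t) A (self_module A)"
    using P(1) cgenideal_ideal[OF tc] submodule_self_iff by blast+
  have pe: "P <+>\<^bsub>self_module A\<^esub> PIdl t = P <+>\<^bsub>A\<^esub> PIdl t" unfolding set_add_def' by simp
  have PtT: "P <+>\<^bsub>self_module A\<^esub> PIdl t = T"
    using V.set_add_least[OF sT, of P "PIdl t"] PT cgenideal_minimal[OF T(1) t(1)] T_eq pe by blast
  have "?len P T = ?len (P \<inter> PIdl t) (PIdl t)"
    using V.rel_length_inter_le[OF sP st V.carrier_is_submodule] PtT V.submodule_subset[OF sP] V.submodule_subset[OF st] by simp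
  also have "\<dots> \<le> ?len {\<zero>} (PIdl t)"
    using ideal_zero_mem[OF P(1)] ideal_zero_mem[OF cgenideal_ideal[OF tc]] by (intro rel_length_mono) auto
  also have "\<dots> \<le> 1"
  proof (rule rel_length_cyclic_simple[OF tc])
    fix r assume r: "r \<in> carrier A" "r \<otimes> t \<noteq> \<zero>"
    then show "\<exists>b\<in>carrier A. b \<otimes> (r \<otimes> t) = t" using inv[OF r(1)] t(1) by blast
  qed
  finally have "?len P T \<noteq> \<infinity>" by (cases "?len P T") (auto simp: one_enat_def)
  moreover have "?len {\<zero>} P \<noteq> \<infinity>" using fin[OF P(1) PT] .
  moreover have "?len {\<zero>} T = ?len {\<zero>} P + ?len P T"
    using V.rel_length_add[OF s0 sP sT] ideal_zero_mem[OF P(1)] PT by auto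
  ultimately show False using T(2) plus_eq_infty_iff_enat by metis
qed

text \<open>Each member of \<open>Y\<close> meets at most one residue class modulo the maximal
  ideal, and finitely many classes do not exhaust an infinite residue field.\<close>

lemma avoid_finitely_many_classes:
  assumes inf: "infinite (carrier (A Quot \<mm>))" and fin: "finite Y"
    and Y: "\<And>Z a b. \<lbrakk>Z \<in> Y; a \<in> Z; b \<in> Z; a \<in> carrier A; b \<in> carrier A\<rbrakk> \<Longrightarrow> a \<ominus> b \<in> \<mm>"
  shows "\<exists>a\<in>carrier A. \<forall>Z\<in>Y. a \<notin> Z"
proof (rule ccontr)
  assume n: "\<not> ?thesis"
  interpret m: ideal \<mm> A by (rule m_ideal)
  have car: "carrier (A Quot \<mm>) = (\<lambda>x. \<mm> +> x) ` carrier A"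
    unfolding FactRing_def A_RCOSETS_def' by auto
  define f where "f Z = (SOME a. a \<in> Z \<and> a \<in> carrier A)" for Z
  have "carrier (A Quot \<mm>) \<subseteq> (\<lambda>Z. \<mm> +> f Z) ` Y"
  proof
    fix c assume "c \<in> carrier (A Quot \<mm>)"
    then obtain a where a: "a \<in> carrier A" "c = \<mm> +> a" unfolding car by blast
    then obtain Z where Z: "Z \<in> Y" "a \<in> Z" using n by blast
    have f: "f Z \<in> Z \<and> f Z \<in> carrier A" unfolding f_def by (rule someI[of _ a]) (use a Z in blast)
    then have "a \<ominus> f Z \<in> \<mm>" using Y[OF Z(1)] Z a by blast
    then have "a \<in> \<mm> +> f Z" using m.a_rcos_module[of "f Z" a] f a by (simp add: a_minus_def)
    then have "\<mm> +> a = \<mm> +> f Z" using m.a_repr_independence' f by metis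
    then show "c \<in> (\<lambda>Z. \<mm> +> f Z) ` Y" using a Z by blast
  qed
  then show False using inf fin finite_surj by blast
qed

end

section \<open>Gradings of abelian groups\<close>

definition hom_comp :: "('b, 'k) ring_scheme \<Rightarrow> ('i \<Rightarrow> 'b set) \<Rightarrow> 'b \<Rightarrow> 'i \<Rightarrow> 'b" where
  "hom_comp G D x = (THE f. (\<forall>u. f u \<in> D u) \<and> finite {u. f u \<noteq> \<zero>\<^bsub>G\<^esub>} \<and>
        x = finsum G f {u. f u \<noteq> \<zero>\<^bsub>G\<^esub>})"

lemma (in abelian_group) finsum_support:
  assumes "finite Z" "\<And>u. f u \<in> carrier G" "\<And>u. u \<notin> Z \<Longrightarrow> f u = \<zero>"
  shows "finsum G f {u. f u \<noteq> \<zero>} = finsum G f Z"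
proof -
  have sub: "{u. f u \<noteq> \<zero>} \<subseteq> Z" using assms(3) by blast
  have fin: "finite {u. f u \<noteq> \<zero>}" using sub assms(1) finite_subset by blast
  have "finsum G f ({u. f u \<noteq> \<zero>} \<union> (Z - {u. f u \<noteq> \<zero>})) =
    finsum G f {u. f u \<noteq> \<zero>} \<oplus> finsum G f (Z - {u. f u \<noteq> \<zero>})"
    by (rule finsum_Un_disjoint) (use assms fin in auto)
  moreover have "finsum G f (Z - {u. f u \<noteq> \<zero>}) = \<zero>"
  proof -
    have "finsum G f (Z - {u. f u \<noteq> \<zero>}) = finsum G (\<lambda>_. \<zero>) (Z - {u. f u \<noteq> \<zero>})"
      by (rule finsum_cong') auto
    then show ?thesis by simp
  qed
  moreover have "{u. f u \<noteq> \<zero>} \<union> (Z - {u. f u \<noteq> \<zero>}) = Z" using sub by blast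
  moreover have "finsum G f {u. f u \<noteq> \<zero>} \<in> carrier G" using assms(2) by (intro finsum_closed) blast
  ultimately show ?thesis by simp
qed

locale graded_group = abelian_group G for G (structure) +
  fixes D :: "'i \<Rightarrow> 'a set"
  assumes decomp: "direct_sum_decomp G D"
begin

abbreviation "cp \<equiv> hom_comp G D"

lemma D_sub: "additive_subgroup (D u) G"
  using decomp unfolding direct_sum_decomp_def by blast

lemma D_carrier: "x \<in> D u \<Longrightarrow> x \<in> carrier G"
  using additive_subgroup.a_subset[OF D_sub] by blast

lemma D_zero [simp]: "\<zero> \<in> D u"
  using additive_subgroup.zero_closed[OF D_sub] .

lemma D_add: "x \<in> D u \<Longrightarrow> y \<in> D u \<Longrightarrow> x \<oplus> y \<in> D u"
  using additive_subgroup.a_closed[OF D_sub] .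

lemma D_neg: "x \<in> D u \<Longrightarrow> \<ominus> x \<in> D u"
  using additive_subgroup.a_inv_closed[OF D_sub] abelian_group_axioms by blast

lemma cp_props:
  assumes "x \<in> carrier G"
  shows "cp x u \<in> D u" "finite {u. cp x u \<noteq> \<zero>}" "x = finsum G (cp x) {u. cp x u \<noteq> \<zero>}"
proof -
  have "\<exists>!f. (\<forall>u. f u \<in> D u) \<and> finite {u. f u \<noteq> \<zero>} \<and> x = finsum G f {u. f u \<noteq> \<zero>}"
    using decomp assms unfolding direct_sum_decomp_def by blast
  from theI'[OF this] show "cp x u \<in> D u" "finite {u. cp x u \<noteq> \<zero>}" "x = finsum G (cp x) {u. cp x u \<noteq> \<zero>}"
    unfolding hom_comp_def by blast+
qed

lemma cp_carrier [simp]: "x \<in> carrier G \<Longrightarrow> cp x u \<in> carrier G"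
  using cp_props(1) D_carrier by blast

lemma cp_unique0:
  assumes "\<And>u. f u \<in> D u" "finite {u. f u \<noteq> \<zero>}" "x = finsum G f {u. f u \<noteq> \<zero>}"
  shows "cp x = f"
proof -
  have "f \<in> {u. f u \<noteq> \<zero>} \<rightarrow> carrier G" using assms(1) D_carrier by blast
  then have "x \<in> carrier G" using assms(3) by simp
  then have "\<exists>!f. (\<forall>u. f u \<in> D u) \<and> finite {u. f u \<noteq> \<zero>} \<and> x = finsum G f {u. f u \<noteq> \<zero>}"
    using decomp unfolding direct_sum_decomp_def by blast
  then show ?thesis unfolding hom_comp_def using assms by (intro the1_equality) blast+
qed

lemma cp_unique:
  assumes "finite Z" "\<And>u. f u \<in> D u" "\<And>u. u \<notin> Z \<Longrightarrow> f u = \<zero>" "x = finsum G f Z"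
  shows "cp x = f"
proof (rule cp_unique0)
  have sub: "{u. f u \<noteq> \<zero>} \<subseteq> Z" using assms(3) by blast
  show "finite {u. f u \<noteq> \<zero>}" by (rule finite_subset[OF sub assms(1)])
  have c: "f u \<in> carrier G" for u using D_carrier[OF assms(2)] .
  show "x = finsum G f {u. f u \<noteq> \<zero>}"
    unfolding assms(4) by (rule finsum_support[OF assms(1) c assms(3), symmetric])
  show "f u \<in> D u" for u by (rule assms(2))
qed

lemma cp_hom: "x \<in> D u \<Longrightarrow> cp x v = (if v = u then x else \<zero>)"
proof -
  assume x: "x \<in> D u"
  have "cp x = (\<lambda>v. if v = u then x else \<zero>)"
  proof (rule cp_unique[of "{u}"])
    show "x = finsum G (\<lambda>v. if v = u then x else \<zero>) {u}"
      using D_carrier[OF x] by simp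
  qed (use x in auto)
  then show ?thesis by simp
qed

lemma cp_self: "x \<in> D u \<Longrightarrow> cp x u = x"
  by (simp add: cp_hom)

lemma cp_add:
  assumes "x \<in> carrier G" "y \<in> carrier G" shows "cp (x \<oplus> y) u = cp x u \<oplus> cp y u"
proof -
  let ?Z = "{u. cp x u \<noteq> \<zero>} \<union> {u. cp y u \<noteq> \<zero>}"
  have fin: "finite ?Z" using cp_props(2) assms by simp
  have "cp (x \<oplus> y) = (\<lambda>u. cp x u \<oplus> cp y u)"
  proof (rule cp_unique[OF fin])
    have 1: "finsum G (cp x) ?Z = x"
      by (rule trans[OF finsum_support[OF fin, symmetric] cp_props(3)[OF assms(1), symmetric]])
        (use assms in auto)
    have 2: "finsum G (cp y) ?Z = y"
      by (rule trans[OF finsum_support[OF fin, symmetric] cp_props(3)[OF assms(2), symmetric]])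
        (use assms in auto)
    have "finsum G (\<lambda>u. cp x u \<oplus> cp y u) ?Z = finsum G (cp x) ?Z \<oplus> finsum G (cp y) ?Z"
      by (rule finsum_addf) (use assms in auto)
    then show "x \<oplus> y = finsum G (\<lambda>u. cp x u \<oplus> cp y u) ?Z" unfolding 1 2 by (rule sym)
  qed (use assms in \<open>auto intro!: D_add cp_props(1)\<close>)
  then show ?thesis by simp
qed

lemma cp_zero [simp]: "cp \<zero> u = \<zero>"
  using cp_hom[OF D_zero] by simp

lemma cp_neg: assumes "x \<in> carrier G" shows "cp (\<ominus> x) u = \<ominus> cp x u"
proof -
  have "cp (\<ominus> x) u \<oplus> cp x u = \<zero>" using cp_add[of "\<ominus> x" x u] assms by (simp add: l_neg)
  then show ?thesis using minus_equality[of "cp (\<ominus> x) u" "cp x u"] assms by simp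
qed

lemma cp_diff: "x \<in> carrier G \<Longrightarrow> y \<in> carrier G \<Longrightarrow> cp (x \<ominus> y) u = cp x u \<ominus> cp y u"
  by (simp add: a_minus_def cp_add cp_neg)

lemma finsum_induct:
  assumes "finite F" "\<And>u. u \<in> F \<Longrightarrow> f u \<in> carrier G" "P \<zero>"
    "\<And>u. u \<in> F \<Longrightarrow> P (f u)" "\<And>x y. \<lbrakk>x \<in> carrier G; y \<in> carrier G; P x; P y\<rbrakk> \<Longrightarrow> P (x \<oplus> y)"
  shows "P (finsum G f F)"
  using assms(1,2,4)
proof (induction F)
  case empty then show ?case using assms(3) by simp
next
  case (insert v F)
  have "finsum G f (insert v F) = f v \<oplus> finsum G f F"
    using insert by (intro finsum_insert) auto
  moreover have "finsum G f F \<in> carrier G" using insert by (intro finsum_closed) auto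
  ultimately show ?case using insert assms(5) by auto
qed

lemma hom_induct:
  assumes "x \<in> carrier G" "\<And>u y. y \<in> D u \<Longrightarrow> P y"
    "\<And>x y. \<lbrakk>x \<in> carrier G; y \<in> carrier G; P x; P y\<rbrakk> \<Longrightarrow> P (x \<oplus> y)"
  shows "P x"
proof -
  have "P (finsum G (cp x) {u. cp x u \<noteq> \<zero>})"
  proof (rule finsum_induct[OF cp_props(2)[OF assms(1)]])
    show "P \<zero>" by (rule assms(2)[OF D_zero])
    show "P (cp x u)" for u by (rule assms(2)[OF cp_props(1)[OF assms(1)]])
    show "cp x u \<in> carrier G" for u by (rule cp_carrier[OF assms(1)])
  qed (rule assms(3))
  then show ?thesis unfolding cp_props(3)[OF assms(1), symmetric] .
qed

text \<open>In contrast to \<open>hom_induct\<close>, the property is required only for the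
  components of this particular \<open>x\<close>. This is the form that works for properties which
  not every homogeneous element has, such as membership in a submodule.\<close>

lemma comp_induct:
  assumes "x \<in> carrier G" "P \<zero>" "\<And>u. P (cp x u)"
    "\<And>x y. \<lbrakk>x \<in> carrier G; y \<in> carrier G; P x; P y\<rbrakk> \<Longrightarrow> P (x \<oplus> y)"
  shows "P x"
proof -
  have "P (finsum G (cp x) {u. cp x u \<noteq> \<zero>})"
  proof (rule finsum_induct[OF cp_props(2)[OF assms(1)]])
    show "cp x u \<in> carrier G" for u by (rule cp_carrier[OF assms(1)])
  qed (rule assms(2-4) | assumption)+
  then show ?thesis unfolding cp_props(3)[OF assms(1), symmetric] .
qed

lemma eq_zero_if_comps:
  assumes "x \<in> carrier G" "\<And>u. cp x u = \<zero>" shows "x = \<zero>"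
  by (rule trans[OF cp_props(3)[OF assms(1)]]) (simp add: assms(2))

lemma graded_sum_iff:
  "x \<in> graded_sum G D U \<longleftrightarrow> x \<in> carrier G \<and> (\<forall>u. u \<notin> U \<longrightarrow> cp x u = \<zero>)"
proof
  assume "x \<in> graded_sum G D U"
  then obtain f I where f: "x = finsum G f I" "finite I" "I \<subseteq> U" "\<forall>u\<in>I. f u \<in> D u"
    unfolding graded_sum_def by blast
  have c: "f u \<in> carrier G" if "u \<in> I" for u using f(4) that D_carrier by blast
  have "x \<in> carrier G" using f(1) c by (auto intro: finsum_closed)
  moreover have "\<forall>u. u \<notin> U \<longrightarrow> cp x u = \<zero>" unfolding f(1)
  proof (rule finsum_induct[OF f(2) c])
    fix v assume v: "v \<in> I"
    then have "v \<in> U" "f v \<in> D v" using f(3,4) by blast+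
    then show "\<forall>u. u \<notin> U \<longrightarrow> cp (f v) u = \<zero>" using cp_hom by auto
  qed (auto simp: cp_add)
  ultimately show "x \<in> carrier G \<and> (\<forall>u. u \<notin> U \<longrightarrow> cp x u = \<zero>)" by blast
next
  assume h: "x \<in> carrier G \<and> (\<forall>u. u \<notin> U \<longrightarrow> cp x u = \<zero>)"
  then have x: "x \<in> carrier G" by blast
  have sub: "{u. cp x u \<noteq> \<zero>} \<subseteq> U" using h by blast
  show "x \<in> graded_sum G D U" unfolding graded_sum_def
    by (intro CollectI exI[of _ "cp x"] exI[of _ "{u. cp x u \<noteq> \<zero>}"])
      (use sub cp_props[OF x] in blast)
qed

lemma graded_sum_induct:
  assumes "x \<in> graded_sum G D U" "P \<zero>" "\<And>u y. u \<in> U \<Longrightarrow> y \<in> D u \<Longrightarrow> P y"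
    "\<And>x y. \<lbrakk>x \<in> carrier G; y \<in> carrier G; P x; P y\<rbrakk> \<Longrightarrow> P (x \<oplus> y)"
  shows "P x"
proof -
  have x: "x \<in> carrier G" "\<forall>u. u \<notin> U \<longrightarrow> cp x u = \<zero>" using assms(1) graded_sum_iff by blast+
  show ?thesis
  proof (rule comp_induct[where P = P, OF x(1)])
    show "P \<zero>" by (rule assms(2))
    fix u show "P (cp x u)"
      using assms(2,3) cp_props(1)[OF x(1)] x(2) by (cases "u \<in> U") auto
  qed (rule assms(4))
qed

lemma graded_sum_hom: "u \<in> U \<Longrightarrow> x \<in> D u \<Longrightarrow> x \<in> graded_sum G D U"
  unfolding graded_sum_iff using D_carrier cp_hom by auto

end

text \<open>Candidate projections \<open>p\<close> suffice: applied to a finite sum of homogeneous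
  elements they return its summands, which gives uniqueness of the decomposition. For quotients
  \<open>p\<close> will be computed from representatives.\<close>

lemma direct_sum_decompI:
  assumes "abelian_group G"
    and D: "\<And>u. additive_subgroup (D u) G"
    and p_mem: "\<And>x u. x \<in> carrier G \<Longrightarrow> p x u \<in> D u"
    and p_add: "\<And>x y u. x \<in> carrier G \<Longrightarrow> y \<in> carrier G \<Longrightarrow> p (x \<oplus>\<^bsub>G\<^esub> y) u = p x u \<oplus>\<^bsub>G\<^esub> p y u"
    and p_hom: "\<And>x u v. x \<in> D u \<Longrightarrow> p x v = (if v = u then x else \<zero>\<^bsub>G\<^esub>)"
    and p_fin: "\<And>x. x \<in> carrier G \<Longrightarrow> finite {u. p x u \<noteq> \<zero>\<^bsub>G\<^esub>}"
    and p_sum: "\<And>x. x \<in> carrier G \<Longrightarrow> x = finsum G (p x) {u. p x u \<noteq> \<zero>\<^bsub>G\<^esub>}"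
  shows "direct_sum_decomp G D" and "\<And>x. x \<in> carrier G \<Longrightarrow> hom_comp G D x = p x"
proof -
  interpret abelian_group G by fact
  have Dc: "x \<in> D u \<Longrightarrow> x \<in> carrier G" for x u using additive_subgroup.a_subset[OF D] by blast
  have D0: "\<zero>\<^bsub>G\<^esub> \<in> D u" for u using additive_subgroup.zero_closed[OF D] .
  have psum: "p (finsum G f F) v = (if v \<in> F then f v else \<zero>\<^bsub>G\<^esub>)"
    if "finite F" "\<forall>u\<in>F. f u \<in> D u" for f F v
    using that
  proof (induction F)
    case empty
    then show ?case using p_hom[OF D0] by simp
  next
    case (insert w F)
    have c: "f \<in> F \<rightarrow> carrier G" "f w \<in> carrier G" using insert Dc by blast+
    have "p (finsum G f (insert w F)) v = p (f w \<oplus>\<^bsub>G\<^esub> finsum G f F) v"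
      using insert c by simp
    also have "\<dots> = p (f w) v \<oplus>\<^bsub>G\<^esub> p (finsum G f F) v" using c by (intro p_add) auto
    also have "p (f w) v = (if v = w then f w else \<zero>\<^bsub>G\<^esub>)" using insert p_hom by blast
    also have "p (finsum G f F) v = (if v \<in> F then f v else \<zero>\<^bsub>G\<^esub>)" using insert by blast
    finally show ?case using insert c by (auto simp: Pi_def)
  qed
  have uniq: "f = p x" if f: "\<forall>u. f u \<in> D u" "finite {u. f u \<noteq> \<zero>\<^bsub>G\<^esub>}" "x = finsum G f {u. f u \<noteq> \<zero>\<^bsub>G\<^esub>}" for f x
  proof
    fix v
    have "p x v = (if v \<in> {u. f u \<noteq> \<zero>\<^bsub>G\<^esub>} then f v else \<zero>\<^bsub>G\<^esub>)"
      using psum[OF f(2), of f v] f(1) unfolding f(3)[symmetric] by blast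
    then show "f v = p x v" by auto
  qed
  show dec: "direct_sum_decomp G D" unfolding direct_sum_decomp_def
  proof (intro conjI allI ballI D)
    fix x assume x: "x \<in> carrier G"
    show "\<exists>!f. (\<forall>u. f u \<in> D u) \<and> finite {u. f u \<noteq> \<zero>\<^bsub>G\<^esub>} \<and> x = finsum G f {u. f u \<noteq> \<zero>\<^bsub>G\<^esub>}"
      by (rule ex1I[of _ "p x"]) (use p_mem[OF x] p_fin[OF x] p_sum[OF x] uniq in blast)+
  qed
  interpret graded_group G D by unfold_locales (rule dec)
  show "hom_comp G D x = p x" if "x \<in> carrier G" for x
    by (rule cp_unique0) (use p_mem p_fin p_sum that in blast)+
qed

text \<open>Additive maps that move degrees along an injection \<open>\<phi>\<close> commute with
  taking components. In all uses \<open>\<phi>\<close> is the shift by the degree of a homogeneous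
  scalar or module element; outside its range the components vanish.\<close>

lemma hom_comp_map:
  assumes "graded_group G D" "graded_group G' D'"
    and h_closed: "\<And>x. x \<in> carrier G \<Longrightarrow> h x \<in> carrier G'"
    and h_add: "\<And>x y. x \<in> carrier G \<Longrightarrow> y \<in> carrier G \<Longrightarrow> h (x \<oplus>\<^bsub>G\<^esub> y) = h x \<oplus>\<^bsub>G'\<^esub> h y"
    and h_hom: "\<And>u x. x \<in> D u \<Longrightarrow> h x \<in> D' (\<phi> u)"
    and inj: "inj \<phi>" and x: "x \<in> carrier G"
  shows "hom_comp G' D' (h x) (\<phi> v) = h (hom_comp G D x v)"
    and "w \<notin> range \<phi> \<Longrightarrow> hom_comp G' D' (h x) w = \<zero>\<^bsub>G'\<^esub>"
proof -
  interpret G: graded_group G D by fact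
  interpret G': graded_group G' D' by fact
  have h0: "h \<zero>\<^bsub>G\<^esub> = \<zero>\<^bsub>G'\<^esub>"
  proof -
    have "h \<zero>\<^bsub>G\<^esub> \<oplus>\<^bsub>G'\<^esub> h \<zero>\<^bsub>G\<^esub> = h \<zero>\<^bsub>G\<^esub>" using h_add[of "\<zero>\<^bsub>G\<^esub>" "\<zero>\<^bsub>G\<^esub>"] by simp
    then show ?thesis using h_closed[of "\<zero>\<^bsub>G\<^esub>"] by simp
  qed
  have "\<forall>v w. G'.cp (h x) (\<phi> v) = h (G.cp x v) \<and> (w \<notin> range \<phi> \<longrightarrow> G'.cp (h x) w = \<zero>\<^bsub>G'\<^esub>)"
  proof (rule G.hom_induct[OF x])
    fix u y assume y: "y \<in> D u"
    show "\<forall>v w. G'.cp (h y) (\<phi> v) = h (G.cp y v) \<and> (w \<notin> range \<phi> \<longrightarrow> G'.cp (h y) w = \<zero>\<^bsub>G'\<^esub>)"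
      unfolding G.cp_hom[OF y] G'.cp_hom[OF h_hom[OF y]] using inj h0 by (auto dest: injD)
  qed (auto simp: h_add h_closed G.cp_add G'.cp_add)
  then show "hom_comp G' D' (h x) (\<phi> v) = h (hom_comp G D x v)"
    and "w \<notin> range \<phi> \<Longrightarrow> hom_comp G' D' (h x) w = \<zero>\<^bsub>G'\<^esub>" by blast+
qed

lemma finsum_self_module [simp]: "finsum (self_module R) f Z = finsum R f Z"
  unfolding finsum_def finprod_def self_module_def by simp

lemma additive_subgroup_self_module [simp]: "additive_subgroup H (self_module R) \<longleftrightarrow> additive_subgroup H R"
proof -
  have "subgroup H (add_monoid (self_module R)) \<longleftrightarrow> subgroup H (add_monoid R)"
    unfolding subgroup_def m_inv_def self_module_def by simp
  then show ?thesis unfolding additive_subgroup_def .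
qed

lemma direct_sum_decomp_self_module [simp]:
  "direct_sum_decomp (self_module R) D \<longleftrightarrow> direct_sum_decomp R D"
  unfolding direct_sum_decomp_def by simp

lemma hom_comp_self_module [simp]: "hom_comp (self_module R) D = hom_comp R D"
  unfolding hom_comp_def by (simp add: fun_eq_iff)

section \<open>Additive closure and ascending chains\<close>

text \<open>Finite sums of elements of \<open>Z\<close>, as an inductive predicate, so that a claim
  about sums reduces to one about a single summand.\<close>

inductive add_closure :: "('b, 'k) ring_scheme \<Rightarrow> 'b set \<Rightarrow> 'b \<Rightarrow> bool" for G Z where
  zero: "add_closure G Z \<zero>\<^bsub>G\<^esub>"
| add: "add_closure G Z x \<Longrightarrow> z \<in> Z \<Longrightarrow> add_closure G Z (x \<oplus>\<^bsub>G\<^esub> z)"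

context abelian_group
begin

lemma add_closure_carrier: "add_closure G Z x \<Longrightarrow> Z \<subseteq> carrier G \<Longrightarrow> x \<in> carrier G"
  by (induction rule: add_closure.induct) auto

lemma add_closure_incl: "z \<in> Z \<Longrightarrow> Z \<subseteq> carrier G \<Longrightarrow> add_closure G Z z"
  using add_closure.add[OF add_closure.zero, of z Z G] by (simp add: subset_iff)

lemma add_closure_add:
  assumes Z: "Z \<subseteq> carrier G" and x: "add_closure G Z x" and y: "add_closure G Z y"
  shows "add_closure G Z (x \<oplus> y)"
  using y
proof (induction rule: add_closure.induct)
  case zero
  then show ?case using x add_closure_carrier[OF x Z] by simp
next
  case (add y z)
  have "x \<oplus> (y \<oplus> z) = (x \<oplus> y) \<oplus> z"
    using add_closure_carrier[OF x Z] add_closure_carrier[OF add(1) Z] add(2) Z by (simp add: a_assoc subset_iff)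
  then show ?case using add add_closure.add by metis
qed

lemma add_closure_least:
  assumes "add_closure G Z x" "\<zero> \<in> H" "\<And>x y. x \<in> H \<Longrightarrow> y \<in> H \<Longrightarrow> x \<oplus> y \<in> H" "Z \<subseteq> H"
  shows "x \<in> H"
  using assms(1) by induction (use assms in auto)

end

lemma add_closure_map:
  assumes "abelian_group G" "abelian_group G'" "add_closure G Z x" "Z \<subseteq> carrier G" "Z' \<subseteq> carrier G'"
    and "\<And>x. x \<in> carrier G \<Longrightarrow> h x \<in> carrier G'"
    and "\<And>x y. x \<in> carrier G \<Longrightarrow> y \<in> carrier G \<Longrightarrow> h (x \<oplus>\<^bsub>G\<^esub> y) = h x \<oplus>\<^bsub>G'\<^esub> h y"
    and Z': "\<And>z. z \<in> Z \<Longrightarrow> add_closure G' Z' (h z)"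
  shows "add_closure G' Z' (h x)"
proof -
  interpret G: abelian_group G by fact
  interpret G': abelian_group G' by fact
  have h0: "h \<zero>\<^bsub>G\<^esub> = \<zero>\<^bsub>G'\<^esub>"
    using assms(7)[of "\<zero>\<^bsub>G\<^esub>" "\<zero>\<^bsub>G\<^esub>"] assms(6)[of "\<zero>\<^bsub>G\<^esub>"] by simp
  show ?thesis using assms(3)
  proof induction
    case zero then show ?case using h0 add_closure.zero by metis
  next
    case (add y z)
    have "y \<in> carrier G" "z \<in> carrier G" using G.add_closure_carrier[OF add(1)] add(2) assms(4) by auto
    then show ?case using assms(7) G'.add_closure_add[OF assms(5) add(3) Z'[OF add(2)]] by simp
  qed
qed

section \<open>Ascending chains and the adjunction of finitely many scalars\<close>

context module
begin

lemma finite_rel_length_set_add: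
  assumes "submodule K R M" "submodule L R M"
    "rel_length R M {\<zero>\<^bsub>M\<^esub>} K \<noteq> \<infinity>" "rel_length R M {\<zero>\<^bsub>M\<^esub>} L \<noteq> \<infinity>"
  shows "rel_length R M {\<zero>\<^bsub>M\<^esub>} (K <+>\<^bsub>M\<^esub> L) \<noteq> \<infinity>"
proof -
  have s: "submodule (K <+>\<^bsub>M\<^esub> L) R M" using submodule_set_add assms by blast
  have "rel_length R M {\<zero>\<^bsub>M\<^esub>} (K <+>\<^bsub>M\<^esub> L) =
      rel_length R M {\<zero>\<^bsub>M\<^esub>} K + rel_length R M K (K <+>\<^bsub>M\<^esub> L)"
    using rel_length_add[OF submodule_zero assms(1) s] submodule_zero_mem[OF assms(1)] set_add_upper1[OF assms(1,2)] by auto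
  moreover have "rel_length R M K (K <+>\<^bsub>M\<^esub> L) = rel_length R M (K \<inter> L) L"
    using rel_length_inter_le[OF assms(1,2) carrier_is_submodule] submodule_subset assms by blast
  moreover have "rel_length R M (K \<inter> L) L \<le> rel_length R M {\<zero>\<^bsub>M\<^esub>} L"
    using submodule_zero_mem assms by (intro rel_length_mono) auto
  ultimately show ?thesis using assms(3,4) by (cases "rel_length R M (K \<inter> L) L") auto
qed

text \<open>The lengths of the \<open>H n\<close> are bounded natural numbers and so attain a
  maximum; from there on additivity leaves length 0 between consecutive members.\<close>

lemma acc_finite_length:
  assumes fin: "rel_length R M {\<zero>\<^bsub>M\<^esub>} Q \<noteq> \<infinity>"
    and H: "\<And>n. submodule (H n) R M" "\<And>n. H n \<subseteq> Q" "\<And>n. H n \<subseteq> H (Suc n)"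
  shows "\<exists>N::nat. \<forall>n\<ge>N. H n = H N"
proof -
  obtain q where q: "rel_length R M {\<zero>\<^bsub>M\<^esub>} Q = enat q" using fin by auto
  have z: "{\<zero>\<^bsub>M\<^esub>} \<subseteq> H n" for n using submodule_zero_mem[OF H(1)] by blast
  have le: "rel_length R M {\<zero>\<^bsub>M\<^esub>} (H n) \<le> enat q" for n
    using rel_length_mono[OF subset_refl H(2)[of n]] q by metis
  define g where "g n = the_enat (rel_length R M {\<zero>\<^bsub>M\<^esub>} (H n))" for n
  have g: "rel_length R M {\<zero>\<^bsub>M\<^esub>} (H n) = enat (g n)" for n
    unfolding g_def using le[of n] by (cases "rel_length R M {\<zero>\<^bsub>M\<^esub>} (H n)") auto
  have gq: "g n \<le> q" for n using le[of n] g[of n] by simp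
  have "finite (range g)" using gq by (meson atMost_iff finite_atMost finite_subset image_subsetI)
  then have "Max (range g) \<in> range g" by (intro Max_in) auto
  then obtain N where N: "g N = Max (range g)" by auto
  have mono: "H N \<subseteq> H n" if "N \<le> n" for n using that H(3) by (simp add: lift_Suc_mono_le)
  have "H n = H N" if n: "N \<le> n" for n
  proof -
    have "g n \<le> g N" unfolding N using \<open>finite (range g)\<close> by (intro Max_ge) auto
    moreover have "enat (g n) = enat (g N) + rel_length R M (H N) (H n)"
      using rel_length_add[OF submodule_zero H(1) H(1) z mono[OF n]] g by metis
    ultimately have "rel_length R M (H N) (H n) = 0"
      by (cases "rel_length R M (H N) (H n)") (auto simp: zero_enat_def)
    then show ?thesis using rel_length_zeroD[OF H(1) H(1) mono[OF n]] by simp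
  qed
  then show ?thesis by blast
qed

text \<open>Subgroups stable under a set \<open>E\<close> of scalars are submodules over the subring
  generated by \<open>E\<close>, without that subring being formed. Enlarging \<open>E\<close> by
  one scalar at a time then plays the role of passing from a ring to a polynomial ring over
  it.\<close>

definition stab :: "'a set \<Rightarrow> 'c set \<Rightarrow> bool" where
  "stab E H \<longleftrightarrow> H \<subseteq> carrier M \<and> \<zero>\<^bsub>M\<^esub> \<in> H \<and> (\<forall>x\<in>H. \<forall>y\<in>H. x \<oplus>\<^bsub>M\<^esub> y \<in> H) \<and>
     (\<forall>x\<in>H. \<ominus>\<^bsub>M\<^esub> x \<in> H) \<and> (\<forall>e\<in>E. \<forall>x\<in>H. e \<odot>\<^bsub>M\<^esub> x \<in> H)"

definition acc_stab :: "'a set \<Rightarrow> 'c set \<Rightarrow> bool" where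
  "acc_stab E V \<longleftrightarrow> (\<forall>H :: nat \<Rightarrow> 'c set. (\<forall>n. stab E (H n) \<and> H n \<subseteq> V \<and> H n \<subseteq> H (Suc n)) \<longrightarrow>
      (\<exists>N. \<forall>n\<ge>N. H n = H N))"

lemma stabD:
  assumes "stab E H"
  shows "H \<subseteq> carrier M" "\<zero>\<^bsub>M\<^esub> \<in> H" "\<And>x y. x \<in> H \<Longrightarrow> y \<in> H \<Longrightarrow> x \<oplus>\<^bsub>M\<^esub> y \<in> H"
    "\<And>x. x \<in> H \<Longrightarrow> \<ominus>\<^bsub>M\<^esub> x \<in> H" "\<And>e x. e \<in> E \<Longrightarrow> x \<in> H \<Longrightarrow> e \<odot>\<^bsub>M\<^esub> x \<in> H"
    "\<And>x y. x \<in> H \<Longrightarrow> y \<in> H \<Longrightarrow> x \<ominus>\<^bsub>M\<^esub> y \<in> H"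
  using assms unfolding stab_def a_minus_def by blast+

text \<open>The sums \<open>v_0 + b v_1 + ... + b^(n-1) v_(n-1)\<close> with all \<open>v_i\<close>
  in \<open>V\<close>: polynomial expressions in \<open>b\<close> of degree below \<open>n\<close>.
  Such an expression need not be unique.\<close>

primrec low :: "'a \<Rightarrow> 'c set \<Rightarrow> nat \<Rightarrow> 'c set" where
  "low b V 0 = {\<zero>\<^bsub>M\<^esub>}"
| "low b V (Suc n) = {x \<oplus>\<^bsub>M\<^esub> (b [^] n) \<odot>\<^bsub>M\<^esub> v | x v. x \<in> low b V n \<and> v \<in> V}"

lemma low_SucI: "x \<in> low b V n \<Longrightarrow> v \<in> V \<Longrightarrow> x \<oplus>\<^bsub>M\<^esub> (b [^] n) \<odot>\<^bsub>M\<^esub> v \<in> low b V (Suc n)"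
  by auto

lemma low_SucE:
  assumes "y \<in> low b V (Suc n)"
  obtains x v where "x \<in> low b V n" "v \<in> V" "y = x \<oplus>\<^bsub>M\<^esub> (b [^] n) \<odot>\<^bsub>M\<^esub> v"
  using assms by auto

context
  fixes E V b
  assumes E: "E \<subseteq> carrier R" and b: "b \<in> carrier R" and V: "stab E V"
begin

lemma stab_low: "stab E (low b V n)"
proof (induction n)
  case 0
  then show ?case using E by (auto simp: stab_def)
next
  case (Suc n)
  note L = stabD[OF Suc] and v = stabD[OF V]
  have bn: "b [^] n \<in> carrier R" using b by simp
  show ?case unfolding stab_def
  proof (intro conjI ballI)
    show "low b V (Suc n) \<subseteq> carrier M"
      using L(1) v(1) bn by (auto simp: subset_iff)
    show "\<zero>\<^bsub>M\<^esub> \<in> low b V (Suc n)" using low_SucI[OF L(2) v(2)] bn by simp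
  next
    fix x y assume "x \<in> low b V (Suc n)" "y \<in> low b V (Suc n)"
    then obtain x1 v1 x2 v2 where *: "x1 \<in> low b V n" "v1 \<in> V" "x = x1 \<oplus>\<^bsub>M\<^esub> (b [^] n) \<odot>\<^bsub>M\<^esub> v1"
      "x2 \<in> low b V n" "v2 \<in> V" "y = x2 \<oplus>\<^bsub>M\<^esub> (b [^] n) \<odot>\<^bsub>M\<^esub> v2" using low_SucE by metis
    have c: "x1 \<in> carrier M" "x2 \<in> carrier M" "v1 \<in> carrier M" "v2 \<in> carrier M" using * L(1) v(1) by auto
    have "x \<oplus>\<^bsub>M\<^esub> y = (x1 \<oplus>\<^bsub>M\<^esub> x2) \<oplus>\<^bsub>M\<^esub> (b [^] n) \<odot>\<^bsub>M\<^esub> (v1 \<oplus>\<^bsub>M\<^esub> v2)"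
      unfolding *(3,6) using c bn by (simp add: smult_r_distr M.add.m_ac)
    then show "x \<oplus>\<^bsub>M\<^esub> y \<in> low b V (Suc n)" using low_SucI[OF L(3)[OF *(1,4)] v(3)[OF *(2,5)]] by metis
  next
    fix x assume "x \<in> low b V (Suc n)"
    then obtain x1 v1 where *: "x1 \<in> low b V n" "v1 \<in> V" "x = x1 \<oplus>\<^bsub>M\<^esub> (b [^] n) \<odot>\<^bsub>M\<^esub> v1" using low_SucE by metis
    have c: "x1 \<in> carrier M" "v1 \<in> carrier M" using * L(1) v(1) by auto
    have "\<ominus>\<^bsub>M\<^esub> x = \<ominus>\<^bsub>M\<^esub> x1 \<oplus>\<^bsub>M\<^esub> (b [^] n) \<odot>\<^bsub>M\<^esub> (\<ominus>\<^bsub>M\<^esub> v1)"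
      unfolding *(3) using c bn by (simp add: smult_r_minus M.minus_add)
    then show "\<ominus>\<^bsub>M\<^esub> x \<in> low b V (Suc n)" using low_SucI[OF L(4)[OF *(1)] v(4)[OF *(2)]] by metis
  next
    fix e x assume e: "e \<in> E" "x \<in> low b V (Suc n)"
    then obtain x1 v1 where *: "x1 \<in> low b V n" "v1 \<in> V" "x = x1 \<oplus>\<^bsub>M\<^esub> (b [^] n) \<odot>\<^bsub>M\<^esub> v1" using low_SucE by metis
    have c: "x1 \<in> carrier M" "v1 \<in> carrier M" "e \<in> carrier R" using * L(1) v(1) e E by auto
    have "e \<odot>\<^bsub>M\<^esub> ((b [^] n) \<odot>\<^bsub>M\<^esub> v1) = (b [^] n) \<odot>\<^bsub>M\<^esub> (e \<odot>\<^bsub>M\<^esub> v1)"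
      using c bn smult_assoc1[of e "b [^] n" v1] smult_assoc1[of "b [^] n" e v1] R.m_comm[of e "b [^] n"] by simp
    then have "e \<odot>\<^bsub>M\<^esub> x = (e \<odot>\<^bsub>M\<^esub> x1) \<oplus>\<^bsub>M\<^esub> (b [^] n) \<odot>\<^bsub>M\<^esub> (e \<odot>\<^bsub>M\<^esub> v1)"
      unfolding *(3) using c bn by (simp add: smult_r_distr)
    then show "e \<odot>\<^bsub>M\<^esub> x \<in> low b V (Suc n)" using low_SucI[OF L(5)[OF e(1) *(1)] v(5)[OF e(1) *(2)]] by metis
  qed
qed

lemma low_carrier: "x \<in> low b V n \<Longrightarrow> x \<in> carrier M"
  using stabD(1)[OF stab_low] by blast

lemma low_Suc: "low b V n \<subseteq> low b V (Suc n)"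
proof
  fix x assume x: "x \<in> low b V n"
  have "x = x \<oplus>\<^bsub>M\<^esub> (b [^] n) \<odot>\<^bsub>M\<^esub> \<zero>\<^bsub>M\<^esub>" using low_carrier[OF x] b by simp
  then show "x \<in> low b V (Suc n)" using low_SucI[OF x stabD(2)[OF V]] by metis
qed

lemma low_mono: "m \<le> n \<Longrightarrow> low b V m \<subseteq> low b V n"
  using low_Suc by (rule lift_Suc_mono_le)

lemma b_low: "x \<in> low b V n \<Longrightarrow> b \<odot>\<^bsub>M\<^esub> x \<in> low b V (Suc n)"
proof (induction n arbitrary: x)
  case 0
  then have "b \<odot>\<^bsub>M\<^esub> x \<in> low b V 0" using b by simp
  then show ?case using low_Suc[of 0] by blast
next
  case (Suc n)
  obtain y v where *: "y \<in> low b V n" "v \<in> V" "x = y \<oplus>\<^bsub>M\<^esub> (b [^] n) \<odot>\<^bsub>M\<^esub> v"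
    using low_SucE[OF Suc.prems] by metis
  have c: "y \<in> carrier M" "v \<in> carrier M" "b [^] n \<in> carrier R" using * low_carrier stabD(1)[OF V] b by auto
  have "b \<odot>\<^bsub>M\<^esub> ((b [^] n) \<odot>\<^bsub>M\<^esub> v) = (b [^] (Suc n)) \<odot>\<^bsub>M\<^esub> v"
    using c b smult_assoc1[of b "b [^] n" v] R.m_comm[of b "b [^] n"] by simp
  then have "b \<odot>\<^bsub>M\<^esub> x = b \<odot>\<^bsub>M\<^esub> y \<oplus>\<^bsub>M\<^esub> (b [^] (Suc n)) \<odot>\<^bsub>M\<^esub> v"
    unfolding *(3) using c b by (simp add: smult_r_distr)
  then show ?case using low_SucI[OF Suc.IH[OF *(1)] *(2)] by metis
qed

lemma stab_Union_low: "stab (insert b E) (\<Union>n. low b V n)"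
  unfolding stab_def
proof (intro conjI ballI)
  show "(\<Union>n. low b V n) \<subseteq> carrier M" using low_carrier by blast
  show "\<zero>\<^bsub>M\<^esub> \<in> (\<Union>n. low b V n)" using stabD(2)[OF stab_low] by blast
next
  fix x y assume "x \<in> (\<Union>n. low b V n)" "y \<in> (\<Union>n. low b V n)"
  then obtain m n where "x \<in> low b V m" "y \<in> low b V n" by blast
  then have "x \<in> low b V (max m n)" "y \<in> low b V (max m n)" using low_mono max.cobounded1 max.cobounded2 by blast+
  then show "x \<oplus>\<^bsub>M\<^esub> y \<in> (\<Union>n. low b V n)" using stabD(3)[OF stab_low] by blast
next
  fix x assume "x \<in> (\<Union>n. low b V n)"
  then show "\<ominus>\<^bsub>M\<^esub> x \<in> (\<Union>n. low b V n)" using stabD(4)[OF stab_low] by blast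
next
  fix e x assume "e \<in> insert b E" "x \<in> (\<Union>n. low b V n)"
  then show "e \<odot>\<^bsub>M\<^esub> x \<in> (\<Union>n. low b V n)" using stabD(5)[OF stab_low] b_low by blast
qed

text \<open>Hilbert's basis argument: compare submodules through their sets of leading coefficients.\<close>

lemma acc_Union_low:
  assumes acc: "acc_stab E V" shows "acc_stab (insert b E) (\<Union>n. low b V n)"
  unfolding acc_stab_def
proof (intro allI impI)
  fix H :: "nat \<Rightarrow> 'c set"
  assume "\<forall>k. stab (insert b E) (H k) \<and> H k \<subseteq> (\<Union>n. low b V n) \<and> H k \<subseteq> H (Suc k)"
  then have H: "\<And>k. stab (insert b E) (H k)" "\<And>k. H k \<subseteq> (\<Union>n. low b V n)" "\<And>k. H k \<subseteq> H (Suc k)" by blast+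
  have Hm: "H k \<subseteq> H l" if "k \<le> l" for k l using that H(3) by (simp add: lift_Suc_mono_le)
  \<comment> \<open>Leading coefficients in degree \<open>n\<close> of the elements of
    \<open>H k\<close>. Since expressions are not unique, \<open>v\<close> counts as soon as some
    lower part completes it to an element of \<open>H k\<close>.\<close>
  define L where "L n k = {v \<in> V. \<exists>x\<in>low b V n. x \<oplus>\<^bsub>M\<^esub> (b [^] n) \<odot>\<^bsub>M\<^esub> v \<in> H k}" for n k
  have bn: "b [^] n \<in> carrier R" for n :: nat using b by simp
  note v = stabD[OF V]
  have Lstab: "stab E (L n k)" for n k
    unfolding stab_def
  proof (intro conjI ballI)
    note l = stabD[OF stab_low[of n]] and h = stabD[OF H(1)[of k]]
    show "L n k \<subseteq> carrier M" unfolding L_def using v(1) by blast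
    show "\<zero>\<^bsub>M\<^esub> \<in> L n k" unfolding L_def
      by (intro CollectI conjI v(2) bexI[of _ "\<zero>\<^bsub>M\<^esub>"] l(2)) (use h(2) bn in simp)
    fix x assume x: "x \<in> L n k"
    then obtain a where a: "x \<in> V" "a \<in> low b V n" "a \<oplus>\<^bsub>M\<^esub> (b [^] n) \<odot>\<^bsub>M\<^esub> x \<in> H k" unfolding L_def by blast
    have ca: "a \<in> carrier M" "x \<in> carrier M" using a v(1) low_carrier by blast+
    have "\<ominus>\<^bsub>M\<^esub> (a \<oplus>\<^bsub>M\<^esub> (b [^] n) \<odot>\<^bsub>M\<^esub> x) = \<ominus>\<^bsub>M\<^esub> a \<oplus>\<^bsub>M\<^esub> (b [^] n) \<odot>\<^bsub>M\<^esub> (\<ominus>\<^bsub>M\<^esub> x)"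
      using ca bn by (simp add: smult_r_minus M.minus_add)
    then show "\<ominus>\<^bsub>M\<^esub> x \<in> L n k" unfolding L_def
      using h(4)[OF a(3)] v(4)[OF a(1)] l(4)[OF a(2)] by (intro CollectI conjI bexI[of _ "\<ominus>\<^bsub>M\<^esub> a"]) simp_all
    {
      fix y assume y: "y \<in> L n k"
      then obtain c where c: "y \<in> V" "c \<in> low b V n" "c \<oplus>\<^bsub>M\<^esub> (b [^] n) \<odot>\<^bsub>M\<^esub> y \<in> H k" unfolding L_def by blast
      have cc: "c \<in> carrier M" "y \<in> carrier M" using c v(1) low_carrier by blast+
      have "(a \<oplus>\<^bsub>M\<^esub> (b [^] n) \<odot>\<^bsub>M\<^esub> x) \<oplus>\<^bsub>M\<^esub> (c \<oplus>\<^bsub>M\<^esub> (b [^] n) \<odot>\<^bsub>M\<^esub> y) =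
         (a \<oplus>\<^bsub>M\<^esub> c) \<oplus>\<^bsub>M\<^esub> (b [^] n) \<odot>\<^bsub>M\<^esub> (x \<oplus>\<^bsub>M\<^esub> y)"
        using ca cc bn by (simp add: smult_r_distr M.add.m_ac)
      then show "x \<oplus>\<^bsub>M\<^esub> y \<in> L n k" unfolding L_def
        using h(3)[OF a(3) c(3)] v(3)[OF a(1) c(1)] l(3)[OF a(2) c(2)]
        by (intro CollectI conjI bexI[of _ "a \<oplus>\<^bsub>M\<^esub> c"]) simp_all
    }
    {
      fix e assume e: "e \<in> E"
      then have ec: "e \<in> carrier R" using E by blast
      have "e \<odot>\<^bsub>M\<^esub> ((b [^] n) \<odot>\<^bsub>M\<^esub> x) = (b [^] n) \<odot>\<^bsub>M\<^esub> (e \<odot>\<^bsub>M\<^esub> x)"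
        using ca ec bn[of n] smult_assoc1[of e "b [^] n" x] smult_assoc1[of "b [^] n" e x] R.m_comm[of e "b [^] n"] by simp
      then have "e \<odot>\<^bsub>M\<^esub> (a \<oplus>\<^bsub>M\<^esub> (b [^] n) \<odot>\<^bsub>M\<^esub> x) = e \<odot>\<^bsub>M\<^esub> a \<oplus>\<^bsub>M\<^esub> (b [^] n) \<odot>\<^bsub>M\<^esub> (e \<odot>\<^bsub>M\<^esub> x)"
        using ca ec bn by (simp add: smult_r_distr)
      then show "e \<odot>\<^bsub>M\<^esub> x \<in> L n k" unfolding L_def
        using h(5)[OF insertI2[OF e] a(3)] v(5)[OF e a(1)] l(5)[OF e a(2)]
        by (intro CollectI conjI bexI[of _ "e \<odot>\<^bsub>M\<^esub> a"]) simp_all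
    }
  qed
  have Lk: "L n k \<subseteq> L n l" if "k \<le> l" for n k l unfolding L_def using Hm[OF that] by blast
  have LSuc: "L n k \<subseteq> L (Suc n) k" for n k
  proof
    fix x assume x: "x \<in> L n k"
    then obtain a where a: "x \<in> V" "a \<in> low b V n" "a \<oplus>\<^bsub>M\<^esub> (b [^] n) \<odot>\<^bsub>M\<^esub> x \<in> H k" unfolding L_def by blast
    have ca: "a \<in> carrier M" "x \<in> carrier M" using a v(1) low_carrier by blast+
    have "b \<odot>\<^bsub>M\<^esub> ((b [^] n) \<odot>\<^bsub>M\<^esub> x) = (b [^] (Suc n)) \<odot>\<^bsub>M\<^esub> x"
      using ca b bn[of n] smult_assoc1[of b "b [^] n" x] R.m_comm[of b "b [^] n"] by simp
    then have "b \<odot>\<^bsub>M\<^esub> (a \<oplus>\<^bsub>M\<^esub> (b [^] n) \<odot>\<^bsub>M\<^esub> x) = b \<odot>\<^bsub>M\<^esub> a \<oplus>\<^bsub>M\<^esub> (b [^] (Suc n)) \<odot>\<^bsub>M\<^esub> x"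
      using ca b bn by (simp add: smult_r_distr)
    then show "x \<in> L (Suc n) k" unfolding L_def
      using stabD(5)[OF H(1)[of k] insertI1 a(3)] a(1) b_low[OF a(2)]
      by (intro CollectI conjI bexI[of _ "b \<odot>\<^bsub>M\<^esub> a"]) simp_all
  qed
  have Ln: "L m k \<subseteq> L n k" if "m \<le> n" for m n k using that LSuc[of _ k] by (rule lift_Suc_mono_le[where f = "\<lambda>n. L n k", rotated])
  have LV: "L n k \<subseteq> V" for n k unfolding L_def by blast
  have stat: "\<exists>N. \<forall>k\<ge>N. F k = F N" if "\<And>k. stab E (F k)" "\<And>k. F k \<subseteq> V" "\<And>k. F k \<subseteq> F (Suc k)" for F :: "nat \<Rightarrow> 'c set"
    using acc that unfolding acc_stab_def by blast
  \<comment> \<open>\<open>L\<close> grows in both arguments. Stability of its diagonal settles all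
    degrees \<open>n \<ge> N\<close> at once, and the finitely many degrees below \<open>N\<close>
    become stable one by one.\<close>
  have "\<exists>N. \<forall>k\<ge>N. L k k = L N N"
    by (rule stat[of "\<lambda>k. L k k", OF Lstab LV]) (use Lk Ln in \<open>meson order_trans le_SucI order_refl\<close>)
  then obtain N where N: "\<And>k. N \<le> k \<Longrightarrow> L k k = L N N" by blast
  have "\<forall>n. \<exists>N. \<forall>k\<ge>N. L n k = L n N"
    by (intro allI stat[OF Lstab LV]) (use Lk in auto)
  then obtain f where f: "\<And>n k. f n \<le> k \<Longrightarrow> L n k = L n (f n)" by metis
  define N' where "N' = N + (\<Sum>n<N. f n)"
  have fN': "f n \<le> N'" if "n < N" for n unfolding N'_def using member_le_sum[of n "{..<N}" f] that by simp
  have eqL: "L n k = L n N'" if k: "N' \<le> k" for n k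
  proof (cases "n < N")
    case True
    then show ?thesis using f[of n k] f[of n N'] fN'[OF True] k by simp
  next
    case False
    have *: "L n l = L N N" if "N \<le> l" for l
    proof
      have "L n l \<subseteq> L (max n l) (max n l)" using Lk Ln by (meson max.cobounded1 max.cobounded2 order_trans)
      then show "L n l \<subseteq> L N N" using N[of "max n l"] that by simp
      have "L N N \<subseteq> L n N" "L n N \<subseteq> L n l" using Ln Lk False that by simp_all
      then show "L N N \<subseteq> L n l" by blast
    qed
    show ?thesis using *[of k] *[of N'] k unfolding N'_def by simp
  qed
  have "H k = H N'" if k: "N' \<le> k" for k
  proof
    show "H N' \<subseteq> H k" using Hm[OF k] .
    \<comment> \<open>Subtracting an element of \<open>H N'\<close> with the same leading
      coefficient lowers the degree and stays in \<open>H k\<close>, so the induction on the degree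
      applies to the difference.\<close>
    have "y \<in> H N'" if "y \<in> low b V n" "y \<in> H k" for n y
      using that
    proof (induction n arbitrary: y)
      case 0
      then show ?case using stabD(2)[OF H(1)] by simp
    next
      case (Suc n)
      obtain x w where *: "x \<in> low b V n" "w \<in> V" "y = x \<oplus>\<^bsub>M\<^esub> (b [^] n) \<odot>\<^bsub>M\<^esub> w"
        using low_SucE[OF Suc.prems(1)] by metis
      then have "w \<in> L n k" unfolding L_def using Suc.prems(2) by blast
      then have "w \<in> L n N'" using eqL[OF k] by simp
      then obtain x' where x': "x' \<in> low b V n" "x' \<oplus>\<^bsub>M\<^esub> (b [^] n) \<odot>\<^bsub>M\<^esub> w \<in> H N'" unfolding L_def by blast
      let ?z = "x' \<oplus>\<^bsub>M\<^esub> (b [^] n) \<odot>\<^bsub>M\<^esub> w"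
      have c: "x \<in> carrier M" "x' \<in> carrier M" "w \<in> carrier M" using * x' low_carrier v(1) by auto
      then have cb: "(b [^] n) \<odot>\<^bsub>M\<^esub> w \<in> carrier M" using bn by simp
      have "y \<ominus>\<^bsub>M\<^esub> ?z = x \<ominus>\<^bsub>M\<^esub> x'"
      proof -
        have "(x \<ominus>\<^bsub>M\<^esub> x') \<oplus>\<^bsub>M\<^esub> ?z = ((x \<ominus>\<^bsub>M\<^esub> x') \<oplus>\<^bsub>M\<^esub> x') \<oplus>\<^bsub>M\<^esub> (b [^] n) \<odot>\<^bsub>M\<^esub> w"
          using c cb by (simp add: M.a_assoc)
        also have "\<dots> = y" using M.add_minus_cancel(3)[OF c(1,2)] *(3) by simp
        finally show ?thesis using M.add_minus_cancel(2)[of "x \<ominus>\<^bsub>M\<^esub> x'" ?z] c cb by simp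
      qed
      moreover have "y \<ominus>\<^bsub>M\<^esub> ?z \<in> H k" using stabD(6)[OF H(1) Suc.prems(2)] x'(2) Hm[OF k] by blast
      moreover have "x \<ominus>\<^bsub>M\<^esub> x' \<in> low b V n" using stabD(6)[OF stab_low *(1) x'(1)] .
      ultimately have "y \<ominus>\<^bsub>M\<^esub> ?z \<in> H N'" using Suc.IH by simp
      then have "(y \<ominus>\<^bsub>M\<^esub> ?z) \<oplus>\<^bsub>M\<^esub> ?z \<in> H N'" using stabD(3)[OF H(1)] x'(2) by blast
      moreover have "y \<in> carrier M" using *(3) c cb by simp
      ultimately show ?case using M.add_minus_cancel(3)[of y ?z] c cb by simp
    qed
    then show "H k \<subseteq> H N'" using H(2)[of k] by blast
  qed
  then show "\<exists>N. \<forall>k\<ge>N. H k = H N" by blast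
qed

end

text \<open>Repeats the basis argument for each scalar of \<open>B\<close>; the resulting
  \<open>V'\<close> consists of the polynomial expressions in \<open>B\<close> with coefficients in
  \<open>V\<close>.\<close>

lemma acc_adjoin_finite:
  assumes "finite B" "B \<subseteq> carrier R" "E \<subseteq> carrier R" "stab E V" "acc_stab E V"
  shows "\<exists>V'. stab (E \<union> B) V' \<and> V \<subseteq> V' \<and> acc_stab (E \<union> B) V'"
  using assms(1,2)
proof (induction B)
  case empty then show ?case using assms by auto
next
  case (insert b B)
  then obtain V' where V': "stab (E \<union> B) V'" "V \<subseteq> V'" "acc_stab (E \<union> B) V'" by blast
  have EB: "E \<union> B \<subseteq> carrier R" and b: "b \<in> carrier R" using insert assms by blast+
  have "V' \<subseteq> (\<Union>n. low b V' n)"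
  proof
    fix x assume x: "x \<in> V'"
    have "\<zero>\<^bsub>M\<^esub> \<oplus>\<^bsub>M\<^esub> (b [^] (0::nat)) \<odot>\<^bsub>M\<^esub> x \<in> low b V' (Suc 0)" by (rule low_SucI) (use x in simp_all)
    moreover have "x \<in> carrier M" using x stabD(1)[OF V'(1)] by blast
    ultimately have "x \<in> low b V' (Suc 0)" by simp
    then show "x \<in> (\<Union>n. low b V' n)" by blast
  qed
  then show ?case using stab_Union_low[OF EB b V'(1)] acc_Union_low[OF EB b V'(1) V'(3)] V'(2)
    by (intro exI[of _ "\<Union>n. low b V' n"]) auto
qed

end

section \<open>Standard multigraded algebras\<close>

lemma fun_upd_plus_unit_deg: "0 < u i \<Longrightarrow> (\<lambda>j. (u(i := u i - 1)) j + unit_deg i j) = u"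
  by (auto simp: unit_deg_def fun_eq_iff)

locale graded_algebra = artinian_local A \<mm> for A :: "('a, 'k) ring_scheme" and \<mm> +
  fixes S :: "('a, 's, 'q) module_scheme" (structure) and Sg :: "('d::finite \<Rightarrow> nat) \<Rightarrow> 's set"
  assumes std: "standard_multigraded_algebra A S Sg"
begin

lemma alg: "algebra A S" using std unfolding standard_multigraded_algebra_def by blast

sublocale S: cring S using algebra.M_cring[OF alg] .
sublocale AS: module A S using algebra.module[OF alg] .
sublocale SG: graded_group S Sg
  by (unfold_locales) (use std in \<open>simp add: standard_multigraded_algebra_def\<close>)

abbreviation iota where "iota a \<equiv> a \<odot> \<one>"

lemma Sg_smult: "a \<in> carrier A \<Longrightarrow> s \<in> Sg u \<Longrightarrow> a \<odot> s \<in> Sg u"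
  using std unfolding standard_multigraded_algebra_def by blast

lemma Sg_mult: "s \<in> Sg u \<Longrightarrow> t \<in> Sg v \<Longrightarrow> s \<otimes> t \<in> Sg (\<lambda>i. u i + v i)"
  using std unfolding standard_multigraded_algebra_def by blast

lemma Sg_carrier: "s \<in> Sg u \<Longrightarrow> s \<in> carrier S" by (rule SG.D_carrier)

lemma iota_mult:
  assumes "a \<in> carrier A" "s \<in> carrier S" shows "iota a \<otimes> s = a \<odot> s"
  using algebra.smult_assoc2[OF alg assms(1) S.one_closed assms(2)] assms by simp

lemma iota_closed [simp]: "a \<in> carrier A \<Longrightarrow> iota a \<in> carrier S" by simp

lemma iota_add: "a \<in> carrier A \<Longrightarrow> b \<in> carrier A \<Longrightarrow> iota (a \<oplus>\<^bsub>A\<^esub> b) = iota a \<oplus> iota b"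
  by (simp add: AS.smult_l_distr)

lemma iota_prod: "a \<in> carrier A \<Longrightarrow> b \<in> carrier A \<Longrightarrow> iota (a \<otimes>\<^bsub>A\<^esub> b) = iota a \<otimes> iota b"
  by (simp add: AS.smult_assoc1 iota_mult)

lemma iota_zero: "iota \<zero>\<^bsub>A\<^esub> = \<zero>" by simp

lemma iota_neg: "a \<in> carrier A \<Longrightarrow> iota (\<ominus>\<^bsub>A\<^esub> a) = \<ominus> iota a" by (simp add: AS.smult_l_minus)

lemma iota_diff: "a \<in> carrier A \<Longrightarrow> b \<in> carrier A \<Longrightarrow> iota (a \<ominus>\<^bsub>A\<^esub> b) = iota a \<ominus> iota b"
  by (simp add: a_minus_def iota_add iota_neg)

lemma iota_pow: "a \<in> carrier A \<Longrightarrow> iota (a [^]\<^bsub>A\<^esub> (n::nat)) = iota a [^] n"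
  by (induction n) (simp_all add: iota_prod)

lemma inj_add_deg: "inj (\<lambda>u i. v i + (u i :: nat))"
  by (rule injI) (auto simp: fun_eq_iff)

lemma cp_mult_hom:
  assumes "s \<in> Sg v" "x \<in> carrier S"
  shows "SG.cp (s \<otimes> x) (\<lambda>i. v i + u i) = s \<otimes> SG.cp x u"
  by (rule hom_comp_map(1)[OF SG.graded_group_axioms SG.graded_group_axioms _ _ _ inj_add_deg assms(2), where h = "\<lambda>x. s \<otimes> x"])
    (use assms Sg_carrier Sg_mult S.r_distr in auto)

text \<open>Homogeneity of the unit is a consequence of the grading: its component \<open>e\<close>
  in degree zero satisfies \<open>s e = s\<close> for homogeneous \<open>s\<close>, hence for all
  \<open>s\<close>, so \<open>e\<close> is the unit.\<close>

lemma one_Sg: "\<one> \<in> Sg (\<lambda>_. 0)"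
proof -
  let ?e = "SG.cp \<one> (\<lambda>_. 0)"
  have e: "?e \<in> carrier S" by simp
  have hom: "s \<otimes> ?e = s" if s: "s \<in> Sg v" for s v
    using cp_mult_hom[OF s S.one_closed, of "\<lambda>_. 0"] SG.cp_self[OF s] Sg_carrier[OF s] by simp
  have "\<one> \<otimes> ?e = \<one>"
  proof (rule SG.hom_induct[where P = "\<lambda>x. x \<otimes> ?e = x", OF S.one_closed])
    show "y \<otimes> ?e = y" if "y \<in> Sg u" for u y using hom[OF that] .
    show "(x \<oplus> y) \<otimes> ?e = x \<oplus> y"
      if "x \<in> carrier S" "y \<in> carrier S" "x \<otimes> ?e = x" "y \<otimes> ?e = y" for x y
      using S.l_distr[OF that(1,2) e] that by simp
  qed
  then have "?e = \<one>" using e by simp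
  then show ?thesis using SG.cp_props(1)[OF S.one_closed] by metis
qed

lemma iota_Sg: "a \<in> carrier A \<Longrightarrow> iota a \<in> Sg (\<lambda>_. 0)"
  using Sg_smult[OF _ one_Sg] .

section \<open>Components of the algebra are spanned by monomials in the generators\<close>

definition gens :: "'s set" where
  "gens = (SOME B. finite B \<and> B \<subseteq> (\<Union>i. Sg (unit_deg i)) \<and>
        generate_ring S ((\<lambda>a. iota a) ` carrier A \<union> B) = carrier S)"

lemma gens_props: "finite gens" "gens \<subseteq> (\<Union>i. Sg (unit_deg i))"
  "generate_ring S ((\<lambda>a. iota a) ` carrier A \<union> gens) = carrier S"
proof -
  have "\<exists>B. finite B \<and> B \<subseteq> (\<Union>i. Sg (unit_deg i)) \<and>
        generate_ring S ((\<lambda>a. iota a) ` carrier A \<union> B) = carrier S"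
    using std unfolding standard_multigraded_algebra_def by blast
  from someI_ex[OF this] show "finite gens" "gens \<subseteq> (\<Union>i. Sg (unit_deg i))"
    "generate_ring S ((\<lambda>a. iota a) ` carrier A \<union> gens) = carrier S" unfolding gens_def by blast+
qed

lemma gens_carrier: "b \<in> gens \<Longrightarrow> b \<in> carrier S"
  using gens_props(2) Sg_carrier by blast

text \<open>The \<open>A\<close>-combinations of monomials of multidegree \<open>u\<close> in the
  generators. The direction \<open>i\<close> is part of the rule \<open>mult\<close> because a
  generator equal to zero lies in every component.\<close>

inductive mono_span :: "('d \<Rightarrow> nat) \<Rightarrow> 's \<Rightarrow> bool" where
  base: "a \<in> carrier A \<Longrightarrow> mono_span (\<lambda>_. 0) (iota a)"
| mult: "mono_span u s \<Longrightarrow> b \<in> gens \<Longrightarrow> b \<in> Sg (unit_deg i) \<Longrightarrow> mono_span (\<lambda>j. u j + unit_deg i j) (s \<otimes> b)"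
| add: "mono_span u s \<Longrightarrow> mono_span u t \<Longrightarrow> mono_span u (s \<oplus> t)"
| zero: "mono_span u \<zero>"

lemma mono_span_Sg: "mono_span u s \<Longrightarrow> s \<in> Sg u"
  by (induction rule: mono_span.induct) (auto intro: iota_Sg Sg_mult SG.D_add)

lemma mono_span_scal: "mono_span u s \<Longrightarrow> a \<in> carrier A \<Longrightarrow> mono_span u (iota a \<otimes> s)"
proof (induction rule: mono_span.induct)
  case (base a')
  then show ?case using mono_span.base[of "a \<otimes>\<^bsub>A\<^esub> a'"] by (simp add: iota_prod)
next
  case (mult u s b i)
  have "iota a \<otimes> (s \<otimes> b) = (iota a \<otimes> s) \<otimes> b"
    using mult Sg_carrier[OF mono_span_Sg[OF mult(1)]] gens_carrier by (simp add: S.m_assoc)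
  then show ?case using mono_span.mult[OF mult.IH[OF mult.prems] mult(2,3)] by simp
next
  case (add u s t)
  have "iota a \<otimes> (s \<oplus> t) = iota a \<otimes> s \<oplus> iota a \<otimes> t"
    using Sg_carrier[OF mono_span_Sg[OF add(1)]] Sg_carrier[OF mono_span_Sg[OF add(2)]] add by (intro S.r_distr) auto
  then show ?case using mono_span.add add by simp
next
  case (zero u)
  then show ?case using mono_span.zero by simp
qed

lemma mono_span_neg: "mono_span u s \<Longrightarrow> mono_span u (\<ominus> s)"
proof -
  assume s: "mono_span u s"
  have "iota (\<ominus>\<^bsub>A\<^esub> \<one>\<^bsub>A\<^esub>) \<otimes> s = \<ominus> s"
    using Sg_carrier[OF mono_span_Sg[OF s]] iota_neg[of "\<one>\<^bsub>A\<^esub>"] S.l_minus[of "\<one>" s] by simp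
  then show ?thesis using mono_span_scal[OF s, of "\<ominus>\<^bsub>A\<^esub> \<one>\<^bsub>A\<^esub>"] by simp
qed

lemma mono_span_mult: "mono_span v t \<Longrightarrow> mono_span u s \<Longrightarrow> mono_span (\<lambda>j. u j + v j) (s \<otimes> t)"
proof (induction rule: mono_span.induct)
  case (base a)
  then show ?case using mono_span_scal[OF base(2,1)] Sg_carrier[OF mono_span_Sg[OF base(2)]] S.m_comm[of "iota a" s] by simp
next
  case (mult v t b i)
  have c: "s \<in> carrier S" "t \<in> carrier S" "b \<in> carrier S"
    using Sg_carrier[OF mono_span_Sg[OF mult(1)]] Sg_carrier[OF mono_span_Sg[OF mult(5)]] gens_carrier[OF mult(2)] by auto
  have "mono_span (\<lambda>j. u j + v j + unit_deg i j) ((s \<otimes> t) \<otimes> b)"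
    using mono_span.mult[OF mult.IH[OF mult.prems] mult(2,3)] .
  then show ?case using S.m_assoc[OF c] by (simp add: add.assoc)
next
  case (add v t t')
  have "s \<otimes> (t \<oplus> t') = s \<otimes> t \<oplus> s \<otimes> t'"
    by (rule S.r_distr) (use add Sg_carrier mono_span_Sg in blast)+
  then show ?case using mono_span.add add by simp
next
  case (zero v)
  then show ?case using Sg_carrier[OF mono_span_Sg[OF zero]] mono_span.zero by simp
qed

text \<open>The invariant for the induction over the generation of \<open>S\<close> as a ring. It
  speaks of components because inhomogeneous elements occur in that induction.\<close>

definition comps_spanned :: "'s \<Rightarrow> bool" where
  "comps_spanned x \<longleftrightarrow> x \<in> carrier S \<and> (\<forall>u. mono_span u (SG.cp x u))"

lemma comps_spanned_add: "comps_spanned x \<Longrightarrow> comps_spanned y \<Longrightarrow> comps_spanned (x \<oplus> y)"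
  unfolding comps_spanned_def by (simp add: SG.cp_add mono_span.add)

lemma comps_spanned_hom: "mono_span u s \<Longrightarrow> comps_spanned s"
  unfolding comps_spanned_def using Sg_carrier[OF mono_span_Sg] SG.cp_hom[OF mono_span_Sg] mono_span.zero by simp

lemma comps_spanned_mult:
  assumes x: "comps_spanned x" and y: "comps_spanned y" shows "comps_spanned (x \<otimes> y)"
proof -
  have c: "x \<in> carrier S" "y \<in> carrier S" using assms unfolding comps_spanned_def by auto
  have z: "comps_spanned \<zero>" using comps_spanned_hom[OF mono_span.zero] .
  have 1: "comps_spanned (x \<otimes> t)" if t: "mono_span v t" for v t
  proof (rule SG.comp_induct[where P = "\<lambda>x. comps_spanned (x \<otimes> t)", OF c(1)])
    have tc: "t \<in> carrier S" using Sg_carrier[OF mono_span_Sg[OF t]] .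
    show "comps_spanned (\<zero> \<otimes> t)" using z tc by simp
    show "comps_spanned (SG.cp x u \<otimes> t)" for u
      using comps_spanned_hom[OF mono_span_mult[OF t, of u]] x unfolding comps_spanned_def by blast
    show "comps_spanned ((a \<oplus> b) \<otimes> t)"
      if "a \<in> carrier S" "b \<in> carrier S" "comps_spanned (a \<otimes> t)" "comps_spanned (b \<otimes> t)" for a b
      using S.l_distr[OF that(1,2) tc] comps_spanned_add[OF that(3,4)] by simp
  qed
  show ?thesis
  proof (rule SG.comp_induct[where P = "\<lambda>y. comps_spanned (x \<otimes> y)", OF c(2)])
    show "comps_spanned (x \<otimes> \<zero>)" using z c by simp
    show "comps_spanned (x \<otimes> SG.cp y u)" for u
      using 1 y unfolding comps_spanned_def by blast
    show "comps_spanned (x \<otimes> (a \<oplus> b))"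
      if "a \<in> carrier S" "b \<in> carrier S" "comps_spanned (x \<otimes> a)" "comps_spanned (x \<otimes> b)" for a b
      using S.r_distr[OF that(1,2) c(1)] comps_spanned_add[OF that(3,4)] by simp
  qed
qed

lemma mono_span_gen: "b \<in> gens \<Longrightarrow> b \<in> Sg (unit_deg i) \<Longrightarrow> mono_span (unit_deg i) b"
  using mono_span.mult[OF mono_span.base[OF one_closed], of b i] gens_carrier by simp

lemma all_comps_spanned:
  assumes "x \<in> carrier S" shows "comps_spanned x"
proof -
  have "x \<in> generate_ring S ((\<lambda>a. iota a) ` carrier A \<union> gens)" using assms gens_props(3) by simp
  then show ?thesis
  proof (induction rule: generate_ring.induct)
    case one
    then show ?case using comps_spanned_hom[OF mono_span.base[OF one_closed]] by simp
  next
    case (incl h)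
    then consider a where "a \<in> carrier A" "h = iota a" | i where "h \<in> gens" "h \<in> Sg (unit_deg i)"
      using gens_props(2) by blast
    then show ?case
      by cases (use comps_spanned_hom mono_span.base mono_span_gen in blast)+
  next
    case (a_inv h)
    then show ?case unfolding comps_spanned_def by (simp add: SG.cp_neg mono_span_neg)
  next
    case (eng_add h1 h2)
    then show ?case by (simp add: comps_spanned_add)
  next
    case (eng_mult h1 h2)
    then show ?case by (simp add: comps_spanned_mult)
  qed
qed

lemma Sg_mono_span: "s \<in> Sg u \<Longrightarrow> mono_span u s"
  using all_comps_spanned[OF Sg_carrier] SG.cp_self unfolding comps_spanned_def by metis

lemma Sg_zero_deg:
  assumes "s \<in> Sg (\<lambda>_. 0)" obtains a where "a \<in> carrier A" "s = iota a"
proof -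
  have "\<exists>a\<in>carrier A. s = iota a" if "mono_span u s" "u = (\<lambda>_. 0)" for u
    using that
  proof (induction rule: mono_span.induct)
    case (mult u s b i)
    then have "u i + unit_deg i i = 0" by metis
    then show ?case by (simp add: unit_deg_def)
  next
    case (add u s t)
    then obtain a b where "a \<in> carrier A" "s = iota a" "b \<in> carrier A" "t = iota b" by blast
    then show ?case using iota_add[of a b] a_closed[of a b] by metis
  next
    case (zero u)
    then show ?case using iota_zero by (metis zero_closed)
  qed blast
  then show thesis using Sg_mono_span[OF assms] that by blast
qed

definition gen_prods :: "'d \<Rightarrow> ('d \<Rightarrow> nat) \<Rightarrow> 's set" where
  "gen_prods i u = {t \<otimes> b | t b. t \<in> Sg (u(i := u i - 1)) \<and> b \<in> gens \<and> b \<in> Sg (unit_deg i)}"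

lemma gen_prods_carrier: "gen_prods i u \<subseteq> carrier S"
  unfolding gen_prods_def using Sg_carrier gens_carrier by auto

text \<open>A monomial whose degree is positive at \<open>i\<close> contains a generator of degree
  \<open>unit_deg i\<close>, which commutativity allows to move to the end.\<close>

lemma Sg_decomp:
  assumes "s \<in> Sg u" "0 < u i" shows "add_closure S (gen_prods i u) s"
  using Sg_mono_span[OF assms(1)] assms(2)
proof (induction rule: mono_span.induct)
  case (mult u s b j)
  have bc: "b \<in> carrier S" using gens_carrier[OF mult(2)] .
  let ?u = "\<lambda>k. u k + unit_deg j k"
  show ?case
  proof (cases "j = i")
    case True
    have "?u(i := ?u i - 1) = u" using True by (auto simp: unit_deg_def fun_eq_iff)
    then have "s \<otimes> b \<in> gen_prods i ?u" unfolding gen_prods_def using mult True mono_span_Sg by (metis (mono_tags, lifting) mem_Collect_eq)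
    then show ?thesis by (intro S.add_closure_incl gen_prods_carrier)
  next
    case False
    then have ui: "0 < u i" using mult.prems by (simp add: unit_deg_def)
    show ?thesis
    proof (rule add_closure_map[OF S.is_abelian_group S.is_abelian_group mult.IH[OF ui] gen_prods_carrier gen_prods_carrier, where h = "\<lambda>x. x \<otimes> b"])
      fix z assume "z \<in> gen_prods i u"
      then obtain t c where tc: "z = t \<otimes> c" "t \<in> Sg (u(i := u i - 1))" "c \<in> gens" "c \<in> Sg (unit_deg i)"
        unfolding gen_prods_def by blast
      have e: "(\<lambda>k. (u(i := u i - 1)) k + unit_deg j k) = ?u(i := ?u i - 1)"
        using False by (auto simp: unit_deg_def fun_eq_iff)
      have "t \<otimes> b \<in> Sg (?u(i := ?u i - 1))" using Sg_mult[OF tc(2) mult(3)] unfolding e .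
      moreover have "z \<otimes> b = (t \<otimes> b) \<otimes> c"
        unfolding tc(1) using Sg_carrier[OF tc(2)] gens_carrier[OF tc(3)] bc by (simp add: S.m_ac)
      ultimately have "z \<otimes> b \<in> gen_prods i ?u" unfolding gen_prods_def using tc by blast
      then show "add_closure S (gen_prods i ?u) (z \<otimes> b)" by (intro S.add_closure_incl gen_prods_carrier)
    qed (use bc S.l_distr in auto)
  qed
next
  case (add u s t)
  then show ?case using S.add_closure_add[OF gen_prods_carrier] by blast
qed (auto intro: add_closure.zero)

lemma Sg_in_ideal_if_gens_in_ideal:
  assumes I: "ideal I S" and g: "\<And>b. b \<in> Sg (unit_deg i) \<Longrightarrow> b \<in> I" and s: "s \<in> Sg u" "0 < u i"
  shows "s \<in> I"
proof (rule S.add_closure_least[OF Sg_decomp[OF s]])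
  show "gen_prods i u \<subseteq> I"
    unfolding gen_prods_def using g S.ideal_mult_mem[OF I] Sg_carrier by blast
qed (use S.ideal_zero_mem[OF I] S.ideal_add_mem[OF I] in auto)

lemma Sg_pow: "s \<in> Sg u \<Longrightarrow> s [^] (n::nat) \<in> Sg (\<lambda>i. n * u i)"
proof (induction n)
  case 0 then show ?case using one_Sg by simp
next
  case (Suc n)
  then show ?case using Sg_mult[of "s [^] n" "\<lambda>i. n * u i" s u] by (simp add: add.commute)
qed

lemma plus_plus_subset_iff:
  assumes "ideal I S"
  shows "plus_plus S Sg \<subseteq> I \<longleftrightarrow> (\<forall>u s. (\<forall>i. 0 < u i) \<longrightarrow> s \<in> Sg u \<longrightarrow> s \<in> I)"
proof
  assume h: "plus_plus S Sg \<subseteq> I"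
  show "\<forall>u s. (\<forall>i. 0 < u i) \<longrightarrow> s \<in> Sg u \<longrightarrow> s \<in> I"
  proof (intro allI impI)
    fix u :: "'d \<Rightarrow> nat" and s assume "\<forall>i. 0 < u i" "s \<in> Sg u"
    then have "s \<in> plus_plus S Sg" unfolding plus_plus_def by (intro SG.graded_sum_hom[of u]) auto
    then show "s \<in> I" using h by blast
  qed
next
  assume h: "\<forall>u s. (\<forall>i. 0 < u i) \<longrightarrow> s \<in> Sg u \<longrightarrow> s \<in> I"
  show "plus_plus S Sg \<subseteq> I"
  proof
    fix x assume "x \<in> plus_plus S Sg"
    then show "x \<in> I" unfolding plus_plus_def
    proof (rule SG.graded_sum_induct[where P = "\<lambda>x. x \<in> I"])
      show "\<zero> \<in> I" by (rule S.ideal_zero_mem[OF assms])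
      show "y \<in> I" if "u \<in> {u. \<forall>i. 0 < u i}" "y \<in> Sg u" for u y using h that by blast
      show "y \<oplus> z \<in> I" if "y \<in> I" "z \<in> I" for y z using S.ideal_add_mem[OF assms that] .
    qed
  qed
qed

text \<open>Avoidance of finitely many prime ideals by an \<open>A\<close>-submodule, using that a line
  \<open>w + a w'\<close> meets every prime not containing both points in at most one residue class of \<open>a\<close>.\<close>

lemma prime_avoidance:
  assumes inf: "infinite (carrier (A Quot \<mm>))" and fin: "finite \<P>"
    and W: "W \<subseteq> carrier S" "W \<noteq> {}" "\<And>x y. x \<in> W \<Longrightarrow> y \<in> W \<Longrightarrow> x \<oplus> y \<in> W"
      "\<And>a x. a \<in> carrier A \<Longrightarrow> x \<in> W \<Longrightarrow> iota a \<otimes> x \<in> W"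
    and P: "\<And>P. P \<in> \<P> \<Longrightarrow> primeideal P S" "\<And>P. P \<in> \<P> \<Longrightarrow> \<not> W \<subseteq> P"
  shows "\<exists>w\<in>W. \<forall>P\<in>\<P>. w \<notin> P"
  using fin P
proof (induction \<P>)
  case empty then show ?case using W(2) by blast
next
  case (insert Q \<P>)
  obtain w where w: "w \<in> W" "\<forall>P\<in>\<P>. w \<notin> P" using insert by blast
  obtain w' where w': "w' \<in> W" "w' \<notin> Q" using insert.prems(2)[of Q] by blast
  have c: "w \<in> carrier S" "w' \<in> carrier S" using w w' W(1) by auto
  define Z where "Z P = {a \<in> carrier A. w \<oplus> iota a \<otimes> w' \<in> P}" for P
  \<comment> \<open>If \<open>a - b\<close> were a unit, the difference of the two points on the
    line would put \<open>w'\<close> into \<open>P\<close>, and then also \<open>w\<close>. But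
    \<open>w'\<close> avoids \<open>Q\<close> and \<open>w\<close> avoids the remaining
    primes.\<close>
  have key: "a \<ominus>\<^bsub>A\<^esub> b \<in> \<mm>" if PI: "P \<in> insert Q \<P>" and ab: "a \<in> Z P" "b \<in> Z P" for P a b
  proof (rule ccontr)
    assume n: "a \<ominus>\<^bsub>A\<^esub> b \<notin> \<mm>"
    have abc: "a \<in> carrier A" "b \<in> carrier A" using ab unfolding Z_def by auto
    have Pp: "primeideal P S" using insert.prems(1) PI by blast
    have Pi: "ideal P S" using primeideal.axioms(1)[OF Pp] .
    obtain e where e: "e \<in> carrier A" "e \<otimes>\<^bsub>A\<^esub> (a \<ominus>\<^bsub>A\<^esub> b) = \<one>\<^bsub>A\<^esub>" using unit_if_notin_m[OF _ n] abc by auto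
    have ic: "iota a \<in> carrier S" "iota b \<in> carrier S" using abc by auto
    have "(w \<oplus> iota a \<otimes> w') \<ominus> (w \<oplus> iota b \<otimes> w') \<in> P"
      using S.ideal_diff_mem[OF Pi] ab unfolding Z_def by blast
    moreover have "(w \<oplus> iota a \<otimes> w') \<ominus> (w \<oplus> iota b \<otimes> w') = (iota a \<ominus> iota b) \<otimes> w'"
      using c ic by algebra
    ultimately have "iota (a \<ominus>\<^bsub>A\<^esub> b) \<otimes> w' \<in> P" using iota_diff[OF abc] by simp
    then have "iota e \<otimes> (iota (a \<ominus>\<^bsub>A\<^esub> b) \<otimes> w') \<in> P" using S.ideal_mult_mem[OF Pi] e by simp
    moreover have "iota e \<otimes> (iota (a \<ominus>\<^bsub>A\<^esub> b) \<otimes> w') = iota (e \<otimes>\<^bsub>A\<^esub> (a \<ominus>\<^bsub>A\<^esub> b)) \<otimes> w'"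
    proof -
      have "iota (e \<otimes>\<^bsub>A\<^esub> (a \<ominus>\<^bsub>A\<^esub> b)) = iota e \<otimes> iota (a \<ominus>\<^bsub>A\<^esub> b)"
        by (rule iota_prod) (use e abc in simp_all)
      moreover have "iota e \<otimes> (iota (a \<ominus>\<^bsub>A\<^esub> b) \<otimes> w') = (iota e \<otimes> iota (a \<ominus>\<^bsub>A\<^esub> b)) \<otimes> w'"
        by (rule S.m_assoc[symmetric]) (use e(1) abc c in simp_all)
      ultimately show ?thesis by (simp only:)
    qed
    ultimately have "iota (e \<otimes>\<^bsub>A\<^esub> (a \<ominus>\<^bsub>A\<^esub> b)) \<otimes> w' \<in> P" by (simp only:)
    then have w'P: "w' \<in> P" using e(2) c by simp
    then have "iota a \<otimes> w' \<in> P" using S.ideal_mult_mem[OF Pi] ic by blast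
    then have "(w \<oplus> iota a \<otimes> w') \<ominus> iota a \<otimes> w' \<in> P"
      using S.ideal_diff_mem[OF Pi] ab(1) unfolding Z_def by blast
    then have "w \<in> P" using S.add_minus_cancel(2)[of w "iota a \<otimes> w'"] c ic by simp
    then show False using w'P w(2) w'(2) PI by blast
  qed
  have "\<exists>a\<in>carrier A. \<forall>X'\<in>Z ` insert Q \<P>. a \<notin> X'"
    by (rule avoid_finitely_many_classes[OF inf]) (use insert.hyps key in auto)
  then obtain a where a: "a \<in> carrier A" "\<forall>P\<in>insert Q \<P>. a \<notin> Z P" by blast
  then have "w \<oplus> iota a \<otimes> w' \<in> W" "\<forall>P\<in>insert Q \<P>. w \<oplus> iota a \<otimes> w' \<notin> P"
    using W(3)[OF w(1) W(4)[OF a(1) w'(1)]] unfolding Z_def by blast+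
  then show ?case by blast
qed

end

section \<open>Finitely generated multigraded modules\<close>

lemma restrict_scalars_simps [simp]:
  "carrier (restrict_scalars S M) = carrier M" "x \<oplus>\<^bsub>restrict_scalars S M\<^esub> y = x \<oplus>\<^bsub>M\<^esub> y"
  "\<zero>\<^bsub>restrict_scalars S M\<^esub> = \<zero>\<^bsub>M\<^esub>" "a \<odot>\<^bsub>restrict_scalars S M\<^esub> x = (a \<odot>\<^bsub>S\<^esub> \<one>\<^bsub>S\<^esub>) \<odot>\<^bsub>M\<^esub> x"
  by (simp_all add: restrict_scalars_def)

lemma set_add_restrict_scalars [simp]: "K <+>\<^bsub>restrict_scalars S M\<^esub> L = K <+>\<^bsub>M\<^esub> L"
  unfolding set_add_def' by simp

locale graded_module = graded_algebra A \<mm> S Sg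
  for A :: "('a, 'k) ring_scheme" and \<mm> and S :: "('a, 's, 'q) module_scheme"
    and Sg :: "('d::finite \<Rightarrow> nat) \<Rightarrow> 's set" +
  fixes M :: "('s, 'm, 'r) module_scheme" (structure) and Mg :: "('d \<Rightarrow> nat) \<Rightarrow> 'm set"
  assumes fg: "fg_multigraded_module S Sg M Mg"
begin

sublocale SM: module S M
  using fg unfolding fg_multigraded_module_def finitely_generated_module_def by blast

sublocale MG: graded_group M Mg
  by unfold_locales (use fg in \<open>simp add: fg_multigraded_module_def\<close>)

lemma Mg_smult: "s \<in> Sg u \<Longrightarrow> m \<in> Mg v \<Longrightarrow> s \<odot> m \<in> Mg (\<lambda>i. u i + v i)"
  using fg unfolding fg_multigraded_module_def by blast

lemma Mg_carrier: "m \<in> Mg u \<Longrightarrow> m \<in> carrier M" by (rule MG.D_carrier)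

sublocale AM: module A "restrict_scalars S M"
proof (rule moduleI)
  show "abelian_group (restrict_scalars S M)"
  proof (rule abelian_groupI)
    fix x assume "x \<in> carrier (restrict_scalars S M)"
    then show "\<exists>y\<in>carrier (restrict_scalars S M). y \<oplus>\<^bsub>restrict_scalars S M\<^esub> x = \<zero>\<^bsub>restrict_scalars S M\<^esub>"
      by (intro bexI[of _ "\<ominus> x"]) (auto simp: SM.M.l_neg)
  qed (auto simp: SM.M.a_ac)
qed (auto simp: is_cring SM.smult_l_distr SM.smult_r_distr SM.smult_assoc1 iota_add iota_prod)

abbreviation Vm where "Vm \<equiv> restrict_scalars S M"
abbreviation len where "len \<equiv> rel_length A (restrict_scalars S M)"

lemma A_submodule_iff:
  "submodule H A Vm \<longleftrightarrow> H \<subseteq> carrier M \<and> \<zero> \<in> H \<and> (\<forall>x\<in>H. \<forall>y\<in>H. x \<oplus> y \<in> H) \<and>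
     (\<forall>a\<in>carrier A. \<forall>x\<in>H. iota a \<odot> x \<in> H)"
  unfolding AM.submodule_iff by simp

lemma A_submodule_if_S_submodule: "submodule H S M \<Longrightarrow> submodule H A Vm"
  unfolding A_submodule_iff SM.submodule_iff by auto

lemma A_submodule_Mg: "submodule (Mg n) A Vm"
  unfolding A_submodule_iff
  using Mg_carrier MG.D_zero MG.D_add Mg_smult[OF iota_Sg, of _ _ n] by auto

lemma cp_smult_hom:
  assumes "s \<in> Sg v" "x \<in> carrier M"
  shows "MG.cp (s \<odot> x) (\<lambda>i. v i + u i) = s \<odot> MG.cp x u"
    and "w \<notin> range (\<lambda>u i. v i + u i) \<Longrightarrow> MG.cp (s \<odot> x) w = \<zero>"
proof -
  note * = hom_comp_map[OF MG.graded_group_axioms MG.graded_group_axioms _ _ _ inj_add_deg assms(2), where h = "\<lambda>x. s \<odot> x"]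
  show "MG.cp (s \<odot> x) (\<lambda>i. v i + u i) = s \<odot> MG.cp x u"
    by (rule *(1)) (use assms Sg_carrier Mg_smult SM.smult_r_distr in auto)
  show "w \<notin> range (\<lambda>u i. v i + u i) \<Longrightarrow> MG.cp (s \<odot> x) w = \<zero>"
    by (rule *(2)) (use assms Sg_carrier Mg_smult SM.smult_r_distr in auto)
qed

definition graded_sub :: "'m set \<Rightarrow> bool" where
  "graded_sub K \<longleftrightarrow> submodule K S M \<and> (\<forall>m\<in>K. \<forall>u. MG.cp m u \<in> K)"

lemma graded_subD: "graded_sub K \<Longrightarrow> submodule K S M" "graded_sub K \<Longrightarrow> m \<in> K \<Longrightarrow> MG.cp m u \<in> K"
  unfolding graded_sub_def by auto

lemma graded_sub_zero: "graded_sub {\<zero>}"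
  unfolding graded_sub_def using SM.submodule_zero by simp

lemma graded_sub_carrier: "graded_sub (carrier M)"
  unfolding graded_sub_def using SM.carrier_is_submodule by simp

lemma graded_sub_set_add:
  assumes "graded_sub K" "graded_sub L" shows "graded_sub (K <+>\<^bsub>M\<^esub> L)"
  unfolding graded_sub_def
proof (intro conjI ballI allI)
  show "submodule (K <+>\<^bsub>M\<^esub> L) S M" using SM.submodule_set_add graded_subD(1) assms by blast
  fix m u assume "m \<in> K <+>\<^bsub>M\<^esub> L"
  then obtain k l where kl: "k \<in> K" "l \<in> L" "m = k \<oplus> l" unfolding SM.set_add_iff by blast
  have "k \<in> carrier M" "l \<in> carrier M" using kl SM.submodule_subset[OF graded_subD(1)[OF assms(1)]] SM.submodule_subset[OF graded_subD(1)[OF assms(2)]] by auto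
  then have "MG.cp m u = MG.cp k u \<oplus> MG.cp l u" using kl MG.cp_add by simp
  then show "MG.cp m u \<in> K <+>\<^bsub>M\<^esub> L" unfolding SM.set_add_iff using graded_subD(2) assms kl by blast
qed

subsection \<open>Noetherian properties\<close>

text \<open>The submodule \<open>A w\<close> is the image of \<open>A\<close> under
  \<open>a \<mapsto> a w\<close>, so its length is at most that of \<open>A\<close>.\<close>

lemma finite_length_cyclic:
  assumes "w \<in> carrier M"
  shows "\<exists>L. submodule L A Vm \<and> w \<in> L \<and> len {\<zero>} L \<noteq> \<infinity>"
proof -
  interpret f: module_map A "self_module A" Vm "\<lambda>a. iota a \<odot> w"
    by (intro module_map.intro module_self_module AM.module_axioms module_map_axioms.intro)
      (use assms in \<open>auto simp: iota_add iota_prod SM.smult_l_distr SM.smult_assoc1\<close>)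
  let ?L = "(\<lambda>a. iota a \<odot> w) ` carrier A"
  have c: "submodule (carrier A) A (self_module A)" using f.M1.carrier_is_submodule by simp
  have L: "submodule ?L A Vm" using f.submodule_image[OF c] .
  have z: "submodule {\<zero>} A Vm" using AM.submodule_zero by simp
  have "{\<zero>} <+>\<^bsub>M\<^esub> ?L = ?L"
    using AM.set_add_upper2[OF z L] AM.set_add_least[OF L _ subset_refl, of "{\<zero>}"] AM.submodule_zero_mem[OF L] by auto
  then have "rel_length A (self_module A) {x \<in> carrier A. iota x \<odot> w \<in> {\<zero>}} (carrier A) = len {\<zero>} ?L"
    using f.rel_length_preimage[OF c z] by simp
  moreover have "rel_length A (self_module A) {x \<in> carrier A. iota x \<odot> w \<in> {\<zero>}} (carrier A) \<le>
      rel_length A (self_module A) {\<zero>\<^bsub>A\<^esub>} (carrier A)"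
    using assms by (intro rel_length_mono) auto
  ultimately have "len {\<zero>} ?L \<noteq> \<infinity>" using finite_length by (metis enat_ord_simps(5))
  moreover have "w = iota \<one>\<^bsub>A\<^esub> \<odot> w" using assms by simp
  then have "w \<in> ?L" using one_closed by blast
  ultimately show ?thesis using L by blast
qed

lemma finite_length_set_add:
  assumes "submodule K A Vm" "submodule L A Vm" "len {\<zero>} K \<noteq> \<infinity>" "len {\<zero>} L \<noteq> \<infinity>"
  shows "len {\<zero>} (K <+>\<^bsub>M\<^esub> L) \<noteq> \<infinity>"
  using AM.finite_rel_length_set_add[OF assms(1,2)] assms(3,4) by simp

lemma A_submodule_set_add: "submodule K A Vm \<Longrightarrow> submodule L A Vm \<Longrightarrow> submodule (K <+>\<^bsub>M\<^esub> L) A Vm"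
  using AM.submodule_set_add by simp

lemma A_set_add_upper: "submodule K A Vm \<Longrightarrow> submodule L A Vm \<Longrightarrow> K \<subseteq> K <+>\<^bsub>M\<^esub> L"
  "submodule K A Vm \<Longrightarrow> submodule L A Vm \<Longrightarrow> L \<subseteq> K <+>\<^bsub>M\<^esub> L"
  using AM.set_add_upper1 AM.set_add_upper2 by simp_all

lemma finite_length_span:
  assumes "finite W" "W \<subseteq> carrier M"
  shows "\<exists>L. submodule L A Vm \<and> W \<subseteq> L \<and> len {\<zero>} L \<noteq> \<infinity>"
  using assms
proof (induction W)
  case empty
  then show ?case using AM.submodule_zero by (intro exI[of _ "{\<zero>}"]) (simp add: zero_enat_def)
next
  case (insert w W)
  then obtain L where L: "submodule L A Vm" "W \<subseteq> L" "len {\<zero>} L \<noteq> \<infinity>" by blast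
  obtain L' where L': "submodule L' A Vm" "w \<in> L'" "len {\<zero>} L' \<noteq> \<infinity>" using finite_length_cyclic insert by blast
  show ?case
    using A_submodule_set_add[OF L(1) L'(1)] finite_length_set_add[OF L(1) L'(1) L(3) L'(3)]
      A_set_add_upper[OF L(1) L'(1)] L(2) L'(2) by (intro exI[of _ "L <+>\<^bsub>M\<^esub> L'"]) blast
qed

lemma stab_iota_iff: "SM.stab (iota ` carrier A) H \<longleftrightarrow> submodule H A Vm"
proof
  assume "SM.stab (iota ` carrier A) H"
  then show "submodule H A Vm" unfolding A_submodule_iff SM.stab_def by blast
next
  assume h: "submodule H A Vm"
  have "\<ominus> x \<in> H" if x: "x \<in> H" for x
  proof -
    have "x \<in> carrier M" "iota (\<ominus>\<^bsub>A\<^esub> \<one>\<^bsub>A\<^esub>) \<odot> x \<in> H" using h x unfolding A_submodule_iff by auto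
    then show ?thesis using iota_neg[of "\<one>\<^bsub>A\<^esub>"] SM.smult_l_minus[of "\<one>\<^bsub>S\<^esub>" x] by simp
  qed
  then show "SM.stab (iota ` carrier A) H" using h unfolding A_submodule_iff SM.stab_def by blast
qed

text \<open>The module generators lie in an \<open>A\<close>-submodule of finite length, which
  satisfies the chain condition. Adjoining the algebra generators carries the condition over to a
  subgroup stable under all of \<open>S\<close>, and that subgroup is \<open>M\<close>.\<close>

theorem acc_submodules:
  fixes H :: "nat \<Rightarrow> 'm set"
  assumes H: "\<And>n. submodule (H n) S M" "\<And>n. H n \<subseteq> H (Suc n)"
  shows "\<exists>N. \<forall>n\<ge>N. H n = H N"
proof -
  obtain W where W: "finite W" "W \<subseteq> carrier M" "submodule_span S M W = carrier M"
    using fg unfolding fg_multigraded_module_def finitely_generated_module_def by blast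
  obtain V where V: "submodule V A Vm" "W \<subseteq> V" "len {\<zero>} V \<noteq> \<infinity>"
    using finite_length_span[OF W(1,2)] by blast
  let ?E = "iota ` carrier A"
  have E: "?E \<subseteq> carrier S" by auto
  have B: "gens \<subseteq> carrier S" using gens_carrier by blast
  have accV: "SM.acc_stab ?E V" unfolding SM.acc_stab_def stab_iota_iff
    using AM.acc_finite_length[of V] V(3) by simp
  obtain V' where V': "SM.stab (?E \<union> gens) V'" "V \<subseteq> V'" "SM.acc_stab (?E \<union> gens) V'"
    using SM.acc_adjoin_finite[OF gens_props(1) B E _ accV] V(1) stab_iota_iff by blast
  note v = SM.stabD[OF V'(1)]
  have sm: "\<forall>x\<in>V'. s \<odot> x \<in> V'" if s: "s \<in> carrier S" for s
  proof -
    have "s \<in> generate_ring S (?E \<union> gens)" using s gens_props(3) by simp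
    moreover have "t \<in> carrier S \<and> (\<forall>x\<in>V'. t \<odot> x \<in> V')" if "t \<in> generate_ring S (?E \<union> gens)" for t
      using that
    proof (induction rule: generate_ring.induct)
      case one
      have "\<one>\<^bsub>S\<^esub> \<odot> x = x" if "x \<in> V'" for x using that v(1) by (intro SM.smult_one) blast
      then show ?case by simp
    next
      case (incl h) then show ?case using v(5) E B by blast
    next
      case (a_inv h)
      have "(\<ominus>\<^bsub>S\<^esub> h) \<odot> x = \<ominus> (h \<odot> x)" if "x \<in> V'" for x
        using that v(1) a_inv by (intro SM.smult_l_minus) blast+
      then show ?case using v(4) a_inv by simp
    next
      case (eng_add h1 h2)
      have "(h1 \<oplus>\<^bsub>S\<^esub> h2) \<odot> x = h1 \<odot> x \<oplus> h2 \<odot> x" if "x \<in> V'" for x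
        using that v(1) eng_add by (intro SM.smult_l_distr) blast+
      then show ?case using v(3) eng_add by simp
    next
      case (eng_mult h1 h2)
      have "(h1 \<otimes>\<^bsub>S\<^esub> h2) \<odot> x = h1 \<odot> (h2 \<odot> x)" if "x \<in> V'" for x
        using that v(1) eng_mult by (intro SM.smult_assoc1) blast+
      then show ?case using eng_mult by simp
    qed
    ultimately show ?thesis by blast
  qed
  have "submodule V' S M" unfolding SM.submodule_iff
  proof (intro conjI ballI)
    show "V' \<subseteq> carrier M" by (rule v(1))
    show "\<zero> \<in> V'" by (rule v(2))
    show "x \<oplus> y \<in> V'" if "x \<in> V'" "y \<in> V'" for x y using v(3)[OF that] .
    show "s \<odot> x \<in> V'" if "s \<in> carrier S" "x \<in> V'" for s x using sm that by blast
  qed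
  then have cV: "carrier M \<subseteq> V'" using W(3) V(2) V'(2) unfolding submodule_span_def by blast
  have st: "SM.stab (?E \<union> gens) (H n)" for n
    unfolding SM.stab_def
  proof (intro conjI ballI)
    show "H n \<subseteq> carrier M" using SM.submodule_subset[OF H(1)] .
    show "\<zero> \<in> H n" using SM.submodule_zero_mem[OF H(1)] .
    show "x \<oplus> y \<in> H n" if "x \<in> H n" "y \<in> H n" for x y using SM.submodule_add_mem[OF H(1) that] .
    show "\<ominus> x \<in> H n" if "x \<in> H n" for x using SM.submodule_neg_mem[OF H(1) that] .
    show "e \<odot> x \<in> H n" if "e \<in> ?E \<union> gens" "x \<in> H n" for e x
      using SM.submodule_smult_mem[OF H(1) _ that(2)] that(1) E B by blast
  qed
  have HV: "H n \<subseteq> V'" for n using SM.submodule_subset[OF H(1)] cV by blast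
  have "\<forall>n. SM.stab (?E \<union> gens) (H n) \<and> H n \<subseteq> V' \<and> H n \<subseteq> H (Suc n)" by (intro allI conjI st HV H(2))
  then show ?thesis using V'(3)[unfolded SM.acc_stab_def, THEN spec, of H] by (rule rev_mp)
qed

text \<open>Noetherian induction in the form used below: a maximal counterexample, or a maximal
  submodule with a good property.\<close>

theorem exists_maximal_submodule:
  assumes ne: "Y \<noteq> {}" and Y: "\<And>K. K \<in> Y \<Longrightarrow> submodule K S M"
  shows "\<exists>K\<in>Y. \<forall>K'\<in>Y. K \<subseteq> K' \<longrightarrow> K' = K"
proof (rule ccontr)
  assume "\<not> ?thesis"
  then have "\<forall>K\<in>Y. \<exists>K'\<in>Y. K \<subset> K'" by blast
  then obtain g where g: "\<And>K. K \<in> Y \<Longrightarrow> g K \<in> Y \<and> K \<subset> g K" by metis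
  obtain K0 where K0: "K0 \<in> Y" using ne by blast
  define H where "H n = (g ^^ n) K0" for n
  have HY: "H n \<in> Y" for n by (induction n) (simp_all add: H_def K0 g)
  have "H n \<subset> H (Suc n)" for n using g[OF HY[of n]] by (simp add: H_def)
  note lt = this
  have "\<exists>N. \<forall>n\<ge>N. H n = H N"
    by (rule acc_submodules) (use Y[OF HY] lt in auto)
  then obtain N where "\<forall>n\<ge>N. H n = H N" by blast
  then have "H (Suc N) = H N" using le_SucI by blast
  then show False using lt[of N] by blast
qed

end

context graded_algebra
begin

text \<open>Every result about modules becomes available for \<open>S\<close> itself, in particular
  the chain condition for ideals and the finite length of the components.\<close>

lemma graded_module_self: "graded_module A \<mm> S Sg (self_module S) Sg"
proof (unfold_locales)
  have span: "submodule_span S (self_module S) {\<one>} = carrier (self_module S)"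
  proof
    show "submodule_span S (self_module S) {\<one>} \<subseteq> carrier (self_module S)"
      unfolding submodule_span_def using S.submodule_self_iff S.oneideal by auto
    show "carrier (self_module S) \<subseteq> submodule_span S (self_module S) {\<one>}"
      unfolding submodule_span_def S.submodule_self_iff using ideal.one_imp_carrier by fastforce
  qed
  show "fg_multigraded_module S Sg (self_module S) Sg"
    unfolding fg_multigraded_module_def finitely_generated_module_def
    using S.module_self_module span SG.decomp Sg_mult by (auto intro!: exI[of _ "{\<one>}"])
qed

lemma exists_maximal_ideal_in_family:
  assumes "Y \<noteq> {}" "\<And>I. I \<in> Y \<Longrightarrow> ideal I S"
  shows "\<exists>I\<in>Y. \<forall>J\<in>Y. I \<subseteq> J \<longrightarrow> J = I"
  using graded_module.exists_maximal_submodule[OF graded_module_self assms(1)] assms(2)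
  by (simp add: S.submodule_self_iff)

end

section \<open>Colon ideals, and factorisation of homogeneous scalars\<close>

context module
begin

lemma smult_commute:
  assumes "s \<in> carrier R" "t \<in> carrier R" "m \<in> carrier M"
  shows "s \<odot>\<^bsub>M\<^esub> (t \<odot>\<^bsub>M\<^esub> m) = t \<odot>\<^bsub>M\<^esub> (s \<odot>\<^bsub>M\<^esub> m)"
  using smult_assoc1[OF assms] smult_assoc1[OF assms(2,1,3)] R.m_comm[OF assms(1,2)] by simp

lemma submodule_add_closure:
  assumes Z: "Z \<subseteq> carrier M" and sm: "\<And>s z. s \<in> carrier R \<Longrightarrow> z \<in> Z \<Longrightarrow> s \<odot>\<^bsub>M\<^esub> z \<in> Z"
  shows "submodule {x. add_closure M Z x} R M"
  unfolding submodule_iff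
proof (intro conjI ballI)
  show "{x. add_closure M Z x} \<subseteq> carrier M" using M.add_closure_carrier[OF _ Z] by blast
  show "\<zero>\<^bsub>M\<^esub> \<in> {x. add_closure M Z x}" using add_closure.zero by blast
  show "a \<oplus>\<^bsub>M\<^esub> b \<in> {x. add_closure M Z x}" if "a \<in> {x. add_closure M Z x}" "b \<in> {x. add_closure M Z x}" for a b
    using M.add_closure_add[OF Z] that by blast
  show "s \<odot>\<^bsub>M\<^esub> x \<in> {x. add_closure M Z x}" if s: "s \<in> carrier R" and x: "x \<in> {x. add_closure M Z x}" for s x
  proof -
    have "add_closure M Z x" using x by blast
    then have "add_closure M Z (s \<odot>\<^bsub>M\<^esub> x)"
      by (rule add_closure_map[OF M.abelian_group_axioms M.abelian_group_axioms _ Z Z, where h = "\<lambda>x. s \<odot>\<^bsub>M\<^esub> x"])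
        (use s sm M.add_closure_incl[OF _ Z] smult_r_distr in auto)
    then show ?thesis by blast
  qed
qed

definition colon :: "'c set \<Rightarrow> 'c \<Rightarrow> 'a set" where
  "colon K m = {s \<in> carrier R. s \<odot>\<^bsub>M\<^esub> m \<in> K}"

lemma ideal_colon:
  assumes K: "submodule K R M" and m: "m \<in> carrier M" shows "ideal (colon K m) R"
  unfolding R.ideal_iff colon_def
  using m submodule_zero_mem[OF K] submodule_add_mem[OF K] submodule_smult_mem[OF K]
  by (auto simp: smult_l_distr smult_assoc1)

text \<open>A colon ideal maximal in a family closed under scalar multiples is prime, because
  passing from \<open>m\<close> to \<open>b m\<close> can only enlarge it. The second clause records
  that it does not change at all as long as \<open>b m\<close> stays outside \<open>K\<close>.
  Existence of maximal elements is an assumption since the ring is arbitrary here.\<close>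

lemma exists_prime_colon:
  assumes K: "submodule K R M" and F: "F \<subseteq> carrier M - K" "F \<noteq> {}"
    and cl: "\<And>m b. m \<in> F \<Longrightarrow> b \<in> carrier R \<Longrightarrow> b \<odot>\<^bsub>M\<^esub> m \<notin> K \<Longrightarrow> b \<odot>\<^bsub>M\<^esub> m \<in> F"
    and max: "\<And>Y. Y \<noteq> {} \<Longrightarrow> (\<And>I. I \<in> Y \<Longrightarrow> ideal I R) \<Longrightarrow> \<exists>I\<in>Y. \<forall>J\<in>Y. I \<subseteq> J \<longrightarrow> J = I"
  shows "\<exists>m\<in>F. primeideal (colon K m) R \<and> (\<forall>b\<in>carrier R. b \<odot>\<^bsub>M\<^esub> m \<notin> K \<longrightarrow> colon K (b \<odot>\<^bsub>M\<^esub> m) = colon K m)"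
proof -
  have "\<exists>I\<in>colon K ` F. \<forall>J\<in>colon K ` F. I \<subseteq> J \<longrightarrow> J = I"
    by (rule max) (use F ideal_colon[OF K] in auto)
  then obtain m where m: "m \<in> F" "\<And>m'. m' \<in> F \<Longrightarrow> colon K m \<subseteq> colon K m' \<Longrightarrow> colon K m' = colon K m" by blast
  have mc: "m \<in> carrier M" "m \<notin> K" using m(1) F by auto
  have eq: "colon K (b \<odot>\<^bsub>M\<^esub> m) = colon K m" if b: "b \<in> carrier R" "b \<odot>\<^bsub>M\<^esub> m \<notin> K" for b
  proof (rule m(2)[OF cl[OF m(1) b]])
    show "colon K m \<subseteq> colon K (b \<odot>\<^bsub>M\<^esub> m)"
    proof
      fix s assume s: "s \<in> colon K m"
      then have sc: "s \<in> carrier R" "s \<odot>\<^bsub>M\<^esub> m \<in> K" unfolding colon_def by auto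
      have "s \<odot>\<^bsub>M\<^esub> (b \<odot>\<^bsub>M\<^esub> m) = b \<odot>\<^bsub>M\<^esub> (s \<odot>\<^bsub>M\<^esub> m)"
        using sc b mc smult_assoc1[of s b m] smult_assoc1[of b s m] R.m_comm[of s b] by simp
      then show "s \<in> colon K (b \<odot>\<^bsub>M\<^esub> m)" unfolding colon_def using sc submodule_smult_mem[OF K b(1) sc(2)] by simp
    qed
  qed
  have "primeideal (colon K m) R"
  proof (rule primeidealI[OF ideal_colon[OF K mc(1)] R.is_cring])
    show "carrier R \<noteq> colon K m" using mc unfolding colon_def by (metis (no_types, lifting) R.one_closed mem_Collect_eq smult_one)
    fix a b assume ab: "a \<in> carrier R" "b \<in> carrier R" "a \<otimes> b \<in> colon K m"
    show "a \<in> colon K m \<or> b \<in> colon K m"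
    proof (cases "b \<in> colon K m")
      case False
      then have n: "b \<odot>\<^bsub>M\<^esub> m \<notin> K" using ab unfolding colon_def by blast
      have "a \<in> colon K (b \<odot>\<^bsub>M\<^esub> m)" using ab mc unfolding colon_def by (simp add: smult_assoc1)
      then show ?thesis using eq[OF ab(2) n] by blast
    qed simp
  qed
  then show ?thesis using m(1) eq by blast
qed

end

context graded_algebra
begin

text \<open>Induction on the total degree of \<open>v\<close>: \<open>Sg_decomp\<close> splits off
  one generator, which is then absorbed into the second factor.\<close>

lemma Sg_add_decomp:
  assumes "s \<in> Sg (\<lambda>i. u i + v i)"
  shows "add_closure S {t \<otimes> t' | t t'. t \<in> Sg u \<and> t' \<in> Sg v} s"
  using assms
proof (induction "\<Sum>i\<in>UNIV. v i" arbitrary: v s)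
  case 0
  then have "v = (\<lambda>_. 0)" by (simp add: fun_eq_iff)
  then have "s \<in> Sg u" "\<one> \<in> Sg v" using 0 one_Sg by auto
  moreover have "s = s \<otimes> \<one>" using Sg_carrier[OF \<open>s \<in> Sg u\<close>] by simp
  ultimately have "s \<in> {t \<otimes> t' | t t'. t \<in> Sg u \<and> t' \<in> Sg v}" by blast
  then show ?case by (rule S.add_closure_incl) (use Sg_carrier in auto)
next
  case (Suc m)
  obtain i where i: "0 < v i" using Suc(2) by (metis gr0I nat.simps(3) sum.neutral)
  let ?v = "v(i := v i - 1)"
  have "(\<Sum>j\<in>UNIV. v j) = v i + (\<Sum>j\<in>UNIV-{i}. v j)" by (subst sum.remove[of UNIV i]) auto
  moreover have "(\<Sum>j\<in>UNIV. ?v j) = (v i - 1) + (\<Sum>j\<in>UNIV-{i}. v j)" by (subst sum.remove[of UNIV i]) auto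
  ultimately have m: "m = (\<Sum>j\<in>UNIV. ?v j)" using Suc(2) i by linarith
  let ?w = "\<lambda>i. u i + v i"
  let ?Z = "{t \<otimes> t' | t t'. t \<in> Sg u \<and> t' \<in> Sg v}"
  have Z: "?Z \<subseteq> carrier S" using Sg_carrier by auto
  have "add_closure S (gen_prods i ?w) s" using Sg_decomp[OF Suc.prems] i by simp
  then show ?case
  proof (rule add_closure_map[OF S.is_abelian_group S.is_abelian_group _ gen_prods_carrier Z, where h = "\<lambda>x. x"])
    fix z assume "z \<in> gen_prods i ?w"
    then obtain t b where tb: "z = t \<otimes> b" "t \<in> Sg (?w(i := ?w i - 1))" "b \<in> gens" "b \<in> Sg (unit_deg i)"
      unfolding gen_prods_def by blast
    have "?w(i := ?w i - 1) = (\<lambda>j. u j + ?v j)" using i by (auto simp: fun_eq_iff)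
    then have t: "t \<in> Sg (\<lambda>j. u j + ?v j)" using tb(2) by simp
    have bc: "b \<in> carrier S" using gens_carrier tb(3) by blast
    show "add_closure S ?Z z" unfolding tb(1)
    proof (rule add_closure_map[OF S.is_abelian_group S.is_abelian_group Suc(1)[OF m t] _ Z, where h = "\<lambda>x. x \<otimes> b"])
      fix y assume "y \<in> {t \<otimes> t' | t t'. t \<in> Sg u \<and> t' \<in> Sg ?v}"
      then obtain p q where pq: "y = p \<otimes> q" "p \<in> Sg u" "q \<in> Sg ?v" by blast
      have "q \<otimes> b \<in> Sg v" using Sg_mult[OF pq(3) tb(4)] unfolding fun_upd_plus_unit_deg[of v i, OF i] .
      moreover have "y \<otimes> b = p \<otimes> (q \<otimes> b)" unfolding pq(1) using Sg_carrier pq bc by (simp add: S.m_assoc)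
      ultimately have "y \<otimes> b \<in> ?Z" using pq(2) by blast
      then show "add_closure S ?Z (y \<otimes> b)" by (rule S.add_closure_incl[OF _ Z])
    qed (use Sg_carrier bc S.l_distr in auto)
  qed auto
qed

lemma Sg_in_ideal_if_summand:
  assumes I: "ideal I S" and v: "\<And>t. t \<in> Sg v \<Longrightarrow> t \<in> I" and s: "s \<in> Sg u" and le: "\<And>i. v i \<le> u i"
  shows "s \<in> I"
proof (rule S.add_closure_least)
  have "(\<lambda>i. (u i - v i) + v i) = u" using le by simp
  then show "add_closure S {t \<otimes> t' | t t'. t \<in> Sg (\<lambda>i. u i - v i) \<and> t' \<in> Sg v} s"
    using Sg_add_decomp[of s "\<lambda>i. u i - v i" v] s by simp
  show "{t \<otimes> t' | t t'. t \<in> Sg (\<lambda>i. u i - v i) \<and> t' \<in> Sg v} \<subseteq> I"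
    using v S.ideal_mult_mem[OF I] Sg_carrier by blast
qed (use S.ideal_zero_mem[OF I] S.ideal_add_mem[OF I] in auto)

lemma plus_plus_subset_if_diag:
  assumes I: "ideal I S" and d: "Sg (diag_deg 1) \<subseteq> I"
  shows "plus_plus S Sg \<subseteq> I"
  unfolding plus_plus_subset_iff[OF I]
proof (intro allI impI)
  fix u :: "'d \<Rightarrow> nat" and s assume u: "\<forall>i. 0 < u i" and s: "s \<in> Sg u"
  show "s \<in> I" by (rule Sg_in_ideal_if_summand[OF I _ s, of "diag_deg 1"]) (use d u in \<open>auto simp: diag_deg_def Suc_le_eq\<close>)
qed

end

section \<open>Finite length of components, and generation in bounded degrees\<close>

context graded_module
begin

lemma cp_smult_right:
  assumes "m \<in> Mg v" "s \<in> carrier S"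
  shows "MG.cp (s \<odot> m) (\<lambda>i. v i + u i) = SG.cp s u \<odot> m"
    and "w \<notin> range (\<lambda>u i. v i + u i) \<Longrightarrow> MG.cp (s \<odot> m) w = \<zero>"
proof -
  have c: "m \<in> carrier M" using Mg_carrier assms by blast
  have h: "x \<odot> m \<in> Mg (\<lambda>i. v i + u i)" if "x \<in> Sg u" for u x
    using Mg_smult[OF that assms(1)] by (simp add: add.commute)
  note * = hom_comp_map[OF SG.graded_group_axioms MG.graded_group_axioms _ _ _ inj_add_deg assms(2), where h = "\<lambda>x. x \<odot> m"]
  show "MG.cp (s \<odot> m) (\<lambda>i. v i + u i) = SG.cp s u \<odot> m"
    by (rule *(1)) (use c h SM.smult_l_distr in auto)
  show "w \<notin> range (\<lambda>u i. v i + u i) \<Longrightarrow> MG.cp (s \<odot> m) w = \<zero>"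
    by (rule *(2)) (use c h SM.smult_l_distr in auto)
qed

text \<open>For an \<open>A\<close>-submodule \<open>V\<close> of \<open>Mg n\<close>, the
  \<open>S\<close>-submodule \<open>G V\<close> generated by \<open>V\<close> recovers
  \<open>V\<close> in degree \<open>n\<close>. The chain condition over \<open>S\<close> yields a
  \<open>V\<close> of finite length with \<open>G V\<close> maximal; enlarging \<open>V\<close> by a
  cyclic \<open>A\<close>-submodule of \<open>Mg n\<close> then changes nothing, so \<open>V\<close>
  is all of \<open>Mg n\<close>.\<close>

lemma Mg_finite_length: "len {\<zero>} (Mg n) \<noteq> \<infinity>"
proof -
  define Z where "Z V = {s \<odot> v | s v. s \<in> carrier S \<and> v \<in> V}" for V
  define G where "G V = {x. add_closure M (Z V) x}" for V
  have Zc: "Z V \<subseteq> carrier M" if "V \<subseteq> Mg n" for V unfolding Z_def using that Mg_carrier by auto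
  have Zs: "s \<odot> z \<in> Z V" if s: "s \<in> carrier S" and z: "z \<in> Z V" and V: "V \<subseteq> Mg n" for s z V
  proof -
    obtain t v where tv: "t \<in> carrier S" "v \<in> V" "z = t \<odot> v" using z unfolding Z_def by blast
    have "v \<in> carrier M" using tv V Mg_carrier by blast
    then have "s \<odot> z = (s \<otimes>\<^bsub>S\<^esub> t) \<odot> v" unfolding tv(3) using s tv by (simp add: SM.smult_assoc1)
    then show ?thesis unfolding Z_def using s tv by blast
  qed
  have G: "submodule (G V) S M" if "V \<subseteq> Mg n" for V
    unfolding G_def by (rule SM.submodule_add_closure[OF Zc[OF that] Zs[OF _ _ that]])
  have VG: "V \<subseteq> G V" if V: "V \<subseteq> Mg n" for V
  proof
    fix v assume v: "v \<in> V"
    have "v \<in> carrier M" using v V Mg_carrier by blast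
    then have "v = \<one>\<^bsub>S\<^esub> \<odot> v" by simp
    then have "v \<in> Z V" unfolding Z_def using v by blast
    then show "v \<in> G V" unfolding G_def using SM.M.add_closure_incl[OF _ Zc[OF V]] by blast
  qed
  \<comment> \<open>In degree \<open>n\<close> only the degree zero part of a scalar contributes,
    and that part comes from \<open>A\<close>.\<close>
  have Gn: "x \<in> V" if x: "x \<in> G V" "x \<in> Mg n" and V: "V \<subseteq> Mg n" "submodule V A Vm" for x V
  proof -
    have "add_closure M (Z V) x" using x unfolding G_def by blast
    then have "MG.cp x n \<in> V"
    proof (induction rule: add_closure.induct)
      case zero then show ?case using V(2) unfolding A_submodule_iff by simp
    next
      case (add y z)
      obtain s v where sv: "s \<in> carrier S" "v \<in> V" "z = s \<odot> v" using add(2) unfolding Z_def by blast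
      have vn: "v \<in> Mg n" using sv V by blast
      obtain a where a: "a \<in> carrier A" "SG.cp s (\<lambda>_. 0) = iota a"
        using Sg_zero_deg[OF SG.cp_props(1)[OF sv(1)]] .
      have "MG.cp z n = iota a \<odot> v" using cp_smult_right(1)[OF vn sv(1), of "\<lambda>_. 0"] a sv by simp
      then have "MG.cp z n \<in> V" using V(2) a sv unfolding A_submodule_iff by auto
      moreover have "y \<in> carrier M" "z \<in> carrier M" using SM.M.add_closure_carrier[OF add(1) Zc[OF V(1)]] add(2) Zc[OF V(1)] by auto
      ultimately show ?case using add.IH V(2) unfolding A_submodule_iff by (simp add: MG.cp_add)
    qed
    then show ?thesis using MG.cp_self[OF x(2)] by simp
  qed
  define Y where "Y = {G V | V. submodule V A Vm \<and> V \<subseteq> Mg n \<and> len {\<zero>} V \<noteq> \<infinity>}"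
  have "G {\<zero>} \<in> Y" unfolding Y_def using AM.submodule_zero by (auto simp: zero_enat_def intro!: exI[of _ "{\<zero>}"])
  then have Yne: "Y \<noteq> {}" by blast
  have Ys: "submodule K S M" if "K \<in> Y" for K using that G unfolding Y_def by blast
  obtain K where K: "K \<in> Y" "\<forall>K'\<in>Y. K \<subseteq> K' \<longrightarrow> K' = K" using exists_maximal_submodule[OF Yne Ys] by blast
  then obtain V where V: "submodule V A Vm" "V \<subseteq> Mg n" "len {\<zero>} V \<noteq> \<infinity>" "K = G V" unfolding Y_def by blast
  have "Mg n \<subseteq> V"
  proof
    fix w assume w: "w \<in> Mg n"
    obtain L where L: "submodule L A Vm" "w \<in> L" "len {\<zero>} L \<noteq> \<infinity>" using finite_length_cyclic[OF Mg_carrier[OF w]] by blast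
    let ?L = "L \<inter> Mg n"
    have sL: "submodule ?L A Vm" using AM.submodule_Int[OF L(1) A_submodule_Mg] .
    have "len {\<zero>} ?L \<le> len {\<zero>} L" by (rule rel_length_mono) auto
    then have fL: "len {\<zero>} ?L \<noteq> \<infinity>" using L(3) by (metis enat_ord_simps(5))
    let ?V = "V <+>\<^bsub>M\<^esub> ?L"
    have s: "submodule ?V A Vm" using A_submodule_set_add[OF V(1) sL] .
    have sub: "?V \<subseteq> Mg n" using AM.set_add_least[OF A_submodule_Mg V(2), of ?L] by simp
    have "G ?V \<in> Y" unfolding Y_def using s sub finite_length_set_add[OF V(1) sL V(3) fL] by blast
    moreover have "G V \<subseteq> G ?V"
    proof -
      have "Z V \<subseteq> Z ?V" unfolding Z_def using A_set_add_upper(1)[OF V(1) sL] by blast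
      then show ?thesis unfolding G_def using SM.M.add_closure_least[of "Z V" _ "{x. add_closure M (Z ?V) x}"]
          SM.M.add_closure_add[OF Zc[OF sub]] SM.M.add_closure_incl[OF _ Zc[OF sub]] add_closure.zero by blast
    qed
    ultimately have "G ?V = G V" using K V(4) by blast
    moreover have "w \<in> ?V" using A_set_add_upper(2)[OF V(1) sL] L(2) w by blast
    ultimately have "w \<in> G V" using VG[OF sub] by blast
    then show "w \<in> V" using Gn w V by blast
  qed
  then have "Mg n = V" using V by blast
  then show ?thesis using V by simp
qed

text \<open>The submodules generated by the homogeneous elements of \<open>K\<close> whose degree is
  at most \<open>N\<close> in each coordinate increase with \<open>N\<close>; \<open>j0\<close> is
  where this chain stops. Taking the component of degree \<open>n\<close> makes the scalars
  homogeneous.\<close>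

lemma graded_sub_generated:
  assumes K: "graded_sub K"
  shows "\<exists>j0. \<forall>n m. m \<in> K \<longrightarrow> m \<in> Mg n \<longrightarrow>
     add_closure M {s \<odot> k | s k w u. s \<in> Sg w \<and> k \<in> K \<and> k \<in> Mg u \<and> (\<forall>i. u i \<le> j0) \<and> n = (\<lambda>i. u i + w i)} m"
proof -
  have Kc: "K \<subseteq> carrier M" using SM.submodule_subset[OF graded_subD(1)[OF K]] .
  define Z where "Z N = {s \<odot> k | s k u. s \<in> carrier S \<and> k \<in> K \<and> k \<in> Mg u \<and> (\<forall>i. u i \<le> N)}" for N
  define C where "C N = {x. add_closure M (Z N) x}" for N
  have Zc: "Z N \<subseteq> carrier M" for N unfolding Z_def using Kc by auto
  have Zs: "s \<odot> z \<in> Z N" if s: "s \<in> carrier S" and z: "z \<in> Z N" for s z N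
  proof -
    obtain t k u where tk: "t \<in> carrier S" "k \<in> K" "k \<in> Mg u" "\<forall>i. u i \<le> N" "z = t \<odot> k" using z unfolding Z_def by blast
    have "s \<odot> z = (s \<otimes>\<^bsub>S\<^esub> t) \<odot> k" unfolding tk(5) using s tk Mg_carrier by (simp add: SM.smult_assoc1)
    then show ?thesis unfolding Z_def using s tk by blast
  qed
  have C: "submodule (C N) S M" for N unfolding C_def by (rule SM.submodule_add_closure[OF Zc Zs])
  have mono: "C N \<subseteq> C N'" if "N \<le> N'" for N N'
  proof -
    have "Z N \<subseteq> Z N'"
    proof
      fix z assume "z \<in> Z N"
      then obtain t k u where tk: "t \<in> carrier S" "k \<in> K" "k \<in> Mg u" "\<forall>i. u i \<le> N" "z = t \<odot> k" unfolding Z_def by blast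
      have "\<forall>i. u i \<le> N'" using tk(4) that order_trans by blast
      then show "z \<in> Z N'" unfolding Z_def using tk by blast
    qed
    then show ?thesis unfolding C_def using SM.M.add_closure_least[of "Z N" _ "{x. add_closure M (Z N') x}"]
        SM.M.add_closure_add[OF Zc] SM.M.add_closure_incl[OF _ Zc] add_closure.zero by blast
  qed
  obtain j0 where j0: "\<And>n. j0 \<le> n \<Longrightarrow> C n = C j0" using acc_submodules[of C] C mono[OF le_SucI[OF order_refl]] by blast
  have "add_closure M {s \<odot> k | s k w u. s \<in> Sg w \<and> k \<in> K \<and> k \<in> Mg u \<and> (\<forall>i. u i \<le> j0) \<and> n = (\<lambda>i. u i + w i)} m"
    (is "add_closure M ?T m") if m: "m \<in> K" "m \<in> Mg n" for n m
  proof -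
    have T: "?T \<subseteq> carrier M" using Sg_carrier Kc by auto
    let ?N = "max j0 (Max (range n))"
    have "n i \<le> ?N" for i by (simp add: le_max_iff_disj)
    moreover have "m = \<one>\<^bsub>S\<^esub> \<odot> m" using m Kc by (simp add: subset_iff)
    ultimately have "m \<in> Z ?N" unfolding Z_def using m S.one_closed by blast
    then have "m \<in> C ?N" unfolding C_def using SM.M.add_closure_incl[OF _ Zc] by blast
    then have "m \<in> C j0" using j0[of ?N] by simp
    then have "add_closure M (Z j0) m" unfolding C_def by blast
    then have "add_closure M ?T (MG.cp m n)"
    proof (rule add_closure_map[OF SM.M.abelian_group_axioms SM.M.abelian_group_axioms _ Zc T, where h = "\<lambda>x. MG.cp x n"])
      fix z assume "z \<in> Z j0"
      then obtain t k u where tk: "t \<in> carrier S" "k \<in> K" "k \<in> Mg u" "\<forall>i. u i \<le> j0" "z = t \<odot> k" unfolding Z_def by blast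
      show "add_closure M ?T (MG.cp z n)"
      proof (cases "n \<in> range (\<lambda>w i. u i + w i)")
        case True
        then obtain w where w: "n = (\<lambda>i. u i + w i)" by blast
        have "MG.cp z n = SG.cp t w \<odot> k" unfolding tk(5) w using cp_smult_right(1)[OF tk(3,1)] .
        moreover have "SG.cp t w \<in> Sg w" using SG.cp_props(1)[OF tk(1)] .
        ultimately have "MG.cp z n \<in> ?T" using tk w by blast
        then show ?thesis by (rule SM.M.add_closure_incl[OF _ T])
      next
        case False
        then show ?thesis unfolding tk(5) using cp_smult_right(2)[OF tk(3,1) False] add_closure.zero by metis
      qed
    qed (auto simp: MG.cp_add)
    then show ?thesis using MG.cp_self[OF m(2)] by simp
  qed
  then show ?thesis by blast
qed

text \<open>Generators sit in degrees at most \<open>j0\<close>, so beyond \<open>j0 + j1\<close>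
  each scalar in front of a generator has degree at least \<open>j1\<close> in every coordinate and
  kills it.\<close>

lemma eventually_zero_if_killed:
  assumes K: "graded_sub K"
    and kill: "\<And>w s m. \<lbrakk>\<And>i. j1 \<le> w i; s \<in> Sg w; m \<in> K\<rbrakk> \<Longrightarrow> s \<odot> m = \<zero>"
  shows "large (\<lambda>n. \<forall>m\<in>Mg n. m \<in> K \<longrightarrow> m = \<zero>)"
proof -
  obtain j0 where j0: "\<And>n m. m \<in> K \<Longrightarrow> m \<in> Mg n \<Longrightarrow>
     add_closure M {s \<odot> k | s k w u. s \<in> Sg w \<and> k \<in> K \<and> k \<in> Mg u \<and> (\<forall>i. u i \<le> j0) \<and> n = (\<lambda>i. u i + w i)} m"
    using graded_sub_generated[OF K] by blast
  show ?thesis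
  proof (rule largeI[of "j0 + j1"], intro ballI impI)
    fix n m assume n: "\<And>i. j0 + j1 \<le> n i" and m: "m \<in> Mg n" "m \<in> K"
    have "m \<in> {\<zero>}"
    proof (rule SM.M.add_closure_least[OF j0[OF m(2,1)]])
      show "{s \<odot> k | s k w u. s \<in> Sg w \<and> k \<in> K \<and> k \<in> Mg u \<and> (\<forall>i. u i \<le> j0) \<and> n = (\<lambda>i. u i + w i)} \<subseteq> {\<zero>}"
      proof
        fix x assume "x \<in> {s \<odot> k | s k w u. s \<in> Sg w \<and> k \<in> K \<and> k \<in> Mg u \<and> (\<forall>i. u i \<le> j0) \<and> n = (\<lambda>i. u i + w i)}"
        then obtain s k w u where *: "x = s \<odot> k" "s \<in> Sg w" "k \<in> K" "\<forall>i. u i \<le> j0" "n = (\<lambda>i. u i + w i)" by blast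
        have "j1 \<le> w i" for i
        proof -
          have "n i = u i + w i" using *(5) by (rule fun_cong)
          moreover have "u i \<le> j0" using *(4) by blast
          ultimately show ?thesis using n[of i] by linarith
        qed
        then show "x \<in> {\<zero>}" using kill[of w s k] * by simp
      qed
    qed auto
    then show "m = \<zero>" by simp
  qed
qed

subsection \<open>Filter-regular elements\<close>

definition ev_inj :: "'s \<Rightarrow> bool" where
  "ev_inj x \<longleftrightarrow> large (\<lambda>n. \<forall>m\<in>Mg n. x \<odot> m = \<zero> \<longrightarrow> m = \<zero>)"

lemma assoc_primes_iff:
  "P \<in> assoc_primes S M \<longleftrightarrow> primeideal P S \<and> (\<exists>m\<in>carrier M. P = SM.colon {\<zero>} m)"
  unfolding assoc_primes_def SM.colon_def by simp

text \<open>\<open>K\<close> is the kernel of \<open>x\<close>, and \<open>L j\<close> its part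
  killed by all scalars of degree at least \<open>j\<close>; these increase and stop at
  \<open>L j0\<close>. Were \<open>K\<close> larger than \<open>L j0\<close>, a maximal colon ideal
  of \<open>L j0\<close> would be an associated prime of \<open>M\<close> containing
  \<open>x\<close> but not S_{++}. Hence one degree bound kills \<open>K\<close>, which therefore
  vanishes in large degrees.\<close>

lemma ev_inj_if_avoids:
  assumes x: "x \<in> Sg v" and av: "\<And>P. P \<in> assoc_primes S M \<Longrightarrow> \<not> plus_plus S Sg \<subseteq> P \<Longrightarrow> x \<notin> P"
  shows "ev_inj x"
proof -
  have xc: "x \<in> carrier S" using Sg_carrier[OF x] .
  define K where "K = {m \<in> carrier M. x \<odot> m = \<zero>}"
  have comm: "s \<odot> (t \<odot> m) = t \<odot> (s \<odot> m)" if "s \<in> carrier S" "t \<in> carrier S" "m \<in> carrier M" for s t m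
    by (rule SM.smult_commute[OF that])
  have Ks: "submodule K S M" unfolding SM.submodule_iff K_def
    using xc by (auto simp: SM.smult_r_distr comm[OF xc])
  have K: "graded_sub K" unfolding graded_sub_def
  proof (intro conjI ballI allI Ks)
    fix m u assume m: "m \<in> K"
    then have mc: "m \<in> carrier M" "x \<odot> m = \<zero>" unfolding K_def by auto
    show "MG.cp m u \<in> K" unfolding K_def using mc cp_smult_hom(1)[OF x mc(1), of u] by simp
  qed
  define L where "L j = {m \<in> K. \<forall>w s. (\<forall>i. j \<le> w i) \<longrightarrow> s \<in> Sg w \<longrightarrow> s \<odot> m = \<zero>}" for j
  have Kc: "m \<in> K \<Longrightarrow> m \<in> carrier M" for m unfolding K_def by simp
  have Lc: "m \<in> L j \<Longrightarrow> m \<in> carrier M" for m j unfolding L_def using Kc by simp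
  have Lkill: "s \<odot> m = \<zero>" if "m \<in> L j" "\<forall>i. j \<le> w i" "s \<in> Sg w" for m j w s
    using that unfolding L_def by blast
  have Ls: "submodule (L j) S M" for j
    unfolding SM.submodule_iff
  proof (intro conjI ballI)
    show "L j \<subseteq> carrier M" using Lc by blast
    show "\<zero> \<in> L j" unfolding L_def using SM.submodule_zero_mem[OF Ks] Sg_carrier by simp
    show "a \<oplus> b \<in> L j" if "a \<in> L j" "b \<in> L j" for a b
      using that SM.submodule_add_mem[OF Ks] Lc unfolding L_def by (auto simp: SM.smult_r_distr Sg_carrier Kc)
    show "a \<odot> m \<in> L j" if "a \<in> carrier S" "m \<in> L j" for a m
    proof -
      have "s \<odot> (a \<odot> m) = a \<odot> (s \<odot> m)" if "s \<in> Sg w" for s w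
        using comm[OF Sg_carrier[OF that] \<open>a \<in> carrier S\<close> Lc[OF \<open>m \<in> L j\<close>]] .
      then show ?thesis using that SM.submodule_smult_mem[OF Ks] unfolding L_def by auto
    qed
  qed
  have Lmono: "L j \<subseteq> L j'" if jj: "j \<le> j'" for j j'
  proof
    fix m assume m: "m \<in> L j"
    have "s \<odot> m = \<zero>" if "\<forall>i. j' \<le> w i" "s \<in> Sg w" for w s
    proof (rule Lkill[OF m _ that(2)])
      show "\<forall>i. j \<le> w i" using that(1) jj order_trans by blast
    qed
    then show "m \<in> L j'" using m unfolding L_def by blast
  qed
  obtain j0 where j0: "\<And>j. j0 \<le> j \<Longrightarrow> L j = L j0" using acc_submodules[of L] Ls Lmono[OF le_SucI[OF order_refl]] by blast
  \<comment> \<open>Consequence of stability: if all scalars of degree at least \<open>d\<close>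
    carry \<open>m\<close> into \<open>L j0\<close>, then \<open>m\<close> lies in
    \<open>L (j0 + d)\<close>, which equals \<open>L j0\<close>.\<close>
  have kill: "m \<in> L j0" if m: "m \<in> K" and d: "\<And>w t. (\<And>i. d \<le> w i) \<Longrightarrow> t \<in> Sg w \<Longrightarrow> t \<odot> m \<in> L j0" for m d
  proof -
    have mc: "m \<in> carrier M" using Kc m by blast
    have "s \<odot> m = \<zero>" if w: "\<forall>i. j0 + d \<le> w i" and s: "s \<in> Sg w" for w s
    proof -
      have "(\<lambda>i. (w i - d) + d) = w"
      proof
        fix i
        have "j0 + d \<le> w i" using w by blast
        then show "(w i - d) + d = w i" by linarith
      qed
      then have "add_closure S {t \<otimes>\<^bsub>S\<^esub> t' | t t'. t \<in> Sg (\<lambda>i. w i - d) \<and> t' \<in> Sg (\<lambda>i. d)} s"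
        using Sg_add_decomp[of s "\<lambda>i. w i - d" "\<lambda>i. d"] s by simp
      then have "s \<in> {s \<in> carrier S. s \<odot> m = \<zero>}"
      proof (rule S.add_closure_least)
        show "{t \<otimes>\<^bsub>S\<^esub> t' | t t'. t \<in> Sg (\<lambda>i. w i - d) \<and> t' \<in> Sg (\<lambda>i. d)} \<subseteq> {s \<in> carrier S. s \<odot> m = \<zero>}"
        proof
          fix y assume "y \<in> {t \<otimes>\<^bsub>S\<^esub> t' | t t'. t \<in> Sg (\<lambda>i. w i - d) \<and> t' \<in> Sg (\<lambda>i. d)}"
          then obtain t t' where t: "y = t \<otimes>\<^bsub>S\<^esub> t'" "t \<in> Sg (\<lambda>i. w i - d)" "t' \<in> Sg (\<lambda>i. d)" by blast
          have "t' \<odot> m \<in> L j0" using d[OF _ t(3)] by simp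
          moreover have "\<forall>i. j0 \<le> w i - d"
          proof
            fix i
            have "j0 + d \<le> w i" using w by blast
            then show "j0 \<le> w i - d" by linarith
          qed
          ultimately have "t \<odot> (t' \<odot> m) = \<zero>" by (rule Lkill[OF _ _ t(2)])
          then show "y \<in> {s \<in> carrier S. s \<odot> m = \<zero>}"
            using t Sg_carrier mc by (simp add: SM.smult_assoc1)
        qed
      qed (use mc in \<open>auto simp: SM.smult_l_distr\<close>)
      then show ?thesis by simp
    qed
    then have "m \<in> L (j0 + d)" unfolding L_def using m by blast
    then show ?thesis using j0[of "j0 + d"] by simp
  qed
  have "K \<subseteq> L j0"
  proof (rule ccontr)
    assume n: "\<not> K \<subseteq> L j0"
    have "\<exists>m\<in>K - L j0. primeideal (SM.colon (L j0) m) S \<and>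
        (\<forall>b\<in>carrier S. b \<odot> m \<notin> L j0 \<longrightarrow> SM.colon (L j0) (b \<odot> m) = SM.colon (L j0) m)"
      by (rule SM.exists_prime_colon[OF Ls])
        (use n Kc SM.submodule_smult_mem[OF Ks] exists_maximal_ideal_in_family in auto)
    then obtain m where m: "m \<in> K" "m \<notin> L j0" "primeideal (SM.colon (L j0) m) S"
      "\<And>b. b \<in> carrier S \<Longrightarrow> b \<odot> m \<notin> L j0 \<Longrightarrow> SM.colon (L j0) (b \<odot> m) = SM.colon (L j0) m" by blast
    let ?P = "SM.colon (L j0) m"
    have mc: "m \<in> carrier M" using Kc m by blast
    have "x \<odot> m = \<zero>" using m(1) unfolding K_def by simp
    then have xP: "x \<in> ?P" unfolding SM.colon_def using xc SM.submodule_zero_mem[OF Ls] by simp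
    have "\<not> plus_plus S Sg \<subseteq> ?P"
    proof
      assume pp: "plus_plus S Sg \<subseteq> ?P"
      have "m \<in> L j0"
      proof (rule kill[OF m(1), of 1])
        fix w :: "'d \<Rightarrow> nat" and t assume w: "\<And>i. 1 \<le> w i" and t: "t \<in> Sg w"
        have w0: "\<forall>i. 0 < w i" using w by (meson less_le_trans zero_less_one)
        have "ideal ?P S" using SM.ideal_colon[OF Ls mc] .
        from pp[unfolded plus_plus_subset_iff[OF this]] w0 t have "t \<in> ?P" by blast
        then show "t \<odot> m \<in> L j0" unfolding SM.colon_def by simp
      qed
      then show False using m(2) by blast
    qed
    moreover have "?P \<in> assoc_primes S M"
    proof -
      \<comment> \<open>Multiplying by \<open>t\<close> of large degree turns the colon ideal of
        \<open>L j0\<close> into an annihilator: anything carrying \<open>m\<close> into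
        \<open>L j0\<close> kills \<open>t m\<close>, and since \<open>t m\<close> is still outside
        \<open>L j0\<close> its colon ideal is unchanged.\<close>
      obtain w t where wt: "\<And>i. j0 \<le> w i" "t \<in> Sg w" "t \<odot> m \<notin> L j0" using kill[OF m(1), of j0] m(2) by blast
      have tc: "t \<in> carrier S" using Sg_carrier wt by blast
      have tm: "t \<odot> m \<in> carrier M" using tc mc by simp
      have "SM.colon {\<zero>} (t \<odot> m) = ?P"
      proof
        have "SM.colon {\<zero>} (t \<odot> m) \<subseteq> SM.colon (L j0) (t \<odot> m)"
          unfolding SM.colon_def using SM.submodule_zero_mem[OF Ls] by auto
        then show "SM.colon {\<zero>} (t \<odot> m) \<subseteq> ?P" using m(4)[OF tc wt(3)] by simp
        show "?P \<subseteq> SM.colon {\<zero>} (t \<odot> m)"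
        proof
          fix p assume "p \<in> ?P"
          then have p: "p \<in> carrier S" "p \<odot> m \<in> L j0" unfolding SM.colon_def by auto
          then have "t \<odot> (p \<odot> m) = \<zero>" unfolding L_def using wt(1,2) by blast
          then show "p \<in> SM.colon {\<zero>} (t \<odot> m)" unfolding SM.colon_def using p comm[OF p(1) tc mc] by simp
        qed
      qed
      then show ?thesis unfolding assoc_primes_iff using m(3) tm by metis
    qed
    ultimately show False using av xP by blast
  qed
  then have "large (\<lambda>n. \<forall>m\<in>Mg n. m \<in> K \<longrightarrow> m = \<zero>)"
    by (intro eventually_zero_if_killed[OF K, of j0]) (auto simp: L_def)
  then show ?thesis unfolding ev_inj_def by (rule large_mono) (auto simp: K_def Mg_carrier)
qed

text \<open>If \<open>x\<close> kills \<open>m\<close>, it kills every component of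
  \<open>m\<close>. A scalar of large degree moves these components into the range where
  \<open>x\<close> is injective, so it kills \<open>m\<close> as well. The prime then contains all
  large degrees, and with them, by taking roots, S_{++}.\<close>

lemma avoids_if_ev_inj:
  assumes x: "x \<in> Sg v" and ei: "ev_inj x" and P: "P \<in> assoc_primes S M" "\<not> plus_plus S Sg \<subseteq> P"
  shows "x \<notin> P"
proof
  assume xP: "x \<in> P"
  obtain m where m: "m \<in> carrier M" "P = SM.colon {\<zero>} m" and pr: "primeideal P S" using P(1) unfolding assoc_primes_iff by blast
  have Pi: "ideal P S" using primeideal.axioms(1)[OF pr] .
  obtain N where N: "\<And>n m. (\<forall>i. N \<le> n i) \<Longrightarrow> m \<in> Mg n \<Longrightarrow> x \<odot> m = \<zero> \<Longrightarrow> m = \<zero>"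
    using ei unfolding ev_inj_def large_def by blast
  have xm: "x \<odot> m = \<zero>" using xP m(2) unfolding SM.colon_def by simp
  have big: "s \<in> P" if w: "\<forall>i. N \<le> w i" and s: "s \<in> Sg w" for w s
  proof -
    have sc: "s \<in> carrier S" using Sg_carrier s by blast
    have "MG.cp (s \<odot> m) u = \<zero>" for u
    proof (cases "u \<in> range (\<lambda>u i. w i + u i)")
      case True
      then obtain u' where u': "u = (\<lambda>i. w i + u' i)" by blast
      have e: "MG.cp (s \<odot> m) u = s \<odot> MG.cp m u'" unfolding u' using cp_smult_hom(1)[OF s m(1)] .
      have "x \<odot> MG.cp m u' = \<zero>" using cp_smult_hom(1)[OF x m(1), of u'] xm by simp
      then have "x \<odot> (s \<odot> MG.cp m u') = \<zero>"
        using sc Sg_carrier[OF x] m(1) SM.smult_assoc1[of x s "MG.cp m u'"] SM.smult_assoc1[of s x "MG.cp m u'"] S.m_comm[of x s] by simp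
      moreover have "s \<odot> MG.cp m u' \<in> Mg u" unfolding u' using Mg_smult[OF s MG.cp_props(1)[OF m(1)]] .
      moreover have "\<forall>i. N \<le> u i" unfolding u' using w by (simp add: trans_le_add1)
      ultimately show ?thesis using N e by simp
    next
      case False
      then show ?thesis using cp_smult_hom(2)[OF s m(1)] by blast
    qed
    then have "s \<odot> m = \<zero>" using MG.eq_zero_if_comps sc m(1) by simp
    then show ?thesis unfolding m(2) SM.colon_def using sc by simp
  qed
  have "plus_plus S Sg \<subseteq> P" unfolding plus_plus_subset_iff[OF Pi]
  proof (intro allI impI)
    fix u :: "'d \<Rightarrow> nat" and s assume u: "\<forall>i. 0 < u i" and s: "s \<in> Sg u"
    have sc: "s \<in> carrier S" using Sg_carrier s by blast
    have "\<forall>i. N \<le> N * u i" using u by (simp add: Suc_le_eq)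
    then have "s [^]\<^bsub>S\<^esub> N \<in> P" using big[OF _ Sg_pow[OF s]] by blast
    then show "s \<in> P"
    proof (induction N)
      case 0
      then have "\<one>\<^bsub>S\<^esub> \<in> P" by simp
      then show ?case using ideal.one_imp_carrier[OF Pi] sc by simp
    next
      case (Suc N)
      then show ?case using primeideal.I_prime[OF pr, of "s [^]\<^bsub>S\<^esub> N" s] sc by auto
    qed
  qed
  then show False using P(2) by blast
qed

theorem filter_regular_iff_ev_inj:
  assumes "x \<in> Sg v"
  shows "(\<forall>P\<in>assoc_primes S M. \<not> plus_plus S Sg \<subseteq> P \<longrightarrow> x \<notin> P) \<longleftrightarrow> ev_inj x"
  using ev_inj_if_avoids[OF assms] avoids_if_ev_inj[OF assms] by blast

text \<open>Noetherian induction on submodules with finitely many associated primes: adding a cyclic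
  submodule generated by an \<open>m\<close> with \<open>K : m\<close> prime contributes at most
  that one prime.\<close>

theorem finite_assoc_primes: "finite (assoc_primes S M)"
proof -
  define good where "good K \<longleftrightarrow> submodule K S M \<and>
    finite {P. primeideal P S \<and> (\<exists>m\<in>K. P = SM.colon {\<zero>} m)}" for K
  have "\<not> primeideal (SM.colon {\<zero>} \<zero>) S"
  proof
    assume "primeideal (SM.colon {\<zero>} \<zero>) S"
    then show False using primeideal.I_notcarr unfolding SM.colon_def by fastforce
  qed
  then have "{P. primeideal P S \<and> (\<exists>m\<in>{\<zero>}. P = SM.colon {\<zero>} m)} = {}" by blast
  then have "good {\<zero>}" unfolding good_def using SM.submodule_zero by simp
  then have ne: "Collect good \<noteq> {}" by blast
  obtain K where K: "good K" "\<And>K'. good K' \<Longrightarrow> K \<subseteq> K' \<Longrightarrow> K' = K"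
    using exists_maximal_submodule[OF ne] unfolding good_def by blast
  have Ks: "submodule K S M" using K(1) unfolding good_def by blast
  have Kc: "K \<subseteq> carrier M" using SM.submodule_subset[OF Ks] .
  have "carrier M \<subseteq> K"
  proof (rule ccontr)
    assume n: "\<not> carrier M \<subseteq> K"
    have "\<exists>m\<in>carrier M - K. primeideal (SM.colon K m) S \<and>
        (\<forall>b\<in>carrier S. b \<odot> m \<notin> K \<longrightarrow> SM.colon K (b \<odot> m) = SM.colon K m)"
      by (rule SM.exists_prime_colon[OF Ks]) (use n exists_maximal_ideal_in_family in auto)
    then obtain m where m: "m \<in> carrier M" "m \<notin> K" "primeideal (SM.colon K m) S"
      "\<And>b. b \<in> carrier S \<Longrightarrow> b \<odot> m \<notin> K \<Longrightarrow> SM.colon K (b \<odot> m) = SM.colon K m" by blast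
    let ?C = "{s \<odot> m | s. s \<in> carrier S}"
    have C: "submodule ?C S M" unfolding SM.submodule_iff
    proof (intro conjI ballI)
      show "?C \<subseteq> carrier M" using m by auto
      have "\<zero> = \<zero>\<^bsub>S\<^esub> \<odot> m" using m by simp
      then show "\<zero> \<in> ?C" by blast
      fix a b assume "a \<in> ?C" "b \<in> ?C"
      then obtain s t where "s \<in> carrier S" "t \<in> carrier S" "a = s \<odot> m" "b = t \<odot> m" by blast
      then have "a \<oplus> b = (s \<oplus>\<^bsub>S\<^esub> t) \<odot> m" "s \<oplus>\<^bsub>S\<^esub> t \<in> carrier S" using m by (simp_all add: SM.smult_l_distr)
      then show "a \<oplus> b \<in> ?C" by blast
    next
      fix a b assume "a \<in> carrier S" "b \<in> ?C"
      then obtain t where "t \<in> carrier S" "b = t \<odot> m" by blast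
      then have "a \<odot> b = (a \<otimes>\<^bsub>S\<^esub> t) \<odot> m" "a \<otimes>\<^bsub>S\<^esub> t \<in> carrier S" using m \<open>a \<in> carrier S\<close> by (simp_all add: SM.smult_assoc1)
      then show "a \<odot> b \<in> ?C" by blast
    qed
    let ?K = "K <+>\<^bsub>M\<^esub> ?C"
    have Ks': "submodule ?K S M" using SM.submodule_set_add[OF Ks C] .
    have "{P. primeideal P S \<and> (\<exists>m'\<in>?K. P = SM.colon {\<zero>} m')} \<subseteq>
        insert (SM.colon K m) {P. primeideal P S \<and> (\<exists>m'\<in>K. P = SM.colon {\<zero>} m')}"
    proof
      fix Q assume "Q \<in> {P. primeideal P S \<and> (\<exists>m'\<in>?K. P = SM.colon {\<zero>} m')}"
      then obtain m' where Q: "primeideal Q S" "m' \<in> ?K" "Q = SM.colon {\<zero>} m'" by blast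
      then obtain k s where ks: "k \<in> K" "s \<in> carrier S" "m' = k \<oplus> s \<odot> m" unfolding SM.set_add_iff by blast
      have kc: "k \<in> carrier M" using ks Kc by blast
      have m'c: "m' \<in> carrier M" using ks kc m by simp
      show "Q \<in> insert (SM.colon K m) {P. primeideal P S \<and> (\<exists>m'\<in>K. P = SM.colon {\<zero>} m')}"
      \<comment> \<open>Either the cyclic module of \<open>m'\<close> meets \<open>K\<close>
        nontrivially, and \<open>Q\<close> is already the annihilator of an element of
        \<open>K\<close>; or it embeds into \<open>(K + S m) / K\<close>, and \<open>Q\<close> is
        the colon ideal of \<open>s m\<close>.\<close>
      proof (cases "\<exists>t\<in>carrier S. t \<odot> m' \<in> K \<and> t \<odot> m' \<noteq> \<zero>")
        case True
        then obtain t where t: "t \<in> carrier S" "t \<odot> m' \<in> K" "t \<odot> m' \<noteq> \<zero>" by blast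
        have tQ: "t \<notin> Q" using t Q(3) unfolding SM.colon_def by simp
        have "SM.colon {\<zero>} (t \<odot> m') = Q"
        proof
          show "SM.colon {\<zero>} (t \<odot> m') \<subseteq> Q"
          proof
            fix r assume "r \<in> SM.colon {\<zero>} (t \<odot> m')"
            then have "r \<in> carrier S" "r \<otimes>\<^bsub>S\<^esub> t \<in> Q" unfolding Q(3) SM.colon_def using t m'c by (auto simp: SM.smult_assoc1)
            then show "r \<in> Q" using primeideal.I_prime[OF Q(1) _ t(1)] tQ by blast
          qed
          show "Q \<subseteq> SM.colon {\<zero>} (t \<odot> m')"
          proof
            fix r assume "r \<in> Q"
            then have r: "r \<in> carrier S" "r \<odot> m' = \<zero>" unfolding Q(3) SM.colon_def by auto
            have "r \<odot> (t \<odot> m') = t \<odot> (r \<odot> m')"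
              by (rule SM.smult_commute[OF r(1) t(1) m'c])
            then show "r \<in> SM.colon {\<zero>} (t \<odot> m')" unfolding SM.colon_def using r t by simp
          qed
        qed
        then show ?thesis using Q(1) t(2) by blast
      next
        case False
        have *: "t \<in> Q \<longleftrightarrow> t \<odot> (s \<odot> m) \<in> K" if t: "t \<in> carrier S" for t
        proof -
          have tk: "t \<odot> k \<in> K" using SM.submodule_smult_mem[OF Ks t ks(1)] .
          have e: "t \<odot> m' = t \<odot> k \<oplus> t \<odot> (s \<odot> m)"
            unfolding ks(3) using t kc ks m by (simp add: SM.smult_r_distr)
          have "t \<odot> m' \<in> K \<longleftrightarrow> t \<odot> (s \<odot> m) \<in> K"
          proof
            assume "t \<odot> m' \<in> K"
            then have "t \<odot> m' \<ominus> t \<odot> k \<in> K" using SM.submodule_diff_mem[OF Ks] tk by blast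
            then show "t \<odot> (s \<odot> m) \<in> K"
              unfolding e using SM.M.add_minus_cancel(1)[of "t \<odot> k" "t \<odot> (s \<odot> m)"] t kc ks(2) m(1) by simp
          next
            assume "t \<odot> (s \<odot> m) \<in> K"
            then show "t \<odot> m' \<in> K" unfolding e using SM.submodule_add_mem[OF Ks tk] by blast
          qed
          moreover have "t \<in> Q \<longleftrightarrow> t \<odot> m' = \<zero>" unfolding Q(3) SM.colon_def using t by simp
          moreover have "t \<odot> m' = \<zero> \<longleftrightarrow> t \<odot> m' \<in> K" using False t SM.submodule_zero_mem[OF Ks] by auto
          ultimately show ?thesis by simp
        qed
        have Qs: "Q = SM.colon K (s \<odot> m)"
          using * S.ideal_subset[OF primeideal.axioms(1)[OF Q(1)]] unfolding SM.colon_def by blast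
        show ?thesis
        proof (cases "s \<odot> m \<in> K")
          case True
          then have "\<one>\<^bsub>S\<^esub> \<in> Q" using *[of "\<one>\<^bsub>S\<^esub>"] ks(2) m(1) by simp
          then show ?thesis using ideal.one_imp_carrier[OF primeideal.axioms(1)[OF Q(1)]] primeideal.I_notcarr[OF Q(1)] by simp
        next
          case False
          then show ?thesis using m(4)[OF ks(2)] Qs by simp
        qed
      qed
    qed
    then have "finite {P. primeideal P S \<and> (\<exists>m'\<in>?K. P = SM.colon {\<zero>} m')}"
      using K(1) unfolding good_def by (meson finite_insert finite_subset)
    then have "good ?K" unfolding good_def using Ks' by blast
    then have "?K = K" using K(2) SM.set_add_upper1[OF Ks C] by blast
    moreover have "m \<in> ?C" using m(1) S.one_closed SM.smult_one[OF m(1)] by (metis (mono_tags, lifting) mem_Collect_eq)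
    ultimately show False using SM.set_add_upper2[OF Ks C] m(2) by blast
  qed
  then have "K = carrier M" using Kc by blast
  moreover have "assoc_primes S M = {P. primeideal P S \<and> (\<exists>m\<in>carrier M. P = SM.colon {\<zero>} m)}"
    using assoc_primes_iff by blast
  ultimately show ?thesis using K(1) unfolding good_def by simp
qed

text \<open>\<open>W\<close> is an arbitrary \<open>A\<close>-submodule of one component because
  there are two applications: all of \<open>Sg (unit_deg i)\<close> for building sequences, and the
  span of the generators of a reduction.\<close>

lemma exists_ev_inj_in:
  assumes inf: "infinite (carrier (A Quot \<mm>))"
    and W: "W \<subseteq> Sg v" "W \<noteq> {}" "\<And>x y. x \<in> W \<Longrightarrow> y \<in> W \<Longrightarrow> x \<oplus>\<^bsub>S\<^esub> y \<in> W"
      "\<And>a x. a \<in> carrier A \<Longrightarrow> x \<in> W \<Longrightarrow> iota a \<otimes>\<^bsub>S\<^esub> x \<in> W"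
    and nsub: "\<And>P. P \<in> assoc_primes S M \<Longrightarrow> W \<subseteq> P \<Longrightarrow> plus_plus S Sg \<subseteq> P"
  shows "\<exists>x\<in>W. ev_inj x"
proof -
  let ?\<P> = "{P \<in> assoc_primes S M. \<not> plus_plus S Sg \<subseteq> P}"
  have "\<exists>w\<in>W. \<forall>P\<in>?\<P>. w \<notin> P"
  proof (rule prime_avoidance[OF inf])
    show "finite ?\<P>" using finite_assoc_primes by simp
    show "W \<subseteq> carrier S" using W(1) Sg_carrier by blast
    show "primeideal P S" if "P \<in> ?\<P>" for P using that assoc_primes_iff by blast
    show "\<not> W \<subseteq> P" if "P \<in> ?\<P>" for P using that nsub by blast
  qed (use W in auto)
  then obtain w where w: "w \<in> W" "\<forall>P\<in>?\<P>. w \<notin> P" by blast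
  have "ev_inj w" by (rule ev_inj_if_avoids[of w v]) (use w W(1) in auto)
  then show ?thesis using w(1) by blast
qed

lemma exists_ev_inj_unit:
  assumes inf: "infinite (carrier (A Quot \<mm>))"
  shows "\<exists>x\<in>Sg (unit_deg i). ev_inj x"
proof (rule exists_ev_inj_in[OF inf subset_refl])
  show "Sg (unit_deg i) \<noteq> {}" using SG.D_zero by blast
  show "x \<oplus>\<^bsub>S\<^esub> y \<in> Sg (unit_deg i)" if "x \<in> Sg (unit_deg i)" "y \<in> Sg (unit_deg i)" for x y
    using SG.D_add that by blast
  show "iota a \<otimes>\<^bsub>S\<^esub> x \<in> Sg (unit_deg i)" if "a \<in> carrier A" "x \<in> Sg (unit_deg i)" for a x
    using Sg_smult[OF that] iota_mult[OF that(1)] Sg_carrier[OF that(2)] by simp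
  fix P assume P: "P \<in> assoc_primes S M" "Sg (unit_deg i) \<subseteq> P"
  have Pi: "ideal P S" using P(1) assoc_primes_iff primeideal.axioms(1) by blast
  show "plus_plus S Sg \<subseteq> P" unfolding plus_plus_subset_iff[OF Pi]
    using Sg_in_ideal_if_gens_in_ideal[OF Pi, of i] P(2) by blast
qed

lemma ev_inj_mult:
  assumes x: "x \<in> Sg u" and y: "y \<in> Sg v" and ei: "ev_inj x" "ev_inj y" shows "ev_inj (x \<otimes>\<^bsub>S\<^esub> y)"
proof -
  have "large (\<lambda>n. (\<forall>m\<in>Mg n. y \<odot> m = \<zero> \<longrightarrow> m = \<zero>) \<and>
      (\<forall>m\<in>Mg (\<lambda>i. n i + v i). x \<odot> m = \<zero> \<longrightarrow> m = \<zero>))"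
    by (rule large_conj) (use ei large_shift_up[of "\<lambda>n. \<forall>m\<in>Mg n. x \<odot> m = \<zero> \<longrightarrow> m = \<zero>" v] in \<open>auto simp: ev_inj_def\<close>)
  then show ?thesis unfolding ev_inj_def
  proof (rule large_mono, intro ballI impI)
    fix n m assume h: "(\<forall>m\<in>Mg n. y \<odot> m = \<zero> \<longrightarrow> m = \<zero>) \<and>
      (\<forall>m\<in>Mg (\<lambda>i. n i + v i). x \<odot> m = \<zero> \<longrightarrow> m = \<zero>)"
      and m: "m \<in> Mg n" "x \<otimes>\<^bsub>S\<^esub> y \<odot> m = \<zero>"
    have "x \<odot> (y \<odot> m) = \<zero>" using m Sg_carrier[OF x] Sg_carrier[OF y] Mg_carrier[OF m(1)] by (simp add: SM.smult_assoc1)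
    moreover have "y \<odot> m \<in> Mg (\<lambda>i. n i + v i)" using Mg_smult[OF y m(1)] by (simp add: add.commute)
    ultimately show "m = \<zero>" using h m(1) by blast
  qed
qed

text \<open>With \<open>Ass\<close> consisting of primes over \<open>S\<^sub>+\<^sub>+\<close>, the element \<open>0\<close> is filter-regular.\<close>

lemma eventually_zero_if_degenerate:
  assumes "\<not> diagonally_nondegenerate S Sg M"
  shows "large (\<lambda>n. Mg n = {\<zero>})"
proof -
  have sub: "Sg (diag_deg 1) \<subseteq> ring_radical S (annihilator S M)" using assms unfolding diagonally_nondegenerate_def by blast
  have "ev_inj \<zero>\<^bsub>S\<^esub>"
  proof (rule ev_inj_if_avoids[of _ "diag_deg 1"])
    fix P assume P: "P \<in> assoc_primes S M" "\<not> plus_plus S Sg \<subseteq> P"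
    obtain m where m: "m \<in> carrier M" "P = SM.colon {\<zero>} m" and pr: "primeideal P S" using P(1) unfolding assoc_primes_iff by blast
    have Pi: "ideal P S" using primeideal.axioms(1)[OF pr] .
    have "Sg (diag_deg 1) \<subseteq> P"
    proof
      fix s assume s: "s \<in> Sg (diag_deg 1)"
      then obtain n :: nat where n: "s [^]\<^bsub>S\<^esub> n \<in> annihilator S M" using sub unfolding ring_radical_def by blast
      have sc: "s \<in> carrier S" using Sg_carrier s by blast
      have "s [^]\<^bsub>S\<^esub> n \<in> P" using n m unfolding annihilator_def SM.colon_def by simp
      then show "s \<in> P"
      proof (induction n)
        case 0
        then have "\<one>\<^bsub>S\<^esub> \<in> P" by simp
        then show ?case using ideal.one_imp_carrier[OF Pi] sc by simp
      next
        case (Suc n)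
        then show ?case using primeideal.I_prime[OF pr, of "s [^]\<^bsub>S\<^esub> n" s] sc by auto
      qed
    qed
    then have "plus_plus S Sg \<subseteq> P" using plus_plus_subset_if_diag[OF Pi] by blast
    then show "\<zero>\<^bsub>S\<^esub> \<notin> P" using P(2) by blast
  qed simp
  then show ?thesis unfolding ev_inj_def by (rule large_mono) (use Mg_carrier MG.D_zero in auto)
qed

end

section \<open>Submodules generated by the multiples of given scalars\<close>

context module
begin

definition gensub :: "'a set \<Rightarrow> 'c set" where
  "gensub Z = {y. add_closure M {x \<odot>\<^bsub>M\<^esub> m | x m. x \<in> Z \<and> m \<in> carrier M} y}"

lemma submodule_gensub:
  assumes "Z \<subseteq> carrier R" shows "submodule (gensub Z) R M"
  unfolding gensub_def
proof (rule submodule_add_closure)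
  show "{x \<odot>\<^bsub>M\<^esub> m | x m. x \<in> Z \<and> m \<in> carrier M} \<subseteq> carrier M" using assms by auto
  fix s z assume s: "s \<in> carrier R" and "z \<in> {x \<odot>\<^bsub>M\<^esub> m | x m. x \<in> Z \<and> m \<in> carrier M}"
  then obtain x m where xm: "x \<in> Z" "m \<in> carrier M" "z = x \<odot>\<^bsub>M\<^esub> m" by blast
  have "s \<odot>\<^bsub>M\<^esub> z = x \<odot>\<^bsub>M\<^esub> (s \<odot>\<^bsub>M\<^esub> m)" unfolding xm(3) using xm assms s by (intro smult_commute) auto
  then show "s \<odot>\<^bsub>M\<^esub> z \<in> {x \<odot>\<^bsub>M\<^esub> m | x m. x \<in> Z \<and> m \<in> carrier M}" using xm s by blast
qed

lemma gensub_mem: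
  assumes "Z \<subseteq> carrier R" "x \<in> Z" "m \<in> carrier M" shows "x \<odot>\<^bsub>M\<^esub> m \<in> gensub Z"
  unfolding gensub_def using assms by (intro CollectI M.add_closure_incl) auto

lemma gensub_least:
  assumes "submodule H R M" "\<And>x m. x \<in> Z \<Longrightarrow> m \<in> carrier M \<Longrightarrow> x \<odot>\<^bsub>M\<^esub> m \<in> H"
  shows "gensub Z \<subseteq> H"
proof
  fix y assume "y \<in> gensub Z"
  then have "add_closure M {x \<odot>\<^bsub>M\<^esub> m | x m. x \<in> Z \<and> m \<in> carrier M} y" unfolding gensub_def by blast
  then show "y \<in> H"
    by (rule M.add_closure_least)
      (use submodule_zero_mem[OF assms(1)] submodule_add_mem[OF assms(1)] assms(2) in blast)+
qed

text \<open>The scalars carrying \<open>M\<close> into \<open>gensub Z\<close> form an ideal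
  containing \<open>Z\<close>, hence contain the ideal generated by \<open>Z\<close>.\<close>

lemma ideal_smult_genideal:
  assumes Z: "Z \<subseteq> carrier R" shows "ideal_smult R (genideal R Z) M = gensub Z"
proof
  have "ideal {s \<in> carrier R. \<forall>m\<in>carrier M. s \<odot>\<^bsub>M\<^esub> m \<in> gensub Z} R"
    unfolding R.ideal_iff
    using submodule_zero_mem[OF submodule_gensub[OF Z]] submodule_add_mem[OF submodule_gensub[OF Z]]
      submodule_smult_mem[OF submodule_gensub[OF Z]]
    by (auto simp: smult_l_distr smult_assoc1)
  moreover have "Z \<subseteq> {s \<in> carrier R. \<forall>m\<in>carrier M. s \<odot>\<^bsub>M\<^esub> m \<in> gensub Z}" using gensub_mem[OF Z] Z by blast
  ultimately have "genideal R Z \<subseteq> {s \<in> carrier R. \<forall>m\<in>carrier M. s \<odot>\<^bsub>M\<^esub> m \<in> gensub Z}"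
    unfolding genideal_def by blast
  then show "ideal_smult R (genideal R Z) M \<subseteq> gensub Z"
    unfolding ideal_smult_def submodule_span_def using submodule_gensub[OF Z] by blast
  show "gensub Z \<subseteq> ideal_smult R (genideal R Z) M"
    unfolding ideal_smult_def submodule_span_def
  proof (rule Inter_greatest)
    fix H assume "H \<in> {H. submodule H R M \<and> {s \<odot>\<^bsub>M\<^esub> m | s m. s \<in> genideal R Z \<and> m \<in> carrier M} \<subseteq> H}"
    then have H: "submodule H R M" "{s \<odot>\<^bsub>M\<^esub> m | s m. s \<in> genideal R Z \<and> m \<in> carrier M} \<subseteq> H" by auto
    have "Z \<subseteq> genideal R Z" unfolding genideal_def by blast
    then show "gensub Z \<subseteq> H" using H by (intro gensub_least) auto
  qed
qed

end

section \<open>Graded quotients\<close>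

lemma (in abelian_group) additive_subgroupI_closed:
  assumes "H \<subseteq> carrier G" "\<zero> \<in> H" "\<And>x y. x \<in> H \<Longrightarrow> y \<in> H \<Longrightarrow> x \<oplus> y \<in> H" "\<And>x. x \<in> H \<Longrightarrow> \<ominus> x \<in> H"
  shows "additive_subgroup H G"
  unfolding additive_subgroup_def using assms by unfold_locales (auto simp: a_inv_def[symmetric])

lemma (in module_map) f_finsum:
  assumes "finite F" "\<And>u. u \<in> F \<Longrightarrow> g u \<in> carrier M"
  shows "f (finsum M g F) = finsum M' (\<lambda>u. f (g u)) F"
  using assms
proof (induction F)
  case empty then show ?case using f_zero by simp
next
  case (insert u F)
  have c: "g \<in> F \<rightarrow> carrier M" "g u \<in> carrier M" using insert by auto
  have c': "(\<lambda>u. f (g u)) \<in> F \<rightarrow> carrier M'" "f (g u) \<in> carrier M'" using insert f_closed by auto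
  show ?case
    using insert c c' f_add[of "g u" "finsum M g F"] M1.M.finsum_closed[OF c(1)] by simp
qed

context graded_module
begin

definition qgr :: "'m set \<Rightarrow> ('d \<Rightarrow> nat) \<Rightarrow> 'm set set" where
  "qgr K u = (\<lambda>m. K +> m) ` Mg u"

lemma coset_cp_cong:
  assumes K: "graded_sub K" and x: "x \<in> carrier M" "y \<in> carrier M" and e: "K +> x = K +> y"
  shows "K +> MG.cp x u = K +> MG.cp y u"
proof -
  note Ks = graded_subD(1)[OF K]
  have "x \<ominus> y \<in> K" using SM.coset_mem_iff[OF Ks x] e by simp
  then have "MG.cp (x \<ominus> y) u \<in> K" using graded_subD(2)[OF K] by blast
  then show ?thesis using SM.coset_mem_iff[OF Ks] MG.cp_diff[OF x] x by simp
qed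

text \<open>Components of a coset are taken from a chosen representative. The choice is harmless
  because \<open>K\<close> contains the components of its elements
  (\<open>coset_cp_cong\<close>).\<close>

lemma graded_module_quotient:
  assumes K: "graded_sub K"
  shows "graded_module A \<mm> S Sg (quotient_module M K) (qgr K)"
    and "x \<in> carrier M \<Longrightarrow> hom_comp (quotient_module M K) (qgr K) (K +> x) u = K +> MG.cp x u"
proof -
  note Ks = graded_subD(1)[OF K]
  let ?Q = "quotient_module M K" and ?\<pi> = "\<lambda>x. K +> x"
  interpret q: module_map S M ?Q ?\<pi> using SM.quotient_module_map[OF Ks] .
  have car: "carrier ?Q = ?\<pi> ` carrier M" using SM.carrier_quotient_module .
  have zero: "\<zero>\<^bsub>?Q\<^esub> = K" using SM.quotient_module_simps by simp
  have pi0: "?\<pi> \<zero> = \<zero>\<^bsub>?Q\<^esub>" using q.f_zero .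
  define rep where "rep c = (SOME x. x \<in> carrier M \<and> c = ?\<pi> x)" for c
  have rep: "rep (?\<pi> x) \<in> carrier M" "?\<pi> x = ?\<pi> (rep (?\<pi> x))" if "x \<in> carrier M" for x
    using someI[of "\<lambda>y. y \<in> carrier M \<and> ?\<pi> x = ?\<pi> y" x] that unfolding rep_def by auto
  define p where "p c u = ?\<pi> (MG.cp (rep c) u)" for c u
  have p: "p (?\<pi> x) u = ?\<pi> (MG.cp x u)" if "x \<in> carrier M" for x u
    unfolding p_def using coset_cp_cong[OF K rep(1)[OF that] that rep(2)[OF that, symmetric]] .
  have ag: "abelian_group ?Q" by (rule q.M2.M.abelian_group_axioms)
  have D: "additive_subgroup (qgr K u) ?Q" for u
  proof (rule q.M2.M.additive_subgroupI_closed)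
    show "qgr K u \<subseteq> carrier ?Q" unfolding qgr_def car using Mg_carrier by blast
    have "?\<pi> \<zero> \<in> qgr K u" unfolding qgr_def using MG.D_zero by blast
    then show "\<zero>\<^bsub>?Q\<^esub> \<in> qgr K u" using pi0 by simp
  next
    fix a b assume "a \<in> qgr K u" "b \<in> qgr K u"
    then obtain x y where xy: "x \<in> Mg u" "y \<in> Mg u" "a = ?\<pi> x" "b = ?\<pi> y" unfolding qgr_def by blast
    then have "a \<oplus>\<^bsub>?Q\<^esub> b = ?\<pi> (x \<oplus> y)" using q.f_add Mg_carrier by simp
    then show "a \<oplus>\<^bsub>?Q\<^esub> b \<in> qgr K u" unfolding qgr_def using MG.D_add[OF xy(1,2)] by blast
  next
    fix a assume "a \<in> qgr K u"
    then obtain x where x: "x \<in> Mg u" "a = ?\<pi> x" unfolding qgr_def by blast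
    then have "\<ominus>\<^bsub>?Q\<^esub> a = ?\<pi> (\<ominus> x)" using q.f_neg[OF Mg_carrier[OF x(1)]] by simp
    then show "\<ominus>\<^bsub>?Q\<^esub> a \<in> qgr K u" unfolding qgr_def using MG.D_neg[OF x(1)] by blast
  qed
  have pm: "p c u \<in> qgr K u" if c: "c \<in> carrier ?Q" for c u
  proof -
    obtain x where x: "x \<in> carrier M" "c = ?\<pi> x" using c unfolding car by blast
    have "?\<pi> (MG.cp x u) \<in> qgr K u" unfolding qgr_def by (rule imageI[OF MG.cp_props(1)[OF x(1)]])
    then show ?thesis using p[OF x(1), of u] x(2) by simp
  qed
  have pa: "p (c \<oplus>\<^bsub>?Q\<^esub> d) u = p c u \<oplus>\<^bsub>?Q\<^esub> p d u" if cd: "c \<in> carrier ?Q" "d \<in> carrier ?Q" for c d u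
  proof -
    obtain x y where x: "x \<in> carrier M" "c = ?\<pi> x" "y \<in> carrier M" "d = ?\<pi> y" using cd unfolding car by blast
    have "c \<oplus>\<^bsub>?Q\<^esub> d = ?\<pi> (x \<oplus> y)" unfolding x(2,4) using x q.f_add by simp
    then have "p (c \<oplus>\<^bsub>?Q\<^esub> d) u = ?\<pi> (MG.cp (x \<oplus> y) u)" using x p[of "x \<oplus> y" u] by simp
    also have "\<dots> = ?\<pi> (MG.cp x u) \<oplus>\<^bsub>?Q\<^esub> ?\<pi> (MG.cp y u)" using x q.f_add[of "MG.cp x u" "MG.cp y u"] by (simp add: MG.cp_add)
    also have "\<dots> = p c u \<oplus>\<^bsub>?Q\<^esub> p d u" using x p by simp
    finally show ?thesis .
  qed
  have ph: "p c v = (if v = u then c else \<zero>\<^bsub>?Q\<^esub>)" if c: "c \<in> qgr K u" for c u v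
  proof -
    obtain x where x: "x \<in> Mg u" "c = ?\<pi> x" using c unfolding qgr_def by blast
    show ?thesis unfolding x(2) p[OF Mg_carrier[OF x(1)]] MG.cp_hom[OF x(1)] using pi0 by simp
  qed
  have pf: "finite {u. p c u \<noteq> \<zero>\<^bsub>?Q\<^esub>}" and ps: "c = finsum ?Q (p c) {u. p c u \<noteq> \<zero>\<^bsub>?Q\<^esub>}" if c: "c \<in> carrier ?Q" for c
  proof -
    obtain x where x: "x \<in> carrier M" "c = ?\<pi> x" using c unfolding car by blast
    let ?F = "{u. MG.cp x u \<noteq> \<zero>}"
    have F: "finite ?F" using MG.cp_props(2)[OF x(1)] .
    have z: "p c u = \<zero>\<^bsub>?Q\<^esub>" if "u \<notin> ?F" for u unfolding x(2) p[OF x(1)] using that pi0 by simp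
    have "{u. p c u \<noteq> \<zero>\<^bsub>?Q\<^esub>} \<subseteq> ?F" using z by blast
    then show "finite {u. p c u \<noteq> \<zero>\<^bsub>?Q\<^esub>}" using F finite_subset by blast
    have "finsum ?Q (p c) {u. p c u \<noteq> \<zero>\<^bsub>?Q\<^esub>} = finsum ?Q (p c) ?F"
    proof (rule q.M2.M.finsum_support[OF F _ z])
      show "p c u \<in> carrier ?Q" for u unfolding x(2) p[OF x(1)] using q.f_closed x(1) by simp
    qed
    also have "finsum ?Q (p c) ?F = finsum ?Q (\<lambda>u. ?\<pi> (MG.cp x u)) ?F"
    proof -
      have "p c = (\<lambda>u. ?\<pi> (MG.cp x u))" unfolding x(2) using p[OF x(1)] by (intro ext)
      then show ?thesis by (simp only:)
    qed
    also have "finsum ?Q (\<lambda>u. ?\<pi> (MG.cp x u)) ?F = ?\<pi> (finsum M (MG.cp x) ?F)"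
      by (rule q.f_finsum[symmetric, OF F]) (use x(1) in simp)
    also have "\<dots> = c" unfolding MG.cp_props(3)[OF x(1), symmetric] x(2) ..
    finally show "c = finsum ?Q (p c) {u. p c u \<noteq> \<zero>\<^bsub>?Q\<^esub>}" by (rule sym)
  qed
  note dec = direct_sum_decompI[where p = p, OF ag D pm pa ph pf ps]
  obtain W where W: "finite W" "W \<subseteq> carrier M" "submodule_span S M W = carrier M"
    using fg unfolding fg_multigraded_module_def finitely_generated_module_def by blast
  have "submodule_span S ?Q (?\<pi> ` W) = carrier ?Q"
  proof
    show "submodule_span S ?Q (?\<pi> ` W) \<subseteq> carrier ?Q"
      unfolding submodule_span_def using q.M2.carrier_is_submodule W(2) car by blast
    show "carrier ?Q \<subseteq> submodule_span S ?Q (?\<pi> ` W)"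
      unfolding submodule_span_def
    proof (rule Inter_greatest)
      fix H assume "H \<in> {H. submodule H S ?Q \<and> ?\<pi> ` W \<subseteq> H}"
      then have H: "submodule H S ?Q" "?\<pi> ` W \<subseteq> H" by auto
      have "submodule {x \<in> carrier M. ?\<pi> x \<in> H} S M" using q.submodule_preimage[OF SM.carrier_is_submodule H(1)] .
      moreover have "W \<subseteq> {x \<in> carrier M. ?\<pi> x \<in> H}" using W(2) H(2) by blast
      ultimately have "carrier M \<subseteq> {x \<in> carrier M. ?\<pi> x \<in> H}" using W(3) unfolding submodule_span_def by blast
      then show "carrier ?Q \<subseteq> H" unfolding car by blast
    qed
  qed
  then have fgQ: "finitely_generated_module S ?Q"
    unfolding finitely_generated_module_def using q.M2.module_axioms W(1,2) car
    by (intro conjI exI[of _ "?\<pi> ` W"]) auto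
  have "\<forall>u v. \<forall>s\<in>Sg u. \<forall>m\<in>qgr K v. s \<odot>\<^bsub>?Q\<^esub> m \<in> qgr K (\<lambda>i. u i + v i)"
  proof (intro allI ballI)
    fix u v s m assume s: "s \<in> Sg u" and m: "m \<in> qgr K v"
    obtain x where x: "x \<in> Mg v" "m = ?\<pi> x" using m unfolding qgr_def by blast
    have "s \<odot>\<^bsub>?Q\<^esub> m = ?\<pi> (s \<odot> x)" using x q.f_smult[OF Sg_carrier[OF s] Mg_carrier[OF x(1)]] by simp
    then show "s \<odot>\<^bsub>?Q\<^esub> m \<in> qgr K (\<lambda>i. u i + v i)" unfolding qgr_def using Mg_smult[OF s x(1)] by blast
  qed
  then show "graded_module A \<mm> S Sg ?Q (qgr K)"
    by (intro graded_module.intro graded_algebra_axioms graded_module_axioms.intro)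
      (use fgQ dec(1) in \<open>simp add: fg_multigraded_module_def\<close>)
  show "x \<in> carrier M \<Longrightarrow> hom_comp ?Q (qgr K) (?\<pi> x) u = ?\<pi> (MG.cp x u)"
    using dec(2)[of "?\<pi> x"] p car by auto
qed

lemma quotient_map_A:
  assumes K: "graded_sub K"
  shows "module_map A Vm (restrict_scalars S (quotient_module M K)) (\<lambda>x. K +> x)"
proof -
  interpret Q: graded_module A \<mm> S Sg "quotient_module M K" "qgr K" using graded_module_quotient(1)[OF K] .
  interpret q: module_map S M "quotient_module M K" "\<lambda>x. K +> x" using SM.quotient_module_map[OF graded_subD(1)[OF K]] .
  show ?thesis
    by (intro module_map.intro AM.module_axioms Q.AM.module_axioms module_map_axioms.intro)
      (use q.f_closed q.f_add q.f_smult in auto)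
qed

lemma len_quotient:
  assumes K: "graded_sub K" and L: "submodule L A Vm"
  shows "rel_length A (restrict_scalars S (quotient_module M K)) {\<zero>\<^bsub>quotient_module M K\<^esub>} ((\<lambda>x. K +> x) ` L) = len (K \<inter> L) L"
proof -
  note Ks = graded_subD(1)[OF K]
  interpret q: module_map A Vm "restrict_scalars S (quotient_module M K)" "\<lambda>x. K +> x" using quotient_map_A[OF K] .
  have z: "\<zero>\<^bsub>quotient_module M K\<^esub> = K" using SM.quotient_module_simps by simp
  have sz: "submodule {K} A (restrict_scalars S (quotient_module M K))" using q.M2.submodule_zero z by simp
  have sL: "submodule ((\<lambda>x. K +> x) ` L) A (restrict_scalars S (quotient_module M K))" using q.submodule_image[OF L] .
  have "{x \<in> L. K +> x \<in> {K}} = K \<inter> L"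
    using SM.coset_zero_iff[OF Ks] AM.submodule_subset[OF L] by auto
  moreover have "K \<in> (\<lambda>x. K +> x) ` L" using q.M2.submodule_zero_mem[OF sL] z by simp
  then have "{K} <+>\<^bsub>restrict_scalars S (quotient_module M K)\<^esub> ((\<lambda>x. K +> x) ` L) = (\<lambda>x. K +> x) ` L"
    using q.M2.set_add_upper2[OF sz sL] q.M2.set_add_least[OF sL _ subset_refl, of "{K}"] by auto
  ultimately show ?thesis using q.rel_length_preimage[OF L sz] z by simp
qed

definition ev_inj_mod :: "'m set \<Rightarrow> 's \<Rightarrow> bool" where
  "ev_inj_mod K x \<longleftrightarrow> large (\<lambda>n. \<forall>m\<in>Mg n. x \<odot> m \<in> K \<longrightarrow> m \<in> K)"

lemma ev_inj_quotient_iff: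
  assumes K: "graded_sub K" and x: "x \<in> carrier S"
  shows "graded_module.ev_inj (quotient_module M K) (qgr K) x \<longleftrightarrow> ev_inj_mod K x"
proof -
  note Ks = graded_subD(1)[OF K]
  interpret Q: graded_module A \<mm> S Sg "quotient_module M K" "qgr K" using graded_module_quotient(1)[OF K] .
  have z: "\<zero>\<^bsub>quotient_module M K\<^esub> = K" using SM.quotient_module_simps by simp
  have "(\<forall>m\<in>qgr K n. x \<odot>\<^bsub>quotient_module M K\<^esub> m = K \<longrightarrow> m = K) \<longleftrightarrow> (\<forall>m\<in>Mg n. x \<odot> m \<in> K \<longrightarrow> m \<in> K)" for n
  proof -
    have "x \<odot>\<^bsub>quotient_module M K\<^esub> (K +> m) = K \<longleftrightarrow> x \<odot> m \<in> K" "K +> m = K \<longleftrightarrow> m \<in> K" if "m \<in> Mg n" for m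
      using SM.coset_smult[OF Ks x Mg_carrier[OF that]] SM.coset_zero_iff[OF Ks] x Mg_carrier[OF that] by simp_all
    then show ?thesis unfolding qgr_def by auto
  qed
  then show ?thesis unfolding Q.ev_inj_def ev_inj_mod_def z by simp
qed

lemma exists_ev_inj_mod:
  assumes "infinite (carrier (A Quot \<mm>))" "graded_sub K"
  shows "\<exists>x\<in>Sg (unit_deg i). ev_inj_mod K x"
proof -
  interpret Q: graded_module A \<mm> S Sg "quotient_module M K" "qgr K" using graded_module_quotient(1)[OF assms(2)] .
  show ?thesis using Q.exists_ev_inj_unit[OF assms(1)] ev_inj_quotient_iff[OF assms(2)] Sg_carrier by blast
qed

section \<open>Hilbert functions\<close>

text \<open>The Hilbert function of \<open>M / K\<close>, whose component of degree \<open>n\<close>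
  is \<open>M_n / (K \<inter> M_n)\<close>. That the length is finite is shown in the lemma of the
  same name.\<close>

definition hilb :: "'m set \<Rightarrow> ('d \<Rightarrow> nat) \<Rightarrow> nat" where
  "hilb K n = the_enat (len (K \<inter> Mg n) (Mg n))"

lemma hilb:
  assumes K: "submodule K S M" shows "len (K \<inter> Mg n) (Mg n) = enat (hilb K n)"
proof -
  have "len (K \<inter> Mg n) (Mg n) \<le> len {\<zero>} (Mg n)"
    using SM.submodule_zero_mem[OF K] by (intro rel_length_mono) auto
  then have "len (K \<inter> Mg n) (Mg n) \<noteq> \<infinity>" using Mg_finite_length by (metis enat_ord_simps(5))
  then show ?thesis unfolding hilb_def by auto
qed

definition scaled :: "'s \<Rightarrow> 'm set" where
  "scaled x = (\<lambda>m. x \<odot> m) ` carrier M"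

lemma graded_sub_scaled:
  assumes x: "x \<in> Sg v" shows "graded_sub (scaled x)"
proof -
  have xc: "x \<in> carrier S" using Sg_carrier[OF x] .
  have "submodule (scaled x) S M" unfolding SM.submodule_iff
  proof (intro conjI ballI)
    show "scaled x \<subseteq> carrier M" unfolding scaled_def using xc by auto
    have "\<zero> = x \<odot> \<zero>" using xc by simp
    then show "\<zero> \<in> scaled x" unfolding scaled_def by blast
    fix a b assume "a \<in> scaled x" "b \<in> scaled x"
    then obtain m n where mn: "m \<in> carrier M" "n \<in> carrier M" "a = x \<odot> m" "b = x \<odot> n" unfolding scaled_def by blast
    then have "a \<oplus> b = x \<odot> (m \<oplus> n)" using xc by (simp add: SM.smult_r_distr)
    then show "a \<oplus> b \<in> scaled x" unfolding scaled_def using mn by simp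
  next
    fix s a assume s: "s \<in> carrier S" and "a \<in> scaled x"
    then obtain m where m: "m \<in> carrier M" "a = x \<odot> m" unfolding scaled_def by blast
    have "s \<odot> a = x \<odot> (s \<odot> m)" unfolding m(2) by (rule SM.smult_commute[OF s xc m(1)])
    then show "s \<odot> a \<in> scaled x" unfolding scaled_def using s m(1) by simp
  qed
  moreover have "MG.cp a u \<in> scaled x" if a: "a \<in> scaled x" for a u
  proof -
    obtain m where m: "m \<in> carrier M" "a = x \<odot> m" using a unfolding scaled_def by blast
    show ?thesis
    proof (cases "u \<in> range (\<lambda>u i. v i + u i)")
      case True
      then obtain u' where "u = (\<lambda>i. v i + u' i)" by blast
      then have "MG.cp a u = x \<odot> MG.cp m u'" unfolding m(2) using cp_smult_hom(1)[OF x m(1)] by simp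
      then show ?thesis unfolding scaled_def using m(1) by simp
    next
      case False
      then have "MG.cp a u = \<zero>" unfolding m(2) using cp_smult_hom(2)[OF x m(1)] by simp
      then show ?thesis using calculation SM.submodule_zero_mem by simp
    qed
  qed
  ultimately show ?thesis unfolding graded_sub_def by blast
qed

lemma scaled_mem: "m \<in> carrier M \<Longrightarrow> x \<odot> m \<in> scaled x"
  unfolding scaled_def by blast

lemma mult_map_A:
  assumes "x \<in> carrier S" shows "module_map A Vm Vm (\<lambda>m. x \<odot> m)"
  by (intro module_map.intro AM.module_axioms module_map_axioms.intro)
    (use assms SM.smult_commute[OF assms] in \<open>auto simp: SM.smult_r_distr\<close>)

text \<open>Multiplication by \<open>x\<close> maps \<open>(M/K)_(n - e_i)\<close> to
  \<open>(M/K)_n\<close>, injectively in large degrees, and its cokernel is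
  \<open>(M/(K + x M))_n\<close>. Integers avoid truncated subtraction.\<close>

lemma hilb_quotient_step:
  assumes K: "graded_sub K" and x: "x \<in> Sg (unit_deg i)" and ei: "ev_inj_mod K x"
  shows "large (\<lambda>n. int (hilb (K <+>\<^bsub>M\<^esub> scaled x) n) = int (hilb K n) - int (hilb K (n(i := n i - 1))))"
proof -
  note Ks = graded_subD(1)[OF K]
  have xc: "x \<in> carrier S" using Sg_carrier[OF x] .
  let ?K = "K <+>\<^bsub>M\<^esub> scaled x"
  have K': "graded_sub ?K" using graded_sub_set_add[OF K graded_sub_scaled[OF x]] .
  have KK': "K \<subseteq> ?K" using SM.set_add_upper1[OF Ks graded_subD(1)[OF graded_sub_scaled[OF x]]] .
  obtain N where N: "\<And>n m. (\<forall>i. N \<le> n i) \<Longrightarrow> m \<in> Mg n \<Longrightarrow> x \<odot> m \<in> K \<Longrightarrow> m \<in> K"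
    using ei unfolding ev_inj_mod_def large_def by blast
  interpret f: module_map A Vm Vm "\<lambda>m. x \<odot> m" using mult_map_A[OF xc] .
  show ?thesis
  \<comment> \<open>One more than \<open>N\<close>, since injectivity is applied in the source
    degree, which is lower by one at \<open>i\<close>.\<close>
  proof (rule largeI[of "N + 1"])
    fix n :: "'d \<Rightarrow> nat" assume n: "\<And>j. N + 1 \<le> n j"
    let ?n = "n(i := n i - 1)"
    have ni: "0 < n i" using n[of i] by simp
    have nn: "\<forall>j. N \<le> ?n j"
    proof
      fix j show "N \<le> ?n j" using n[of j] by auto
    qed
    have dn: "(\<lambda>j. unit_deg i j + ?n j) = n" using fun_upd_plus_unit_deg[of n i, OF ni] by (simp add: add.commute)
    have xM: "x \<odot> m \<in> Mg n" if "m \<in> Mg ?n" for m using Mg_smult[OF x that] unfolding dn .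
    have sKn: "submodule (K \<inter> Mg n) A Vm" using AM.submodule_Int[OF A_submodule_if_S_submodule[OF Ks] A_submodule_Mg] .
    have sKn': "submodule (?K \<inter> Mg n) A Vm" using AM.submodule_Int[OF A_submodule_if_S_submodule[OF graded_subD(1)[OF K']] A_submodule_Mg] .
    have 1: "{m \<in> Mg ?n. x \<odot> m \<in> K \<inter> Mg n} = K \<inter> Mg ?n"
    proof
      show "{m \<in> Mg ?n. x \<odot> m \<in> K \<inter> Mg n} \<subseteq> K \<inter> Mg ?n" using N[OF nn] by blast
      show "K \<inter> Mg ?n \<subseteq> {m \<in> Mg ?n. x \<odot> m \<in> K \<inter> Mg n}" using xM SM.submodule_smult_mem[OF Ks xc] by blast
    qed
    have 2: "(K \<inter> Mg n) <+>\<^bsub>M\<^esub> (\<lambda>m. x \<odot> m) ` Mg ?n = ?K \<inter> Mg n"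
    proof
      have "(\<lambda>m. x \<odot> m) ` Mg ?n \<subseteq> ?K \<inter> Mg n"
        using xM SM.set_add_upper2[OF Ks graded_subD(1)[OF graded_sub_scaled[OF x]]] scaled_mem Mg_carrier by blast
      then show "(K \<inter> Mg n) <+>\<^bsub>M\<^esub> (\<lambda>m. x \<odot> m) ` Mg ?n \<subseteq> ?K \<inter> Mg n"
        using AM.set_add_least[OF sKn', of "K \<inter> Mg n"] KK' by auto
      show "?K \<inter> Mg n \<subseteq> (K \<inter> Mg n) <+>\<^bsub>M\<^esub> (\<lambda>m. x \<odot> m) ` Mg ?n"
      proof
        fix y assume y: "y \<in> ?K \<inter> Mg n"
        then have "y \<in> ?K" by blast
        then obtain k z where kz: "k \<in> K" "z \<in> scaled x" "y = k \<oplus> z" unfolding SM.set_add_iff by blast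
        obtain m where m: "m \<in> carrier M" "z = x \<odot> m" using kz(2) unfolding scaled_def by blast
        have kc: "k \<in> carrier M" using kz(1) SM.submodule_subset[OF Ks] by blast
        have "MG.cp z n = x \<odot> MG.cp m ?n"
          unfolding m(2) using cp_smult_hom(1)[OF x m(1), of ?n] unfolding dn .
        moreover have "y = MG.cp y n" using MG.cp_self y by simp
        then have "y = MG.cp k n \<oplus> MG.cp z n" using kz kc m xc MG.cp_add by simp
        moreover have "MG.cp k n \<in> K \<inter> Mg n" using graded_subD(2)[OF K kz(1)] MG.cp_props(1)[OF kc] by blast
        moreover have "MG.cp m ?n \<in> Mg ?n" using MG.cp_props(1)[OF m(1)] .
        ultimately show "y \<in> (K \<inter> Mg n) <+>\<^bsub>M\<^esub> (\<lambda>m. x \<odot> m) ` Mg ?n" unfolding SM.set_add_iff by blast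
      qed
    qed
    have e1: "len (K \<inter> Mg ?n) (Mg ?n) = len (K \<inter> Mg n) (?K \<inter> Mg n)"
      using f.rel_length_preimage[OF A_submodule_Mg[of ?n] sKn] 1 2 by simp
    have e2: "len (K \<inter> Mg n) (Mg n) = len (K \<inter> Mg n) (?K \<inter> Mg n) + len (?K \<inter> Mg n) (Mg n)"
      by (rule AM.rel_length_add[OF sKn sKn' A_submodule_Mg]) (use KK' in auto)
    have "enat (hilb K n) = enat (hilb K ?n) + enat (hilb ?K n)"
      using e1 e2 hilb[OF Ks] hilb[OF graded_subD(1)[OF K']] by metis
    then show "int (hilb ?K n) = int (hilb K n) - int (hilb K ?n)" by simp
  qed
qed

text \<open>Take a maximal counterexample \<open>K\<close> and a filter-regular \<open>x i\<close>
  modulo \<open>K\<close> in every direction. If some \<open>x i\<close> carries \<open>M\<close>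
  into \<open>K\<close>, injectivity forces \<open>Mg n \<subseteq> K\<close> for large
  \<open>n\<close>. Otherwise every \<open>K + x_i M\<close> is strictly larger, so all backward
  differences are eventually polynomial and can be integrated.\<close>

theorem hilb_eventually_polyfun:
  assumes inf: "infinite (carrier (A Quot \<mm>))" and K: "graded_sub K"
  shows "\<exists>g. polyfun g \<and> large (\<lambda>n. of_nat (hilb K n) = g n)"
proof (rule ccontr)
  assume n: "\<not> ?thesis"
  define bad where "bad K \<longleftrightarrow> graded_sub K \<and> \<not> (\<exists>g. polyfun g \<and> large (\<lambda>n. of_nat (hilb K n) = g n))" for K
  have "bad K" unfolding bad_def using n K by blast
  then have ne: "Collect bad \<noteq> {}" by blast
  have sub: "submodule K' S M" if "K' \<in> Collect bad" for K' using that unfolding bad_def graded_sub_def by blast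
  obtain K where K0: "K \<in> Collect bad" "\<forall>K'\<in>Collect bad. K \<subseteq> K' \<longrightarrow> K' = K"
    using exists_maximal_submodule[OF ne sub] by blast
  have mx: "K' = K" if "bad K'" "K \<subseteq> K'" for K' using K0(2) that by blast
  have bK: "bad K" using K0(1) by blast
  note K = bK mx
  have Kg: "graded_sub K" using K(1) unfolding bad_def by blast
  note Ks = graded_subD(1)[OF Kg]
  obtain x where x: "\<And>i. x i \<in> Sg (unit_deg i)" "\<And>i. ev_inj_mod K (x i)"
    using exists_ev_inj_mod[OF inf Kg] by metis
  have "\<exists>g. polyfun g \<and> large (\<lambda>n. of_nat (hilb K n) = g n)"
  proof (cases "\<exists>i. scaled (x i) \<subseteq> K")
    case True
    then obtain i where i: "scaled (x i) \<subseteq> K" by blast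
    have "large (\<lambda>n. of_nat (hilb K n) = (0::rat))"
      using x(2)[of i] unfolding ev_inj_mod_def
    proof (rule large_mono)
      fix n assume h: "\<forall>m\<in>Mg n. x i \<odot> m \<in> K \<longrightarrow> m \<in> K"
      have "Mg n \<subseteq> K" using h i scaled_mem Mg_carrier by blast
      then have "K \<inter> Mg n = Mg n" by blast
      then show "of_nat (hilb K n) = (0::rat)" unfolding hilb_def by (simp add: zero_enat_def)
    qed
    then show ?thesis using polyfun_zero by blast
  next
    case False
    have "\<exists>g. polyfun g \<and> large (\<lambda>n. of_nat (hilb (K <+>\<^bsub>M\<^esub> scaled (x i)) n) = g n)" for i
    proof (rule ccontr)
      assume n: "\<not> ?thesis"
      have gs: "graded_sub (scaled (x i))" using graded_sub_scaled[OF x(1)] .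
      have "bad (K <+>\<^bsub>M\<^esub> scaled (x i))" unfolding bad_def using n graded_sub_set_add[OF Kg gs] by blast
      then have "K <+>\<^bsub>M\<^esub> scaled (x i) = K" using K(2) SM.set_add_upper1[OF Ks graded_subD(1)[OF gs]] by blast
      then show False using SM.set_add_upper2[OF Ks graded_subD(1)[OF gs]] False by blast
    qed
    then obtain Q where Q: "\<And>i. polyfun (Q i)" "\<And>i. large (\<lambda>n. of_nat (hilb (K <+>\<^bsub>M\<^esub> scaled (x i)) n) = Q i n)" by metis
    show ?thesis
    proof (rule eventually_polyfun_if_differences[OF Q(1)])
      fix i
      show "large (\<lambda>n. of_nat (hilb K n) - of_nat (hilb K (n(i := n i - 1))) = Q i n)"
        using large_conj[OF Q(2)[of i] hilb_quotient_step[OF Kg x(1,2)[of i]]]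
      proof (rule large_mono)
        fix n assume h: "of_nat (hilb (K <+>\<^bsub>M\<^esub> scaled (x i)) n) = Q i n \<and>
          int (hilb (K <+>\<^bsub>M\<^esub> scaled (x i)) n) = int (hilb K n) - int (hilb K (n(i := n i - 1)))"
        then have "(of_int (int (hilb (K <+>\<^bsub>M\<^esub> scaled (x i)) n)) :: rat) = of_int (int (hilb K n) - int (hilb K (n(i := n i - 1))))"
          by simp
        then show "of_nat (hilb K n) - of_nat (hilb K (n(i := n i - 1))) = Q i n" using h by simp
      qed
    qed
  qed
  then show False using K(1) unfolding bad_def by blast
qed

lemma is_hilbert_poly_iff:
  "is_hilbert_poly A S M Mg c \<longleftrightarrow> finite {u. c u \<noteq> 0} \<and> large (\<lambda>n. of_nat (hilb {\<zero>} n) = mpoly_eval c n)"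
proof -
  have e: "module_length A (Vm\<lparr>carrier := Mg n\<rparr>) = enat (hilb {\<zero>} n)" for n
  proof -
    have "{\<zero>} \<inter> Mg n = {\<zero>}" using MG.D_zero by blast
    then show ?thesis using AM.module_length_sub[OF A_submodule_Mg, of n] hilb[OF SM.submodule_zero, of n] by simp
  qed
  show ?thesis unfolding is_hilbert_poly_def large_def e by auto
qed

abbreviation "gensub \<equiv> SM.gensub"

lemmas submodule_gensub = SM.submodule_gensub
lemmas gensub_mem = SM.gensub_mem
lemmas gensub_least = SM.gensub_least
lemmas ideal_smult_genideal = SM.ideal_smult_genideal

lemma gensub_empty: "gensub {} = {\<zero>}"
proof
  show "gensub {} \<subseteq> {\<zero>}" by (rule gensub_least[OF SM.submodule_zero]) auto
  show "{\<zero>} \<subseteq> gensub {}" using SM.submodule_zero_mem[OF submodule_gensub[of "{}"]] by simp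
qed

lemma gensub_insert:
  assumes Z: "Z \<subseteq> carrier S" and x: "x \<in> Sg v"
  shows "gensub (insert x Z) = gensub Z <+>\<^bsub>M\<^esub> scaled x"
proof
  have xc: "x \<in> carrier S" using Sg_carrier[OF x] .
  have Z': "insert x Z \<subseteq> carrier S" using Z xc by blast
  note s1 = submodule_gensub[OF Z] and s2 = graded_subD(1)[OF graded_sub_scaled[OF x]]
  show "gensub (insert x Z) \<subseteq> gensub Z <+>\<^bsub>M\<^esub> scaled x"
    by (rule gensub_least[OF SM.submodule_set_add[OF s1 s2]])
      (use SM.set_add_upper1[OF s1 s2] SM.set_add_upper2[OF s1 s2] gensub_mem[OF Z] scaled_mem in blast)
  show "gensub Z <+>\<^bsub>M\<^esub> scaled x \<subseteq> gensub (insert x Z)"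
  proof (rule SM.set_add_least[OF submodule_gensub[OF Z']])
    show "gensub Z \<subseteq> gensub (insert x Z)" by (rule gensub_least[OF submodule_gensub[OF Z']]) (use gensub_mem[OF Z'] in blast)
    show "scaled x \<subseteq> gensub (insert x Z)" unfolding scaled_def using gensub_mem[OF Z'] by blast
  qed
qed

lemma graded_sub_gensub:
  assumes "finite Z" "\<And>x. x \<in> Z \<Longrightarrow> \<exists>v. x \<in> Sg v" shows "graded_sub (gensub Z)"
  using assms
proof (induction Z)
  case empty then show ?case using gensub_empty graded_sub_zero by simp
next
  case (insert x Z)
  obtain v where v: "x \<in> Sg v" using insert by blast
  have "Z \<subseteq> carrier S" using insert.prems Sg_carrier by blast
  from gensub_insert[OF this v] show ?case
    using graded_sub_set_add[OF insert.IH graded_sub_scaled[OF v]] insert.prems by simp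
qed

end

section \<open>Diagonal subrings and submodules\<close>

lemma diagonal_simps [simp]:
  "carrier (diagonal G D) = graded_sum G D (range diag_deg)" "x \<oplus>\<^bsub>diagonal G D\<^esub> y = x \<oplus>\<^bsub>G\<^esub> y"
  "\<zero>\<^bsub>diagonal G D\<^esub> = \<zero>\<^bsub>G\<^esub>" "x \<otimes>\<^bsub>diagonal G D\<^esub> y = x \<otimes>\<^bsub>G\<^esub> y" "\<one>\<^bsub>diagonal G D\<^esub> = \<one>\<^bsub>G\<^esub>"
  by (simp_all add: diagonal_def)

lemma diagonal_smult [simp]: "s \<odot>\<^bsub>diagonal M D\<^esub> x = s \<odot>\<^bsub>M\<^esub> x"
  by (simp add: diagonal_def)

lemma diagonal_pow [simp]: "x [^]\<^bsub>diagonal G D\<^esub> (n::nat) = x [^]\<^bsub>G\<^esub> n"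
  by (induction n) (simp_all add: nat_pow_def diagonal_def)

lemma diag_deg_add: "(\<lambda>i. diag_deg a i + diag_deg b i) = diag_deg (a + b)"
  by (simp add: diag_deg_def)

lemma diag_deg_inj: "diag_deg a = (diag_deg b :: 'd \<Rightarrow> nat) \<longleftrightarrow> a = b"
  by (auto simp: diag_deg_def fun_eq_iff)

lemma diag_deg_zero: "diag_deg 0 = (\<lambda>_. 0)"
  by (simp add: diag_deg_def)

locale multigraded_group = graded_group G D
  for G :: "('b, 'k) ring_scheme" (structure) and D :: "('d::finite \<Rightarrow> nat) \<Rightarrow> 'b set"
begin

abbreviation "Gdiag \<equiv> graded_sum G D (range diag_deg)"

lemma Gdiag_carrier: "x \<in> Gdiag \<Longrightarrow> x \<in> carrier G"
  unfolding graded_sum_iff by blast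

lemma Gdiag_hom: "x \<in> D (diag_deg j) \<Longrightarrow> x \<in> Gdiag"
  by (rule graded_sum_hom) auto

lemma Gdiag_zero: "\<zero> \<in> Gdiag"
  unfolding graded_sum_iff by simp

lemma Gdiag_add: "x \<in> Gdiag \<Longrightarrow> y \<in> Gdiag \<Longrightarrow> x \<oplus> y \<in> Gdiag"
  unfolding graded_sum_iff by (simp add: cp_add)

lemma Gdiag_neg: "x \<in> Gdiag \<Longrightarrow> \<ominus> x \<in> Gdiag"
  unfolding graded_sum_iff by (simp add: cp_neg)

lemma abelian_group_diagonal: "abelian_group (diagonal G D)"
proof (rule abelian_groupI)
  fix x assume "x \<in> carrier (diagonal G D)"
  then show "\<exists>y\<in>carrier (diagonal G D). y \<oplus>\<^bsub>diagonal G D\<^esub> x = \<zero>\<^bsub>diagonal G D\<^esub>"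
    using Gdiag_neg[of x] Gdiag_carrier[of x] by (intro bexI[of _ "\<ominus> x"]) (auto simp: l_neg)
qed (auto simp: Gdiag_add Gdiag_zero Gdiag_carrier a_ac)

lemma Gdiag_induct:
  assumes "x \<in> Gdiag" "P \<zero>" "\<And>j y. y \<in> D (diag_deg j) \<Longrightarrow> P y"
    "\<And>x y. \<lbrakk>x \<in> carrier G; y \<in> carrier G; P x; P y\<rbrakk> \<Longrightarrow> P (x \<oplus> y)"
  shows "P x"
  by (rule graded_sum_induct[where P = P, OF assms(1,2)]) (use assms(3,4) in auto)

end

context graded_algebra
begin

sublocale SG: multigraded_group S Sg by unfold_locales

abbreviation Rd where "Rd \<equiv> diagonal S Sg"

lemma Gdiag_mult: 
  assumes "x \<in> SG.Gdiag" "y \<in> SG.Gdiag" shows "x \<otimes> y \<in> SG.Gdiag"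
proof (rule SG.Gdiag_induct[where P = "\<lambda>x. x \<otimes> y \<in> SG.Gdiag", OF assms(1)])
  have yc: "y \<in> carrier S" using SG.Gdiag_carrier assms by blast
  show "\<zero> \<otimes> y \<in> SG.Gdiag" using SG.Gdiag_zero yc by simp
  show "(a \<oplus> b) \<otimes> y \<in> SG.Gdiag" if "a \<in> carrier S" "b \<in> carrier S" "a \<otimes> y \<in> SG.Gdiag" "b \<otimes> y \<in> SG.Gdiag" for a b
    using SG.Gdiag_add[OF that(3,4)] S.l_distr[OF that(1,2) yc] by simp
  fix j s assume s: "s \<in> Sg (diag_deg j)"
  have sc: "s \<in> carrier S" using Sg_carrier s by blast
  show "s \<otimes> y \<in> SG.Gdiag"
  proof (rule SG.Gdiag_induct[where P = "\<lambda>y. s \<otimes> y \<in> SG.Gdiag", OF assms(2)])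
    show "s \<otimes> \<zero> \<in> SG.Gdiag" using SG.Gdiag_zero sc by simp
    show "s \<otimes> (a \<oplus> b) \<in> SG.Gdiag" if "a \<in> carrier S" "b \<in> carrier S" "s \<otimes> a \<in> SG.Gdiag" "s \<otimes> b \<in> SG.Gdiag" for a b
      using SG.Gdiag_add[OF that(3,4)] S.r_distr[OF that(1,2) sc] by simp
    fix k t assume "t \<in> Sg (diag_deg k)"
    then show "s \<otimes> t \<in> SG.Gdiag" using SG.Gdiag_hom Sg_mult[OF s, of t "diag_deg k"] unfolding diag_deg_add by blast
  qed
qed

lemma one_Gdiag: "\<one> \<in> SG.Gdiag"
  by (rule SG.Gdiag_hom[of _ 0]) (simp add: diag_deg_zero one_Sg)

lemma cring_diagonal: "cring Rd"
proof (rule cringI)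
  show "abelian_group Rd" by (rule SG.abelian_group_diagonal)
  show "comm_monoid Rd"
    by (rule comm_monoidI) (auto simp: Gdiag_mult one_Gdiag SG.Gdiag_carrier S.m_ac)
qed (auto simp: SG.Gdiag_carrier S.l_distr)

sublocale Rd: cring "diagonal S Sg" by (rule cring_diagonal)

lemma iota_Gdiag: "a \<in> carrier A \<Longrightarrow> iota a \<in> SG.Gdiag"
  using SG.Gdiag_hom[of _ 0] iota_Sg by (simp add: diag_deg_zero)

lemma Gdiag_pow: "x \<in> SG.Gdiag \<Longrightarrow> x [^] (n::nat) \<in> SG.Gdiag"
  by (induction n) (simp_all add: one_Gdiag Gdiag_mult)

text \<open>Degrees are nonnegative, so a product has degree zero only when both factors do:
  projection to degree zero is multiplicative.\<close>

lemma cp_mult_zero_deg: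
  assumes "s \<in> carrier S" "t \<in> carrier S"
  shows "SG.cp (s \<otimes> t) (\<lambda>_. 0) = SG.cp s (\<lambda>_. 0) \<otimes> SG.cp t (\<lambda>_. 0)"
proof (rule SG.hom_induct[where P = "\<lambda>s. SG.cp (s \<otimes> t) (\<lambda>_. 0) = SG.cp s (\<lambda>_. 0) \<otimes> SG.cp t (\<lambda>_. 0)", OF assms(1)])
  fix u y assume y: "y \<in> Sg u"
  show "SG.cp (y \<otimes> t) (\<lambda>_. 0) = SG.cp y (\<lambda>_. 0) \<otimes> SG.cp t (\<lambda>_. 0)"
  proof (cases "u = (\<lambda>_. 0)")
    case True
    then show ?thesis using cp_mult_hom[OF y assms(2), of "\<lambda>_. 0"] SG.cp_self[OF y] by simp
  next
    case False
    interpret SS: graded_module A \<mm> S Sg "self_module S" Sg by (rule graded_module_self)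
    have "(\<lambda>_. 0) \<notin> range (\<lambda>v i. u i + v i)" using False by (auto simp: fun_eq_iff)
    then have "SG.cp (y \<otimes> t) (\<lambda>_. 0) = \<zero>" using SS.cp_smult_hom(2)[OF y, of t "\<lambda>_. 0"] assms(2) by simp
    moreover have "SG.cp y (\<lambda>_. 0) = \<zero>" using SG.cp_hom[OF y] False by auto
    ultimately show ?thesis using assms(2) by simp
  qed
next
  show "SG.cp ((x \<oplus> y) \<otimes> t) (\<lambda>_. 0) = SG.cp (x \<oplus> y) (\<lambda>_. 0) \<otimes> SG.cp t (\<lambda>_. 0)"
    if "x \<in> carrier S" "y \<in> carrier S" "SG.cp (x \<otimes> t) (\<lambda>_. 0) = SG.cp x (\<lambda>_. 0) \<otimes> SG.cp t (\<lambda>_. 0)"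
      "SG.cp (y \<otimes> t) (\<lambda>_. 0) = SG.cp y (\<lambda>_. 0) \<otimes> SG.cp t (\<lambda>_. 0)" for x y
    using that assms(2) by (simp add: S.l_distr SG.cp_add)
qed

text \<open>The graded maximal ideal of the diagonal ring. The structure map may have a kernel,
  hence the existential over \<open>a\<close>; by \<open>iota_in_max_iff\<close> the choice of
  preimage is immaterial when \<open>S\<close> is nonzero.\<close>

definition max_hom :: "'s set" where
  "max_hom = {s \<in> SG.Gdiag. \<exists>a\<in>\<mm>. SG.cp s (\<lambda>_. 0) = iota a}"

lemma iota_in_max_iff:
  assumes one: "\<one> \<noteq> \<zero>" and a: "a \<in> carrier A" and b: "b \<in> \<mm>" "iota a = iota b"
  shows "a \<in> \<mm>"
proof (rule ccontr)
  assume n: "a \<notin> \<mm>"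
  have bc: "b \<in> carrier A" using b ideal_subset[OF m_ideal] by blast
  have "a \<ominus>\<^bsub>A\<^esub> b \<notin> \<mm>"
  proof
    assume "a \<ominus>\<^bsub>A\<^esub> b \<in> \<mm>"
    then have "(a \<ominus>\<^bsub>A\<^esub> b) \<oplus>\<^bsub>A\<^esub> b \<in> \<mm>" using ideal_add_mem[OF m_ideal] b by blast
    then show False using n add_minus_cancel(3)[OF a bc] by simp
  qed
  then obtain c where c: "c \<in> carrier A" "c \<otimes>\<^bsub>A\<^esub> (a \<ominus>\<^bsub>A\<^esub> b) = \<one>\<^bsub>A\<^esub>" using unit_if_notin_m a bc by (metis minus_closed)
  have "iota (a \<ominus>\<^bsub>A\<^esub> b) = \<zero>" using iota_diff[OF a bc] b(2) bc by (simp add: a_minus_def S.r_neg)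
  then have "iota (c \<otimes>\<^bsub>A\<^esub> (a \<ominus>\<^bsub>A\<^esub> b)) = \<zero>" using iota_prod[of c "a \<ominus>\<^bsub>A\<^esub> b"] c(1) a bc by simp
  then show False using c(2) one by simp
qed

lemma primeideal_max_hom:
  assumes one: "\<one> \<noteq> \<zero>" shows "primeideal max_hom Rd"
proof (rule primeidealI[OF _ cring_diagonal])
  have mc: "a \<in> \<mm> \<Longrightarrow> a \<in> carrier A" for a using ideal_subset[OF m_ideal] by blast
  have deg0: "\<exists>a\<in>carrier A. SG.cp s (\<lambda>_. 0) = iota a" if "s \<in> carrier S" for s
    using Sg_zero_deg[OF SG.cp_props(1)[OF that]] by metis
  show "ideal max_hom Rd" unfolding Rd.ideal_iff
  proof (intro conjI ballI)
    show "max_hom \<subseteq> carrier Rd" unfolding max_hom_def by auto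
    show "\<zero>\<^bsub>Rd\<^esub> \<in> max_hom" unfolding max_hom_def
      using SG.Gdiag_zero ideal_zero_mem[OF m_ideal] by (auto intro!: bexI[of _ "\<zero>\<^bsub>A\<^esub>"])
    fix s t assume "s \<in> max_hom" "t \<in> max_hom"
    then obtain a b where "s \<in> SG.Gdiag" "t \<in> SG.Gdiag" "a \<in> \<mm>" "b \<in> \<mm>" "SG.cp s (\<lambda>_. 0) = iota a" "SG.cp t (\<lambda>_. 0) = iota b"
      unfolding max_hom_def by blast
    then show "s \<oplus>\<^bsub>Rd\<^esub> t \<in> max_hom" unfolding max_hom_def
      using SG.Gdiag_add ideal_add_mem[OF m_ideal] mc
      by (auto simp: SG.cp_add SG.Gdiag_carrier iota_add[symmetric] intro!: bexI[of _ "a \<oplus>\<^bsub>A\<^esub> b"])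
  next
    fix s t assume "s \<in> carrier Rd" "t \<in> max_hom"
    then obtain b where t: "s \<in> SG.Gdiag" "t \<in> SG.Gdiag" "b \<in> \<mm>" "SG.cp t (\<lambda>_. 0) = iota b"
      unfolding max_hom_def by auto
    obtain a where a: "a \<in> carrier A" "SG.cp s (\<lambda>_. 0) = iota a" using deg0[OF SG.Gdiag_carrier[OF t(1)]] by blast
    have "SG.cp (s \<otimes> t) (\<lambda>_. 0) = iota (a \<otimes>\<^bsub>A\<^esub> b)"
      using cp_mult_zero_deg[OF SG.Gdiag_carrier[OF t(1)] SG.Gdiag_carrier[OF t(2)]] a t mc by (simp add: iota_prod)
    then show "s \<otimes>\<^bsub>Rd\<^esub> t \<in> max_hom" unfolding max_hom_def
      using Gdiag_mult[OF t(1,2)] ideal_mult_mem[OF m_ideal a(1) t(3)] by auto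
  qed
  show "carrier Rd \<noteq> max_hom"
  proof
    assume e: "carrier Rd = max_hom"
    have "\<one> \<in> max_hom" using e one_Gdiag by auto
    then obtain a where "a \<in> \<mm>" "SG.cp \<one> (\<lambda>_. 0) = iota a" unfolding max_hom_def by blast
    then have "\<one>\<^bsub>A\<^esub> \<in> \<mm>" using iota_in_max_iff[OF one one_closed] SG.cp_self[OF one_Sg] by simp
    then show False using one_notin_m by blast
  qed
  fix s t assume st: "s \<in> carrier Rd" "t \<in> carrier Rd" "s \<otimes>\<^bsub>Rd\<^esub> t \<in> max_hom"
  then have c: "s \<in> SG.Gdiag" "t \<in> SG.Gdiag" by auto
  obtain a where a: "a \<in> carrier A" "SG.cp s (\<lambda>_. 0) = iota a" using deg0[OF SG.Gdiag_carrier[OF c(1)]] by blast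
  obtain b where b: "b \<in> carrier A" "SG.cp t (\<lambda>_. 0) = iota b" using deg0[OF SG.Gdiag_carrier[OF c(2)]] by blast
  obtain d where d: "d \<in> \<mm>" "SG.cp (s \<otimes> t) (\<lambda>_. 0) = iota d" using st(3) unfolding max_hom_def by auto
  have "iota (a \<otimes>\<^bsub>A\<^esub> b) = iota d"
    using cp_mult_zero_deg[OF SG.Gdiag_carrier[OF c(1)] SG.Gdiag_carrier[OF c(2)]] a b d by (simp add: iota_prod)
  then have "a \<otimes>\<^bsub>A\<^esub> b \<in> \<mm>" using iota_in_max_iff[OF one _ d(1)] a b by simp
  then have "a \<in> \<mm> \<or> b \<in> \<mm>" using primeideal.I_prime[OF maximalideal_prime[OF maximal_m]] a b by blast
  then show "s \<in> max_hom \<or> t \<in> max_hom" unfolding max_hom_def using a b c by blast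
qed

lemma Sg_diag_subset_max_hom: "0 < j \<Longrightarrow> Sg (diag_deg j) \<subseteq> max_hom"
proof
  fix s assume j: "0 < j" and s: "s \<in> Sg (diag_deg j)"
  have "diag_deg 0 \<noteq> (diag_deg j :: 'd \<Rightarrow> nat)" using j diag_deg_inj[of 0 j] by simp
  then have "SG.cp s (\<lambda>_. 0) = iota \<zero>\<^bsub>A\<^esub>" using SG.cp_hom[OF s, of "\<lambda>_. 0"] by (simp add: diag_deg_zero)
  then show "s \<in> max_hom" unfolding max_hom_def using SG.Gdiag_hom[OF s] ideal_zero_mem[OF m_ideal] by blast
qed

lemma Sg_diag_subset_ideal:
  assumes I: "ideal I Rd" and d: "Sg (diag_deg 1) \<subseteq> I" and j: "0 < j"
  shows "Sg (diag_deg j) \<subseteq> I"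
proof
  fix s assume s: "s \<in> Sg (diag_deg j)"
  have e: "(\<lambda>i. diag_deg (j - 1) i + diag_deg 1 i) = (diag_deg j :: 'd \<Rightarrow> nat)" using j unfolding diag_deg_add by simp
  have "add_closure S {t \<otimes> t' | t t'. t \<in> Sg (diag_deg (j - 1)) \<and> t' \<in> Sg (diag_deg 1)} s"
    using Sg_add_decomp[of s "diag_deg (j - 1)" "diag_deg 1"] s unfolding e by blast
  then show "s \<in> I"
  proof (rule S.add_closure_least)
    show "\<zero> \<in> I" using Rd.ideal_zero_mem[OF I] by simp
    show "x \<oplus> y \<in> I" if "x \<in> I" "y \<in> I" for x y using Rd.ideal_add_mem[OF I that] by simp
    show "{t \<otimes> t' | t t'. t \<in> Sg (diag_deg (j - 1)) \<and> t' \<in> Sg (diag_deg 1)} \<subseteq> I"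
      using Rd.ideal_mult_mem[OF I] SG.Gdiag_hom d by fastforce
  qed
qed

lemma prime_power_mem:
  assumes P: "primeideal P Rd" and x: "x \<in> SG.Gdiag" and n: "x [^] (n::nat) \<in> P" shows "x \<in> P"
  using n
proof (induction n)
  case 0
  then have "\<one>\<^bsub>Rd\<^esub> \<in> P" by simp
  then have "P = carrier Rd" using ideal.one_imp_carrier[OF primeideal.axioms(1)[OF P]] by blast
  then show ?case using x by simp
next
  case (Suc n)
  then have "x [^] n \<otimes>\<^bsub>Rd\<^esub> x \<in> P" by simp
  then have "x [^] n \<in> P \<or> x \<in> P" using primeideal.I_prime[OF P, of "x [^] n" x] x Gdiag_pow[OF x] by simp
  then show ?case using Suc.IH by blast
qed

text \<open>Modulo \<open>P\<close> every element of the diagonal ring is congruent to a scalar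
  \<open>a\<close> from \<open>A\<close>. For an element of a proper ideal above \<open>P\<close>
  this \<open>a\<close> cannot be a unit, so it is nilpotent and lies in \<open>P\<close>
  already.\<close>

lemma prime_above_diag_maximal:
  assumes P: "primeideal P Rd" and d: "Sg (diag_deg 1) \<subseteq> P" and Q: "primeideal Q Rd" "P \<subseteq> Q"
  shows "P = Q"
proof
  have Pi: "ideal P Rd" and Qi: "ideal Q Rd" using primeideal.axioms(1) P Q by auto
  show "Q \<subseteq> P"
  proof
    fix f assume f: "f \<in> Q"
    have fd: "f \<in> SG.Gdiag" using Rd.ideal_subset[OF Qi] f by auto
    have fc: "f \<in> carrier S" using SG.Gdiag_carrier[OF fd] .
    have "\<exists>a\<in>carrier A. f \<ominus> iota a \<in> P"
    proof (rule SG.Gdiag_induct[where P = "\<lambda>f. \<exists>a\<in>carrier A. f \<ominus> iota a \<in> P", OF fd])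
      have z: "\<zero> \<in> P" using Rd.ideal_zero_mem[OF Pi] by simp
      show "\<exists>a\<in>carrier A. \<zero> \<ominus> iota a \<in> P" using z by (intro bexI[of _ "\<zero>\<^bsub>A\<^esub>"]) (auto simp: a_minus_def)
      show "\<exists>a\<in>carrier A. y \<ominus> iota a \<in> P" if y: "y \<in> Sg (diag_deg j)" for j y
      proof (cases "j = 0")
        case True
        then obtain a where a: "a \<in> carrier A" "y = iota a" using Sg_zero_deg[of y] y by (auto simp: diag_deg_zero)
        then have "y \<ominus> iota a = \<zero>" by (simp add: a_minus_def S.r_neg)
        then show ?thesis using z a(1) by (intro bexI[of _ a]) simp_all
      next
        case False
        then have "y \<in> P" using Sg_diag_subset_ideal[OF Pi d, of j] y by blast
        moreover have "y \<ominus> iota \<zero>\<^bsub>A\<^esub> = y" using Sg_carrier[OF y] by (simp add: a_minus_def)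
        ultimately show ?thesis by (intro bexI[of _ "\<zero>\<^bsub>A\<^esub>"]) simp_all
      qed
      show "\<exists>a\<in>carrier A. (x \<oplus> y) \<ominus> iota a \<in> P"
        if xy: "x \<in> carrier S" "y \<in> carrier S" "\<exists>a\<in>carrier A. x \<ominus> iota a \<in> P" "\<exists>a\<in>carrier A. y \<ominus> iota a \<in> P" for x y
      proof -
        obtain a b where ab: "a \<in> carrier A" "b \<in> carrier A" "x \<ominus> iota a \<in> P" "y \<ominus> iota b \<in> P" using xy by blast
        have ic: "iota a \<in> carrier S" "iota b \<in> carrier S" using ab by auto
        have "(x \<oplus> y) \<ominus> (iota a \<oplus> iota b) = (x \<ominus> iota a) \<oplus> (y \<ominus> iota b)"
          using xy(1,2) ic by algebra
        then have "(x \<oplus> y) \<ominus> iota (a \<oplus>\<^bsub>A\<^esub> b) \<in> P" using iota_add[OF ab(1,2)] Rd.ideal_add_mem[OF Pi ab(3,4)] by simp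
        then show ?thesis using ab by blast
      qed
    qed
    then obtain a where a: "a \<in> carrier A" "f \<ominus> iota a \<in> P" by blast
    have ia: "iota a \<in> SG.Gdiag" using iota_Gdiag[OF a(1)] .
    have iac: "iota a \<in> carrier S" using a(1) by simp
    have "a \<in> \<mm>"
    proof (rule ccontr)
      assume "a \<notin> \<mm>"
      then obtain b where b: "b \<in> carrier A" "b \<otimes>\<^bsub>A\<^esub> a = \<one>\<^bsub>A\<^esub>" using unit_if_notin_m a by blast
      let ?g = "f \<ominus> iota a"
      have gQ: "?g \<in> Q" using a Q(2) by blast
      have "(\<ominus>\<^bsub>Rd\<^esub> \<one>\<^bsub>Rd\<^esub>) \<otimes>\<^bsub>Rd\<^esub> ?g \<in> Q" using Rd.ideal_mult_mem[OF Qi _ gQ] by blast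
      have "f \<oplus>\<^bsub>Rd\<^esub> (\<ominus>\<^bsub>Rd\<^esub> ?g) \<in> Q" using Rd.ideal_add_mem[OF Qi f Rd.ideal_neg_mem[OF Qi gQ]] .
      moreover have "f \<oplus>\<^bsub>Rd\<^esub> (\<ominus>\<^bsub>Rd\<^esub> ?g) = iota a"
      proof -
        have gd: "?g \<in> carrier Rd" using Rd.ideal_subset[OF Qi] gQ by blast
        have "iota a \<oplus>\<^bsub>Rd\<^esub> ?g = f" using S.add_minus_cancel(4)[OF fc iac] by simp
        then have "(iota a \<oplus>\<^bsub>Rd\<^esub> ?g) \<ominus>\<^bsub>Rd\<^esub> ?g = f \<ominus>\<^bsub>Rd\<^esub> ?g" by simp
        moreover have "(iota a \<oplus>\<^bsub>Rd\<^esub> ?g) \<ominus>\<^bsub>Rd\<^esub> ?g = iota a" using Rd.add_minus_cancel(2)[of "iota a" ?g] ia gd by simp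
        ultimately show ?thesis unfolding a_minus_def by simp
      qed
      ultimately have "iota a \<in> Q" by simp
      then have "iota b \<otimes>\<^bsub>Rd\<^esub> iota a \<in> Q" using Rd.ideal_mult_mem[OF Qi, of "iota b"] iota_Gdiag[OF b(1)] by simp
      moreover have "iota b \<otimes> iota a = \<one>" using iota_prod[OF b(1) a(1)] b(2) by simp
      ultimately have "\<one>\<^bsub>Rd\<^esub> \<in> Q" by simp
      then show False using ideal.one_imp_carrier[OF Qi] primeideal.I_notcarr[OF Q(1)] by simp
    qed
    then obtain n :: nat where "a [^]\<^bsub>A\<^esub> n = \<zero>\<^bsub>A\<^esub>" using nilpotent_if_in_m by blast
    then have "iota a [^] n = \<zero>" using iota_pow[OF a(1), of n] by simp
    then have "iota a \<in> P" using prime_power_mem[OF P ia, of n] Rd.ideal_zero_mem[OF Pi] by simp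
    then have "iota a \<oplus>\<^bsub>Rd\<^esub> (f \<ominus> iota a) \<in> P" using Rd.ideal_add_mem[OF Pi _ a(2)] by blast
    then show "f \<in> P" using S.add_minus_cancel(4)[OF fc iac] by simp
  qed
qed (rule Q)

end

section \<open>Chains of primes of the diagonal ring\<close>

context graded_module
begin

sublocale MG: multigraded_group M Mg by unfold_locales

lemma module_diagonal: "module Rd (diagonal M Mg)"
proof (rule moduleI[OF cring_diagonal MG.abelian_group_diagonal])
  show cl: "a \<odot>\<^bsub>diagonal M Mg\<^esub> x \<in> carrier (diagonal M Mg)" if a: "a \<in> carrier Rd" and x: "x \<in> carrier (diagonal M Mg)" for a x
  proof -
    have ad: "a \<in> SG.Gdiag" and xd: "x \<in> MG.Gdiag" using a x by simp_all
    have xc: "x \<in> carrier M" using MG.Gdiag_carrier[OF xd] .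
    have "a \<odot> x \<in> MG.Gdiag"
    proof (rule SG.Gdiag_induct[where P = "\<lambda>a. a \<odot> x \<in> MG.Gdiag", OF ad])
      show "\<zero>\<^bsub>S\<^esub> \<odot> x \<in> MG.Gdiag" using MG.Gdiag_zero xc by simp
      show "(s \<oplus>\<^bsub>S\<^esub> t) \<odot> x \<in> MG.Gdiag" if "s \<in> carrier S" "t \<in> carrier S" "s \<odot> x \<in> MG.Gdiag" "t \<odot> x \<in> MG.Gdiag" for s t
        using MG.Gdiag_add[OF that(3,4)] SM.smult_l_distr[OF that(1,2) xc] by simp
      fix j s assume s: "s \<in> Sg (diag_deg j)"
      have sc: "s \<in> carrier S" using Sg_carrier s by blast
      show "s \<odot> x \<in> MG.Gdiag"
      proof (rule MG.Gdiag_induct[where P = "\<lambda>x. s \<odot> x \<in> MG.Gdiag", OF xd])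
        show "s \<odot> \<zero> \<in> MG.Gdiag" using MG.Gdiag_zero sc by simp
        show "s \<odot> (y \<oplus> z) \<in> MG.Gdiag" if "y \<in> carrier M" "z \<in> carrier M" "s \<odot> y \<in> MG.Gdiag" "s \<odot> z \<in> MG.Gdiag" for y z
          using MG.Gdiag_add[OF that(3,4)] SM.smult_r_distr[OF sc that(1,2)] by simp
        fix k m assume "m \<in> Mg (diag_deg k)"
        then show "s \<odot> m \<in> MG.Gdiag" using MG.Gdiag_hom Mg_smult[OF s, of m "diag_deg k"] unfolding diag_deg_add by blast
      qed
    qed
    then show ?thesis by simp
  qed
qed (auto simp: SG.Gdiag_carrier MG.Gdiag_carrier SM.smult_l_distr SM.smult_r_distr SM.smult_assoc1)

lemma graded_sub_mem_if_comps:
  assumes K: "submodule K S M" and x: "x \<in> carrier M" "\<And>u. MG.cp x u \<in> K" shows "x \<in> K"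
  by (rule MG.comp_induct[where P = "\<lambda>x. x \<in> K", OF x(1)])
    (use SM.submodule_zero_mem[OF K] SM.submodule_add_mem[OF K] x(2) in auto)

text \<open>The annihilator, in the diagonal ring, of the diagonal of \<open>M / K\<close> (see
  \<open>AD_quotient\<close>), phrased inside \<open>M\<close>. Testing homogeneous elements
  suffices by additivity.\<close>

definition AD :: "'m set \<Rightarrow> 's set" where
  "AD K = {s \<in> SG.Gdiag. \<forall>j. \<forall>m\<in>Mg (diag_deg j). s \<odot> m \<in> K}"

lemma AD_all:
  assumes K: "submodule K S M" and s: "s \<in> AD K" and m: "m \<in> MG.Gdiag" shows "s \<odot> m \<in> K"
proof (rule MG.Gdiag_induct[where P = "\<lambda>m. s \<odot> m \<in> K", OF m])
  have sc: "s \<in> carrier S" using s SG.Gdiag_carrier unfolding AD_def by blast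
  show "s \<odot> \<zero> \<in> K" using sc SM.submodule_zero_mem[OF K] by simp
  show "s \<odot> (x \<oplus> y) \<in> K" if "x \<in> carrier M" "y \<in> carrier M" "s \<odot> x \<in> K" "s \<odot> y \<in> K" for x y
    using SM.submodule_add_mem[OF K that(3,4)] SM.smult_r_distr[OF sc that(1,2)] by simp
  show "s \<odot> y \<in> K" if "y \<in> Mg (diag_deg j)" for j y using s that unfolding AD_def by blast
qed

lemma ideal_AD:
  assumes K: "submodule K S M" shows "ideal (AD K) Rd"
  unfolding Rd.ideal_iff
proof (intro conjI ballI)
  show "AD K \<subseteq> carrier Rd" unfolding AD_def by auto
  show "\<zero>\<^bsub>Rd\<^esub> \<in> AD K" unfolding AD_def using SG.Gdiag_zero SM.submodule_zero_mem[OF K] Mg_carrier by auto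
  show "s \<oplus>\<^bsub>Rd\<^esub> t \<in> AD K" if st: "s \<in> AD K" "t \<in> AD K" for s t
  proof -
    have c: "s \<in> carrier S" "t \<in> carrier S" using st SG.Gdiag_carrier unfolding AD_def by blast+
    have "(s \<oplus>\<^bsub>S\<^esub> t) \<odot> m \<in> K" if m: "m \<in> Mg (diag_deg j)" for j m
      using SM.submodule_add_mem[OF K, of "s \<odot> m" "t \<odot> m"] st m SM.smult_l_distr[OF c Mg_carrier[OF m]]
      unfolding AD_def by auto
    then show ?thesis using st SG.Gdiag_add unfolding AD_def by auto
  qed
  show "s \<otimes>\<^bsub>Rd\<^esub> t \<in> AD K" if s: "s \<in> carrier Rd" and t: "t \<in> AD K" for s t
  proof -
    have d: "s \<in> SG.Gdiag" "t \<in> SG.Gdiag" using s t unfolding AD_def by auto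
    have c: "s \<in> carrier S" "t \<in> carrier S" using d SG.Gdiag_carrier by blast+
    have "(s \<otimes>\<^bsub>S\<^esub> t) \<odot> m \<in> K" if m: "m \<in> Mg (diag_deg j)" for j m
      using SM.submodule_smult_mem[OF K c(1), of "t \<odot> m"] t m SM.smult_assoc1[OF c Mg_carrier[OF m]]
      unfolding AD_def by auto
    then show ?thesis using Gdiag_mult[OF d] unfolding AD_def by auto
  qed
qed

lemma annihilator_diagonal: "annihilator Rd (diagonal M Mg) = AD {\<zero>}"
proof
  show "annihilator Rd (diagonal M Mg) \<subseteq> AD {\<zero>}"
    unfolding annihilator_def AD_def using MG.Gdiag_hom by auto
  show "AD {\<zero>} \<subseteq> annihilator Rd (diagonal M Mg)"
    unfolding annihilator_def using AD_all[OF SM.submodule_zero] unfolding AD_def by auto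
qed

lemma AD_quotient:
  assumes K: "graded_sub K"
  shows "annihilator Rd (diagonal (quotient_module M K) (qgr K)) = AD K"
proof -
  interpret Q: graded_module A \<mm> S Sg "quotient_module M K" "qgr K" using graded_module_quotient(1)[OF K] .
  note Ks = graded_subD(1)[OF K]
  have *: "s \<odot>\<^bsub>quotient_module M K\<^esub> (K +> m) = \<zero>\<^bsub>quotient_module M K\<^esub> \<longleftrightarrow> s \<odot> m \<in> K"
    if "s \<in> SG.Gdiag" "m \<in> Mg u" for s m u
    using SM.coset_smult[OF Ks SG.Gdiag_carrier[OF that(1)] Mg_carrier[OF that(2)]]
      SM.coset_zero_iff[OF Ks, of "s \<odot> m"] SG.Gdiag_carrier[OF that(1)] Mg_carrier[OF that(2)]
    by (simp add: SM.quotient_module_simps)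
  have "(\<forall>m\<in>qgr K u. s \<odot>\<^bsub>quotient_module M K\<^esub> m \<in> {\<zero>\<^bsub>quotient_module M K\<^esub>}) \<longleftrightarrow> (\<forall>m\<in>Mg u. s \<odot> m \<in> K)"
    if "s \<in> SG.Gdiag" for s u
    unfolding qgr_def by (simp add: *[OF that] cong: ball_cong)
  then show ?thesis unfolding Q.annihilator_diagonal Q.AD_def AD_def by blast
qed

text \<open>A chain of \<open>n + 1\<close> primes over \<open>AD K\<close>. Relevance of the bottom
  prime is the property that allows \<open>chain_over_step\<close> to find another prime below
  it.\<close>

definition chain_over :: "'m set \<Rightarrow> nat \<Rightarrow> bool" where
  "chain_over K n \<longleftrightarrow> (\<exists>P. (\<forall>i\<le>n. primeideal (P i) Rd) \<and> AD K \<subseteq> P 0 \<and> \<not> Sg (diag_deg 1) \<subseteq> P 0 \<and>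
     (\<forall>i<n. P i \<subset> P (Suc i)))"

lemma chain_over_le_dim:
  assumes "submodule K S M" "chain_over K n"
  shows "ereal (real n) \<le> ring_krull_dim (Rd Quot (AD K))"
  using assms(2) Rd.ring_krull_dim_quot_ge[OF ideal_AD[OF assms(1)], of n] unfolding chain_over_def by blast

text \<open>A prime containing S_(1,...,1) has no prime strictly above it, so the bottom of a chain
  with at least one step is relevant.\<close>

lemma chain_over_if_chain:
  assumes "\<And>i. i \<le> n \<Longrightarrow> primeideal (P i) Rd" "AD K \<subseteq> P 0" "\<And>i. i < n \<Longrightarrow> P i \<subset> P (Suc i)" "1 \<le> n"
  shows "chain_over K n"
proof -
  have "\<not> Sg (diag_deg 1) \<subseteq> P 0"
    using prime_above_diag_maximal[of "P 0" "P 1"] assms(1)[of 0] assms(1)[of 1] assms(3)[of 0] assms(4) by auto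
  then show ?thesis unfolding chain_over_def using assms by blast
qed

text \<open>Localisation at \<open>Q\<close> and at \<open>y\<close> without forming it: a prime
  missing all products of an element outside \<open>Q\<close> with a power of \<open>y\<close> lies
  in \<open>Q\<close> and misses \<open>y\<close>. The hypothesis \<open>avoid\<close> says that the
  localised quotient is nonzero.\<close>

lemma exists_prime_below:
  assumes K: "submodule K S M" and Q: "primeideal Q Rd" and y: "y \<in> Sg (diag_deg 1)"
    and avoid: "\<And>s p. s \<in> SG.Gdiag \<Longrightarrow> s \<notin> Q \<Longrightarrow> s \<otimes>\<^bsub>S\<^esub> y [^]\<^bsub>S\<^esub> (p::nat) \<notin> AD K"
  shows "\<exists>P. primeideal P Rd \<and> AD K \<subseteq> P \<and> P \<subseteq> Q \<and> y \<notin> P"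
proof -
  define T where "T = {s \<otimes>\<^bsub>S\<^esub> y [^]\<^bsub>S\<^esub> (p::nat) | s p. s \<in> SG.Gdiag \<and> s \<notin> Q}"
  have yc: "y \<in> carrier S" using Sg_carrier[OF y] .
  have Qi: "ideal Q Rd" using primeideal.axioms(1)[OF Q] .
  have oneQ: "\<one>\<^bsub>S\<^esub> \<notin> Q" using ideal.one_imp_carrier[OF Qi] primeideal.I_notcarr[OF Q] by auto
  have inT: "s \<otimes>\<^bsub>S\<^esub> y [^]\<^bsub>S\<^esub> (p::nat) \<in> T" if "s \<in> SG.Gdiag" "s \<notin> Q" for s p unfolding T_def using that by blast
  have "\<exists>P. primeideal P Rd \<and> AD K \<subseteq> P \<and> P \<inter> T = {}"
  proof (rule Rd.exists_primeideal_disjoint[OF ideal_AD[OF K]])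
    show "AD K \<inter> T = {}" unfolding T_def using avoid by blast
    show "\<one>\<^bsub>Rd\<^esub> \<in> T" using inT[OF one_Gdiag oneQ, of 0] by simp
    fix a b assume "a \<in> T" "b \<in> T"
    then obtain s p t q where *: "s \<in> SG.Gdiag" "s \<notin> Q" "a = s \<otimes>\<^bsub>S\<^esub> y [^]\<^bsub>S\<^esub> (p::nat)"
      "t \<in> SG.Gdiag" "t \<notin> Q" "b = t \<otimes>\<^bsub>S\<^esub> y [^]\<^bsub>S\<^esub> (q::nat)" unfolding T_def by blast
    have c: "s \<in> carrier S" "t \<in> carrier S" using * SG.Gdiag_carrier by blast+
    have "s \<otimes>\<^bsub>S\<^esub> t \<notin> Q" using primeideal.I_prime[OF Q, of s t] * by auto
    moreover have "a \<otimes>\<^bsub>S\<^esub> b = (s \<otimes>\<^bsub>S\<^esub> t) \<otimes>\<^bsub>S\<^esub> y [^]\<^bsub>S\<^esub> (p + q)"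
      unfolding *(3,6) using c yc by (simp add: S.nat_pow_mult[symmetric] S.m_ac)
    ultimately show "a \<otimes>\<^bsub>Rd\<^esub> b \<in> T" using inT[OF Gdiag_mult[OF *(1,4)]] by simp
  qed
  then obtain P where P: "primeideal P Rd" "AD K \<subseteq> P" "P \<inter> T = {}" by blast
  have "y \<notin> P" using inT[OF one_Gdiag oneQ, of 1] P(3) yc by auto
  moreover have "P \<subseteq> Q"
  proof
    fix s assume s: "s \<in> P"
    have sd: "s \<in> SG.Gdiag" using Rd.ideal_subset[OF primeideal.axioms(1)[OF P(1)]] s by auto
    show "s \<in> Q"
    proof (rule ccontr)
      assume "s \<notin> Q"
      then have "s \<in> T" using inT[OF sd, of 0] SG.Gdiag_carrier[OF sd] by simp
      then show False using s P(3) by blast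
    qed
  qed
  ultimately show ?thesis using P by blast
qed

lemma ev_inj_mod_mult:
  assumes K: "graded_sub K" and "x \<in> Sg u" "y \<in> Sg v" "ev_inj_mod K x" "ev_inj_mod K y"
  shows "ev_inj_mod K (x \<otimes>\<^bsub>S\<^esub> y)"
proof -
  interpret Q: graded_module A \<mm> S Sg "quotient_module M K" "qgr K" using graded_module_quotient(1)[OF K] .
  show ?thesis using Q.ev_inj_mult[OF assms(2,3)] ev_inj_quotient_iff[OF K] assms Sg_carrier S.m_closed by metis
qed

lemma ev_inj_mod_one: "ev_inj_mod K \<one>\<^bsub>S\<^esub>"
  unfolding ev_inj_mod_def by (rule large_True) (auto simp: Mg_carrier)

text \<open>A product of one filter-regular element for each direction in \<open>I\<close>. All
  directions give an element of degree (1,...,1); all but \<open>i\<close> give a factor completing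
  an element of \<open>Sg (unit_deg i)\<close> to that degree.\<close>

lemma exists_ev_inj_mod_prod:
  assumes inf: "infinite (carrier (A Quot \<mm>))" and K: "graded_sub K" and fin: "finite I"
  shows "\<exists>z\<in>Sg (\<lambda>j. if j \<in> I then 1 else 0). ev_inj_mod K z"
  using fin
proof (induction I)
  case empty
  then show ?case using one_Sg ev_inj_mod_one by auto
next
  case (insert i I)
  obtain z where z: "z \<in> Sg (\<lambda>j. if j \<in> I then 1 else 0)" "ev_inj_mod K z" using insert.IH by blast
  obtain x where x: "x \<in> Sg (unit_deg i)" "ev_inj_mod K x" using exists_ev_inj_mod[OF inf K] by blast
  have "(\<lambda>j. unit_deg i j + (if j \<in> I then 1 else 0)) = (\<lambda>j. if j \<in> insert i I then 1 else 0)"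
    using insert.hyps by (auto simp: unit_deg_def fun_eq_iff)
  then have "x \<otimes>\<^bsub>S\<^esub> z \<in> Sg (\<lambda>j. if j \<in> insert i I then 1 else 0)" using Sg_mult[OF x(1) z(1)] by simp
  then show ?case using ev_inj_mod_mult[OF K x(1) z(1) x(2) z(2)] by blast
qed

lemma ev_inj_mod_power:
  assumes y: "y \<in> carrier S" and yd: "y \<in> Sg v"
    and N: "\<forall>n m. (\<forall>i. N \<le> n i) \<longrightarrow> m \<in> Mg n \<longrightarrow> y \<odot> m \<in> K \<longrightarrow> m \<in> K"
    and n: "\<forall>i. N \<le> n i" and m: "m \<in> Mg n" and p: "y [^]\<^bsub>S\<^esub> (p::nat) \<odot> m \<in> K"
  shows "m \<in> K"
  using n m p
proof (induction p arbitrary: n m)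
  case 0
  then show ?case using Mg_carrier by simp
next
  case (Suc p)
  have mc: "m \<in> carrier M" using Mg_carrier Suc by blast
  have f1: "y [^]\<^bsub>S\<^esub> p \<odot> (y \<odot> m) \<in> K" using Suc.prems(3) y mc by (simp add: SM.smult_assoc1)
  have f2: "y \<odot> m \<in> Mg (\<lambda>i. v i + n i)" using Mg_smult[OF yd Suc.prems(2)] .
  have f3: "\<forall>i. N \<le> v i + n i" using Suc.prems(1) by (simp add: trans_le_add2)
  have "y \<odot> m \<in> K" by (rule Suc.IH[OF f3 f2 f1])
  then show ?case using N Suc.prems(1,2) by blast
qed

text \<open>The element \<open>y = x z\<close> of degree (1,...,1) annihilates the diagonal of
  \<open>M / (K + x M)\<close>, so it lies in \<open>P 0\<close>. A prime below \<open>P 0\<close>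
  missing \<open>y\<close> exists: if \<open>s y^p\<close> annihilated the diagonal of
  \<open>M / K\<close> with \<open>s\<close> outside \<open>P 0\<close>, injectivity of
  \<open>y\<close> would let \<open>s\<close> annihilate it in degrees from \<open>N\<close> on, so
  \<open>s t\<close> would lie in \<open>P 0\<close> for all \<open>t\<close> of degree (N,...,N),
  and \<open>P 0\<close> would be irrelevant.\<close>

lemma chain_over_step:
  assumes inf: "infinite (carrier (A Quot \<mm>))" and K: "graded_sub K" and x: "x \<in> Sg (unit_deg i)" and ei: "ev_inj_mod K x"
    and ch: "chain_over (K <+>\<^bsub>M\<^esub> scaled x) n"
  shows "chain_over K (Suc n)"
proof -
  note Ks = graded_subD(1)[OF K]
  let ?K = "K <+>\<^bsub>M\<^esub> scaled x"
  have gx: "submodule (scaled x) S M" using graded_subD(1)[OF graded_sub_scaled[OF x]] .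
  obtain P where P: "\<forall>i\<le>n. primeideal (P i) Rd" "AD ?K \<subseteq> P 0" "\<not> Sg (diag_deg 1) \<subseteq> P 0" "\<forall>i<n. P i \<subset> P (Suc i)"
    using ch unfolding chain_over_def by blast
  have P0: "primeideal (P 0) Rd" using P(1) by blast
  obtain z where z: "z \<in> Sg (\<lambda>j. if j \<in> UNIV - {i} then 1 else 0)" "ev_inj_mod K z"
    using exists_ev_inj_mod_prod[OF inf K, of "UNIV - {i}"] by auto
  let ?y = "x \<otimes>\<^bsub>S\<^esub> z"
  have dd: "(\<lambda>j. unit_deg i j + (if j \<in> UNIV - {i} then 1 else 0)) = diag_deg 1"
    by (auto simp: unit_deg_def diag_deg_def fun_eq_iff)
  have y: "?y \<in> Sg (diag_deg 1)" using Sg_mult[OF x z(1)] unfolding dd .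
  have yei: "ev_inj_mod K ?y" using ev_inj_mod_mult[OF K x z(1) ei z(2)] .
  have c: "x \<in> carrier S" "z \<in> carrier S" "?y \<in> carrier S" using Sg_carrier x z(1) y by blast+
  have yAD: "?y \<in> AD ?K"
  proof -
    have "?y \<odot> m \<in> ?K" if "m \<in> Mg u" for u m
    proof -
      have "?y \<odot> m = x \<odot> (z \<odot> m)" using SM.smult_assoc1[OF c(1,2) Mg_carrier[OF that]] .
      moreover have "x \<odot> (z \<odot> m) \<in> scaled x" using scaled_mem c Mg_carrier[OF that] by simp
      ultimately show ?thesis using SM.set_add_upper2[OF Ks gx] by auto
    qed
    then show ?thesis unfolding AD_def using SG.Gdiag_hom[OF y] by blast
  qed
  obtain N where N: "\<forall>n m. (\<forall>i. N \<le> n i) \<longrightarrow> m \<in> Mg n \<longrightarrow> ?y \<odot> m \<in> K \<longrightarrow> m \<in> K"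
    using yei unfolding ev_inj_mod_def large_def by blast
  have "\<exists>P'. primeideal P' Rd \<and> AD K \<subseteq> P' \<and> P' \<subseteq> P 0 \<and> ?y \<notin> P'"
  proof (rule exists_prime_below[OF Ks P0 y])
    fix s p assume s: "s \<in> SG.Gdiag" "s \<notin> P 0"
    have sc: "s \<in> carrier S" using SG.Gdiag_carrier s by blast
    show "s \<otimes>\<^bsub>S\<^esub> ?y [^]\<^bsub>S\<^esub> (p::nat) \<notin> AD K"
    proof
      assume sy: "s \<otimes>\<^bsub>S\<^esub> ?y [^]\<^bsub>S\<^esub> p \<in> AD K"
      have yp: "?y [^]\<^bsub>S\<^esub> p \<in> Sg (\<lambda>i. p * diag_deg 1 i)" using Sg_pow[OF y] .
      have ypc: "?y [^]\<^bsub>S\<^esub> p \<in> carrier S" using Sg_carrier[OF yp] .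
      \<comment> \<open>Since \<open>s\<close> is inhomogeneous, the power of \<open>y\<close> is
        cancelled component by component; all components of \<open>s m\<close> sit in degrees at
        least \<open>j\<close>.\<close>
      have key: "s \<odot> m \<in> K" if m: "m \<in> Mg (diag_deg j)" and j: "N \<le> j" for m j
      proof (rule graded_sub_mem_if_comps[OF Ks])
        have mc: "m \<in> carrier M" using Mg_carrier m by blast
        show "s \<odot> m \<in> carrier M" using sc mc by simp
        fix u
        show "MG.cp (s \<odot> m) u \<in> K"
        proof (cases "u \<in> range (\<lambda>u i. diag_deg j i + u i)")
          case False
          then show ?thesis using cp_smult_right(2)[OF m sc] SM.submodule_zero_mem[OF Ks] by simp
        next
          case True
          then have Nu: "\<forall>i. N \<le> u i" using j by (auto simp: diag_deg_def)
          have "(s \<otimes>\<^bsub>S\<^esub> ?y [^]\<^bsub>S\<^esub> p) \<odot> m \<in> K" using sy m unfolding AD_def by blast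
          then have "?y [^]\<^bsub>S\<^esub> p \<odot> (s \<odot> m) \<in> K"
            using SM.smult_assoc1[OF sc ypc mc] SM.smult_commute[OF sc ypc mc] by simp
          then have "MG.cp (?y [^]\<^bsub>S\<^esub> p \<odot> (s \<odot> m)) (\<lambda>i. p * diag_deg 1 i + u i) \<in> K" using graded_subD(2)[OF K] by blast
          then have 1: "?y [^]\<^bsub>S\<^esub> p \<odot> MG.cp (s \<odot> m) u \<in> K" using cp_smult_hom(1)[OF yp, of "s \<odot> m" u] sc mc by simp
          have 2: "MG.cp (s \<odot> m) u \<in> Mg u" using MG.cp_props(1) sc mc by simp
          show ?thesis by (rule ev_inj_mod_power[OF c(3) y N Nu 2 1])
        qed
      qed
      have tP: "t \<in> P 0" if t: "t \<in> Sg (diag_deg N)" for t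
      proof -
        have tc: "t \<in> carrier S" using Sg_carrier t by blast
        have "s \<otimes>\<^bsub>S\<^esub> t \<in> AD K" unfolding AD_def
        proof (intro CollectI conjI allI ballI)
          show "s \<otimes>\<^bsub>S\<^esub> t \<in> SG.Gdiag" using Gdiag_mult[OF s(1) SG.Gdiag_hom[OF t]] .
          fix j m assume m: "m \<in> Mg (diag_deg j)"
          have "t \<odot> m \<in> Mg (diag_deg (N + j))" using Mg_smult[OF t m] unfolding diag_deg_add .
          then have "s \<odot> (t \<odot> m) \<in> K" using key by simp
          then show "(s \<otimes>\<^bsub>S\<^esub> t) \<odot> m \<in> K" using SM.smult_assoc1[OF sc tc Mg_carrier[OF m]] by simp
        qed
        moreover have "K \<subseteq> ?K" using SM.set_add_upper1[OF Ks gx] .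
        then have "AD K \<subseteq> AD ?K" unfolding AD_def by blast
        ultimately have "s \<otimes>\<^bsub>Rd\<^esub> t \<in> P 0" using P(2) by auto
        then show ?thesis using primeideal.I_prime[OF P0, of s t] s SG.Gdiag_hom[OF t] by auto
      qed
      have "Sg (diag_deg 1) \<subseteq> P 0"
      proof
        fix r assume r: "r \<in> Sg (diag_deg 1)"
        have dN: "(\<lambda>i. N * diag_deg 1 i) = (diag_deg N :: 'd \<Rightarrow> nat)" by (simp add: diag_deg_def)
        have "r [^]\<^bsub>S\<^esub> N \<in> Sg (diag_deg N)" using Sg_pow[OF r, of N] unfolding dN .
        then show "r \<in> P 0" using prime_power_mem[OF P0 SG.Gdiag_hom[OF r]] tP by blast
      qed
      then show False using P(3) by blast
    qed
  qed
  then obtain P' where P': "primeideal P' Rd" "AD K \<subseteq> P'" "P' \<subseteq> P 0" "?y \<notin> P'" by blast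
  have "P' \<subset> P 0" using P' yAD P(2) by blast
  moreover have "\<not> Sg (diag_deg 1) \<subseteq> P'" using P'(4) y by blast
  ultimately show ?thesis unfolding chain_over_def
  proof (intro exI[of _ "\<lambda>i. case i of 0 \<Rightarrow> P' | Suc j \<Rightarrow> P j"] conjI allI impI)
    fix i assume "i \<le> Suc n"
    then show "primeideal (case i of 0 \<Rightarrow> P' | Suc j \<Rightarrow> P j) Rd" using P(1) P'(1) by (cases i) auto
  next
    fix i assume "i < Suc n"
    then show "(case i of 0 \<Rightarrow> P' | Suc j \<Rightarrow> P j) \<subset> (case Suc i of 0 \<Rightarrow> P' | Suc j \<Rightarrow> P j)"
      using P(4) \<open>P' \<subset> P 0\<close> by (cases i) auto
  qed (use P' in auto)
qed

text \<open>The chain is \<open>P \<subset> max_hom\<close> with \<open>P\<close> missing a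
  filter-regular \<open>y\<close> of degree (1,...,1). An \<open>s\<close> outside
  \<open>max_hom\<close> has a unit as degree zero part, so \<open>s y^p m \<in> K\<close> gives
  \<open>y^p m \<in> K\<close> by taking lowest components, contradicting the choice of
  \<open>m\<close> outside \<open>K\<close> in the range where \<open>y\<close> is
  injective.\<close>

lemma chain_over_base:
  assumes inf: "infinite (carrier (A Quot \<mm>))" and K: "graded_sub K"
    and ne: "\<And>N. \<exists>j\<ge>N. \<not> Mg (diag_deg j) \<subseteq> K"
  shows "chain_over K 1"
proof -
  note Ks = graded_subD(1)[OF K]
  obtain y where y0: "y \<in> Sg (\<lambda>j. if j \<in> (UNIV::'d set) then 1 else 0)" "ev_inj_mod K y"
    using exists_ev_inj_mod_prod[OF inf K, of "UNIV :: 'd set"] by auto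
  have y: "y \<in> Sg (diag_deg 1)" using y0(1) by (simp add: diag_deg_def)
  have yc: "y \<in> carrier S" using Sg_carrier[OF y] .
  obtain N where N: "\<forall>n m. (\<forall>i. N \<le> n i) \<longrightarrow> m \<in> Mg n \<longrightarrow> y \<odot> m \<in> K \<longrightarrow> m \<in> K"
    using y0(2) unfolding ev_inj_mod_def large_def by blast
  obtain j m where m: "N \<le> j" "m \<in> Mg (diag_deg j)" "m \<notin> K" using ne[of N] by blast
  have mc: "m \<in> carrier M" using Mg_carrier m by blast
  have one: "\<one>\<^bsub>S\<^esub> \<noteq> \<zero>\<^bsub>S\<^esub>"
  proof
    assume "\<one>\<^bsub>S\<^esub> = \<zero>\<^bsub>S\<^esub>"
    then have "m = \<zero>" using SM.smult_one[OF mc] SM.smult_l_null[OF mc] by simp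
    then show False using m(3) SM.submodule_zero_mem[OF Ks] by blast
  qed
  have pr: "primeideal max_hom Rd" using primeideal_max_hom[OF one] .
  have "\<exists>P. primeideal P Rd \<and> AD K \<subseteq> P \<and> P \<subseteq> max_hom \<and> y \<notin> P"
  proof (rule exists_prime_below[OF Ks pr y])
    fix s p assume s: "s \<in> SG.Gdiag" "s \<notin> max_hom"
    have sc: "s \<in> carrier S" using SG.Gdiag_carrier s by blast
    show "s \<otimes>\<^bsub>S\<^esub> y [^]\<^bsub>S\<^esub> (p::nat) \<notin> AD K"
    proof
      assume sy: "s \<otimes>\<^bsub>S\<^esub> y [^]\<^bsub>S\<^esub> p \<in> AD K"
      have yp: "y [^]\<^bsub>S\<^esub> p \<in> Sg (\<lambda>i. p * diag_deg 1 i)" using Sg_pow[OF y] .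
      have ypc: "y [^]\<^bsub>S\<^esub> p \<in> carrier S" using Sg_carrier[OF yp] .
      let ?m = "y [^]\<^bsub>S\<^esub> p \<odot> m"
      have m': "?m \<in> Mg (\<lambda>i. p * diag_deg 1 i + diag_deg j i)" using Mg_smult[OF yp m(2)] .
      obtain a where a: "a \<in> carrier A" "SG.cp s (\<lambda>_. 0) = iota a" using Sg_zero_deg[OF SG.cp_props(1)[OF sc]] .
      have am: "a \<notin> \<mm>" using s a unfolding max_hom_def by blast
      have "(s \<otimes>\<^bsub>S\<^esub> y [^]\<^bsub>S\<^esub> p) \<odot> m \<in> K" using sy m(2) unfolding AD_def by blast
      then have "s \<odot> ?m \<in> K" using SM.smult_assoc1[OF sc ypc mc] by simp
      then have "MG.cp (s \<odot> ?m) (\<lambda>i. (p * diag_deg 1 i + diag_deg j i) + 0) \<in> K" using graded_subD(2)[OF K] by blast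
      then have "iota a \<odot> ?m \<in> K" using cp_smult_right(1)[OF m' sc, of "\<lambda>_. 0"] a by simp
      moreover obtain b where b: "b \<in> carrier A" "b \<otimes>\<^bsub>A\<^esub> a = \<one>\<^bsub>A\<^esub>" using unit_if_notin_m[OF a(1) am] .
      ultimately have "iota b \<odot> (iota a \<odot> ?m) \<in> K" using SM.submodule_smult_mem[OF Ks] by simp
      moreover have "iota b \<odot> (iota a \<odot> ?m) = iota (b \<otimes>\<^bsub>A\<^esub> a) \<odot> ?m"
        using SM.smult_assoc1[of "iota b" "iota a" ?m] iota_prod[OF b(1) a(1)] a(1) b(1) ypc mc by simp
      ultimately have "?m \<in> K" using b(2) ypc mc by simp
      then have "m \<in> K" using ev_inj_mod_power[OF yc y N _ m(2)] m(1) by (simp add: diag_deg_def)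
      then show False using m(3) by blast
    qed
  qed
  then obtain P where P: "primeideal P Rd" "AD K \<subseteq> P" "P \<subseteq> max_hom" "y \<notin> P" by blast
  have "P \<subset> max_hom" using P Sg_diag_subset_max_hom[of 1] y by auto
  moreover have "\<not> Sg (diag_deg 1) \<subseteq> P" using P(4) y by blast
  ultimately show ?thesis unfolding chain_over_def
    by (intro exI[of _ "\<lambda>i. if i = 0 then P else max_hom"]) (use P pr in auto)
qed

subsection \<open>Filter-regular sequences of prescribed type\<close>

text \<open>The list \<open>is\<close> fixes the order of the degrees, so that differences of
  Hilbert functions can be taken in the same order.\<close>

definition weak_seq :: "'d list \<Rightarrow> 's list \<Rightarrow> bool" where
  "weak_seq is xs \<longleftrightarrow> length xs = length is \<and>
     (\<forall>t<length is. xs ! t \<in> Sg (unit_deg (is ! t)) \<and> ev_inj_mod (gensub (set (take t xs))) (xs ! t))"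

lemma weak_seq_graded_sub: "weak_seq is xs \<Longrightarrow> graded_sub (gensub (set (take t xs)))"
proof (rule graded_sub_gensub)
  fix x assume w: "weak_seq is xs" and "x \<in> set (take t xs)"
  then obtain i where "i < length xs" "x = xs ! i" by (metis in_set_conv_nth in_set_takeD)
  then show "\<exists>v. x \<in> Sg v" using w unfolding weak_seq_def by auto
qed simp

lemma gensub_take_Suc:
  assumes w: "weak_seq is xs" and t: "t < length is"
  shows "gensub (set (take (Suc t) xs)) = gensub (set (take t xs)) <+>\<^bsub>M\<^esub> scaled (xs ! t)"
proof -
  have "length xs = length is" using w unfolding weak_seq_def by blast
  then have "set (take (Suc t) xs) = insert (xs ! t) (set (take t xs))" using t by (simp add: take_Suc_conv_app_nth)
  moreover have "set (take t xs) \<subseteq> carrier S"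
  proof
    fix x assume "x \<in> set (take t xs)"
    then obtain i where "i < length xs" "x = xs ! i" by (metis in_set_conv_nth in_set_takeD)
    then show "x \<in> carrier S" using w Sg_carrier unfolding weak_seq_def by auto
  qed
  moreover have "xs ! t \<in> Sg (unit_deg (is ! t))" using w t unfolding weak_seq_def by blast
  ultimately show ?thesis using gensub_insert by simp
qed

lemma exists_weak_seq:
  assumes inf: "infinite (carrier (A Quot \<mm>))" shows "\<exists>xs. weak_seq is xs"
proof (induction "is" rule: rev_induct)
  case Nil then show ?case by (intro exI[of _ "[]"]) (simp add: weak_seq_def)
next
  case (snoc i js)
  then obtain xs where xs: "weak_seq js xs" by blast
  have l: "length xs = length js" using xs unfolding weak_seq_def by blast
  have "graded_sub (gensub (set xs))" using weak_seq_graded_sub[OF xs, of "length xs"] by simp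
  then obtain x where x: "x \<in> Sg (unit_deg i)" "ev_inj_mod (gensub (set xs)) x" using exists_ev_inj_mod[OF inf] by blast
  have "weak_seq (js @ [i]) (xs @ [x])"
    unfolding weak_seq_def
  proof (intro conjI allI impI)
    show "length (xs @ [x]) = length (js @ [i])" using l by simp
    fix t assume t: "t < length (js @ [i])"
    show "(xs @ [x]) ! t \<in> Sg (unit_deg ((js @ [i]) ! t))"
      using x(1) xs l t unfolding weak_seq_def by (cases "t = length js") (auto simp: nth_append)
    show "ev_inj_mod (gensub (set (take t (xs @ [x])))) ((xs @ [x]) ! t)"
      using x(2) xs l t unfolding weak_seq_def by (cases "t = length js") (auto simp: nth_append)
  qed
  then show ?case by blast
qed

lemma chain_over_weak_seq:
  assumes inf: "infinite (carrier (A Quot \<mm>))" and w: "weak_seq is xs"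
    and ch: "chain_over (gensub (set (take t xs))) n" and t: "t \<le> length is"
  shows "chain_over {\<zero>} (n + t)"
  using ch t
proof (induction t arbitrary: n)
  case 0
  then show ?case using gensub_empty by simp
next
  case (Suc t)
  then have t: "t < length is" by simp
  have "chain_over (gensub (set (take t xs))) (Suc n)"
  proof (rule chain_over_step[OF inf weak_seq_graded_sub[OF w]])
    show "xs ! t \<in> Sg (unit_deg (is ! t))" "ev_inj_mod (gensub (set (take t xs))) (xs ! t)" using w t unfolding weak_seq_def by auto
    show "chain_over (gensub (set (take t xs)) <+>\<^bsub>M\<^esub> scaled (xs ! t)) n" using Suc.prems(1) gensub_take_Suc[OF w t] by simp
  qed
  then show ?case using Suc.IH[of "Suc n"] t by simp
qed

lemma hilb_weak_seq:
  assumes w: "weak_seq is xs" and c: "is_hilbert_poly A S M Mg c"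
    and deg: "\<And>u. c u \<noteq> 0 \<Longrightarrow> (\<Sum>j\<in>UNIV. u j) \<le> length is"
  shows "large (\<lambda>n. of_nat (hilb (gensub (set xs)) n) = c (count_list is) * (\<Prod>i\<in>UNIV. fact (count_list is i)))"
proof -
  have l: "length xs = length is" using w unfolding weak_seq_def by blast
  have c': "finite {u. c u \<noteq> 0}" "large (\<lambda>n. of_nat (hilb {\<zero>} n) = mpoly_eval c n)"
    using c unfolding is_hilbert_poly_iff by auto
  define h where "h t n = (of_nat (hilb (gensub (set (take t xs))) n) :: rat)" for t n
  have "large (\<lambda>n. h (length is) n = c (count_list is) * (\<Prod>i\<in>UNIV. fact (count_list is i)))"
  proof (rule iterated_nabla_top[OF c'(1) deg])
    show "large (\<lambda>n. h 0 n = mpoly_eval c n)" unfolding h_def using c'(2) gensub_empty by simp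
    fix t assume t: "t < length is"
    have x: "xs ! t \<in> Sg (unit_deg (is ! t))" "ev_inj_mod (gensub (set (take t xs))) (xs ! t)" using w t unfolding weak_seq_def by auto
    show "large (\<lambda>n. h (Suc t) n = h t n - h t (n(is ! t := n (is ! t) - 1)))"
      using hilb_quotient_step[OF weak_seq_graded_sub[OF w] x]
    proof (rule large_mono)
      fix n
      assume h: "int (hilb (gensub (set (take t xs)) <+>\<^bsub>M\<^esub> scaled (xs ! t)) n) =
         int (hilb (gensub (set (take t xs))) n) - int (hilb (gensub (set (take t xs))) (n(is ! t := n (is ! t) - 1)))"
      have "(of_int (int (hilb (gensub (set (take (Suc t) xs))) n)) :: rat) =
         of_int (int (hilb (gensub (set (take t xs))) n) - int (hilb (gensub (set (take t xs))) (n(is ! t := n (is ! t) - 1))))"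
        unfolding gensub_take_Suc[OF w t] h ..
      then show "h (Suc t) n = h t n - h t (n(is ! t := n (is ! t) - 1))" unfolding h_def by simp
    qed
  qed
  then show ?thesis unfolding h_def using l by simp
qed

lemma not_subset_if_hilb_nonzero:
  assumes K: "submodule K S M" and h: "large (\<lambda>n. hilb K n \<noteq> 0)"
  shows "\<exists>j\<ge>N. \<not> Mg (diag_deg j) \<subseteq> K"
proof -
  obtain N' where N': "\<And>n. (\<forall>i. N' \<le> n i) \<Longrightarrow> hilb K n \<noteq> 0" using h unfolding large_def by blast
  have "hilb K (diag_deg (max N N')) \<noteq> 0" by (rule N') (simp add: diag_deg_def)
  moreover have "hilb K n = 0" if "Mg n \<subseteq> K" for n
  proof -
    have "K \<inter> Mg n = Mg n" using that by blast
    then show ?thesis unfolding hilb_def by (simp add: zero_enat_def)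
  qed
  ultimately show ?thesis by (intro exI[of _ "max N N'"]) auto
qed

text \<open>For a monomial \<open>k\<close> of top degree \<open>D\<close>, a sequence of type
  \<open>k\<close> leaves a quotient with nonzero constant Hilbert function. It carries a chain of
  length 1, which lifts through the \<open>D\<close> steps to a chain of length \<open>D + 1\<close>
  over \<open>M\<close>.\<close>

theorem hilbert_poly_degree:
  assumes inf: "infinite (carrier (A Quot \<mm>))" and c: "is_hilbert_poly A S M Mg c"
    and dim: "module_krull_dim Rd (diagonal M Mg) = ereal (real ell)"
    and u: "c u \<noteq> 0"
  shows "(\<Sum>j\<in>UNIV. u j) + 1 \<le> ell"
proof -
  have fin: "finite {u. c u \<noteq> 0}" using c unfolding is_hilbert_poly_iff by auto
  define D where "D = Max ((\<lambda>u. \<Sum>j\<in>UNIV. u j) ` {u. c u \<noteq> 0})"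
  have "D \<in> (\<lambda>u. \<Sum>j\<in>UNIV. u j) ` {u. c u \<noteq> 0}" unfolding D_def using fin u by (intro Max_in) auto
  then obtain k where k: "c k \<noteq> 0" "(\<Sum>j\<in>UNIV. k j) = D" by auto
  have le: "(\<Sum>j\<in>UNIV. v j) \<le> D" if "c v \<noteq> 0" for v unfolding D_def using fin that by (intro Max_ge) auto
  obtain js where js: "count_list js = k" using exists_count_list by blast
  have len: "length js = D" using sum_count_list_UNIV[of js] k js by simp
  obtain xs where xs: "weak_seq js xs" using exists_weak_seq[OF inf] by blast
  have l: "length xs = length js" using xs unfolding weak_seq_def by blast
  have "large (\<lambda>n. of_nat (hilb (gensub (set xs)) n) = c k * (\<Prod>i\<in>UNIV. fact (k i)))"
    using hilb_weak_seq[OF xs c] le len js by simp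
  then have "large (\<lambda>n. hilb (gensub (set xs)) n \<noteq> 0)" 
  proof (rule large_mono)
    fix n assume h: "of_nat (hilb (gensub (set xs)) n) = c k * (\<Prod>i\<in>UNIV. fact (k i))"
    have "c k * (\<Prod>i\<in>UNIV. fact (k i)) \<noteq> 0" using k(1) by simp
    then show "hilb (gensub (set xs)) n \<noteq> 0" using h by (metis of_nat_0)
  qed
  moreover have g: "graded_sub (gensub (set xs))" using weak_seq_graded_sub[OF xs, of "length xs"] by simp
  ultimately have "chain_over (gensub (set xs)) 1"
    using chain_over_base[OF inf g] not_subset_if_hilb_nonzero[OF graded_subD(1)[OF g]] by blast
  then have "chain_over {\<zero>} (1 + length js)" using chain_over_weak_seq[OF inf xs, of "length js" 1] l by simp
  from chain_over_le_dim[OF SM.submodule_zero this] have "1 + length js \<le> ell"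
    using dim unfolding module_krull_dim_def annihilator_diagonal by simp
  then show ?thesis using le[OF u] len by simp
qed

end

context module
begin

lemma mult_map: "a \<in> carrier R \<Longrightarrow> module_map R M M (\<lambda>z. a \<odot>\<^bsub>M\<^esub> z)"
  by (intro module_map.intro module_axioms module_map_axioms.intro)
    (simp_all add: smult_r_distr smult_commute)

lemma submodule_smult_image:
  assumes "ideal I R" "w \<in> carrier M" shows "submodule ((\<lambda>s. s \<odot>\<^bsub>M\<^esub> w) ` I) R M"
proof -
  have "module_map R (self_module R) M (\<lambda>s. s \<odot>\<^bsub>M\<^esub> w)"
    by (intro module_map.intro R.module_self_module module_axioms module_map_axioms.intro)
      (use assms(2) in \<open>simp_all add: smult_l_distr smult_assoc1\<close>)
  then show ?thesis by (rule module_map.submodule_image) (rule R.submodule_self_iff[THEN iffD2, OF assms(1)])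
qed

end

section \<open>Reductions\<close>

context graded_module
begin

sublocale DM: module "diagonal S Sg" "diagonal M Mg" by (rule module_diagonal)

lemma ideal_smult_diagonal:
  assumes "B \<subseteq> SG.Gdiag" shows "ideal_smult Rd (genideal Rd B) (diagonal M Mg) = DM.gensub B"
  using DM.ideal_smult_genideal assms by simp

lemma diagonal_gensub_subset:
  assumes B: "B \<subseteq> SG.Gdiag" shows "DM.gensub B \<subseteq> gensub B"
proof
  have Bc: "B \<subseteq> carrier S" using B SG.Gdiag_carrier by blast
  fix y assume "y \<in> DM.gensub B"
  then have y: "add_closure (diagonal M Mg) {x \<odot>\<^bsub>diagonal M Mg\<^esub> m | x m. x \<in> B \<and> m \<in> carrier (diagonal M Mg)} y"
    unfolding DM.gensub_def by blast
  show "y \<in> gensub B"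
  proof (rule DM.M.add_closure_least[OF y])
    show "\<zero>\<^bsub>diagonal M Mg\<^esub> \<in> gensub B" using SM.submodule_zero_mem[OF submodule_gensub[OF Bc]] by simp
    show "a \<oplus>\<^bsub>diagonal M Mg\<^esub> b \<in> gensub B" if "a \<in> gensub B" "b \<in> gensub B" for a b
      using SM.submodule_add_mem[OF submodule_gensub[OF Bc] that] by simp
    show "{x \<odot>\<^bsub>diagonal M Mg\<^esub> m | x m. x \<in> B \<and> m \<in> carrier (diagonal M Mg)} \<subseteq> gensub B"
      using gensub_mem[OF Bc] MG.Gdiag_carrier by auto
  qed
qed

text \<open>An element of \<open>x M\<close> of diagonal degree \<open>j + 1\<close> is
  \<open>x\<close> times a component of diagonal degree \<open>j\<close>, as taking components
  commutes with multiplication by \<open>x\<close>.\<close>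

lemma diagonal_gensub_single:
  assumes x: "x \<in> Sg (diag_deg 1)"
  shows "DM.gensub {x} \<inter> Mg (diag_deg (Suc j)) = (\<lambda>m. x \<odot> m) ` Mg (diag_deg j)"
proof
  have xd: "{x} \<subseteq> SG.Gdiag" using SG.Gdiag_hom[OF x] by simp
  show "(\<lambda>m. x \<odot> m) ` Mg (diag_deg j) \<subseteq> DM.gensub {x} \<inter> Mg (diag_deg (Suc j))"
  proof (rule image_subsetI)
    fix m assume m: "m \<in> Mg (diag_deg j)"
    have "x \<odot>\<^bsub>diagonal M Mg\<^esub> m \<in> DM.gensub {x}"
      by (rule DM.gensub_mem) (use xd MG.Gdiag_hom[OF m] in auto)
    moreover have "x \<odot> m \<in> Mg (diag_deg (Suc j))" using Mg_smult[OF x m] unfolding diag_deg_add by simp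
    ultimately show "x \<odot> m \<in> DM.gensub {x} \<inter> Mg (diag_deg (Suc j))" by simp
  qed
  show "DM.gensub {x} \<inter> Mg (diag_deg (Suc j)) \<subseteq> (\<lambda>m. x \<odot> m) ` Mg (diag_deg j)"
  proof
    fix y assume y: "y \<in> DM.gensub {x} \<inter> Mg (diag_deg (Suc j))"
    then have "y \<in> gensub {x}" using diagonal_gensub_subset[OF xd] by blast
    moreover have "gensub {x} \<subseteq> scaled x"
      by (rule gensub_least[OF graded_subD(1)[OF graded_sub_scaled[OF x]]]) (use scaled_mem in blast)
    ultimately obtain z where z: "z \<in> carrier M" "y = x \<odot> z" unfolding scaled_def by blast
    have "MG.cp (x \<odot> z) (\<lambda>i. diag_deg 1 i + diag_deg j i) = x \<odot> MG.cp z (diag_deg j)"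
      using cp_smult_hom(1)[OF x z(1)] .
    moreover have "MG.cp y (diag_deg (Suc j)) = y" using MG.cp_self y by blast
    ultimately have "y = x \<odot> MG.cp z (diag_deg j)" unfolding diag_deg_add z(2)[symmetric] by simp
    then show "y \<in> (\<lambda>m. x \<odot> m) ` Mg (diag_deg j)" using MG.cp_props(1)[OF z(1)] by blast
  qed
qed

text \<open>Diagonal information spreads to all large degrees. \<open>M\<close> is generated in
  degrees at most \<open>J\<close>, and for \<open>n \<ge> J\<close> the scalar in front of a
  generator factors so that one factor first lifts the generator to the diagonal degree
  \<open>J\<close>, hence into \<open>L\<close>.\<close>

lemma large_subset_if_diag:
  assumes L: "submodule L S M" and d: "\<And>j. n0 \<le> j \<Longrightarrow> Mg (diag_deg j) \<subseteq> L"
  shows "large (\<lambda>n. Mg n \<subseteq> L)"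
proof -
  obtain j0 where j0: "\<forall>n m. m \<in> carrier M \<longrightarrow> m \<in> Mg n \<longrightarrow>
     add_closure M {s \<odot> k | s k w u. s \<in> Sg w \<and> k \<in> carrier M \<and> k \<in> Mg u \<and> (\<forall>i. u i \<le> j0) \<and> n = (\<lambda>i. u i + w i)} m"
    using graded_sub_generated[OF graded_sub_carrier] by blast
  define J where "J = max j0 n0"
  show ?thesis
  proof (rule largeI[of J], rule subsetI)
    fix n :: "'d \<Rightarrow> nat" and m assume n: "\<And>i. J \<le> n i" and m: "m \<in> Mg n"
    have "add_closure M {s \<odot> k | s k w u. s \<in> Sg w \<and> k \<in> carrier M \<and> k \<in> Mg u \<and> (\<forall>i. u i \<le> j0) \<and> n = (\<lambda>i. u i + w i)} m"
      using j0 m Mg_carrier[OF m] by blast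
    then show "m \<in> L"
    proof (rule SM.M.add_closure_least)
      show "\<zero> \<in> L" using SM.submodule_zero_mem[OF L] .
      show "a \<oplus> b \<in> L" if "a \<in> L" "b \<in> L" for a b using SM.submodule_add_mem[OF L that] .
      show "{s \<odot> k | s k w u. s \<in> Sg w \<and> k \<in> carrier M \<and> k \<in> Mg u \<and> (\<forall>i. u i \<le> j0) \<and> n = (\<lambda>i. u i + w i)} \<subseteq> L"
      proof (rule subsetI)
        fix y assume "y \<in> {s \<odot> k | s k w u. s \<in> Sg w \<and> k \<in> carrier M \<and> k \<in> Mg u \<and> (\<forall>i. u i \<le> j0) \<and> n = (\<lambda>i. u i + w i)}"
        then obtain s k w u where y: "y = s \<odot> k" "s \<in> Sg w" "k \<in> Mg u" "\<forall>i. u i \<le> j0" "n = (\<lambda>i. u i + w i)" by blast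
        have kc: "k \<in> carrier M" using Mg_carrier[OF y(3)] .
        let ?u = "\<lambda>i. n i - J" and ?v = "\<lambda>i. J - u i"
        have w: "w = (\<lambda>i. ?u i + ?v i)"
        proof
          fix i show "w i = ?u i + ?v i" using n[of i] y(4)[rule_format, of i] fun_cong[OF y(5), of i] unfolding J_def by simp
        qed
        have ku: "(\<lambda>i. ?v i + u i) = diag_deg J"
        proof
          fix i show "?v i + u i = diag_deg J i" using y(4)[rule_format, of i] unfolding J_def diag_deg_def by simp
        qed
        have "s \<in> Sg (\<lambda>i. ?u i + ?v i)" using y(2) w by simp
        from Sg_add_decomp[OF this] have ac: "add_closure S {t \<otimes>\<^bsub>S\<^esub> t' | t t'. t \<in> Sg ?u \<and> t' \<in> Sg ?v} s" .
        have "s \<in> {s \<in> carrier S. s \<odot> k \<in> L}"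
        proof (rule S.add_closure_least[OF ac])
          show "\<zero>\<^bsub>S\<^esub> \<in> {s \<in> carrier S. s \<odot> k \<in> L}" using SM.submodule_zero_mem[OF L] kc by simp
          show "a \<oplus>\<^bsub>S\<^esub> b \<in> {s \<in> carrier S. s \<odot> k \<in> L}"
            if "a \<in> {s \<in> carrier S. s \<odot> k \<in> L}" "b \<in> {s \<in> carrier S. s \<odot> k \<in> L}" for a b
            using that SM.submodule_add_mem[OF L] SM.smult_l_distr[of a b k] kc by simp
          show "{t \<otimes>\<^bsub>S\<^esub> t' | t t'. t \<in> Sg ?u \<and> t' \<in> Sg ?v} \<subseteq> {s \<in> carrier S. s \<odot> k \<in> L}"
          proof (rule subsetI)
            fix z assume "z \<in> {t \<otimes>\<^bsub>S\<^esub> t' | t t'. t \<in> Sg ?u \<and> t' \<in> Sg ?v}"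
            then obtain t t' where z: "z = t \<otimes>\<^bsub>S\<^esub> t'" "t \<in> Sg ?u" "t' \<in> Sg ?v" by blast
            have tc: "t \<in> carrier S" "t' \<in> carrier S" using Sg_carrier[OF z(2)] Sg_carrier[OF z(3)] by auto
            have "t' \<odot> k \<in> Mg (diag_deg J)" using Mg_smult[OF z(3) y(3)] unfolding ku .
            then have "t' \<odot> k \<in> L" using d[of J] unfolding J_def by auto
            then have "t \<odot> (t' \<odot> k) \<in> L" using SM.submodule_smult_mem[OF L tc(1)] by blast
            then show "z \<in> {s \<in> carrier S. s \<odot> k \<in> L}" using z(1) tc kc by (simp add: SM.smult_assoc1)
          qed
        qed
        then show "y \<in> L" using y(1) by simp
      qed
    qed
  qed
qed

text \<open>The exponent is the threshold \<open>N\<close> itself: whatever the degree of a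
  homogeneous element, \<open>y^N\<close> moves it to a degree at least \<open>N\<close> in every
  coordinate. One exponent thus serves all of \<open>M\<close>.\<close>

lemma power_smult_subset:
  assumes L: "submodule L S M" and l: "large (\<lambda>n. Mg n \<subseteq> L)" and y: "y \<in> Sg (diag_deg 1)"
  shows "\<exists>p::nat. \<forall>m\<in>carrier M. (y [^]\<^bsub>S\<^esub> p) \<odot> m \<in> L"
proof -
  obtain N where N: "\<And>n. (\<forall>i. N \<le> n i) \<Longrightarrow> Mg n \<subseteq> L" using l unfolding large_def by blast
  have yp: "y [^]\<^bsub>S\<^esub> N \<in> Sg (\<lambda>i. N * diag_deg 1 i)" using Sg_pow[OF y] .
  have ypc: "y [^]\<^bsub>S\<^esub> N \<in> carrier S" using Sg_carrier[OF yp] .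
  have "(y [^]\<^bsub>S\<^esub> N) \<odot> m \<in> L" if m: "m \<in> carrier M" for m
  proof (rule MG.hom_induct[where P = "\<lambda>m. (y [^]\<^bsub>S\<^esub> N) \<odot> m \<in> L", OF m])
    show "(y [^]\<^bsub>S\<^esub> N) \<odot> k \<in> L" if k: "k \<in> Mg u" for u k
    proof -
      have "Mg (\<lambda>i. N * diag_deg 1 i + u i) \<subseteq> L" by (rule N) (simp add: diag_deg_def)
      then show ?thesis using Mg_smult[OF yp k] by blast
    qed
    show "(y [^]\<^bsub>S\<^esub> N) \<odot> (a \<oplus> b) \<in> L"
      if "a \<in> carrier M" "b \<in> carrier M" "(y [^]\<^bsub>S\<^esub> N) \<odot> a \<in> L" "(y [^]\<^bsub>S\<^esub> N) \<odot> b \<in> L" for a b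
      using SM.submodule_add_mem[OF L that(3,4)] SM.smult_r_distr[OF ypc that(1,2)] by simp
  qed
  then show ?thesis by blast
qed

text \<open>Nakayama's lemma for the localisation at \<open>P\<close>, by Noetherian induction on submodules
  instead of determinants.\<close>

lemma annihilator_not_subset_if_power_smult:
  assumes P: "primeideal P S" and y: "y \<in> carrier S" "y \<notin> P"
    and sub: "\<And>m. m \<in> carrier M \<Longrightarrow> y \<odot> m \<in> gensub P"
  shows "\<not> annihilator S M \<subseteq> P"
proof
  assume ann: "annihilator S M \<subseteq> P"
  have Pi: "ideal P S" using primeideal.axioms(1)[OF P] .
  have Pc: "p \<in> carrier S" if "p \<in> P" for p using S.ideal_subset[OF Pi] that by blast
  have oneP: "\<one>\<^bsub>S\<^esub> \<notin> P" using S.ideal_mult_mem[OF Pi y(1), of "\<one>\<^bsub>S\<^esub>"] y by auto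
  have prod: "s \<otimes>\<^bsub>S\<^esub> t \<notin> P" if "s \<in> carrier S" "t \<in> carrier S" "s \<notin> P" "t \<notin> P" for s t
    using primeideal.I_prime[OF P that(1,2)] that(3,4) by blast
  \<comment> \<open>The submodules \<open>K\<close> for which \<open>M / K\<close> is not
    annihilated by any element outside \<open>P\<close>, that is, remains nonzero after localising
    at \<open>P\<close>.\<close>
  define Y where "Y = {K. submodule K S M \<and> (\<forall>a\<in>carrier S - P. \<exists>m\<in>carrier M. a \<odot> m \<notin> K)}"
  have "{\<zero>} \<in> Y" unfolding Y_def using SM.submodule_zero ann unfolding annihilator_def by auto
  then have "Y \<noteq> {}" by blast
  moreover have "submodule K S M" if "K \<in> Y" for K using that unfolding Y_def by simp
  ultimately have "\<exists>K\<in>Y. \<forall>K'\<in>Y. K \<subseteq> K' \<longrightarrow> K' = K" by (rule exists_maximal_submodule)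
  then obtain K where K: "K \<in> Y" and max: "\<And>K'. K' \<in> Y \<Longrightarrow> K \<subseteq> K' \<Longrightarrow> K' = K" by blast
  have Ks: "submodule K S M" using K unfolding Y_def by blast
  have kc: "k \<in> carrier M" if "k \<in> K" for k using SM.submodule_subset[OF Ks] that by blast
  have esc: "\<exists>m\<in>carrier M. a \<odot> m \<notin> K" if "a \<in> carrier S" "a \<notin> P" for a using K that unfolding Y_def by blast
  obtain w where w: "w \<in> carrier M" "w \<notin> K" using esc[OF S.one_closed oneP] by force
  let ?C = "\<lambda>I. (\<lambda>s. s \<odot> w) ` I"
  have Cs: "submodule (?C I) S M" if "ideal I S" for I using SM.submodule_smult_image[OF that w(1)] .
  let ?K' = "K <+>\<^bsub>M\<^esub> ?C (carrier S)"
  note C1 = Cs[OF S.oneideal]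
  have "w \<in> ?K'" using SM.set_add_upper2[OF Ks C1] S.one_closed w(1) SM.smult_one by force
  then have "?K' \<notin> Y" using max SM.set_add_upper1[OF Ks C1] w(2) by blast
  \<comment> \<open>By maximality of \<open>K\<close>, the quotient by \<open>K + S w\<close> does
    vanish at \<open>P\<close>: up to the factor \<open>a\<close>, the module is generated by
    \<open>w\<close> modulo \<open>K\<close>.\<close>
  then obtain a where a: "a \<in> carrier S" "a \<notin> P" "\<And>m. m \<in> carrier M \<Longrightarrow> a \<odot> m \<in> ?K'"
    unfolding Y_def using SM.submodule_set_add[OF Ks C1] by blast
  interpret f: module_map S M M "\<lambda>z. a \<odot> z" by (rule SM.mult_map[OF a(1)])
  let ?H = "{z \<in> carrier M. a \<odot> z \<in> K <+>\<^bsub>M\<^esub> ?C P}"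
  have "gensub P \<subseteq> ?H"
  proof (rule gensub_least)
    show "submodule ?H S M"
      using f.submodule_preimage[OF SM.carrier_is_submodule SM.submodule_set_add[OF Ks Cs[OF Pi]]] .
    fix x m assume x: "x \<in> P" and m: "m \<in> carrier M"
    obtain k s where h: "a \<odot> m = k \<oplus> s \<odot> w" "k \<in> K" "s \<in> carrier S" using a(3)[OF m] unfolding SM.set_add_iff by blast
    have "a \<odot> (x \<odot> m) = x \<odot> k \<oplus> (s \<otimes>\<^bsub>S\<^esub> x) \<odot> w"
      using SM.smult_commute[OF a(1) Pc[OF x] m] Pc[OF x] h(3) kc[OF h(2)] w(1) unfolding h(1)
      by (simp add: SM.smult_r_distr SM.smult_assoc1 SM.smult_commute)
    moreover have "x \<odot> k \<in> K" "s \<otimes>\<^bsub>S\<^esub> x \<in> P"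
      using SM.submodule_smult_mem[OF Ks Pc[OF x] h(2)] S.ideal_mult_mem[OF Pi h(3) x] by auto
    ultimately show "x \<odot> m \<in> ?H" unfolding SM.set_add_iff using m Pc[OF x] by blast
  qed
  then have "a \<odot> (y \<odot> w) \<in> K <+>\<^bsub>M\<^esub> ?C P" using sub[OF w(1)] by blast
  then obtain k d where kd: "k \<in> K" "d \<in> P" "a \<odot> (y \<odot> w) = k \<oplus> d \<odot> w" unfolding SM.set_add_iff by blast
  \<comment> \<open>The relation \<open>a y w = k + d w\<close> with \<open>d\<close> in
    \<open>P\<close> shows that \<open>b = a y - d\<close>, which is outside \<open>P\<close>,
    carries \<open>w\<close> into \<open>K\<close>. Then \<open>b a\<close> carries all of
    \<open>M\<close> into \<open>K\<close>, contrary to the choice of \<open>K\<close>.\<close>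
  define b where "b = a \<otimes>\<^bsub>S\<^esub> y \<ominus>\<^bsub>S\<^esub> d"
  have dS: "d \<in> carrier S" using Pc[OF kd(2)] .
  have bc: "b \<in> carrier S" unfolding b_def using a(1) y(1) dS by simp
  have "b \<oplus>\<^bsub>S\<^esub> d = a \<otimes>\<^bsub>S\<^esub> y" unfolding b_def using S.add_minus_cancel(3)[of "a \<otimes>\<^bsub>S\<^esub> y" d] a(1) y(1) dS by simp
  then have bP: "b \<notin> P" using S.ideal_add_mem[OF Pi _ kd(2), of b] prod[OF a(1) y(1) a(2) y(2)] by auto
  have "b \<odot> w = (k \<oplus> d \<odot> w) \<ominus> d \<odot> w"
    unfolding b_def kd(3)[symmetric] using a(1) y(1) dS w(1)
    by (simp add: a_minus_def SM.smult_l_distr SM.smult_l_minus SM.smult_assoc1)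
  then have bw: "b \<odot> w \<in> K" using SM.M.add_minus_cancel(2)[of k "d \<odot> w"] kc[OF kd(1)] dS w(1) kd(1) by simp
  obtain m where m: "m \<in> carrier M" "(b \<otimes>\<^bsub>S\<^esub> a) \<odot> m \<notin> K" using esc[OF _ prod[OF bc a(1) bP a(2)]] bc a(1) by auto
  obtain k s where h: "a \<odot> m = k \<oplus> s \<odot> w" "k \<in> K" "s \<in> carrier S" using a(3)[OF m(1)] unfolding SM.set_add_iff by blast
  have "(b \<otimes>\<^bsub>S\<^esub> a) \<odot> m = b \<odot> k \<oplus> s \<odot> (b \<odot> w)"
    using SM.smult_assoc1[OF bc a(1) m(1)] SM.smult_r_distr[OF bc kc[OF h(2)], of "s \<odot> w"]
      SM.smult_commute[OF bc h(3) w(1)] h(3) w(1) unfolding h(1) by simp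
  moreover have "b \<odot> k \<oplus> s \<odot> (b \<odot> w) \<in> K"
    by (rule SM.submodule_add_mem[OF Ks SM.submodule_smult_mem[OF Ks bc h(2)] SM.submodule_smult_mem[OF Ks h(3) bw]])
  ultimately show False using m(2) by simp
qed

text \<open>If \<open>P\<close> contained \<open>B\<close> but not S_{++}, a power of some
  \<open>y\<close> outside \<open>P\<close> would carry \<open>M\<close> into
  \<open>B M \<subseteq> P M\<close>. The Nakayama argument then gives an annihilator of
  \<open>M\<close> outside \<open>P\<close>, but an associated prime contains the
  annihilator.\<close>

lemma prime_contains_plus_plus_if_reduction:
  assumes B: "B \<subseteq> Sg (diag_deg 1)" and red: "\<And>j. n0 \<le> j \<Longrightarrow> Mg (diag_deg j) \<subseteq> gensub B"
    and P: "P \<in> assoc_primes S M" "B \<subseteq> P"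
  shows "plus_plus S Sg \<subseteq> P"
proof (rule ccontr)
  assume n: "\<not> plus_plus S Sg \<subseteq> P"
  have Pp: "primeideal P S" using P(1) unfolding assoc_primes_iff by blast
  have Pi: "ideal P S" using primeideal.axioms(1)[OF Pp] .
  obtain y where y: "y \<in> Sg (diag_deg 1)" "y \<notin> P" using plus_plus_subset_if_diag[OF Pi] n by blast
  have Bc: "B \<subseteq> carrier S" using B Sg_carrier by blast
  have "large (\<lambda>n. Mg n \<subseteq> gensub B)" using large_subset_if_diag[OF submodule_gensub[OF Bc] red] .
  from power_smult_subset[OF submodule_gensub[OF Bc] this y(1)]
  obtain p :: nat where p: "\<forall>m\<in>carrier M. (y [^]\<^bsub>S\<^esub> p) \<odot> m \<in> gensub B" by blast
  have Pc: "P \<subseteq> carrier S" using S.ideal_subset[OF Pi] .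
  have "gensub B \<subseteq> gensub P"
    by (rule gensub_least[OF submodule_gensub[OF Pc]]) (use gensub_mem[OF Pc] P(2) in blast)
  moreover have yc: "y \<in> carrier S" using Sg_carrier[OF y(1)] .
  have ypP: "y [^]\<^bsub>S\<^esub> p \<notin> P"
  proof (induction p)
    case 0
    show ?case
    proof
      assume "y [^]\<^bsub>S\<^esub> (0::nat) \<in> P"
      then have "\<one>\<^bsub>S\<^esub> \<in> P" by simp
      then have "y \<in> P" using S.ideal_mult_mem[OF Pi yc, of "\<one>\<^bsub>S\<^esub>"] yc by simp
      then show False using y(2) by blast
    qed
  next
    case (Suc p)
    then show ?case using primeideal.I_prime[OF Pp, of "y [^]\<^bsub>S\<^esub> p" y] yc y(2) by auto
  qed
  moreover have "y [^]\<^bsub>S\<^esub> p \<in> carrier S" using yc by simp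
  ultimately have "\<not> annihilator S M \<subseteq> P"
    by (intro annihilator_not_subset_if_power_smult[OF Pp]) (use p in blast)+
  moreover have "annihilator S M \<subseteq> P" using P(1) unfolding assoc_primes_iff annihilator_def SM.colon_def by auto
  ultimately show False by blast
qed

end

section \<open>Spans over the base ring, and principal minimal reductions\<close>

context graded_algebra
begin

abbreviation "A_span B \<equiv> {z. add_closure S {iota a \<otimes> b | a b. a \<in> carrier A \<and> b \<in> B} z}"

lemma A_span_props:
  assumes B: "B \<subseteq> Sg v"
  shows "A_span B \<subseteq> Sg v" "A_span B \<noteq> {}" "B \<subseteq> A_span B"
    and "x \<in> A_span B \<Longrightarrow> y \<in> A_span B \<Longrightarrow> x \<oplus> y \<in> A_span B"
    and "a \<in> carrier A \<Longrightarrow> x \<in> A_span B \<Longrightarrow> iota a \<otimes> x \<in> A_span B"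
proof -
  let ?Z = "{iota a \<otimes> b | a b. a \<in> carrier A \<and> b \<in> B}"
  have Bc: "b \<in> carrier S" if "b \<in> B" for b using B Sg_carrier that by blast
  have Zv: "?Z \<subseteq> Sg v" using B Sg_smult iota_mult Bc by auto
  have Zc: "?Z \<subseteq> carrier S" using Zv Sg_carrier by blast
  show "A_span B \<subseteq> Sg v"
  proof
    fix z assume "z \<in> A_span B"
    then have z: "add_closure S ?Z z" by simp
    show "z \<in> Sg v" by (rule S.add_closure_least[OF z SG.D_zero _ Zv]) (rule SG.D_add)
  qed
  show "A_span B \<noteq> {}" using add_closure.zero[of S ?Z] by blast
  show "B \<subseteq> A_span B"
  proof
    fix b assume b: "b \<in> B"
    have "iota \<one>\<^bsub>A\<^esub> \<otimes> b \<in> ?Z" using b by blast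
    then have "b \<in> ?Z" using Bc[OF b] by simp
    then show "b \<in> A_span B" using S.add_closure_incl[OF _ Zc] by simp
  qed
  show "x \<oplus> y \<in> A_span B" if "x \<in> A_span B" "y \<in> A_span B" using S.add_closure_add[OF Zc] that by simp
  show "iota a \<otimes> x \<in> A_span B" if a: "a \<in> carrier A" and x: "x \<in> A_span B"
  proof -
    have x': "add_closure S ?Z x" using x by simp
    have "add_closure S ?Z (iota a \<otimes> x)"
    proof (rule add_closure_map[OF S.is_abelian_group S.is_abelian_group x' Zc Zc, where h = "\<lambda>x. iota a \<otimes> x"])
      fix z assume "z \<in> ?Z"
      then obtain a' b where z: "a' \<in> carrier A" "b \<in> B" "z = iota a' \<otimes> b" by blast
      have "iota a \<otimes> z = (iota a \<otimes> iota a') \<otimes> b"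
        unfolding z(3) by (rule S.m_assoc[symmetric]) (use a z(1) Bc[OF z(2)] in simp_all)
      also have "\<dots> = iota (a \<otimes>\<^bsub>A\<^esub> a') \<otimes> b" unfolding iota_prod[OF a z(1)] ..
      finally have e: "iota a \<otimes> z = iota (a \<otimes>\<^bsub>A\<^esub> a') \<otimes> b" .
      have "iota (a \<otimes>\<^bsub>A\<^esub> a') \<otimes> b \<in> ?Z" using z(2) m_closed[OF a z(1)] by blast
      then show "add_closure S ?Z (iota a \<otimes> z)" unfolding e by (rule S.add_closure_incl[OF _ Zc])
    qed (use a S.r_distr in simp_all)
    then show ?thesis by simp
  qed
qed

lemma A_span_subset_ideal:
  assumes J: "ideal J Rd" and B: "B \<subseteq> J" shows "A_span B \<subseteq> J"
proof
  fix z assume "z \<in> A_span B"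
  then have z: "add_closure S {iota a \<otimes> b | a b. a \<in> carrier A \<and> b \<in> B} z" by simp
  show "z \<in> J"
  proof (rule S.add_closure_least[OF z])
    show "\<zero> \<in> J" using Rd.ideal_zero_mem[OF J] by simp
    show "x \<oplus> y \<in> J" if "x \<in> J" "y \<in> J" for x y using Rd.ideal_add_mem[OF J that] by simp
    show "{iota a \<otimes> b | a b. a \<in> carrier A \<and> b \<in> B} \<subseteq> J"
    proof (rule subsetI)
      fix y assume "y \<in> {iota a \<otimes> b | a b. a \<in> carrier A \<and> b \<in> B}"
      then obtain a b where y: "y = iota a \<otimes> b" "a \<in> carrier A" "b \<in> B" by blast
      have "iota a \<otimes>\<^bsub>Rd\<^esub> b \<in> J" by (rule Rd.ideal_mult_mem[OF J]) (use iota_Gdiag[OF y(2)] y(3) B in auto)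
      then show "y \<in> J" using y(1) by simp
    qed
  qed
qed

abbreviation "Rg \<equiv> \<lambda>j. Sg (diag_deg j)"

lemma ideal_genideal_diag: "B \<subseteq> Sg (diag_deg 1) \<Longrightarrow> ideal (genideal Rd B) Rd"
  using SG.Gdiag_hom by (intro Rd.genideal_ideal) auto

lemma deg_one_part_A_submodule:
  assumes J: "ideal J Rd"
  shows "submodule (J \<inter> Sg (diag_deg 1)) A (restrict_scalars S (self_module S))"
proof -
  interpret GS: graded_module A \<mm> S Sg "self_module S" Sg by (rule graded_module_self)
  show ?thesis unfolding GS.A_submodule_iff
  proof (intro conjI ballI)
    show "J \<inter> Sg (diag_deg 1) \<subseteq> carrier (self_module S)" using Sg_carrier by auto
    show "\<zero>\<^bsub>self_module S\<^esub> \<in> J \<inter> Sg (diag_deg 1)" using Rd.ideal_zero_mem[OF J] SG.D_zero by simp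
    show "x \<oplus>\<^bsub>self_module S\<^esub> y \<in> J \<inter> Sg (diag_deg 1)"
      if "x \<in> J \<inter> Sg (diag_deg 1)" "y \<in> J \<inter> Sg (diag_deg 1)" for x y
      using Rd.ideal_add_mem[OF J] SG.D_add[of x "diag_deg 1" y] that by simp
    show "iota a \<odot>\<^bsub>self_module S\<^esub> x \<in> J \<inter> Sg (diag_deg 1)"
      if a: "a \<in> carrier A" and x: "x \<in> J \<inter> Sg (diag_deg 1)" for a x
    proof -
      have "iota a \<otimes>\<^bsub>Rd\<^esub> x \<in> J" by (rule Rd.ideal_mult_mem[OF J]) (use iota_Gdiag[OF a] x in auto)
      moreover have "iota a \<otimes> x \<in> Sg (diag_deg 1)" using iota_mult[OF a, of x] Sg_smult[OF a, of x "diag_deg 1"] x Sg_carrier[of x "diag_deg 1"] by auto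
      ultimately show ?thesis by simp
    qed
  qed
qed

end

context graded_module
begin

abbreviation "Ng \<equiv> \<lambda>j. Mg (diag_deg j)"
abbreviation "reduction J \<equiv> is_reduction Rd Rg (diagonal M Mg) Ng J"

lemma reduction_iff:
  "reduction J \<longleftrightarrow> (\<exists>B\<subseteq>Sg (diag_deg 1). J = genideal Rd B \<and> (\<exists>n0. \<forall>n\<ge>n0. Mg (diag_deg n) \<subseteq> DM.gensub B))"
proof -
  have "ideal_smult Rd (genideal Rd B) (diagonal M Mg) = DM.gensub B" if "B \<subseteq> Sg (diag_deg 1)" for B
    using ideal_smult_diagonal[of B] SG.Gdiag_hom that by blast
  then show ?thesis unfolding is_reduction_def by (metis (no_types, lifting) inf.absorb_iff2)
qed

lemma ev_inj_surj:
  assumes x: "x \<in> Sg (diag_deg 1)" and ei: "ev_inj x" and e: "large (\<lambda>n. hilb {\<zero>} n = e)"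
  shows "\<exists>n0. \<forall>j\<ge>n0. (\<lambda>m. x \<odot> m) ` Mg (diag_deg j) = Mg (diag_deg (Suc j))"
proof -
  have xc: "x \<in> carrier S" using Sg_carrier[OF x] .
  interpret f: module_map A Vm Vm "\<lambda>m. x \<odot> m" using mult_map_A[OF xc] .
  have "large (\<lambda>n. (\<forall>m\<in>Mg n. x \<odot> m = \<zero> \<longrightarrow> m = \<zero>) \<and> hilb {\<zero>} n = e)"
    using large_conj[OF ei[unfolded ev_inj_def] e] .
  then obtain N where N: "\<And>n. (\<forall>i. N \<le> n i) \<Longrightarrow> (\<forall>m\<in>Mg n. x \<odot> m = \<zero> \<longrightarrow> m = \<zero>) \<and> hilb {\<zero>} n = e"
    unfolding large_def by blast
  have lenN: "len {\<zero>} (Mg (diag_deg j)) = enat e" if "N \<le> j" for j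
  proof -
    have "{\<zero>} \<inter> Mg (diag_deg j) = {\<zero>}" using MG.D_zero by blast
    moreover have "hilb {\<zero>} (diag_deg j) = e" using N[of "diag_deg j"] that by (simp add: diag_deg_def)
    ultimately show ?thesis using hilb[OF SM.submodule_zero, of "diag_deg j"] by simp
  qed
  show ?thesis
  proof (intro exI[of _ N] allI impI)
    fix j assume j: "N \<le> j"
    let ?I = "(\<lambda>m. x \<odot> m) ` Mg (diag_deg j)"
    have zs: "submodule {\<zero>} A Vm" using AM.submodule_zero by simp
    have Is: "submodule ?I A Vm" using f.submodule_image[OF A_submodule_Mg] .
    have sub: "?I \<subseteq> Mg (diag_deg (Suc j))"
    proof (rule image_subsetI)
      show "x \<odot> m \<in> Mg (diag_deg (Suc j))" if "m \<in> Mg (diag_deg j)" for m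
        using Mg_smult[OF x that] unfolding diag_deg_add by simp
    qed
    have z0: "\<zero> \<in> ?I" using AM.submodule_zero_mem[OF Is] by simp
    have "{\<zero>} <+>\<^bsub>M\<^esub> ?I = ?I"
      using AM.set_add_upper2[OF zs Is] AM.set_add_least[OF Is _ subset_refl, of "{\<zero>}"] z0 by auto
    moreover have "\<forall>m\<in>Mg (diag_deg j). x \<odot> m = \<zero> \<longrightarrow> m = \<zero>" using N[of "diag_deg j"] j by (simp add: diag_deg_def)
    then have "{m \<in> Mg (diag_deg j). x \<odot> m \<in> {\<zero>}} = {\<zero>}" using MG.D_zero xc by auto
    ultimately have "len {\<zero>} ?I = enat e"
      using f.rel_length_preimage[OF A_submodule_Mg zs, of "diag_deg j"] lenN[OF j] by simp
    moreover have "len {\<zero>} (Mg (diag_deg (Suc j))) = enat e" using lenN[of "Suc j"] j by simp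
    moreover have "len {\<zero>} (Mg (diag_deg (Suc j))) = len {\<zero>} ?I + len ?I (Mg (diag_deg (Suc j)))"
      by (rule AM.rel_length_add[OF zs Is A_submodule_Mg _ sub]) (use z0 in simp)
    ultimately have "len ?I (Mg (diag_deg (Suc j))) = 0"
      by (cases "len ?I (Mg (diag_deg (Suc j)))") (simp_all add: zero_enat_def)
    then show "?I = Mg (diag_deg (Suc j))" using rel_length_zeroD[OF Is A_submodule_Mg sub] by simp
  qed
qed

lemma reduction_single:
  assumes x: "x \<in> Sg (diag_deg 1)" and ei: "ev_inj x" and e: "large (\<lambda>n. hilb {\<zero>} n = e)"
  shows "reduction (genideal Rd {x})"
proof -
  obtain n0 where n0: "\<forall>j\<ge>n0. (\<lambda>m. x \<odot> m) ` Mg (diag_deg j) = Mg (diag_deg (Suc j))" using ev_inj_surj[OF assms] by blast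
  have "Mg (diag_deg n) \<subseteq> DM.gensub {x}" if n: "Suc n0 \<le> n" for n
  proof -
    obtain j where "n = Suc j" "n0 \<le> j" using n by (cases n) auto
    then show ?thesis using diagonal_gensub_single[OF x, of j] n0 by blast
  qed
  then show ?thesis unfolding reduction_iff using x by (intro exI[of _ "{x}"]) auto
qed

lemma reduction_contains_single:
  assumes inf: "infinite (carrier (A Quot \<mm>))" and J: "reduction J" and e: "large (\<lambda>n. hilb {\<zero>} n = e)"
  shows "\<exists>x\<in>Sg (diag_deg 1). ev_inj x \<and> genideal Rd {x} \<subseteq> J \<and> reduction (genideal Rd {x})"
proof -
  obtain B n0 where B: "B \<subseteq> Sg (diag_deg 1)" "J = genideal Rd B" "\<And>n. n0 \<le> n \<Longrightarrow> Mg (diag_deg n) \<subseteq> DM.gensub B"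
    using J unfolding reduction_iff by blast
  have Bd: "B \<subseteq> SG.Gdiag" using B(1) SG.Gdiag_hom by blast
  have Ji: "ideal J Rd" unfolding B(2) using ideal_genideal_diag[OF B(1)] .
  have BJ: "B \<subseteq> J" unfolding B(2) genideal_def by blast
  have red: "Mg (diag_deg n) \<subseteq> gensub B" if "n0 \<le> n" for n using B(3)[OF that] diagonal_gensub_subset[OF Bd] by blast
  note AB = A_span_props[OF B(1)]
  have "\<exists>x\<in>A_span B. ev_inj x"
  proof (rule exists_ev_inj_in[OF inf AB(1,2)])
    show "x \<oplus>\<^bsub>S\<^esub> y \<in> A_span B" if "x \<in> A_span B" "y \<in> A_span B" for x y by (rule AB(4)[OF that])
    show "iota a \<otimes>\<^bsub>S\<^esub> x \<in> A_span B" if "a \<in> carrier A" "x \<in> A_span B" for a x by (rule AB(5)[OF that])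
    show "plus_plus S Sg \<subseteq> P" if P: "P \<in> assoc_primes S M" "A_span B \<subseteq> P" for P
      by (rule prime_contains_plus_plus_if_reduction[OF B(1) red P(1)]) (use AB(3) P(2) in blast)+
  qed
  then obtain x where x: "x \<in> A_span B" "ev_inj x" by blast
  have x1: "x \<in> Sg (diag_deg 1)" using x(1) AB(1) by blast
  have "x \<in> J" using A_span_subset_ideal[OF Ji BJ] x(1) by blast
  then have "genideal Rd {x} \<subseteq> J" using Rd.genideal_minimal[OF Ji, of "{x}"] by simp
  then show ?thesis using x1 x(2) reduction_single[OF x1 x(2) e] by blast
qed

text \<open>A reduction is generated by its elements of degree 1, so a smaller one has a strictly
  smaller degree 1 part. These parts have finite length over \<open>A\<close>, and a reduction with
  the least length is minimal.\<close>

lemma exists_minimal_reduction: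
  assumes "reduction J0"
  shows "\<exists>J. is_minimal_reduction Rd Rg (diagonal M Mg) Ng J"
proof -
  interpret GS: graded_module A \<mm> S Sg "self_module S" Sg by (rule graded_module_self)
  define f where "f J = the_enat (GS.len {\<zero>\<^bsub>S\<^esub>} (J \<inter> Sg (diag_deg 1)))" for J
  have id: "ideal J Rd" if "reduction J" for J using that ideal_genideal_diag unfolding reduction_iff by blast
  have fin: "GS.len {\<zero>\<^bsub>S\<^esub>} (J \<inter> Sg (diag_deg 1)) = enat (f J)" for J
  proof -
    have "GS.len {\<zero>\<^bsub>S\<^esub>} (J \<inter> Sg (diag_deg 1)) \<le> GS.len {\<zero>\<^bsub>S\<^esub>} (Sg (diag_deg 1))" by (intro rel_length_mono) auto
    moreover have "GS.len {\<zero>\<^bsub>S\<^esub>} (Sg (diag_deg 1)) \<noteq> \<infinity>" using GS.Mg_finite_length[of "diag_deg 1"] by simp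
    ultimately have "GS.len {\<zero>\<^bsub>S\<^esub>} (J \<inter> Sg (diag_deg 1)) \<noteq> \<infinity>" by (metis enat_ord_simps(5))
    then show ?thesis unfolding f_def by auto
  qed
  have less: "f K < f J" if K: "reduction K" and J: "reduction J" and KJ: "K \<subset> J" for K J
  proof -
    let ?K = "K \<inter> Sg (diag_deg 1)" and ?J = "J \<inter> Sg (diag_deg 1)"
    obtain B where B: "B \<subseteq> Sg (diag_deg 1)" "J = genideal Rd B" using J unfolding reduction_iff by blast
    have "B \<subseteq> J" unfolding B(2) genideal_def by blast
    moreover have "\<not> B \<subseteq> K" using Rd.genideal_minimal[OF id[OF K], of B] KJ unfolding B(2) by blast
    ultimately have sub: "?K \<subset> ?J" using KJ B(1) by blast
    note sK = deg_one_part_A_submodule[OF id[OF K]] and sJ = deg_one_part_A_submodule[OF id[OF J]]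
    have z: "submodule {\<zero>\<^bsub>S\<^esub>} A GS.Vm" using GS.AM.submodule_zero by simp
    have "\<zero>\<^bsub>S\<^esub> \<in> ?K" using GS.AM.submodule_zero_mem[OF sK] by simp
    then have "GS.len {\<zero>\<^bsub>S\<^esub>} ?J = GS.len {\<zero>\<^bsub>S\<^esub>} ?K + GS.len ?K ?J"
      using sub by (intro GS.AM.rel_length_add[OF z sK sJ]) auto
    moreover have "1 \<le> GS.len ?K ?J" using rel_length_pos[OF sK sJ sub] .
    ultimately have "enat (f K) + 1 \<le> enat (f J)" unfolding fin by (metis add_left_mono)
    then show ?thesis by (simp add: one_enat_def)
  qed
  obtain J where J: "reduction J" "\<And>K. reduction K \<Longrightarrow> f J \<le> f K"
    using ex_has_least_nat[of "\<lambda>J. reduction J" J0 f] assms by blast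
  have "\<not> (\<exists>K. reduction K \<and> K \<subset> J)" using less[OF _ J(1)] J(2) by (meson leD)
  then show ?thesis unfolding is_minimal_reduction_def using J(1) by blast
qed

text \<open>Both uses of \<open>LEAST\<close> are justified by existence: some minimal reduction
  exists, and each has a finite reduction number. A minimal reduction attaining the minimum contains
  a principal reduction \<open>(x)\<close> and so equals it, which turns the reduction number into a
  statement about surjectivity of \<open>x\<close>.\<close>

lemma reduction_number_surj:
  assumes inf: "infinite (carrier (A Quot \<mm>))" and e: "large (\<lambda>n. hilb {\<zero>} n = e)"
  shows "\<exists>x\<in>Sg (diag_deg 1). ev_inj x \<and>
     (\<forall>m\<ge>reduction_number Rd Rg (diagonal M Mg) Ng. (\<lambda>z. x \<odot> z) ` Mg (diag_deg m) = Mg (diag_deg (Suc m)))"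
proof -
  obtain x0 where x0: "x0 \<in> Sg (\<lambda>j. if j \<in> (UNIV::'d set) then 1 else 0)" "ev_inj_mod {\<zero>} x0"
    using exists_ev_inj_mod_prod[OF inf graded_sub_zero, of UNIV] by auto
  have "x0 \<in> Sg (diag_deg 1)" "ev_inj x0" using x0 by (simp_all add: diag_deg_def ev_inj_def ev_inj_mod_def)
  then obtain J0 where J0: "is_minimal_reduction Rd Rg (diagonal M Mg) Ng J0"
    using exists_minimal_reduction reduction_single[OF _ _ e] by blast
  let ?r = "reduction_number Rd Rg (diagonal M Mg) Ng"
  have "\<exists>r J. is_minimal_reduction Rd Rg (diagonal M Mg) Ng J \<and> r = reduction_number_wrt Rd (diagonal M Mg) Ng J" using J0 by blast
  then have "\<exists>J. is_minimal_reduction Rd Rg (diagonal M Mg) Ng J \<and> ?r = reduction_number_wrt Rd (diagonal M Mg) Ng J"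
    unfolding reduction_number_def by (rule LeastI_ex)
  then obtain J where J: "is_minimal_reduction Rd Rg (diagonal M Mg) Ng J" "?r = reduction_number_wrt Rd (diagonal M Mg) Ng J" by blast
  have Jr: "reduction J" using J(1) unfolding is_minimal_reduction_def by blast
  obtain x where x: "x \<in> Sg (diag_deg 1)" "ev_inj x" "genideal Rd {x} \<subseteq> J" "reduction (genideal Rd {x})"
    using reduction_contains_single[OF inf Jr e] by blast
  have Jx: "J = genideal Rd {x}" using J(1) x(3,4) unfolding is_minimal_reduction_def by blast
  have gs: "ideal_smult Rd J (diagonal M Mg) = DM.gensub {x}"
    unfolding Jx by (rule ideal_smult_diagonal) (use SG.Gdiag_hom[OF x(1)] in simp)
  have "\<exists>n. \<forall>m\<ge>n. ideal_smult Rd J (diagonal M Mg) \<inter> Ng (m + 1) = Ng (m + 1)"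
  proof -
    obtain n0 where "\<forall>n\<ge>n0. ideal_smult Rd J (diagonal M Mg) \<inter> Ng n = Ng n" using Jr unfolding is_reduction_def by blast
    then show ?thesis by (intro exI[of _ n0]) auto
  qed
  then have "\<forall>m\<ge>?r. ideal_smult Rd J (diagonal M Mg) \<inter> Ng (m + 1) = Ng (m + 1)"
    unfolding J(2) reduction_number_wrt_def by (rule LeastI_ex)
  then have "\<forall>m\<ge>?r. (\<lambda>z. x \<odot> z) ` Mg (diag_deg m) = Mg (diag_deg (Suc m))"
    unfolding gs using diagonal_gensub_single[OF x(1)] by simp
  then show ?thesis using x(1,2) by blast
qed

end

subsection \<open>Powers of the irrelevant ideal of the diagonal\<close>

context graded_algebra
begin

abbreviation "Gdiag_ge k \<equiv> graded_sum S Sg (diag_deg ` {k..})"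

lemma ideals_set_power_Suc: "I [^]\<^bsub>ideals_set R\<^esub> Suc k = ideal_prod R (I [^]\<^bsub>ideals_set R\<^esub> k) I"
  by (simp add: nat_pow_def ideals_set_def)

text \<open>Upper bound for the powers of the irrelevant ideal; the lower bound is
  \<open>x^k\<close> in \<open>power_in_diagonal_plus_power\<close>. Each bound yields one direction
  of the description of the elements killed by some power.\<close>

lemma diagonal_plus_power_subset: "diagonal_plus S Sg [^]\<^bsub>ideals_set Rd\<^esub> (k::nat) \<subseteq> Gdiag_ge k"
proof (induction k)
  case 0
  have "{0..} = (UNIV :: nat set)" by auto
  then show ?case by (simp add: nat_pow_def ideals_set_def)
next
  case (Suc k)
  show ?case unfolding ideals_set_power_Suc
  proof
    fix x assume "x \<in> ideal_prod Rd (diagonal_plus S Sg [^]\<^bsub>ideals_set Rd\<^esub> k) (diagonal_plus S Sg)"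
    then show "x \<in> Gdiag_ge (Suc k)"
    proof induction
      case (prod i j)
      have i: "i \<in> Gdiag_ge k" using prod(1) Suc by blast
      have j: "j \<in> graded_sum S Sg (diag_deg ` {0<..})" using prod(2) unfolding diagonal_plus_def .
      have jc: "j \<in> carrier S" using j unfolding SG.graded_sum_iff by blast
      have add: "x \<oplus> y \<in> Gdiag_ge (Suc k)" if "x \<in> Gdiag_ge (Suc k)" "y \<in> Gdiag_ge (Suc k)" for x y
        using that by (simp add: SG.graded_sum_iff SG.cp_add)
      have z: "\<zero> \<in> Gdiag_ge (Suc k)" by (simp add: SG.graded_sum_iff)
      have "i \<otimes> j \<in> Gdiag_ge (Suc k)"
      proof (rule SG.graded_sum_induct[where P = "\<lambda>i. i \<otimes> j \<in> Gdiag_ge (Suc k)", OF i])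
        show "\<zero> \<otimes> j \<in> Gdiag_ge (Suc k)" using z jc by simp
        show "(a \<oplus> b) \<otimes> j \<in> Gdiag_ge (Suc k)"
          if "a \<in> carrier S" "b \<in> carrier S" "a \<otimes> j \<in> Gdiag_ge (Suc k)" "b \<otimes> j \<in> Gdiag_ge (Suc k)" for a b
          using add[OF that(3,4)] S.l_distr[OF that(1,2) jc] by simp
        fix u s assume "u \<in> diag_deg ` {k..}" and s: "s \<in> Sg u"
        then obtain p where p: "u = diag_deg p" "k \<le> p" by blast
        have sc: "s \<in> carrier S" using Sg_carrier[OF s] .
        show "s \<otimes> j \<in> Gdiag_ge (Suc k)"
        proof (rule SG.graded_sum_induct[where P = "\<lambda>j. s \<otimes> j \<in> Gdiag_ge (Suc k)", OF j])
          show "s \<otimes> \<zero> \<in> Gdiag_ge (Suc k)" using z sc by simp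
          show "s \<otimes> (a \<oplus> b) \<in> Gdiag_ge (Suc k)"
            if "a \<in> carrier S" "b \<in> carrier S" "s \<otimes> a \<in> Gdiag_ge (Suc k)" "s \<otimes> b \<in> Gdiag_ge (Suc k)" for a b
            using add[OF that(3,4)] S.r_distr[OF that(1,2) sc] by simp
          fix v y assume "v \<in> diag_deg ` {0<..}" and y: "y \<in> Sg v"
          then obtain q where q: "v = diag_deg q" "0 < q" by blast
          have "s \<otimes> y \<in> Sg (diag_deg (p + q))" using Sg_mult[OF s y] unfolding p(1) q(1) diag_deg_add .
          then show "s \<otimes> y \<in> Gdiag_ge (Suc k)"
            by (rule SG.graded_sum_hom[rotated]) (use p(2) q(2) in auto)
        qed
      qed
      then show ?case by simp
    next
      case (sum s1 s2)
      then show ?case by (simp add: SG.graded_sum_iff SG.cp_add)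
    qed
  qed
qed

lemma power_in_diagonal_plus_power:
  assumes x: "x \<in> Sg (diag_deg 1)"
  shows "x [^] (k::nat) \<in> diagonal_plus S Sg [^]\<^bsub>ideals_set Rd\<^esub> k"
proof (induction k)
  case 0
  then show ?case using one_Gdiag by (simp add: nat_pow_def ideals_set_def)
next
  case (Suc k)
  have "x \<in> diagonal_plus S Sg" unfolding diagonal_plus_def using x by (intro SG.graded_sum_hom[of "diag_deg 1"]) auto
  from ideal_prod.prod[OF Suc this, of Rd] show ?case unfolding ideals_set_power_Suc by simp
qed

end

context graded_module
begin

text \<open>If a power of the irrelevant ideal kills \<open>m\<close>, so does some
  \<open>x^k\<close>; as \<open>x^Q m\<close> lies in the range where \<open>x\<close> is injective,
  it vanishes already. Conversely, if \<open>x^Q m = 0\<close> and \<open>t\<close> has degree at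
  least \<open>N\<close>, then \<open>x^Q\<close> kills \<open>t m\<close>, which lies in that
  range, so \<open>t m = 0\<close>.\<close>

lemma zero_colon_infty_hom:
  assumes x: "x \<in> Sg (diag_deg 1)"
    and N: "\<forall>n m. (\<forall>i. N \<le> n i) \<longrightarrow> m \<in> Mg n \<longrightarrow> x \<odot> m = \<zero> \<longrightarrow> m = \<zero>" and Q: "N \<le> Q"
  shows "zero_colon_infty Rd (diagonal M Mg) (diagonal_plus S Sg) \<inter> Mg (diag_deg n) =
     {m \<in> Mg (diag_deg n). (x [^]\<^bsub>S\<^esub> Q) \<odot> m = \<zero>}"
proof -
  have xc: "x \<in> carrier S" using Sg_carrier[OF x] .
  have xp: "x [^]\<^bsub>S\<^esub> p \<in> Sg (diag_deg p)" for p :: nat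
  proof -
    have dN: "(\<lambda>i. p * diag_deg 1 i) = (diag_deg p :: 'd \<Rightarrow> nat)" by (simp add: diag_deg_def)
    show ?thesis using Sg_pow[OF x, of p] unfolding dN .
  qed
  have xpc: "x [^]\<^bsub>S\<^esub> p \<in> carrier S" for p :: nat using xc by simp
  have N': "\<forall>n m. (\<forall>i. N \<le> n i) \<longrightarrow> m \<in> Mg n \<longrightarrow> x \<odot> m \<in> {\<zero>} \<longrightarrow> m \<in> {\<zero>}" using N by simp
  have inj: "m = \<zero>" if m: "m \<in> Mg (diag_deg j)" "N \<le> j" and p: "(x [^]\<^bsub>S\<^esub> (p::nat)) \<odot> m = \<zero>" for m j p
  proof -
    have "\<forall>i. N \<le> (diag_deg j :: 'd \<Rightarrow> nat) i" using m(2) by (simp add: diag_deg_def)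
    then have "m \<in> {\<zero>}" using ev_inj_mod_power[OF xc x N' _ m(1), of p] p by simp
    then show ?thesis by simp
  qed
  have "(\<exists>k::nat. \<forall>s\<in>diagonal_plus S Sg [^]\<^bsub>ideals_set Rd\<^esub> k. s \<odot> m = \<zero>) \<longleftrightarrow> (x [^]\<^bsub>S\<^esub> Q) \<odot> m = \<zero>"
    if m: "m \<in> Mg (diag_deg n)" for m
  proof
    have mc: "m \<in> carrier M" using Mg_carrier[OF m] .
    have xQm: "(x [^]\<^bsub>S\<^esub> Q) \<odot> m \<in> Mg (diag_deg (Q + n))" using Mg_smult[OF xp m] unfolding diag_deg_add .
    assume "\<exists>k::nat. \<forall>s\<in>diagonal_plus S Sg [^]\<^bsub>ideals_set Rd\<^esub> k. s \<odot> m = \<zero>"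
    then obtain k :: nat where "\<forall>s\<in>diagonal_plus S Sg [^]\<^bsub>ideals_set Rd\<^esub> k. s \<odot> m = \<zero>" by blast
    then have k: "(x [^]\<^bsub>S\<^esub> k) \<odot> m = \<zero>" using power_in_diagonal_plus_power[OF x, of k] by blast
    have "(x [^]\<^bsub>S\<^esub> k) \<odot> ((x [^]\<^bsub>S\<^esub> Q) \<odot> m) = (x [^]\<^bsub>S\<^esub> Q) \<odot> ((x [^]\<^bsub>S\<^esub> k) \<odot> m)" using SM.smult_commute[OF xpc xpc mc] .
    then have "(x [^]\<^bsub>S\<^esub> k) \<odot> ((x [^]\<^bsub>S\<^esub> Q) \<odot> m) = \<zero>" unfolding k using xpc by simp
    then show "(x [^]\<^bsub>S\<^esub> Q) \<odot> m = \<zero>" using inj[OF xQm] Q by simp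
  next
    have mc: "m \<in> carrier M" using Mg_carrier[OF m] .
    assume z: "(x [^]\<^bsub>S\<^esub> Q) \<odot> m = \<zero>"
    have "s \<odot> m = \<zero>" if "s \<in> diagonal_plus S Sg [^]\<^bsub>ideals_set Rd\<^esub> N" for s
    proof -
      have s: "s \<in> Gdiag_ge N" using diagonal_plus_power_subset[of N] that by blast
      show ?thesis
      proof (rule SG.graded_sum_induct[where P = "\<lambda>s. s \<odot> m = \<zero>", OF s])
        show "\<zero>\<^bsub>S\<^esub> \<odot> m = \<zero>" using mc by simp
        show "(a \<oplus>\<^bsub>S\<^esub> b) \<odot> m = \<zero>" if "a \<in> carrier S" "b \<in> carrier S" "a \<odot> m = \<zero>" "b \<odot> m = \<zero>" for a b
          using SM.smult_l_distr[OF that(1,2) mc] that(3,4) by simp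
        fix u t assume "u \<in> diag_deg ` {N..}" and t: "t \<in> Sg u"
        then obtain j where j: "u = diag_deg j" "N \<le> j" by blast
        have tm: "t \<odot> m \<in> Mg (diag_deg (j + n))" using Mg_smult[OF t m] unfolding j(1) diag_deg_add .
        have "(x [^]\<^bsub>S\<^esub> Q) \<odot> (t \<odot> m) = t \<odot> ((x [^]\<^bsub>S\<^esub> Q) \<odot> m)" using SM.smult_commute[OF xpc Sg_carrier[OF t] mc] .
        then have "(x [^]\<^bsub>S\<^esub> Q) \<odot> (t \<odot> m) = \<zero>" unfolding z using Sg_carrier[OF t] by simp
        then show "t \<odot> m = \<zero>" using inj[OF tm] j(2) by simp
      qed
    qed
    then show "\<exists>k::nat. \<forall>s\<in>diagonal_plus S Sg [^]\<^bsub>ideals_set Rd\<^esub> k. s \<odot> m = \<zero>" by blast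
  qed
  then show ?thesis unfolding zero_colon_infty_def using MG.Gdiag_hom by auto
qed

text \<open>Multiplication by a power of the generator \<open>x\<close> of a minimal reduction maps \<open>M\<^sub>n\<close>, for \<open>n\<close>
  at least the reduction number, onto a component in the stable range.\<close>

theorem length_mod_zero_colon_infty:
  assumes inf: "infinite (carrier (A Quot \<mm>))" and e: "large (\<lambda>n. hilb {\<zero>} n = e)"
    and n: "reduction_number Rd Rg (diagonal M Mg) Ng \<le> n"
  defines "Z \<equiv> zero_colon_infty Rd (diagonal M Mg) (diagonal_plus S Sg) \<inter> Mg (diag_deg n)"
  shows "submodule Z A Vm" and "len Z (Mg (diag_deg n)) = enat e"
proof -
  obtain x where x: "x \<in> Sg (diag_deg 1)" "ev_inj x"
      "\<And>m. reduction_number Rd Rg (diagonal M Mg) Ng \<le> m \<Longrightarrow> (\<lambda>z. x \<odot> z) ` Mg (diag_deg m) = Mg (diag_deg (Suc m))"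
    using reduction_number_surj[OF inf e] by blast
  have xc: "x \<in> carrier S" using Sg_carrier[OF x(1)] .
  obtain N where N: "\<forall>n m. (\<forall>i. N \<le> n i) \<longrightarrow> m \<in> Mg n \<longrightarrow> x \<odot> m = \<zero> \<longrightarrow> m = \<zero>"
    using x(2) unfolding ev_inj_def large_def by blast
  obtain N' where N': "\<And>n. (\<forall>i. N' \<le> n i) \<Longrightarrow> hilb {\<zero>} n = e" using e unfolding large_def by blast
  \<comment> \<open>At least \<open>N\<close>, so that \<open>x^Q\<close> describes the colon
    submodule; at least \<open>N'\<close>, so that the component of degree \<open>n + Q\<close> has
    length \<open>e\<close>.\<close>
  define Q where "Q = max N N'"
  have Z: "Z = {m \<in> Mg (diag_deg n). (x [^]\<^bsub>S\<^esub> Q) \<odot> m \<in> {\<zero>}}"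
    unfolding Z_def using zero_colon_infty_hom[OF x(1) N, of Q n] by (simp add: Q_def)
  have xpc: "x [^]\<^bsub>S\<^esub> p \<in> carrier S" for p :: nat using xc by simp
  interpret f: module_map A Vm Vm "\<lambda>m. (x [^]\<^bsub>S\<^esub> Q) \<odot> m" using mult_map_A[OF xpc] .
  have zs: "submodule {\<zero>} A Vm" using AM.submodule_zero by simp
  show "submodule Z A Vm" unfolding Z using f.submodule_preimage[OF A_submodule_Mg zs] .
  \<comment> \<open>Surjectivity of \<open>x\<close> from degree \<open>n\<close> on, iterated; this
    is the place where \<open>n\<close> must be at least the reduction number.\<close>
  have im: "(\<lambda>m. (x [^]\<^bsub>S\<^esub> p) \<odot> m) ` Mg (diag_deg n) = Mg (diag_deg (n + p))" for p :: nat
  proof (induction p)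
    case 0
    have "(\<lambda>m. \<one>\<^bsub>S\<^esub> \<odot> m) ` Mg (diag_deg n) = (\<lambda>m. m) ` Mg (diag_deg n)"
      by (rule image_cong[OF refl]) (use Mg_carrier in simp)
    then show ?case by simp
  next
    case (Suc p)
    have "(\<lambda>m. (x [^]\<^bsub>S\<^esub> Suc p) \<odot> m) ` Mg (diag_deg n) = (\<lambda>m. x \<odot> ((x [^]\<^bsub>S\<^esub> p) \<odot> m)) ` Mg (diag_deg n)"
    proof (rule image_cong[OF refl])
      fix m assume "m \<in> Mg (diag_deg n)"
      then have mc: "m \<in> carrier M" using Mg_carrier by blast
      have "x [^]\<^bsub>S\<^esub> Suc p = x \<otimes>\<^bsub>S\<^esub> x [^]\<^bsub>S\<^esub> p" using S.nat_pow_Suc2[OF xc] .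
      then show "(x [^]\<^bsub>S\<^esub> Suc p) \<odot> m = x \<odot> ((x [^]\<^bsub>S\<^esub> p) \<odot> m)" using SM.smult_assoc1[OF xc xpc mc] by simp
    qed
    also have "\<dots> = (\<lambda>z. x \<odot> z) ` ((\<lambda>m. (x [^]\<^bsub>S\<^esub> p) \<odot> m) ` Mg (diag_deg n))" by (simp only: image_image)
    also have "\<dots> = Mg (diag_deg (Suc (n + p)))" unfolding Suc using x(3)[of "n + p"] n by simp
    finally show ?case by simp
  qed
  have nQ: "{\<zero>} \<inter> Mg (diag_deg (n + Q)) = {\<zero>}" using MG.D_zero by blast
  have "{\<zero>} <+>\<^bsub>M\<^esub> Mg (diag_deg (n + Q)) = Mg (diag_deg (n + Q))"
    using AM.set_add_upper2[OF zs A_submodule_Mg, of "diag_deg (n + Q)"]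
      AM.set_add_least[OF A_submodule_Mg _ subset_refl, of "{\<zero>}" "diag_deg (n + Q)"] MG.D_zero by auto
  then have "len Z (Mg (diag_deg n)) = len {\<zero>} (Mg (diag_deg (n + Q)))"
    unfolding Z using f.rel_length_preimage[OF A_submodule_Mg zs, of "diag_deg n"] im[of Q] by simp
  also have "\<dots> = enat (hilb {\<zero>} (diag_deg (n + Q)))" using hilb[OF SM.submodule_zero, of "diag_deg (n + Q)"] nQ by simp
  also have "hilb {\<zero>} (diag_deg (n + Q)) = e" by (rule N') (simp add: diag_deg_def Q_def)
  finally show "len Z (Mg (diag_deg n)) = enat e" .
qed

end

section \<open>Mixed multiplicities\<close>

lemma seq_of_type_iff:
  "seq_of_type Sg k xs \<longleftrightarrow> (\<exists>is. length is = length xs \<and> count_list is = k \<and>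
     (\<forall>j<length xs. xs ! j \<in> Sg (unit_deg (is ! j))))"
proof -
  have c: "count_list is i = card {j. j < length is \<and> is ! j = i}" for "is" and i :: 'a
    unfolding count_list_eq_length_filter length_filter_conv_card by (intro arg_cong[where f = card]) auto
  show ?thesis
  proof
    assume "seq_of_type Sg k xs"
    then obtain \<tau> where t: "\<forall>j<length xs. xs ! j \<in> Sg (unit_deg (\<tau> j))" "\<forall>i. card {j. j < length xs \<and> \<tau> j = i} = k i"
      unfolding seq_of_type_def by blast
    let ?is = "map \<tau> [0..<length xs]"
    have "{j. j < length ?is \<and> ?is ! j = i} = {j. j < length xs \<and> \<tau> j = i}" for i by auto
    then have "count_list ?is = k" using t(2) unfolding fun_eq_iff c by simp
    then show "\<exists>is. length is = length xs \<and> count_list is = k \<and> (\<forall>j<length xs. xs ! j \<in> Sg (unit_deg (is ! j)))"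
      using t(1) by (intro exI[of _ ?is]) simp
  next
    assume "\<exists>is. length is = length xs \<and> count_list is = k \<and> (\<forall>j<length xs. xs ! j \<in> Sg (unit_deg (is ! j)))"
    then obtain "is" where i: "length is = length xs" "count_list is = k" "\<forall>j<length xs. xs ! j \<in> Sg (unit_deg (is ! j))" by blast
    then show "seq_of_type Sg k xs" unfolding seq_of_type_def using c[of "is"]
      by (intro exI[of _ "\<lambda>j. is ! j"]) auto
  qed
qed

context graded_module
begin

lemma is_hilbert_poly_unique:
  assumes "is_hilbert_poly A S M Mg c" "is_hilbert_poly A S M Mg c'" shows "c = c'"
proof -
  have f: "finite {u. c u \<noteq> 0}" "finite {u. c' u \<noteq> 0}" using assms unfolding is_hilbert_poly_iff by auto
  have l: "large (\<lambda>n. of_nat (hilb {\<zero>} n) = mpoly_eval c n \<and> of_nat (hilb {\<zero>} n) = mpoly_eval c' n)"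
    using assms unfolding is_hilbert_poly_iff by (intro large_conj) auto
  have "large (\<lambda>n. mpoly_eval (\<lambda>u. c u - c' u) n = 0)"
    by (rule large_mono[OF l]) (simp add: mpoly_eval_diff[OF f])
  moreover have "finite {u. c u - c' u \<noteq> 0}"
    by (rule finite_subset[OF _ finite_UnI[OF f]]) auto
  ultimately have "(\<lambda>u. c u - c' u) = (\<lambda>_. 0)" by (rule mpoly_eval_large_zero[rotated])
  then show ?thesis by (auto simp: fun_eq_iff)
qed

text \<open>The coefficient at \<open>k\<close> times the factorials is an eventual value of a
  Hilbert function, hence a natural number. With uniqueness of the Hilbert polynomial this makes the
  definite description in \<open>mixed_multiplicity\<close> meaningful.\<close>

lemma hilb_weak_seq_mixed_multiplicity:
  assumes inf: "infinite (carrier (A Quot \<mm>))"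
    and dim: "module_krull_dim Rd (diagonal M Mg) = ereal (real ell)" and k: "(\<Sum>i\<in>UNIV. k i) + 1 = ell"
    and w: "weak_seq is xs" and is_k: "count_list is = k"
  shows "large (\<lambda>n. hilb (gensub (set xs)) n = mixed_multiplicity A S M Mg k)"
proof -
  obtain g where g: "polyfun g" "large (\<lambda>n. of_nat (hilb {\<zero>} n) = g n)"
    using hilb_eventually_polyfun[OF inf graded_sub_zero] by blast
  obtain c where c: "finite {u. c u \<noteq> 0}" "\<And>n. g n = mpoly_eval c n" using g(1) unfolding polyfun_def by blast
  have hp: "is_hilbert_poly A S M Mg c" unfolding is_hilbert_poly_iff using c(1) g(2) unfolding c(2) by blast
  have len_is: "length is = (\<Sum>i\<in>UNIV. k i)" using sum_count_list_UNIV[of "is"] unfolding is_k by simp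
  define F where "F = (\<Prod>i\<in>UNIV. fact (k i) :: rat)"
  have F0: "F \<noteq> 0" unfolding F_def by simp
  have "(\<Sum>j\<in>UNIV. u j) \<le> length is" if "c u \<noteq> 0" for u
    using hilbert_poly_degree[OF inf hp dim that] k len_is by simp
  then have l: "large (\<lambda>n. of_nat (hilb (gensub (set xs)) n) = c k * F)"
    using hilb_weak_seq[OF w hp] unfolding is_k F_def by blast
  then obtain N where "\<And>n. (\<forall>i. N \<le> n i) \<Longrightarrow> of_nat (hilb (gensub (set xs)) n) = c k * F" unfolding large_def by blast
  from this[of "\<lambda>_. N"] obtain e where e: "of_nat e = c k * F" by blast
  have "mixed_multiplicity A S M Mg k = e"
    unfolding mixed_multiplicity_def F_def[symmetric]
  proof (rule the_equality)
    show "\<exists>c. is_hilbert_poly A S M Mg c \<and> c k = of_nat e / F"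
      using hp F0 by (intro exI[of _ c]) (simp add: e)
    fix e' assume "\<exists>c. is_hilbert_poly A S M Mg c \<and> c k = of_nat e' / F"
    then obtain c' where c': "is_hilbert_poly A S M Mg c'" "c' k = of_nat e' / F" by blast
    have "c k = of_nat e' / F" using is_hilbert_poly_unique[OF hp c'(1)] c'(2) by simp
    then have "(of_nat e' :: rat) = of_nat e" unfolding e using F0 by simp
    then show "e' = e" by simp
  qed
  then show ?thesis using l unfolding e[symmetric] by simp
qed

subsection \<open>Filter-regular sequences and degenerate quotients\<close>

lemma quot_seq_eq:
  assumes "set xs \<subseteq> carrier S"
  shows "quot_seq S M xs = quotient_module M (gensub (set xs))"
    "quot_seq_grading S M xs Mg = qgr (gensub (set xs))"
proof -
  show "quot_seq S M xs = quotient_module M (gensub (set xs))"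
    unfolding quot_seq_def ideal_smult_genideal[OF assms] ..
  show "quot_seq_grading S M xs Mg = qgr (gensub (set xs))"
    by (rule ext) (simp add: quot_seq_grading_def qgr_def ideal_smult_genideal[OF assms])
qed

lemma filter_regular_elem_quotient_iff:
  assumes K: "graded_sub K" and x: "x \<in> Sg v"
  shows "filter_regular_elem S Sg (quotient_module M K) x \<longleftrightarrow>
     diagonally_nondegenerate S Sg (quotient_module M K) \<and> ev_inj_mod K x"
proof -
  interpret Q: graded_module A \<mm> S Sg "quotient_module M K" "qgr K" using graded_module_quotient(1)[OF K] .
  have "(\<forall>P\<in>assoc_primes S (quotient_module M K). \<not> plus_plus S Sg \<subseteq> P \<longrightarrow> x \<notin> P) \<longleftrightarrow> ev_inj_mod K x"
    using Q.filter_regular_iff_ev_inj[OF x] ev_inj_quotient_iff[OF K Sg_carrier[OF x]] by simp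
  then show ?thesis unfolding filter_regular_elem_def using x by blast
qed

lemma set_take_homogeneous:
  assumes "length xs = length is" "\<forall>j<length xs. xs ! j \<in> Sg (unit_deg (is ! j))" "x \<in> set (take t xs)"
  shows "\<exists>v. x \<in> Sg v"
proof -
  obtain i where "i < length xs" "x = xs ! i" using assms(3) by (metis in_set_conv_nth in_set_takeD)
  then show ?thesis using assms(2) by blast
qed

lemma filter_regular_seq_iff_weak_seq:
  assumes l: "length xs = length is" and h: "\<forall>j<length xs. xs ! j \<in> Sg (unit_deg (is ! j))"
  shows "filter_regular_seq S Sg M xs \<longleftrightarrow> weak_seq is xs \<and>
     (\<forall>t<length xs. diagonally_nondegenerate S Sg (quotient_module M (gensub (set (take t xs)))))"
proof -
  have hom: "\<exists>v. x \<in> Sg v" if "x \<in> set (take t xs)" for x t using set_take_homogeneous[OF l h that] .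
  have "filter_regular_elem S Sg (quot_seq S M (take t xs)) (xs ! t) \<longleftrightarrow>
      diagonally_nondegenerate S Sg (quotient_module M (gensub (set (take t xs)))) \<and> ev_inj_mod (gensub (set (take t xs))) (xs ! t)"
    if t: "t < length xs" for t
  proof -
    have "set (take t xs) \<subseteq> carrier S" using hom Sg_carrier by blast
    moreover have "graded_sub (gensub (set (take t xs)))" using hom by (intro graded_sub_gensub) auto
    moreover have "xs ! t \<in> Sg (unit_deg (is ! t))" using h t by blast
    ultimately show ?thesis using quot_seq_eq(1)[of "take t xs"] filter_regular_elem_quotient_iff by simp
  qed
  then show ?thesis unfolding filter_regular_seq_def weak_seq_def using l h by auto
qed

lemma hilb_zero_iff:
  assumes K: "submodule K S M" shows "hilb K n = 0 \<longleftrightarrow> Mg n \<subseteq> K"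
proof -
  have s: "submodule (K \<inter> Mg n) A Vm" using AM.submodule_Int[OF A_submodule_if_S_submodule[OF K] A_submodule_Mg] .
  have "hilb K n = 0 \<longleftrightarrow> len (K \<inter> Mg n) (Mg n) = 0" using hilb[OF K, of n] by (simp add: zero_enat_def)
  also have "\<dots> \<longleftrightarrow> K \<inter> Mg n = Mg n"
    using rel_length_zeroD[OF s A_submodule_Mg, of n] by auto
  finally show ?thesis by blast
qed

lemma large_subset_if_degenerate:
  assumes K: "graded_sub K" and d: "\<not> diagonally_nondegenerate S Sg (quotient_module M K)"
  shows "large (\<lambda>n. Mg n \<subseteq> K)"
proof -
  interpret Q: graded_module A \<mm> S Sg "quotient_module M K" "qgr K" using graded_module_quotient(1)[OF K] .
  have z: "\<zero>\<^bsub>quotient_module M K\<^esub> = K" using SM.quotient_module_simps by simp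
  show ?thesis
  proof (rule large_mono[OF Q.eventually_zero_if_degenerate[OF d]])
    fix n assume q: "qgr K n = {\<zero>\<^bsub>quotient_module M K\<^esub>}"
    show "Mg n \<subseteq> K"
    proof
      fix m assume m: "m \<in> Mg n"
      then have "K +> m \<in> qgr K n" unfolding qgr_def by blast
      then have "K +> m = K" unfolding q z by blast
      then show "m \<in> K" using SM.coset_zero_iff[OF graded_subD(1)[OF K] Mg_carrier[OF m]] by simp
    qed
  qed
qed

lemma hilb_quotient:
  assumes K: "graded_sub K"
  shows "graded_module.hilb A S (quotient_module M K) (qgr K) {\<zero>\<^bsub>quotient_module M K\<^esub>} n = hilb K n"
proof -
  interpret Q: graded_module A \<mm> S Sg "quotient_module M K" "qgr K" using graded_module_quotient(1)[OF K] .
  have "{\<zero>\<^bsub>quotient_module M K\<^esub>} \<inter> qgr K n = {\<zero>\<^bsub>quotient_module M K\<^esub>}" using Q.MG.D_zero by blast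
  then have "enat (Q.hilb {\<zero>\<^bsub>quotient_module M K\<^esub>} n) = Q.len {\<zero>\<^bsub>quotient_module M K\<^esub>} (qgr K n)"
    using Q.hilb[OF Q.SM.submodule_zero, of n] by simp
  also have "\<dots> = enat (hilb K n)"
    using len_quotient[OF K A_submodule_Mg, of n] hilb[OF graded_subD(1)[OF K], of n] unfolding qgr_def by simp
  finally show ?thesis by simp
qed

subsection \<open>The dimension of the diagonal of the quotient\<close>

text \<open>The lower bound is \<open>chain_over_base\<close>. A chain with two or more steps over
  the last quotient would be prolonged by \<open>length is = ell - 1\<close> further primes to a
  chain over \<open>M\<close> of length above \<open>ell\<close>.\<close>

lemma dim_quotient_eq_one:
  assumes inf: "infinite (carrier (A Quot \<mm>))"
    and dim: "module_krull_dim Rd (diagonal M Mg) = ereal (real ell)"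
    and w: "weak_seq is xs" and l: "length is + 1 = ell"
    and nz: "large (\<lambda>n. hilb (gensub (set xs)) n \<noteq> 0)"
  shows "module_krull_dim Rd (diagonal (quotient_module M (gensub (set xs))) (qgr (gensub (set xs)))) = 1"
proof -
  let ?K = "gensub (set xs)"
  have lx: "length xs = length is" using w unfolding weak_seq_def by blast
  have K: "graded_sub ?K" using weak_seq_graded_sub[OF w, of "length xs"] by simp
  note Ks = graded_subD(1)[OF K]
  have "chain_over ?K 1" using chain_over_base[OF inf K] not_subset_if_hilb_nonzero[OF Ks nz] by blast
  then have "1 \<le> ring_krull_dim (Rd Quot (AD ?K))" using chain_over_le_dim[OF Ks, of 1] by (simp add: one_ereal_def)
  moreover have "ring_krull_dim (Rd Quot (AD ?K)) \<le> 1"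
    unfolding ring_krull_dim_def
  proof (rule Sup_least)
    fix y :: ereal assume "y \<in> {ereal (real n) | n. \<exists>P. (\<forall>i\<le>n. primeideal (P i) (Rd Quot (AD ?K))) \<and> (\<forall>i<n. P i \<subset> P (Suc i))}"
    then obtain n Q where n: "y = ereal (real n)" "\<And>i. i \<le> n \<Longrightarrow> primeideal (Q i) (Rd Quot (AD ?K))" "\<And>i. i < n \<Longrightarrow> Q i \<subset> Q (Suc i)" by blast
    have "n \<le> 1"
    proof (rule ccontr)
      assume n1: "\<not> n \<le> 1"
      obtain P where P: "\<forall>i\<le>n. primeideal (P i) Rd \<and> AD ?K \<subseteq> P i" "\<forall>i<n. P i \<subset> P (Suc i)"
        using Rd.ring_krull_dim_quot_chain[where n = n and Q = Q, OF ideal_AD[OF Ks] n(2,3)] by blast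
      have "chain_over ?K n" by (rule chain_over_if_chain[of n P]) (use P n1 in auto)
      then have "chain_over {\<zero>} (n + length is)" using chain_over_weak_seq[OF inf w, of "length is" n] lx by simp
      from chain_over_le_dim[OF SM.submodule_zero this] have "n + length is \<le> ell"
        using dim unfolding module_krull_dim_def annihilator_diagonal by simp
      then show False using l n1 by simp
    qed
    then show "y \<le> 1" unfolding n(1) by (simp add: one_ereal_def)
  qed
  ultimately show ?thesis unfolding module_krull_dim_def AD_quotient[OF K] by (rule antisym[rotated])
qed

text \<open>If \<open>M / K\<close> vanished in large degrees, all elements of some degree (N,...,N)
  would lie in \<open>AD K\<close>, and every prime over \<open>AD K\<close> would contain
  S_(1,...,1). Positive dimension provides one that does not.\<close>

lemma not_large_subset_if_dim_quotient_eq_one: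
  assumes K: "graded_sub K"
    and dim: "module_krull_dim Rd (diagonal (quotient_module M K) (qgr K)) = 1"
  shows "\<not> large (\<lambda>n. Mg n \<subseteq> K)"
proof
  assume "large (\<lambda>n. Mg n \<subseteq> K)"
  then obtain N where N: "\<And>n. (\<forall>i. N \<le> n i) \<Longrightarrow> Mg n \<subseteq> K" unfolding large_def by blast
  note Ks = graded_subD(1)[OF K]
  have "\<not> ring_krull_dim (Rd Quot (AD K)) \<le> 0" using dim unfolding module_krull_dim_def AD_quotient[OF K] by simp
  then obtain n Q where n: "\<not> ereal (real n) \<le> 0" "\<And>i. i \<le> n \<Longrightarrow> primeideal (Q i) (Rd Quot (AD K))" "\<And>i. i < n \<Longrightarrow> Q i \<subset> Q (Suc i)"
    unfolding ring_krull_dim_def Sup_le_iff by blast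
  obtain P where P: "\<forall>i\<le>n. primeideal (P i) Rd \<and> AD K \<subseteq> P i" "\<forall>i<n. P i \<subset> P (Suc i)"
    using Rd.ring_krull_dim_quot_chain[where n = n and Q = Q, OF ideal_AD[OF Ks] n(2,3)] by blast
  have n1: "1 \<le> n" using n(1) by (cases n) (auto simp: zero_ereal_def)
  have "chain_over K n" by (rule chain_over_if_chain[of n P]) (use P n1 in auto)
  then obtain P' where P': "primeideal P' Rd" "AD K \<subseteq> P'" "\<not> Sg (diag_deg 1) \<subseteq> P'" unfolding chain_over_def by blast
  have "Sg (diag_deg N) \<subseteq> AD K"
  proof
    fix s assume s: "s \<in> Sg (diag_deg N)"
    have "s \<odot> m \<in> K" if m: "m \<in> Mg (diag_deg j)" for j m
    proof -
      have "s \<odot> m \<in> Mg (diag_deg (N + j))" using Mg_smult[OF s m] unfolding diag_deg_add .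
      moreover have "Mg (diag_deg (N + j)) \<subseteq> K" by (rule N) (simp add: diag_deg_def)
      ultimately show ?thesis by blast
    qed
    then show "s \<in> AD K" unfolding AD_def using SG.Gdiag_hom[OF s] by blast
  qed
  moreover have "y [^]\<^bsub>S\<^esub> N \<in> Sg (diag_deg N)" if "y \<in> Sg (diag_deg 1)" for y
  proof -
    have dN: "(\<lambda>i. N * diag_deg 1 i) = (diag_deg N :: 'd \<Rightarrow> nat)" by (simp add: diag_deg_def)
    show ?thesis using Sg_pow[OF that, of N] unfolding dN .
  qed
  ultimately have "Sg (diag_deg 1) \<subseteq> P'" using prime_power_mem[OF P'(1) SG.Gdiag_hom] P'(2) by blast
  then show False using P'(3) by blast
qed

text \<open>Degeneracy at any stage makes that quotient vanish in large degrees, and with it every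
  later one, including the last.\<close>

lemma weak_seq_nondegenerate:
  assumes w: "weak_seq is xs" and nz: "large (\<lambda>n. hilb (gensub (set xs)) n \<noteq> 0)"
  shows "diagonally_nondegenerate S Sg (quotient_module M (gensub (set (take t xs))))"
proof (rule ccontr)
  let ?K = "gensub (set xs)"
  have K: "submodule ?K S M" using graded_subD(1)[OF weak_seq_graded_sub[OF w, of "length xs"]] by simp
  have g: "graded_sub (gensub (set (take t xs)))" using weak_seq_graded_sub[OF w] .
  have c: "set xs \<subseteq> carrier S"
    using set_take_homogeneous[of xs "is" _ "length xs"] w Sg_carrier unfolding weak_seq_def by fastforce
  have "gensub (set (take t xs)) \<subseteq> ?K"
    by (rule gensub_least[OF K]) (use gensub_mem[OF c] set_take_subset[of t xs] in blast)
  moreover assume "\<not> diagonally_nondegenerate S Sg (quotient_module M (gensub (set (take t xs))))"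
  then have "large (\<lambda>n. Mg n \<subseteq> gensub (set (take t xs)))" by (rule large_subset_if_degenerate[OF g])
  ultimately have "large (\<lambda>n. hilb ?K n = 0)" unfolding hilb_zero_iff[OF K] by (elim large_mono) blast
  from large_conj[OF this nz] have "large (\<lambda>n::'d \<Rightarrow> nat. False)" by (rule large_mono) auto
  then show False by (rule large_const)
qed

theorem mixed_multiplicity_nonzero_iff:
  assumes inf: "infinite (carrier (A Quot \<mm>))"
    and dim: "module_krull_dim Rd (diagonal M Mg) = ereal (real ell)" and k: "(\<Sum>i\<in>UNIV. k i) + 1 = ell"
  shows "mixed_multiplicity A S M Mg k \<noteq> 0 \<longleftrightarrow>
      (\<exists>xs. length xs = ell - 1 \<and> seq_of_type Sg k xs \<and> filter_regular_seq S Sg M xs \<and>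
         module_krull_dim Rd (diagonal (quot_seq S M xs) (quot_seq_grading S M xs Mg)) = 1)"
proof
  assume e: "mixed_multiplicity A S M Mg k \<noteq> 0"
  obtain "is" where is_k: "count_list is = k" using exists_count_list by blast
  have l: "length is + 1 = ell" using sum_count_list_UNIV[of "is"] k unfolding is_k by simp
  obtain xs where w: "weak_seq is xs" using exists_weak_seq[OF inf] by blast
  have h: "length xs = length is" "\<forall>j<length xs. xs ! j \<in> Sg (unit_deg (is ! j))" using w unfolding weak_seq_def by auto
  have "large (\<lambda>n. hilb (gensub (set xs)) n = mixed_multiplicity A S M Mg k)"
    using hilb_weak_seq_mixed_multiplicity[OF inf dim k w is_k] .
  then have nz: "large (\<lambda>n. hilb (gensub (set xs)) n \<noteq> 0)" by (rule large_mono) (use e in simp)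
  have "filter_regular_seq S Sg M xs"
    unfolding filter_regular_seq_iff_weak_seq[OF h] using w weak_seq_nondegenerate[OF w nz] by blast
  moreover have "seq_of_type Sg k xs" unfolding seq_of_type_iff using h is_k by (intro exI[of _ "is"]) simp
  moreover have "set xs \<subseteq> carrier S" using set_take_homogeneous[OF h, of _ "length xs"] Sg_carrier by fastforce
  then have "module_krull_dim Rd (diagonal (quot_seq S M xs) (quot_seq_grading S M xs Mg)) = 1"
    using dim_quotient_eq_one[OF inf dim w l nz] quot_seq_eq by simp
  moreover have "length xs = ell - 1" using h(1) l by simp
  ultimately show "\<exists>xs. length xs = ell - 1 \<and> seq_of_type Sg k xs \<and> filter_regular_seq S Sg M xs \<and>
         module_krull_dim Rd (diagonal (quot_seq S M xs) (quot_seq_grading S M xs Mg)) = 1" by blast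
next
  assume "\<exists>xs. length xs = ell - 1 \<and> seq_of_type Sg k xs \<and> filter_regular_seq S Sg M xs \<and>
         module_krull_dim Rd (diagonal (quot_seq S M xs) (quot_seq_grading S M xs Mg)) = 1"
  then obtain xs where xs: "seq_of_type Sg k xs" "filter_regular_seq S Sg M xs"
      "module_krull_dim Rd (diagonal (quot_seq S M xs) (quot_seq_grading S M xs Mg)) = 1" by blast
  obtain "is" where h: "length xs = length is" "\<forall>j<length xs. xs ! j \<in> Sg (unit_deg (is ! j))" and is_k: "count_list is = k"
    using xs(1) unfolding seq_of_type_iff by metis
  have w: "weak_seq is xs" using xs(2) unfolding filter_regular_seq_iff_weak_seq[OF h] by blast
  have K: "graded_sub (gensub (set xs))" using weak_seq_graded_sub[OF w, of "length xs"] by simp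
  have "set xs \<subseteq> carrier S" using set_take_homogeneous[OF h, of _ "length xs"] Sg_carrier by fastforce
  then have "\<not> large (\<lambda>n. Mg n \<subseteq> gensub (set xs))"
    using not_large_subset_if_dim_quotient_eq_one[OF K] xs(3) quot_seq_eq by simp
  moreover have "large (\<lambda>n. hilb (gensub (set xs)) n = mixed_multiplicity A S M Mg k)"
    using hilb_weak_seq_mixed_multiplicity[OF inf dim k w is_k] .
  ultimately show "mixed_multiplicity A S M Mg k \<noteq> 0"
    unfolding hilb_zero_iff[OF graded_subD(1)[OF K], symmetric] by (cases "mixed_multiplicity A S M Mg k = 0") simp_all
qed

theorem mixed_multiplicity_eq_length:
  assumes inf: "infinite (carrier (A Quot \<mm>))"
    and dim: "module_krull_dim Rd (diagonal M Mg) = ereal (real ell)" and k: "(\<Sum>i\<in>UNIV. k i) + 1 = ell"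
    and xs: "seq_of_type Sg k xs" "filter_regular_seq S Sg M xs"
    and n: "reduction_number Rd Rg (diagonal (quot_seq S M xs) (quot_seq_grading S M xs Mg))
       (\<lambda>j. quot_seq_grading S M xs Mg (diag_deg j)) \<le> n"
  shows "enat (mixed_multiplicity A S M Mg k) =
     module_length A (quotient_module ((restrict_scalars S (quot_seq S M xs))\<lparr>carrier := quot_seq_grading S M xs Mg (diag_deg n)\<rparr>)
       (zero_colon_infty Rd (diagonal (quot_seq S M xs) (quot_seq_grading S M xs Mg)) (diagonal_plus S Sg)
         \<inter> quot_seq_grading S M xs Mg (diag_deg n)))"
proof -
  obtain "is" where h: "length xs = length is" "\<forall>j<length xs. xs ! j \<in> Sg (unit_deg (is ! j))" and is_k: "count_list is = k"
    using xs(1) unfolding seq_of_type_iff by metis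
  have w: "weak_seq is xs" using xs(2) unfolding filter_regular_seq_iff_weak_seq[OF h] by blast
  let ?K = "gensub (set xs)"
  have K: "graded_sub ?K" using weak_seq_graded_sub[OF w, of "length xs"] by simp
  have c: "set xs \<subseteq> carrier S" using set_take_homogeneous[OF h, of _ "length xs"] Sg_carrier by fastforce
  interpret Q: graded_module A \<mm> S Sg "quotient_module M ?K" "qgr ?K" using graded_module_quotient(1)[OF K] .
  have e: "large (\<lambda>n. Q.hilb {\<zero>\<^bsub>quotient_module M ?K\<^esub>} n = mixed_multiplicity A S M Mg k)"
    using hilb_weak_seq_mixed_multiplicity[OF inf dim k w is_k] unfolding hilb_quotient[OF K] .
  have n': "reduction_number Rd Rg (diagonal (quotient_module M ?K) (qgr ?K)) (\<lambda>j. qgr ?K (diag_deg j)) \<le> n"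
    using n unfolding quot_seq_eq[OF c] .
  show ?thesis unfolding quot_seq_eq[OF c]
    using Q.AM.module_length_subquotient[OF Q.length_mod_zero_colon_infty(1)[OF inf e n'] Q.A_submodule_Mg Int_lower2]
      Q.length_mod_zero_colon_infty(2)[OF inf e n'] by simp
qed

end

text \<open>Part (i) and part (ii) as a conjunction. The dimension is handed over as a natural
  number \<open>ell\<close>, and the condition on \<open>k\<close> is written with
  \<open>+ 1\<close> to avoid truncated subtraction. The intersection with
  \<open>Mbar_g (diag_deg n)\<close> is the degree \<open>n\<close> part of the colon submodule, by
  which the component of degree \<open>n\<close> is divided.\<close>

theorem mainTheorem1:
  fixes A :: "('a, 'p) ring_scheme" and \<mm> :: "'a set"
    and S :: "('a, 's, 'q) module_scheme" and Sg :: "('d::finite \<Rightarrow> nat) \<Rightarrow> 's set"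
    and M :: "('s, 'm, 'r) module_scheme" and Mg :: "('d \<Rightarrow> nat) \<Rightarrow> 'm set"
    and ell :: nat and k :: "'d \<Rightarrow> nat"
  assumes "artinian_ring A" and "local_ring_with A \<mm>"
    and "infinite (carrier (A Quot \<mm>))"
    and "standard_multigraded_algebra A S Sg"
    and "fg_multigraded_module S Sg M Mg"
    and "\<not> Sg (diag_deg 1) \<subseteq> ring_radical S (annihilator S M)"
    and "module_krull_dim (diagonal S Sg) (diagonal M Mg) = ereal (real ell)"
    and "(\<Sum>i\<in>UNIV. k i) + 1 = ell"
  shows "(mixed_multiplicity A S M Mg k \<noteq> 0 \<longleftrightarrow>
      (\<exists>xs. length xs = ell - 1 \<and> seq_of_type Sg k xs \<and> filter_regular_seq S Sg M xs \<and>
         module_krull_dim (diagonal S Sg)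
           (diagonal (quot_seq S M xs) (quot_seq_grading S M xs Mg)) = 1)) \<and>
    (mixed_multiplicity A S M Mg k \<noteq> 0 \<longrightarrow>
      (\<forall>xs. length xs = ell - 1 \<and> seq_of_type Sg k xs \<and> filter_regular_seq S Sg M xs \<longrightarrow>
        (let Mbar = quot_seq S M xs;
             Mbar_g = quot_seq_grading S M xs Mg;
             r = reduction_number (diagonal S Sg) (\<lambda>j. Sg (diag_deg j))
                   (diagonal Mbar Mbar_g) (\<lambda>j. Mbar_g (diag_deg j))
         in \<forall>n\<ge>r. enat (mixed_multiplicity A S M Mg k) =
              module_length A
                (quotient_module ((restrict_scalars S Mbar)\<lparr>carrier := Mbar_g (diag_deg n)\<rparr>)
                   (zero_colon_infty (diagonal S Sg) (diagonal Mbar Mbar_g) (diagonal_plus S Sg)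
                      \<inter> Mbar_g (diag_deg n))))))"
proof -
  interpret graded_module A \<mm> S Sg M Mg using assms(1,2,4,5) by unfold_locales
  note hyps = assms(3,7,8)
  show ?thesis unfolding Let_def
    using mixed_multiplicity_nonzero_iff[OF hyps] mixed_multiplicity_eq_length[OF hyps] by blast
qed

end
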